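(* Let $L$ be a positive-definite even lattice of rank $1$, $M$ the rank one Heisenberg vertex operator algebra based on $\mathfrak{H}=\mathbb{C}\otimes_{\mathbb{Z}}L$, $a\in\mathfrak{H}$ with $(a,a)=1$, and $N=M\otimes e^\beta$ with $\beta\in L$. Let $v_1,\dots,v_n$ be Fock states of the form $a[-1]^{e_1}\cdots a[-p]^{e_p}.\mathbf 1$ (non-negative integer exponents) in $M$, and let $\Phi$ be the labelled set determined by these states. Then for lattice elements $\alpha_1,\dots,\alpha_n\in L$ satisfying $\alpha_1+\dots+\alpha_n=0$, $$F_N(v_1\otimes e^{\alpha_1},z_1;\dots;v_n\otimes e^{\alpha_n},z_n;q)=Q_N(v_1,z_1;\dots;v_n,z_n;q)\,F_N(\mathbf 1\otimes e^{\alpha_1},z_1;\dots;\mathbf 1\otimes e^{\alpha_n},z_n;q),$$ where $Q_N(v_1,z_1;\dots;v_n,z_n;q)=\sum_{\varphi\in\mathrm{Inv}(\Phi)}\Gamma(\varphi)$.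
   Context: Lattice VOA. $V_L=M\otimes\mathbb{C}[L]=\bigoplus_{\alpha\in L}M\otimes e^\alpha$; $M$ is the Fock space of the Heisenberg algebra $[h(m),h'(n)]=(h,h')m\delta_{m,-n}$, with conformal vector $\frac12a(-1)^2\mathbf 1$ and central charge $c=1$. For $h\in\mathfrak{H}$: $Y(h,z)=\sum_nh(n)z^{-n-1}$ and $h(0)(u\otimes e^\gamma)=(h,\gamma)u\otimes e^\gamma$. Write $e^\alpha$ also for $\mathbf 1\otimes e^\alpha$. $Y(e^\alpha,z)=Y_-(e^\alpha,z)Y_+(e^\alpha,z)e^\alpha z^\alpha$, $Y_\pm(e^\alpha,z)=\exp(\mp\sum_{n>0}\frac{\alpha(\pm n)}{n}z^{\mp n})$, with operators $e^\alpha(u\otimes e^\gamma)=\epsilon(\alpha,\gamma)u\otimes e^{\alpha+\gamma}$, $z^\alpha(u\otimes e^\gamma)=z^{(\alpha,\gamma)}u\otimes e^\gamma$, where the cocycle $\epsilon=\pm1$ satisfies $\epsilon(\alpha,\gamma+\delta)=\epsilon(\alpha,\gamma)\epsilon(\alpha,\delta)$ and $\epsilon(\alpha,-\alpha)=\epsilon(\alpha,\alpha)=1$, and the operators satisfy $e^\alpha e^\gamma e^{-\alpha}e^{-\gamma}=(-1)^{(\alpha,\gamma)}$. Square-bracket modes: $Y[v,z]=\sum_nv[n]z^{-n-1}=Y(q_z^{L(0)}v,q_z-1)$, $q_z=\exp(z)$. For $v=a[-1]^{e_1}\cdots a[-p]^{e_p}.\mathbf 1$, $v\otimes e^\alpha$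 denotes $a[-1]^{e_1}\cdots a[-p]^{e_p}.e^\alpha\in V_L$. $n$-point function: $\tau$ in the upper half plane, $q=\exp(2\pi i\tau)$, $q_i=\exp(z_i)$, $z_{ij}=z_i-z_j$, and $F_N(u_1,z_1;\dots;u_n,z_n;q)=Tr_N\,Y(q_1^{L(0)}u_1,q_1)\cdots Y(q_n^{L(0)}u_n,q_n)q^{L(0)-c/24}$ (the composite acts on $N$ because $\alpha_1+\dots+\alpha_n=0$). Functions. For even $k\ge2$, $E_k(\tau)=-\frac{B_k}{k!}+\frac{2}{(k-1)!}\sum_{n\ge1}\sigma_{k-1}(n)q^n$ ($B_k$ Bernoulli numbers, $\sigma_{k-1}(n)=\sum_{d|n}d^{k-1}$); $E_k=0$ for odd $k\ge1$. $P_0(z,\tau)=-\log z+\sum_{k\ge2}\frac1kE_k(\tau)z^k$; $P_n(z,\tau)=\frac{(-1)^n}{(n-1)!}\frac{d^n}{dz^n}P_0(z,\tau)$ for $n\ge1$. For integers $r,s\ge1$: $C(r,s,\tau)=(-1)^{r+1}\frac{(r+s-1)!}{(r-1)!(s-1)!}E_{r+s}(\tau)$, $D(r,s,z,\tau)=(-1)^{r+1}\frac{(r+s-1)!}{(r-1)!(s-1)!}P_{r+s}(z,\tau)$, $C(r,0,\tau)=(-1)^{r+1}E_r(\tau)$, $D(r,0,z,\tau)=(-1)^{r+1}P_r(z,\tau)$. Labelled sets. $\Phi_i$ is a finite set with elements labelled by positive integers, with exactly as many elements of label $m$ as the exponent of $a[-m]$ in $v_i$; $\Phi=\Phi_1\cup\dots\cup\Phi_n$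 (disjoint union). $\mathrm{Inv}(\Phi)$ is the set of permutations $\varphi$ of $\Phi$ with $\varphi^2=1$ (distinct permutations are considered distinct regardless of labels). $\Gamma(\varphi)=\prod_\Xi\gamma(\Xi)$ over the orbits $\Xi$ of $\varphi$ on $\Phi$, where: for a two-element orbit with labels $r,s$, the elements lying in $\Phi_i,\Phi_j$ respectively, $\gamma(\Xi)=D(r,s,z_{ij},\tau)$ if $i\neq j$ and $\gamma(\Xi)=C(r,s,\tau)$ if $i=j$; for a one-element orbit with label $r$ in $\Phi_k$, $\gamma(\Xi)=\bigl(a,\ \delta_{r,1}\beta+C(r,0,\tau)\alpha_k+\sum_{l>k}D(r,0,z_{kl},\tau)\alpha_l\bigr)$.
   Formalization: In γ for one-element orbits the sum over l>k is replaced by the sum over l≠k (with l>k the claim fails, e.g. n=2, v_1=1, v_2=a[-1].1, α_1=-α_2≠0); F_N is taken in its domain of convergence |q_1|>...>|q_n|>|q q_1|. *)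

theory Defs
  imports
    "HOL-Complex_Analysis.Complex_Analysis"
    "HOL-Combinatorics.Combinatorics"
    "HOL-Library.Multiset"
    "HOL-Library.Poly_Mapping"
    "HOL-Computational_Algebra.Formal_Laurent_Series"
begin

section \<open>Rank one even lattices\<close>

text \<open>
  The lattice \<open>L\<close> is a subgroup of the complex vector space \<open>H\<close> (the whole type \<open>'h\<close>).  Since
  \<open>L\<close> is the free abelian group on one nonzero vector and spans \<open>H\<close>, the space \<open>H\<close> is the
  complexification of \<open>L\<close>, and the bilinear form on \<open>H\<close> is the extension of the form on \<open>L\<close>.
\<close>

locale rank_one_even_lattice = vector_space scale
  for scale :: "complex \<Rightarrow> 'h::ab_group_add \<Rightarrow> 'h" +
  fixes form :: "'h \<Rightarrow> 'h \<Rightarrow> complex" and L :: "'h set"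
  assumes form_sym: "form x y = form y x"
    and form_add_left: "form (x + y) w = form x w + form y w"
    and form_scale_left: "form (scale c x) y = c * form x y"
    and rank_one: "\<exists>g. g \<noteq> 0 \<and> L = (\<lambda>k::int. scale (of_int k) g) ` UNIV"
    and spans: "span L = UNIV"
    and even_form: "x \<in> L \<Longrightarrow> \<exists>k::int. form x x = of_int (2 * k)"
    and positive: "x \<in> L \<Longrightarrow> x \<noteq> 0 \<Longrightarrow> 0 < Re (form x x)"


section \<open>The space of the lattice vertex operator algebra\<close>

text \<open>
  The pair \<open>(\<mu>, \<gamma>)\<close> indexes the vector
  \<open>a(-n\<^sub>1) \<dots> a(-n\<^sub>k) \<one> \<otimes> e\<^sup>\<gamma>\<close>, where \<open>\<mu>\<close> is the multiset of the positive integers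
  \<open>n\<^sub>1, \<dots>, n\<^sub>k\<close>.  These vectors, with \<open>0 \<notin># \<mu>\<close> and \<open>\<gamma> \<in> L\<close>, form a basis of \<open>V\<^sub>L\<close>.
\<close>

type_synonym 'h vec = "(nat multiset \<times> 'h) \<Rightarrow>\<^sub>0 complex"

abbreviation basis :: "nat multiset \<times> 'h \<Rightarrow> 'h vec" where
  "basis b \<equiv> Poly_Mapping.single b 1"

definition smult :: "complex \<Rightarrow> 'h vec \<Rightarrow> 'h vec" where
  "smult c v = Poly_Mapping.map ((*) c) v"

definition lin_ext :: "(nat multiset \<times> 'h \<Rightarrow> 'h vec) \<Rightarrow> 'h vec \<Rightarrow> 'h vec" where
  "lin_ext f v = (\<Sum>b\<in>Poly_Mapping.keys v. smult (Poly_Mapping.lookup v b) (f b))"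

text \<open>
  For a formal series \<open>X = (\<Sum>j. X\<^sub>j t\<^sup>j)\<close> of operators, \<open>op_pow X k j\<close> is the coefficient of
  \<open>t\<^sup>j\<close> in the \<open>k\<close>-th power of \<open>X\<close>.  If \<open>X\<^sub>0 = 0\<close>, powers with \<open>k > j\<close> do not contribute to \<open>t\<^sup>j\<close>,
  so \<open>op_exp X j\<close> is the coefficient of \<open>t\<^sup>j\<close> in \<open>exp X\<close>.
\<close>

primrec op_pow :: "(nat \<Rightarrow> 'h vec \<Rightarrow> 'h vec) \<Rightarrow> nat \<Rightarrow> nat \<Rightarrow> 'h vec \<Rightarrow> 'h vec" where
  "op_pow X 0 j = (\<lambda>v. if j = 0 then v else 0)"
| "op_pow X (Suc k) j = (\<lambda>v. \<Sum>i\<le>j. X i (op_pow X k (j - i) v))"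

definition op_exp :: "(nat \<Rightarrow> 'h vec \<Rightarrow> 'h vec) \<Rightarrow> nat \<Rightarrow> 'h vec \<Rightarrow> 'h vec" where
  "op_exp X j v = (\<Sum>k\<le>j. smult (1 / fact k) (op_pow X k j v))"


section \<open>Vertex operators\<close>

context
  fixes form :: "'h::ab_group_add \<Rightarrow> 'h \<Rightarrow> complex" and a :: 'h and eps :: "'h \<Rightarrow> 'h \<Rightarrow> complex"
begin

text \<open>\<open>osc m\<close> is \<open>a(m)\<close>; for \<open>m > 0\<close> it acts on \<open>M\<close> as \<open>m \<partial>/\<partial>a(-m)\<close>, because \<open>(a,a) = 1\<close>.\<close>

definition osc :: "int \<Rightarrow> 'h vec \<Rightarrow> 'h vec" where
  "osc m = lin_ext (\<lambda>(\<mu>, \<gamma>).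
     if m < 0 then basis (add_mset (nat (- m)) \<mu>, \<gamma>)
     else if m = 0 then Poly_Mapping.single (\<mu>, \<gamma>) (form a \<gamma>)
     else Poly_Mapping.single (\<mu> - {#nat m#}, \<gamma>) (of_int m * of_nat (count \<mu> (nat m))))"

text \<open>\<open>h(m)\<close> for an arbitrary \<open>h\<close>: the space \<open>H\<close> is spanned by \<open>a\<close>, so \<open>h\<close> is \<open>(a,h)\<close> times \<open>a\<close>.\<close>

definition hmode :: "'h \<Rightarrow> int \<Rightarrow> 'h vec \<Rightarrow> 'h vec" where
  "hmode h m v = smult (form a h) (osc m v)"

text \<open>
  \<open>Y_minus \<alpha> j\<close> is the coefficient of \<open>z\<^sup>j\<close> in \<open>Y\<^sub>-(e\<^sup>\<alpha>,z)\<close>, and \<open>Y_plus \<alpha> j\<close> is the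
  coefficient of \<open>z\<close> to the power \<open>-j\<close> in \<open>Y\<^sub>+(e\<^sup>\<alpha>,z)\<close>.
\<close>

definition Y_minus :: "'h \<Rightarrow> nat \<Rightarrow> 'h vec \<Rightarrow> 'h vec" where
  "Y_minus \<alpha> = op_exp (\<lambda>n v. if n = 0 then 0 else smult (1 / of_nat n) (hmode \<alpha> (- int n) v))"

definition Y_plus :: "'h \<Rightarrow> nat \<Rightarrow> 'h vec \<Rightarrow> 'h vec" where
  "Y_plus \<alpha> = op_exp (\<lambda>n v. if n = 0 then 0 else smult (- 1 / of_nat n) (hmode \<alpha> (int n) v))"

definition exp_op :: "'h \<Rightarrow> 'h vec \<Rightarrow> 'h vec" where
  "exp_op \<alpha> = lin_ext (\<lambda>(\<mu>, \<gamma>). Poly_Mapping.single (\<mu>, \<alpha> + \<gamma>) (eps \<alpha> \<gamma>))"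

text \<open>\<open>z_pow \<alpha> k\<close> is the coefficient of \<open>z\<^sup>k\<close> in the operator \<open>z\<^sup>\<alpha>\<close>.\<close>

definition z_pow :: "'h \<Rightarrow> int \<Rightarrow> 'h vec \<Rightarrow> 'h vec" where
  "z_pow \<alpha> k = lin_ext (\<lambda>(\<mu>, \<gamma>). if form \<alpha> \<gamma> = of_int k then basis (\<mu>, \<gamma>) else 0)"

text \<open>
  \<open>exp_mode \<alpha> m\<close> is the coefficient of \<open>z\<close> to the power \<open>-m-1\<close> in
  \<open>Y(e\<^sup>\<alpha>,z) = Y\<^sub>-(e\<^sup>\<alpha>,z) Y\<^sub>+(e\<^sup>\<alpha>,z) e\<^sup>\<alpha> z\<^sup>\<alpha>\<close>.  Applied to a given vector, only finitely
  many terms of the sum are nonzero.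
\<close>

definition exp_mode :: "'h \<Rightarrow> int \<Rightarrow> 'h vec \<Rightarrow> 'h vec" where
  "exp_mode \<alpha> m v = Sum_any (\<lambda>(i, j).
     Y_minus \<alpha> i (Y_plus \<alpha> j (exp_op \<alpha> (z_pow \<alpha> (int j - int i - m - 1) v))))"

text \<open>
  The modes of the states \<open>a(-n\<^sub>1) \<dots> a(-n\<^sub>k) e\<^sup>\<alpha>\<close>, by normal ordering: with
  \<open>A(z)\<close> denoting the \<open>(n-1)\<close>-st divided derivative
  \<open>(\<Sum>k. binom(-k-1, n-1) a(k) z\<^bsup>-k-n\<^esup>)\<close> of \<open>Y(a,z)\<close>,
  \<open>Y(a(-n)u,z) = A\<^sub>-(z) Y(u,z) + Y(u,z) A\<^sub>+(z)\<close>, where \<open>A\<^sub>-\<close> and \<open>A\<^sub>+\<close> collect the terms with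
  \<open>k < 0\<close> and \<open>k \<ge> 0\<close>.  The result does not depend on the order of the list.  Again the
  sums are finite on every vector.
\<close>

primrec list_mode :: "nat list \<Rightarrow> 'h \<Rightarrow> int \<Rightarrow> 'h vec \<Rightarrow> 'h vec" where
  "list_mode [] \<alpha> m = exp_mode \<alpha> m"
| "list_mode (n # ns) \<alpha> m = (\<lambda>v. Sum_any (\<lambda>k::int. smult (of_int (- k - 1) gchoose (n - 1))
     (if k < 0 then osc k (list_mode ns \<alpha> (m - k - int n) v)
      else list_mode ns \<alpha> (m - k - int n) (osc k v))))"

text \<open>\<open>vmode u m\<close> is the mode \<open>u(m)\<close> in \<open>Y(u,z) = (\<Sum>m. u(m) z\<^bsup>-m-1\<^esup>)\<close>.\<close>

definition vmode :: "'h vec \<Rightarrow> int \<Rightarrow> 'h vec \<Rightarrow> 'h vec" where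
  "vmode u m v =
     lin_ext (\<lambda>(\<mu>, \<alpha>). list_mode (sorted_list_of_multiset \<mu>) \<alpha> m v) u"

definition conformal_vector :: "'h vec" where
  "conformal_vector = Poly_Mapping.single ({#1, 1#}, 0) (1 / 2)"

definition L0 :: "'h vec \<Rightarrow> 'h vec" where
  "L0 = vmode conformal_vector 1"

definition weight :: "nat multiset \<times> 'h \<Rightarrow> complex" where
  "weight b = (THE w. L0 (basis b) = smult w (basis b))"

text \<open>\<open>exp_L0 x\<close> is \<open>exp(x L(0))\<close>.\<close>

definition exp_L0 :: "complex \<Rightarrow> 'h vec \<Rightarrow> 'h vec" where
  "exp_L0 x = lin_ext (\<lambda>b. Poly_Mapping.single b (exp (x * weight b)))"


section \<open>Square bracket modes and Fock states\<close>

text \<open>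
  For \<open>u\<close> of \<open>L(0)\<close>-weight \<open>w\<close>, \<open>Y[u,z]\<close> is the sum of the
  \<open>u(m) exp(w z) (exp z - 1)\<^bsup>-m-1\<^esup>\<close>, and \<open>u[n]\<close> is its coefficient at \<open>z\<^bsup>-n-1\<^esup>\<close>.
\<close>

definition sq_coeff :: "complex \<Rightarrow> int \<Rightarrow> int \<Rightarrow> complex" where
  "sq_coeff w m n =
     fls_nth (fps_to_fls (fps_exp w) * fps_to_fls (fps_exp 1 - 1) powi (- m - 1)) (- n - 1)"

definition sq_mode :: "'h vec \<Rightarrow> int \<Rightarrow> 'h vec \<Rightarrow> 'h vec" where
  "sq_mode u n v =
     lin_ext (\<lambda>b. Sum_any (\<lambda>m::int. smult (sq_coeff (weight b) m n) (vmode (basis b) m v))) u"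

definition a_vec :: "'h vec" where
  "a_vec = basis ({#1#}, 0)"

text \<open>
  The state \<open>v \<otimes> e\<^sup>\<alpha> = a[-1]\<^bsup>e 1\<^esup> \<dots> a[-p]\<^bsup>e p\<^esup> . e\<^sup>\<alpha>\<close>, for the Fock state \<open>v\<close> given by the exponents
  \<open>e 1, \<dots>, e p\<close>.
\<close>

definition fock_state :: "nat \<Rightarrow> (nat \<Rightarrow> nat) \<Rightarrow> 'h \<Rightarrow> 'h vec" where
  "fock_state p e \<alpha> = foldr (\<lambda>m. sq_mode a_vec (- int m) ^^ e m) [1..<Suc p] (basis ({#}, \<alpha>))"


section \<open>The n-point function\<close>

text \<open>
  The coefficient \<open>u\<^sub>1(m\<^sub>1) q\<^sub>1\<^bsup>-m\<^sub>1-1\<^esup> \<dots> u\<^sub>n(m\<^sub>n) q\<^sub>n\<^bsup>-m\<^sub>n-1\<^esup>\<close> of the composite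
  of the vertex operators \<open>Y(q\<^sub>i\<^bsup>L(0)\<^esup> u\<^sub>i, q\<^sub>i)\<close>, where \<open>q\<^sub>i = exp (z i)\<close>.
\<close>

definition mode_product ::
    "nat \<Rightarrow> (nat \<Rightarrow> 'h vec) \<Rightarrow> (nat \<Rightarrow> complex) \<Rightarrow> (nat \<Rightarrow> int) \<Rightarrow> 'h vec \<Rightarrow> 'h vec" where
  "mode_product n u z m = foldr (\<lambda>i v. smult (exp (of_int (- m i - 1) * z i))
     (vmode (exp_L0 (z i) (u i)) (m i) v)) [1..<Suc n]"

text \<open>
  The trace over \<open>N = M \<otimes> e\<^sup>\<beta>\<close>, computed in the basis of \<open>N\<close> made of eigenvectors of \<open>L(0)\<close>; the
  diagonal entries of the composite are sums over all choices of the \<open>n\<close> modes.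
\<close>

definition n_point ::
    "'h \<Rightarrow> nat \<Rightarrow> (nat \<Rightarrow> 'h vec) \<Rightarrow> (nat \<Rightarrow> complex) \<Rightarrow> complex \<Rightarrow> complex" where
  "n_point \<beta> n u z \<tau> = (\<Sum>\<^sub>\<infinity>\<mu>\<in>{\<mu>. 0 \<notin># \<mu>}.
     (\<Sum>\<^sub>\<infinity>m\<in>PiE {1..n} (\<lambda>_. UNIV).
        Poly_Mapping.lookup (mode_product n u z m (basis (\<mu>, \<beta>))) (\<mu>, \<beta>))
     * exp (2 * of_real pi * \<i> * \<tau> * (weight (\<mu>, \<beta>) - 1 / 24)))"

text \<open>
  In the commutation relation \<open>e\<^sup>\<alpha> e\<^sup>\<gamma> e\<^bsup>-\<alpha>\<^esup> e\<^bsup>-\<gamma>\<^esup> = (-1)\<^bsup>(\<alpha>,\<gamma>)\<^esup>\<close> the integer \<open>k\<close> is \<open>(\<alpha>,\<gamma>)\<close>.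
\<close>

definition cocycle :: "'h set \<Rightarrow> bool" where
  "cocycle L \<longleftrightarrow>
     (\<forall>\<alpha>\<in>L. \<forall>\<gamma>\<in>L. eps \<alpha> \<gamma> \<in> {1, -1}) \<and>
     (\<forall>\<alpha>\<in>L. \<forall>\<gamma>\<in>L. \<forall>\<delta>\<in>L. eps \<alpha> (\<gamma> + \<delta>) = eps \<alpha> \<gamma> * eps \<alpha> \<delta>) \<and>
     (\<forall>\<alpha>\<in>L. eps \<alpha> (- \<alpha>) = 1 \<and> eps \<alpha> \<alpha> = 1) \<and>
     (\<forall>\<alpha>\<in>L. \<forall>\<gamma>\<in>L. \<forall>k::int. form \<alpha> \<gamma> = of_int k \<longrightarrow>
       (\<forall>\<mu>. \<forall>\<delta>\<in>L. exp_op \<alpha> (exp_op \<gamma> (exp_op (- \<alpha>) (exp_op (- \<gamma>) (basis (\<mu>, \<delta>)))))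
          = smult ((- 1) powi k) (basis (\<mu>, \<delta>))))"

end


section \<open>Elliptic functions\<close>

definition bernoulli :: "nat \<Rightarrow> complex" where
  "bernoulli k = fact k * fps_nth (fps_X / (fps_exp 1 - 1)) k"

definition sigma :: "nat \<Rightarrow> nat \<Rightarrow> nat" where
  "sigma k n = (\<Sum>d | d dvd n. d ^ k)"

definition E_fun :: "nat \<Rightarrow> complex \<Rightarrow> complex" where
  "E_fun k \<tau> = (if odd k then 0 else
     - bernoulli k / fact k + 2 / fact (k - 1) *
       (\<Sum>\<^sub>\<infinity>n\<in>{1..}. of_nat (sigma (k - 1) n) * exp (2 * of_real pi * \<i> * \<tau>) ^ n))"

definition P0_fun :: "complex \<Rightarrow> complex \<Rightarrow> complex" where
  "P0_fun z \<tau> = - Ln z + (\<Sum>\<^sub>\<infinity>k\<in>{2..}. E_fun k \<tau> / of_nat k * z ^ k)"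

definition period_lattice :: "complex \<Rightarrow> complex set" where
  "period_lattice \<tau> = {2 * of_real pi * \<i> * (of_int k * \<tau> + of_int l) | k l :: int. True}"

text \<open>
  The series for \<open>P\<^sub>0\<close> converges only near \<open>0\<close>.  For \<open>n \<ge> 1\<close>, \<open>P_fun n\<close> is the analytic continuation of
  \<open>(-1)\<^sup>n/(n-1)!\<close> times the \<open>n\<close>-th derivative of \<open>P\<^sub>0\<close> to the complement of the period lattice, where it
  is single-valued (the cut of \<open>Ln\<close> is avoided in the condition near \<open>0\<close>).  The value \<open>0\<close>
  at the poles is a convention.
\<close>

definition P_fun :: "nat \<Rightarrow> complex \<Rightarrow> complex \<Rightarrow> complex" where
  "P_fun n z \<tau> = (THE f.
     f holomorphic_on (- period_lattice \<tau>) \<and>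
     (\<forall>w\<in>period_lattice \<tau>. f w = 0) \<and>
     (\<exists>r>0. \<forall>w\<in>ball 0 r - \<real>\<^sub>\<le>\<^sub>0.
        f w = (- 1) ^ n / fact (n - 1) * (deriv ^^ n) (\<lambda>x. P0_fun x \<tau>) w)) z"

definition C_fun :: "nat \<Rightarrow> nat \<Rightarrow> complex \<Rightarrow> complex" where
  "C_fun r s \<tau> = (if s = 0 then (- 1) ^ (r + 1) * E_fun r \<tau>
     else (- 1) ^ (r + 1) * fact (r + s - 1) / (fact (r - 1) * fact (s - 1)) * E_fun (r + s) \<tau>)"

definition D_fun :: "nat \<Rightarrow> nat \<Rightarrow> complex \<Rightarrow> complex \<Rightarrow> complex" where
  "D_fun r s z \<tau> = (if s = 0 then (- 1) ^ (r + 1) * P_fun r z \<tau>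
     else (- 1) ^ (r + 1) * fact (r + s - 1) / (fact (r - 1) * fact (s - 1)) * P_fun (r + s) z \<tau>)"


section \<open>Labelled sets and involutions\<close>

text \<open>The element \<open>(i, r, j)\<close> is the \<open>j\<close>-th element of \<open>\<Phi>\<^sub>i\<close> with label \<open>r\<close>.\<close>

definition labelled_set :: "nat \<Rightarrow> (nat \<Rightarrow> nat) \<Rightarrow> (nat \<Rightarrow> nat \<Rightarrow> nat) \<Rightarrow> (nat \<times> nat \<times> nat) set" where
  "labelled_set n p e = {(i, r, j). i \<in> {1..n} \<and> r \<in> {1..p i} \<and> j < e i r}"

definition Inv :: "'a set \<Rightarrow> ('a \<Rightarrow> 'a) set" where
  "Inv \<Phi> = {\<phi>. \<phi> permutes \<Phi> \<and> \<phi> \<circ> \<phi> = id}"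

context
  fixes scale :: "complex \<Rightarrow> 'h::ab_group_add \<Rightarrow> 'h"
    and form :: "'h \<Rightarrow> 'h \<Rightarrow> complex" and a :: 'h
    and n :: nat and \<alpha> :: "nat \<Rightarrow> 'h" and \<beta> :: 'h
    and z :: "nat \<Rightarrow> complex" and \<tau> :: complex
begin

definition gamma_two :: "nat \<times> nat \<times> nat \<Rightarrow> nat \<times> nat \<times> nat \<Rightarrow> complex" where
  "gamma_two x y = (case (x, y) of ((i, r, _), (j, s, _)) \<Rightarrow>
     if i \<noteq> j then D_fun r s (z i - z j) \<tau> else C_fun r s \<tau>)"

text \<open>
  The sum extends over all \<open>l \<noteq> k\<close>.  Summing only over \<open>l > k\<close> would omit contractions: for
  \<open>n = 2\<close>, the states \<open>e\<close> to the \<open>\<alpha>\<^sub>1\<close> and \<open>a[-1]\<close> applied to \<open>e\<close> to the \<open>- \<alpha>\<^sub>1\<close> contribute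
  \<open>P\<^sub>1(z\<^sub>2 - z\<^sub>1) (a, \<alpha>\<^sub>1)\<close>, coming from \<open>l = 1 < k = 2\<close>.
\<close>

definition gamma_one :: "nat \<times> nat \<times> nat \<Rightarrow> complex" where
  "gamma_one x = (case x of (k, r, _) \<Rightarrow>
     form a ((if r = 1 then \<beta> else 0) + scale (C_fun r 0 \<tau>) (\<alpha> k)
       + (\<Sum>l\<in>{1..n} - {k}. scale (D_fun r 0 (z k - z l) \<tau>) (\<alpha> l))))"

text \<open>
  \<open>gamma_two\<close> is symmetric in its arguments, so the choice of the order of a two-element orbit is immaterial.
\<close>

definition gamma_orbit :: "(nat \<times> nat \<times> nat) set \<Rightarrow> complex" where
  "gamma_orbit \<Xi> = (let (x, y) = (SOME (x, y). \<Xi> = {x, y})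
     in if x = y then gamma_one x else gamma_two x y)"

definition Gamma_inv ::
    "(nat \<times> nat \<times> nat) set \<Rightarrow> (nat \<times> nat \<times> nat \<Rightarrow> nat \<times> nat \<times> nat) \<Rightarrow> complex" where
  "Gamma_inv \<Phi> \<phi> = (\<Prod>\<Xi>\<in>orbit \<phi> ` \<Phi>. gamma_orbit \<Xi>)"

definition Q_fun :: "(nat \<Rightarrow> nat) \<Rightarrow> (nat \<Rightarrow> nat \<Rightarrow> nat) \<Rightarrow> complex" where
  "Q_fun p e = (\<Sum>\<phi>\<in>Inv (labelled_set n p e). Gamma_inv (labelled_set n p e) \<phi>)"

end

end

theory Submission
 imports Defs "HOL-Real_Asymp.Real_Asymp"
begin

text \<open>
 On a sector of fixed momentum the vertex operators act by matrices indexed by partitions, and the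
 n-point function is, up to a factor that does not depend on the Fock states, the trace of the
 product of these matrices weighted by the degree.  Moving \<open>a(k)\<close> once around the trace expresses
 the trace with an extra factor \<open>a(k)\<close> by the commutators of \<open>a(k)\<close> with the vertex operators, divided
 by \<open>1 - q^k\<close>.  Summation over \<open>k\<close> against the coefficients of the modes of \<open>a[-r]\<close> gives Zhu's recursion:
 its coefficients are the Lambert series of \<open>P\<^sub>m\<close> and \<open>E\<^sub>m\<close>, and it removes the label \<open>r\<close> either alone or
 together with one other label.  The sum over involutions satisfies the same recursion, because an
 involution either fixes a given point or exchanges it with another one.
\<close>

abbreviation (input) single where "single \<equiv> Poly_Mapping.single"

abbreviation (input) Yterm where
 "Yterm form a eps \<alpha> m i j v \<equiv> Y_minus form a \<alpha> i (Y_plus form a \<alpha> j (exp_op eps \<alpha> (z_pow form \<alpha> (int j - int i - m - 1) v)))"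

abbreviation (input) lookup where "lookup \<equiv> Poly_Mapping.lookup"

abbreviation (input) keys where "keys \<equiv> Poly_Mapping.keys"

abbreviation (input) deg :: "nat multiset => nat" where "deg \<equiv> sum_mset"

abbreviation (input) dg :: "nat multiset => real" where "dg \<mu> \<equiv> 1 + real (deg \<mu>)"

abbreviation (input) nom :: "complex => complex" where "nom \<tau> \<equiv> exp (2 * of_real pi * \<i> * \<tau>)"

section \<open>Linear operators on the Fock space\<close>

lemma lookup_smult [simp]: "lookup (smult c v) b = c * lookup v b" by (simp add: smult_def map.rep_eq when_def)

lemma smult_add_right: "smult c (u + v) = smult c u + smult c v" by (rule poly_mapping_eqI) (simp add: lookup_add algebra_simps)

lemma smult_add_left: "smult (c + d) v = smult c v + smult d v" by (rule poly_mapping_eqI) (simp add: lookup_add algebra_simps)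

lemma smult_smult [simp]: "smult c (smult d v) = smult (c * d) v" by (rule poly_mapping_eqI) (simp add: algebra_simps)

lemma smult_zero [simp]: "smult 0 v = 0" "smult c 0 = 0" by (rule poly_mapping_eqI, simp)+

lemma smult_one [simp]: "smult 1 v = v" by (rule poly_mapping_eqI) simp

lemma smult_sum: "smult c (\<Sum>i\<in>A. f i) = (\<Sum>i\<in>A. smult c (f i))"
 by (induction A rule: infinite_finite_induct) (simp_all add: smult_add_right)

lemma smult_single [simp]: "smult c (single b d) = single b (c * d)" by (rule poly_mapping_eqI) (simp add: lookup_single when_def)

definition linear_op :: "('h vec => 'h vec) => bool" where
 "linear_op T \<longleftrightarrow> (\<forall>u v. T (u + v) = T u + T v) \<and> (\<forall>c v. T (smult c v) = smult c (T v))"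

lemma linear_opI:
 "(\<And>u v. T (u + v) = T u + T v) ==> (\<And>c v. T (smult c v) = smult c (T v)) ==> linear_op T"
 by (simp add: linear_op_def)

lemma linear_opD:
 assumes "linear_op T"
 shows "T (u + v) = T u + T v" "T (smult c v) = smult c (T v)" "T 0 = 0" "T (\<Sum>i\<in>A. f i) = (\<Sum>i\<in>A. T (f i))"
proof -
 show add: "T (u + v) = T u + T v" for u v using assms by (simp add: linear_op_def)
 show smult: "T (smult c v) = smult c (T v)" for c v using assms by (simp add: linear_op_def)
 show zero: "T 0 = 0" using smult[of 0 0] by simp
 show "T (\<Sum>i\<in>A. f i) = (\<Sum>i\<in>A. T (f i))" by (induction A rule: infinite_finite_induct) (simp_all add: add zero)
qed

lemma vec_eq_sum_basis:
 assumes "finite A" "keys v \<subseteq> A"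
 shows "v = (\<Sum>b\<in>A. smult (lookup v b) (basis b))"
proof (rule poly_mapping_eqI)
 fix k
 have "lookup (\<Sum>b\<in>A. smult (lookup v b) (basis b)) k
  = (\<Sum>b\<in>A. if b = k then lookup v b else 0)" by (simp add: lookup_sum lookup_single when_def if_distrib cong: if_cong)
 also have "\<dots> = lookup v k" using assms by (auto simp: sum.delta in_keys_iff)
 finally show "lookup v k = lookup (\<Sum>b\<in>A. smult (lookup v b) (basis b)) k" by simp
qed

lemma linear_op_expand:
 assumes "linear_op T" "finite A" "keys v \<subseteq> A"
 shows "T v = (\<Sum>b\<in>A. smult (lookup v b) (T (basis b)))" by (subst vec_eq_sum_basis[OF assms(2,3)]) (simp only: linear_opD[OF assms(1)])

lemma linear_op_eqI:
 assumes "linear_op S" "linear_op T" "\<And>b. b \<in> keys v ==> S (basis b) = T (basis b)"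
 shows "S v = T v" unfolding linear_op_expand[OF assms(1) finite_keys order_refl, of v]
  linear_op_expand[OF assms(2) finite_keys order_refl, of v] by (rule sum.cong) (simp_all add: assms(3))

lemma lin_ext_superset:
 assumes "finite A" "keys v \<subseteq> A"
 shows "lin_ext f v = (\<Sum>b\<in>A. smult (lookup v b) (f b))" unfolding lin_ext_def
 by (rule sum.mono_neutral_left) (use assms in \<open>auto simp: in_keys_iff\<close>)

lemma lin_ext_add: "lin_ext f (u + v) = lin_ext f u + lin_ext f v"
proof -
 let ?A = "keys u \<union> keys v"
 have "keys (u + v) \<subseteq> ?A" by (rule Poly_Mapping.keys_add)
 thus ?thesis by (simp add: lin_ext_superset[of ?A] lookup_add smult_add_left sum.distrib)
qed

lemma lin_ext_smult: "lin_ext f (smult c v) = smult c (lin_ext f v)"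
proof -
 have "keys (smult c v) \<subseteq> keys v" by (auto simp: in_keys_iff)
 thus ?thesis by (simp add: lin_ext_superset[of "keys v"] smult_sum)
qed

lemma linear_op_lin_ext [intro, simp]: "linear_op (lin_ext f)" by (simp add: linear_op_def lin_ext_add lin_ext_smult)

lemma lin_ext_single [simp]: "lin_ext f (single b c) = smult c (f b)" by (cases "c = 0") (simp_all add: lin_ext_def)

lemma linear_op_id [intro, simp]: "linear_op (\<lambda>v. v)" by (simp add: linear_op_def)

lemma linear_op_zero [intro, simp]: "linear_op (\<lambda>v. 0)" by (simp add: linear_op_def)

lemma linear_op_compose: "linear_op S ==> linear_op T ==> linear_op (\<lambda>v. S (T v))" by (simp add: linear_op_def)

lemma linear_op_plus: "linear_op S ==> linear_op T ==> linear_op (\<lambda>v. S v + T v)"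
 by (simp add: linear_op_def smult_add_right algebra_simps)

lemma linear_op_scaled: "linear_op T ==> linear_op (\<lambda>v. smult c (T v))"
 by (simp add: linear_op_def smult_add_right algebra_simps)

lemma linear_op_sum: "(\<And>i. i \<in> A ==> linear_op (T i)) ==> linear_op (\<lambda>v. \<Sum>i\<in>A. T i v)"
 by (simp add: linear_op_def sum.distrib smult_sum)

lemma Sum_any_superset:
 assumes "finite A" "\<And>a. a \<notin> A ==> g a = 0"
 shows "Sum_any g = sum g A" by (rule Sum_any.expand_superset) (use assms in auto)

lemma linear_op_Sum_any:
 assumes "\<And>i. linear_op (T i)" "\<And>v. finite {i. T i v \<noteq> 0}"
 shows "linear_op (\<lambda>v. Sum_any (\<lambda>i. T i v))"
proof (rule linear_opI)
 fix u v
 let ?A = "{i. T i u \<noteq> 0} \<union> {i. T i v \<noteq> 0}"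
 have fin: "finite ?A" using assms(2) by simp
 show "Sum_any (\<lambda>i. T i (u + v)) = Sum_any (\<lambda>i. T i u) + Sum_any (\<lambda>i. T i v)"
  by (subst (1 2 3) Sum_any_superset[OF fin]) (auto simp: linear_opD(1)[OF assms(1)] sum.distrib)
next
 fix c v
 let ?A = "{i. T i v \<noteq> 0}"
 show "Sum_any (\<lambda>i. T i (smult c v)) = smult c (Sum_any (\<lambda>i. T i v))"
  by (subst (1 2) Sum_any_superset[OF assms(2)[of v]]) (auto simp: linear_opD(2)[OF assms(1)] smult_sum)
qed

context
 fixes form :: "'h::ab_group_add => 'h => complex" and a :: 'h
begin

abbreviation (input) "oscm \<equiv> osc form a"

lemma linear_op_osc [intro, simp]: "linear_op (osc form a m)" by (simp add: osc_def)

lemma linear_op_hmode [intro, simp]: "linear_op (hmode form a h m)" unfolding hmode_def by (intro linear_op_scaled linear_op_osc)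

lemma osc_basis:
 "m < 0 ==> osc form a m (basis (\<mu>, \<gamma>)) = basis (add_mset (nat (- m)) \<mu>, \<gamma>)"
 "osc form a 0 (basis (\<mu>, \<gamma>)) = smult (form a \<gamma>) (basis (\<mu>, \<gamma>))"
 "m > 0 ==> osc form a m (basis (\<mu>, \<gamma>)) =
  smult (of_int m * of_nat (count \<mu> (nat m))) (basis (\<mu> - {#nat m#}, \<gamma>))" by (simp_all add: osc_def)

lemma lookup_osc_neg:
 assumes "m < 0"
 shows "lookup (osc form a m v) (\<mu>, \<gamma>) =
  (if nat (- m) \<in># \<mu> then lookup v (\<mu> - {#nat (- m)#}, \<gamma>) else 0)"
proof -
 have "lookup (osc form a m v) (\<mu>, \<gamma>) = (\<Sum>b\<in>keys v.
   if nat (- m) \<in># \<mu> \<and> b = (\<mu> - {#nat (- m)#}, \<gamma>) then lookup v b else 0)"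
  unfolding linear_op_expand[OF linear_op_osc finite_keys order_refl, of m v] lookup_sum
  by (rule sum.cong) (use assms in \<open>auto simp: osc_basis lookup_single when_def split: prod.splits if_splits\<close>)
 also have "\<dots> = (if nat (- m) \<in># \<mu> then lookup v (\<mu> - {#nat (- m)#}, \<gamma>) else 0)" by (auto simp: in_keys_iff)
 finally show ?thesis .
qed

lemma lookup_osc_zero:
 "lookup (osc form a 0 v) (\<mu>, \<gamma>) = form a \<gamma> * lookup v (\<mu>, \<gamma>)"
proof -
 have "lookup (osc form a 0 v) (\<mu>, \<gamma>) = (\<Sum>b\<in>keys v.
   if b = (\<mu>, \<gamma>) then form a \<gamma> * lookup v b else 0)"
  unfolding linear_op_expand[OF linear_op_osc finite_keys order_refl, of 0 v] lookup_sum
  by (rule sum.cong) (auto simp: osc_basis lookup_single when_def split: prod.splits if_splits)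
 also have "\<dots> = form a \<gamma> * lookup v (\<mu>, \<gamma>)" by (auto simp: in_keys_iff)
 finally show ?thesis .
qed

lemma lookup_osc_pos:
 assumes "m > 0"
 shows "lookup (osc form a m v) (\<mu>, \<gamma>) =
  of_int m * of_nat (Suc (count \<mu> (nat m))) * lookup v (add_mset (nat m) \<mu>, \<gamma>)"
proof -
 have "lookup (osc form a m v) (\<mu>, \<gamma>) = (\<Sum>b\<in>keys v.
   if b = (add_mset (nat m) \<mu>, \<gamma>) then of_int m * of_nat (Suc (count \<mu> (nat m))) * lookup v b else 0)"
  unfolding linear_op_expand[OF linear_op_osc finite_keys order_refl, of m v] lookup_sum
 proof (rule sum.cong[OF refl])
  fix b assume "b \<in> keys v"
  obtain \<nu> \<delta> where b: "b = (\<nu>, \<delta>)" by (cases b)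
  have "count \<nu> (nat m) = 0 \<or> (\<nu> - {#nat m#} = \<mu> \<longleftrightarrow> \<nu> = add_mset (nat m) \<mu>)"
   by (metis count_greater_zero_iff add_mset_remove_trivial_eq add_mset_remove_trivial insert_DiffM not_gr_zero)
  thus "lookup (smult (lookup v b) (osc form a m (basis b))) (\<mu>, \<gamma>) =
   (if b = (add_mset (nat m) \<mu>, \<gamma>) then of_int m * of_nat (Suc (count \<mu> (nat m))) * lookup v b else 0)"
   using assms by (auto simp: b osc_basis lookup_single when_def)
 qed
 also have "\<dots> = of_int m * of_nat (Suc (count \<mu> (nat m))) * lookup v (add_mset (nat m) \<mu>, \<gamma>)" by (auto simp: in_keys_iff)
 finally show ?thesis .
qed

lemmas lookup_osc = lookup_osc_neg lookup_osc_zero lookup_osc_pos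

lemma osc_commute_pos_neg:
 assumes "k > 0" "l < 0"
 shows "osc form a k (osc form a l v) = osc form a l (osc form a k v) + (if k + l = 0 then smult (of_int k) v else 0)"
proof (rule poly_mapping_eqI, clarify)
 fix \<mu> \<gamma>
 show "lookup (osc form a k (osc form a l v)) (\<mu>, \<gamma>) =
   lookup (osc form a l (osc form a k v) + (if k + l = 0 then smult (of_int k) v else 0)) (\<mu>, \<gamma>)"
 proof (cases "k + l = 0")
  case True
  hence l: "l = - k" by simp
  show ?thesis
  proof (cases "nat k \<in># \<mu>")
   case True
   then obtain \<nu> where "\<mu> = add_mset (nat k) \<nu>" by (meson mset_add)
   thus ?thesis using assms by (simp add: l lookup_osc lookup_add algebra_simps)
  next
   case False
   hence "count \<mu> (nat k) = 0" by (simp add: not_in_iff)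
   with False show ?thesis using assms by (simp add: l lookup_osc lookup_add)
  qed
 next
  case False
  hence ne: "nat k \<noteq> nat (- l)" using assms by auto
  show ?thesis
  proof (cases "nat (- l) \<in># \<mu>")
   case True
   then obtain \<nu> where "\<mu> = add_mset (nat (- l)) \<nu>" by (meson mset_add)
   thus ?thesis using assms ne False by (simp add: lookup_osc add_mset_commute)
  next
   case neg: False
   thus ?thesis using assms ne False by (simp add: lookup_osc)
  qed
 qed
qed

lemma osc_commute_zero: "osc form a 0 (osc form a l v) = osc form a l (osc form a 0 v)"
proof (rule poly_mapping_eqI)
 fix b :: "nat multiset \<times> 'h"
 obtain \<mu> \<gamma> where b: "b = (\<mu>, \<gamma>)" by (cases b)
 show "lookup (osc form a 0 (osc form a l v)) b = lookup (osc form a l (osc form a 0 v)) b"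
  unfolding b by (cases l "0::int" rule: linorder_cases) (simp_all add: lookup_osc)
qed

lemma osc_commute_pos:
 assumes "k > 0" "l > 0"
 shows "osc form a k (osc form a l v) = osc form a l (osc form a k v)"
proof (rule poly_mapping_eqI)
 fix b :: "nat multiset \<times> 'h"
 obtain \<mu> \<gamma> where b: "b = (\<mu>, \<gamma>)" by (cases b)
 show "lookup (osc form a k (osc form a l v)) b = lookup (osc form a l (osc form a k v)) b"
  unfolding b lookup_osc_pos[OF assms(1)] lookup_osc_pos[OF assms(2)] add_mset_commute[of "nat k" "nat l" \<mu>] by (cases "nat k = nat l") simp_all
qed

lemma osc_commute_neg:
 assumes "k < 0" "l < 0"
 shows "osc form a k (osc form a l v) = osc form a l (osc form a k v)"
proof (rule poly_mapping_eqI)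
 fix b :: "nat multiset \<times> 'h"
 obtain \<mu> \<gamma> where b: "b = (\<mu>, \<gamma>)" by (cases b)
 have m: "nat (- k) \<in># \<mu> - {#nat (- l)#} \<longleftrightarrow> nat (- k) \<in># \<mu>"
  "nat (- l) \<in># \<mu> - {#nat (- k)#} \<longleftrightarrow> nat (- l) \<in># \<mu>" if "nat (- k) \<noteq> nat (- l)"
  using that by (auto simp: in_diff_count split: if_splits)
 have c: "\<mu> - {#nat (- k)#} - {#nat (- l)#} = \<mu> - {#nat (- l)#} - {#nat (- k)#}" by (rule diff_right_commute)
 show "lookup (osc form a k (osc form a l v)) b = lookup (osc form a l (osc form a k v)) b"
  unfolding b lookup_osc_neg[OF assms(1)] lookup_osc_neg[OF assms(2)] by (cases "nat (- k) = nat (- l)") (use m c in simp_all)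
qed

lemma osc_commute:
 "osc form a k (osc form a l v) = osc form a l (osc form a k v) + (if k + l = 0 then smult (of_int k) v else 0)"
proof -
 consider "k > 0" "l < 0" | "k < 0" "l > 0" | "k = 0" | "l = 0" | "k > 0" "l > 0" | "k < 0" "l < 0"
  by (cases k "0::int" rule: linorder_cases; cases l "0::int" rule: linorder_cases; blast)
 thus ?thesis
 proof cases
  case 1 thus ?thesis by (rule osc_commute_pos_neg)
 next
  case 2
  show ?thesis
  proof (cases "k + l = 0")
   case True
   hence l: "of_int l = - (of_int k :: complex)" by (simp add: eq_neg_iff_add_eq_0 flip: of_int_add)
   have "smult (of_int l) v + smult (of_int k) v = 0" unfolding l by (simp flip: smult_add_left)
   thus ?thesis using osc_commute_pos_neg[OF 2(2,1), of v] True by (simp add: add.commute[of l k] add.assoc)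
  next
   case False
   thus ?thesis using osc_commute_pos_neg[OF 2(2,1), of v] by (simp add: add.commute[of l k])
  qed
 next
  case 3 thus ?thesis using osc_commute_zero[of l v] by (cases "l = 0") simp_all
 next
  case 4 thus ?thesis using osc_commute_zero[of k v] by (cases "k = 0") simp_all
 next
  case 5 thus ?thesis using osc_commute_pos[of k l v] by simp
 next
  case 6 thus ?thesis using osc_commute_neg[of k l v] by simp
 qed
qed

end

lemma sum_triangle_swap:
 fixes f :: "nat => nat => 'a::comm_monoid_add"
 shows "(\<Sum>i\<le>j. \<Sum>l\<le>j - i. f i l) = (\<Sum>l\<le>j. \<Sum>i\<le>j - l. f i l)"
proof -
 have "(\<Sum>i\<le>j. \<Sum>l\<le>j - i. f i l) = (\<Sum>(i, l)\<in>(SIGMA i:{..j}. {..j - i}). f i l)" by (rule sum.Sigma) auto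
 also have "\<dots> = (\<Sum>(l, i)\<in>(SIGMA l:{..j}. {..j - l}). f i l)"
  by (rule sum.reindex_bij_witness[where i = prod.swap and j = prod.swap]) auto
 also have "\<dots> = (\<Sum>l\<le>j. \<Sum>i\<le>j - l. f i l)" by (rule sum.Sigma[symmetric]) auto
 finally show ?thesis .
qed

lemma linear_op_If_zero: "linear_op T ==> linear_op (\<lambda>v. if P then 0 else T v)" by (cases P) simp_all

lemma linear_op_op_pow:
 assumes "\<And>i. linear_op (X i)"
 shows "linear_op (op_pow X k j)"
proof (induction k arbitrary: j)
 case 0
 thus ?case by (cases "j = 0") simp_all
next
 case (Suc k)
 thus ?case by (auto intro!: linear_op_sum linear_op_compose[OF assms])
qed

lemma linear_op_op_exp:
 assumes "\<And>i. linear_op (X i)"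
 shows "linear_op (op_exp X j)" unfolding op_exp_def using linear_op_op_pow[OF assms] by (intro linear_op_sum linear_op_scaled)

lemma op_pow_eq_0:
 assumes "\<And>i. linear_op (X i)" "\<And>v. X 0 v = 0" "j < k"
 shows "op_pow X k j v = 0" using assms(3)
proof (induction k arbitrary: j)
 case (Suc k)
 have "X i (op_pow X k (j - i) v) = 0" if "i \<le> j" for i
 proof (cases "i = 0")
  case False
  thus ?thesis using Suc that by (simp add: linear_opD(3)[OF assms(1)])
 qed (simp add: assms(2))
 thus ?case by simp
qed simp

lemma op_pow_commute:
 assumes X: "\<And>i. linear_op (X i)" and B: "linear_op B"
  and BX: "\<And>i v. B (X i v) = X i (B v) + smult (c i) v"
 shows "B (op_pow X k j v) = op_pow X k j (B v)
  + (\<Sum>i\<le>j. smult (of_nat k * c i) (op_pow X (k - 1) (j - i) v))"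
proof (induction k arbitrary: j)
 case 0
 thus ?case by (simp add: linear_opD[OF B])
next
 case (Suc k)
 have "B (op_pow X (Suc k) j v) = (\<Sum>i\<le>j. X i (B (op_pow X k (j - i) v)) + smult (c i) (op_pow X k (j - i) v))"
  by (simp add: linear_opD[OF B] BX)
 also have "\<dots> = (\<Sum>i\<le>j. X i (op_pow X k (j - i) (B v)))
   + (\<Sum>i\<le>j. \<Sum>l\<le>j - i. smult (of_nat k * c l) (X i (op_pow X (k - 1) (j - i - l) v)))
   + (\<Sum>i\<le>j. smult (c i) (op_pow X k (j - i) v))" by (simp add: Suc.IH linear_opD[OF X] sum.distrib)
 also have "(\<Sum>i\<le>j. \<Sum>l\<le>j - i. smult (of_nat k * c l) (X i (op_pow X (k - 1) (j - i - l) v)))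
   = (\<Sum>l\<le>j. smult (of_nat k * c l) (\<Sum>i\<le>j - l. X i (op_pow X (k - 1) (j - l - i) v)))"
  by (subst sum_triangle_swap) (simp add: smult_sum add.commute)
 also have "\<dots> = (\<Sum>l\<le>j. smult (of_nat k * c l) (op_pow X k (j - l) v))" by (cases k) simp_all
 finally show ?case by (simp add: sum.distrib[symmetric] smult_add_left distrib_right add_ac)
qed

lemma op_exp_extend:
 assumes "\<And>i. linear_op (X i)" "\<And>v. X 0 v = 0" "j \<le> K"
 shows "op_exp X j v = (\<Sum>k\<le>K. smult (1 / fact k) (op_pow X k j v))" unfolding op_exp_def
 by (rule sum.mono_neutral_left) (use assms in \<open>auto simp: op_pow_eq_0\<close>)

lemma op_exp_commute:
 assumes X: "\<And>i. linear_op (X i)" "\<And>v. X 0 v = 0" and B: "linear_op B"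
  and BX: "\<And>i v. B (X i v) = X i (B v) + smult (c i) v" and c0: "c 0 = 0"
 shows "B (op_exp X j v) = op_exp X j (B v) + (\<Sum>i\<le>j. smult (c i) (op_exp X (j - i) v))"
proof -
 have "B (op_exp X j v) = op_exp X j (B v)
  + (\<Sum>k\<le>j. \<Sum>i\<le>j. smult (of_nat k / fact k * c i) (op_pow X (k - 1) (j - i) v))"
  by (simp add: op_exp_def linear_opD[OF B] op_pow_commute[OF X(1) B BX] smult_add_right smult_sum sum.distrib)
 also have "(\<Sum>k\<le>j. \<Sum>i\<le>j. smult (of_nat k / fact k * c i) (op_pow X (k - 1) (j - i) v))
  = (\<Sum>i\<le>j. smult (c i) (\<Sum>k\<le>j. smult (of_nat k / fact k) (op_pow X (k - 1) (j - i) v)))"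
  by (subst sum.swap) (simp add: smult_sum mult.commute)
 also have "\<dots> = (\<Sum>i\<le>j. smult (c i) (op_exp X (j - i) v))"
 proof (rule sum.cong[OF refl])
  fix i assume i: "i \<in> {..j}"
  show "smult (c i) (\<Sum>k\<le>j. smult (of_nat k / fact k) (op_pow X (k - 1) (j - i) v)) = smult (c i) (op_exp X (j - i) v)"
  proof (cases "i = 0")
   case False
   with i obtain J where J: "j = Suc J" by (cases j) auto
   have "(\<Sum>k\<le>j. smult (of_nat k / fact k) (op_pow X (k - 1) (j - i) v))
    = (\<Sum>k\<le>J. smult (of_nat (Suc k) / fact (Suc k)) (op_pow X k (j - i) v))" unfolding J sum.atMost_Suc_shift by simp
   also have "\<dots> = (\<Sum>k\<le>J. smult (1 / fact k) (op_pow X k (j - i) v))" by (simp add: field_simps del: of_nat_Suc)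
   also have "\<dots> = op_exp X (j - i) v" by (rule op_exp_extend[symmetric]) (use X False J in auto)
   finally show ?thesis by simp
  qed (simp add: c0)
 qed
 finally show ?thesis .
qed

definition sector :: "'h => 'h vec set" where
 "sector \<gamma> = {v. \<forall>\<mu> \<delta>. lookup v (\<mu>, \<delta>) \<noteq> 0 \<longrightarrow> \<delta> = \<gamma> \<and> 0 \<notin># \<mu>}"

lemma sector_lookup: "v \<in> sector \<gamma> ==> \<delta> \<noteq> \<gamma> \<or> 0 \<in># \<mu> ==> lookup v (\<mu>, \<delta>) = 0"
 by (auto simp: sector_def)

lemma sector_keys: "v \<in> sector \<gamma> ==> b \<in> keys v ==> \<exists>\<mu>. b = (\<mu>, \<gamma>) \<and> 0 \<notin># \<mu>"
 by (cases b) (auto simp: sector_def in_keys_iff)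

lemma sector_basis: "0 \<notin># \<mu> ==> basis (\<mu>, \<gamma>) \<in> sector \<gamma>"
 by (auto simp: sector_def lookup_single when_def)

lemma sector_zero [simp]: "0 \<in> sector \<gamma>" by (simp add: sector_def)

lemma sector_add: "u \<in> sector \<gamma> ==> v \<in> sector \<gamma> ==> u + v \<in> sector \<gamma>"
 unfolding sector_def mem_Collect_eq lookup_add by (metis add.right_neutral)

lemma sector_smult: "u \<in> sector \<gamma> ==> smult c u \<in> sector \<gamma>" by (auto simp: sector_def)

lemma sector_sum: "(\<And>i. i \<in> A ==> f i \<in> sector \<gamma>) ==> sum f A \<in> sector \<gamma>"
 by (induction A rule: infinite_finite_induct) (auto intro: sector_add)

lemma sector_osc:
 assumes "v \<in> sector \<gamma>"
 shows "osc form a m v \<in> sector \<gamma>" unfolding sector_def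
proof (intro CollectI allI impI)
 fix \<mu> \<delta> assume *: "lookup (osc form a m v) (\<mu>, \<delta>) \<noteq> 0"
 have v: "\<delta> = \<gamma> \<and> 0 \<notin># \<nu>" if "lookup v (\<nu>, \<delta>) \<noteq> 0" for \<nu>
  using assms that by (auto simp: sector_def)
 show "\<delta> = \<gamma> \<and> 0 \<notin># \<mu>"
 proof (cases m "0::int" rule: linorder_cases)
  case less
  with * have "nat (- m) \<in># \<mu>" "lookup v (\<mu> - {#nat (- m)#}, \<delta>) \<noteq> 0" by (auto simp: lookup_osc split: if_splits)
  with v[OF this(2)] less show ?thesis by (auto dest!: multi_member_split)
 next
  case equal
  with * show ?thesis by (intro v) (auto simp: lookup_osc)
 next
  case greater
  with * have "lookup v (add_mset (nat m) \<mu>, \<delta>) \<noteq> 0" by (auto simp: lookup_osc)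
  from v[OF this] show ?thesis by simp
 qed
qed

lemma sector_op_pow:
 assumes "\<And>i v. v \<in> sector \<gamma> ==> X i v \<in> sector \<gamma>" "v \<in> sector \<gamma>"
 shows "op_pow X k j v \<in> sector \<gamma>" using assms(2) by (induction k arbitrary: j) (auto intro!: sector_sum assms(1))

lemma sector_op_exp:
 assumes "\<And>i v. v \<in> sector \<gamma> ==> X i v \<in> sector \<gamma>" "v \<in> sector \<gamma>"
 shows "op_exp X j v \<in> sector \<gamma>" unfolding op_exp_def by (intro sector_sum sector_smult sector_op_pow assms)

context
 fixes form :: "'h::ab_group_add => 'h => complex" and a :: 'h
begin

lemma linear_op_Y [intro, simp]: "linear_op (Y_minus form a \<alpha> j)" "linear_op (Y_plus form a \<alpha> j)" unfolding Y_minus_def Y_plus_def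
 by (intro linear_op_op_exp linear_op_If_zero linear_op_scaled linear_op_hmode conjI)+

lemma sector_Y:
 assumes "v \<in> sector \<gamma>"
 shows "Y_minus form a \<alpha> j v \<in> sector \<gamma>" "Y_plus form a \<alpha> j v \<in> sector \<gamma>"
 unfolding Y_minus_def Y_plus_def hmode_def by (rule sector_op_exp; auto intro!: sector_smult sector_osc assms)+

lemma Y_plus_eq_0:
 assumes "\<And>\<mu> \<gamma>. lookup v (\<mu>, \<gamma>) \<noteq> 0 ==> deg \<mu> \<le> D" "D < j"
 shows "Y_plus form a \<alpha> j v = 0"
proof -
 let ?X = "\<lambda>n v. if n = 0 then 0 else smult (- 1 / of_nat n) (hmode form a \<alpha> (int n) v)"
 have pw: "deg \<mu> + j \<le> D" if "lookup (op_pow ?X k j v) (\<mu>, \<gamma>) \<noteq> 0" for k j \<mu> \<gamma> using that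
 proof (induction k arbitrary: j \<mu> \<gamma>)
  case 0
  thus ?case using assms(1) by (auto split: if_splits)
 next
  case (Suc k)
  then obtain i where i: "i \<le> j" "lookup (?X i (op_pow ?X k (j - i) v)) (\<mu>, \<gamma>) \<noteq> 0"
   by (force simp: lookup_sum elim: sum.not_neutral_contains_not_neutral)
  hence "i > 0" by (auto split: if_splits)
  with i have "lookup (op_pow ?X k (j - i) v) (add_mset i \<mu>, \<gamma>) \<noteq> 0" by (auto simp: hmode_def lookup_osc split: if_splits)
  from Suc.IH[OF this] i(1) show ?case by simp
 qed
 have "lookup (op_pow ?X k j v) (\<mu>, \<gamma>) = 0" for k \<mu> \<gamma> using pw[of k j \<mu> \<gamma>] assms(2) by linarith
 hence "op_pow ?X k j v = 0" for k by (intro poly_mapping_eqI) auto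
 thus ?thesis by (simp add: Y_plus_def op_exp_def)
qed

lemma degree_bound: "\<exists>D. \<forall>\<mu> \<gamma>. lookup v (\<mu>, \<gamma>) \<noteq> 0 \<longrightarrow> deg \<mu> \<le> (D::nat)"
proof -
 have "deg \<mu> \<le> Max ((\<lambda>b. deg (fst b)) ` keys v)" if "lookup v (\<mu>, \<gamma>) \<noteq> 0" for \<mu> \<gamma>
  by (rule Max_ge) (use that in \<open>force simp: in_keys_iff\<close>)+
 thus ?thesis by blast
qed

lemma osc_Y_plus:
 "osc form a m (Y_plus form a \<alpha> j v) = Y_plus form a \<alpha> j (osc form a m v)
  + (if m < 0 \<and> - m \<le> int j then smult (form a \<alpha>) (Y_plus form a \<alpha> (j - nat (- m)) v) else 0)"
proof -
 let ?c = "\<lambda>i. if m < 0 \<and> i = nat (- m) then form a \<alpha> else 0"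
 have "osc form a m (Y_plus form a \<alpha> j v) = Y_plus form a \<alpha> j (osc form a m v)
  + (\<Sum>i\<le>j. smult (?c i) (Y_plus form a \<alpha> (j - i) v))" unfolding Y_plus_def
 proof (rule op_exp_commute)
  fix i v
  have "of_int m * (form a \<alpha> * (- 1 / of_nat i)) = form a \<alpha>" if "m + int i = 0" "i \<noteq> 0"
  proof -
   have "of_int m = - (of_nat i :: complex)" using that(1) by (metis add_eq_0_iff2 of_int_minus of_int_of_nat_eq)
   thus ?thesis using that(2) by simp
  qed
  thus "osc form a m (if i = 0 then 0 else smult (- 1 / of_nat i) (hmode form a \<alpha> (int i) v)) =
    (if i = 0 then 0 else smult (- 1 / of_nat i) (hmode form a \<alpha> (int i) (osc form a m v))) + smult (?c i) v"
   using osc_commute[of form a m "int i" v] by (auto simp: hmode_def linear_opD[OF linear_op_osc] smult_add_right mult_ac)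
 qed (auto intro!: linear_op_scaled linear_op_If_zero)
 also have "(\<Sum>i\<le>j. smult (?c i) (Y_plus form a \<alpha> (j - i) v)) =
  (\<Sum>i\<le>j. if i = nat (- m) then (if m < 0 then smult (form a \<alpha>) (Y_plus form a \<alpha> (j - nat (- m)) v) else 0) else 0)"
  by (rule sum.cong) auto
 also have "\<dots> = (if m < 0 \<and> - m \<le> int j then smult (form a \<alpha>) (Y_plus form a \<alpha> (j - nat (- m)) v) else 0)" by auto
 finally show ?thesis .
qed

lemma osc_Y_minus:
 "osc form a m (Y_minus form a \<alpha> j v) = Y_minus form a \<alpha> j (osc form a m v)
  + (if m > 0 \<and> m \<le> int j then smult (form a \<alpha>) (Y_minus form a \<alpha> (j - nat m) v) else 0)"
proof -
 let ?c = "\<lambda>i. if m > 0 \<and> i = nat m then form a \<alpha> else 0"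
 have "osc form a m (Y_minus form a \<alpha> j v) = Y_minus form a \<alpha> j (osc form a m v)
  + (\<Sum>i\<le>j. smult (?c i) (Y_minus form a \<alpha> (j - i) v))" unfolding Y_minus_def
 proof (rule op_exp_commute)
  fix i v
  have "of_int m * (form a \<alpha> * (1 / of_nat i)) = form a \<alpha>" if "m - int i = 0" "i \<noteq> 0"
  proof -
   have "m = int i" using that(1) by simp
   thus ?thesis using that(2) by simp
  qed
  thus "osc form a m (if i = 0 then 0 else smult (1 / of_nat i) (hmode form a \<alpha> (- int i) v)) =
    (if i = 0 then 0 else smult (1 / of_nat i) (hmode form a \<alpha> (- int i) (osc form a m v))) + smult (?c i) v"
   using osc_commute[of form a m "- int i" v] by (auto simp: hmode_def linear_opD[OF linear_op_osc] smult_add_right mult_ac)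
 qed (auto intro!: linear_op_scaled linear_op_If_zero)
 also have "(\<Sum>i\<le>j. smult (?c i) (Y_minus form a \<alpha> (j - i) v)) =
  (\<Sum>i\<le>j. if i = nat m then (if m > 0 then smult (form a \<alpha>) (Y_minus form a \<alpha> (j - nat m) v) else 0) else 0)"
  by (rule sum.cong) auto
 also have "\<dots> = (if m > 0 \<and> m \<le> int j then smult (form a \<alpha>) (Y_minus form a \<alpha> (j - nat m) v) else 0)" by auto
 finally show ?thesis .
qed

definition Ym :: "'h => int => 'h vec => 'h vec" where
 "Ym \<alpha> i v = (if i < 0 then 0 else Y_minus form a \<alpha> (nat i) v)"

definition Yp :: "'h => int => 'h vec => 'h vec" where
 "Yp \<alpha> i v = (if i < 0 then 0 else Y_plus form a \<alpha> (nat i) v)"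

lemma linear_op_Ym [intro, simp]: "linear_op (Ym \<alpha> i)" "linear_op (Yp \<alpha> i)"
 unfolding Ym_def [abs_def] Yp_def [abs_def] by (rule linear_op_If_zero linear_op_Y)+

lemma osc_Ym:
 "osc form a m (Ym \<alpha> i v) = Ym \<alpha> i (osc form a m v) + (if m > 0 then smult (form a \<alpha>) (Ym \<alpha> (i - m) v) else 0)"
 by (auto simp: Ym_def osc_Y_minus linear_opD[OF linear_op_osc] nat_diff_distrib)

lemma osc_Yp:
 "osc form a m (Yp \<alpha> i v) = Yp \<alpha> i (osc form a m v) + (if m < 0 then smult (form a \<alpha>) (Yp \<alpha> (i + m) v) else 0)"
proof -
 have "nat i - nat (- m) = nat (i + m)" if "0 \<le> i" "m < 0" "- m \<le> i" using that by arith
 thus ?thesis by (auto simp: Yp_def osc_Y_plus linear_opD[OF linear_op_osc])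
qed

definition Emode :: "'h => int => 'h vec => 'h vec" where
 "Emode \<alpha> d v = Sum_any (\<lambda>j. Ym \<alpha> (d + j) (Yp \<alpha> j v))"

lemma Yp_bound: "\<exists>D. \<forall>j. j \<notin> {0..int D} \<longrightarrow> Yp \<alpha> j v = 0"
proof -
 obtain D where D: "\<forall>\<mu> \<gamma>. lookup v (\<mu>, \<gamma>) \<noteq> 0 \<longrightarrow> deg \<mu> \<le> (D::nat)"
  using degree_bound by blast
 have "Yp \<alpha> j v = 0" if "j \<notin> {0..int D}" for j using that Y_plus_eq_0[of v D "nat j"] D by (auto simp: Yp_def)
 thus ?thesis by blast
qed

lemma Emode_support: "finite {j. Ym \<alpha> (d + j) (Yp \<alpha> j v) \<noteq> 0}"
proof -
 obtain D where "\<forall>j. j \<notin> {0..int D} \<longrightarrow> Yp \<alpha> j v = 0" using Yp_bound by blast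
 hence "{j. Ym \<alpha> (d + j) (Yp \<alpha> j v) \<noteq> 0} \<subseteq> {0..int D}" using linear_opD(3)[OF linear_op_Ym(1)] by force
 thus ?thesis by (rule finite_subset) simp
qed

lemma linear_op_Emode [intro, simp]: "linear_op (Emode \<alpha> d)" unfolding Emode_def
 by (rule linear_op_Sum_any) (auto intro: linear_op_compose Emode_support)

lemma Emode_superset:
 assumes "finite A" "\<And>j. j \<notin> A ==> Yp \<alpha> j v = 0"
 shows "Emode \<alpha> d v = (\<Sum>j\<in>A. Ym \<alpha> (d + j) (Yp \<alpha> j v))"
 unfolding Emode_def by (rule Sum_any_superset) (use assms in \<open>simp_all add: linear_opD[OF linear_op_Ym(1)]\<close>)

lemma osc_Emode:
 assumes "k \<noteq> 0"
 shows "osc form a k (Emode \<alpha> d v) = Emode \<alpha> d (osc form a k v) + smult (form a \<alpha>) (Emode \<alpha> (d - k) v)"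
proof -
 obtain D1 D2 where D: "\<forall>j. j \<notin> {0..int D1} \<longrightarrow> Yp \<alpha> j v = 0" "\<forall>j. j \<notin> {0..int D2} \<longrightarrow> Yp \<alpha> j (osc form a k v) = 0"
  using Yp_bound by metis
 define A where "A = {- \<bar>k\<bar>..int D1 + int D2 + \<bar>k\<bar>}"
 have "{0..int D1} \<subseteq> A" "{0..int D2} \<subseteq> A" by (auto simp: A_def)
 with D have A: "finite A" "\<And>j. j \<notin> A ==> Yp \<alpha> j v = 0" "\<And>j. j \<notin> A ==> Yp \<alpha> j (osc form a k v) = 0"
  by (simp add: A_def, blast, blast)
 have "osc form a k (Emode \<alpha> d v) = (\<Sum>j\<in>A. osc form a k (Ym \<alpha> (d + j) (Yp \<alpha> j v)))"
  by (simp add: Emode_superset[OF A(1,2)] linear_opD[OF linear_op_osc])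
 also have "\<dots> = Emode \<alpha> d (osc form a k v) + smult (form a \<alpha>) (Emode \<alpha> (d - k) v)"
 proof (cases "k > 0")
  case True
  thus ?thesis by (simp add: Emode_superset[OF A(1,2)] Emode_superset[OF A(1,3)] osc_Ym osc_Yp sum.distrib smult_sum algebra_simps)
 next
  case False
  with assms have k: "k < 0" by simp
  have "(\<Sum>j\<in>A. Ym \<alpha> (d + j) (Yp \<alpha> (j + k) v)) = (\<Sum>j\<in>(\<lambda>j. j + k) ` A. Ym \<alpha> (d - k + j) (Yp \<alpha> j v))"
   by (subst sum.reindex) (auto simp: inj_on_def)
  also have "\<dots> = Emode \<alpha> (d - k) v"
  proof (rule Emode_superset[symmetric])
   fix j assume "j \<notin> (\<lambda>j. j + k) ` A"
   hence "j - k \<notin> A" by (metis diff_add_cancel image_eqI)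
   hence "j \<notin> {0..int D1}" using k by (auto simp: A_def)
   thus "Yp \<alpha> j v = 0" using D(1) by blast
  qed (simp add: A)
  finally show ?thesis using k by (simp add: Emode_superset[OF A(1,3)] osc_Ym osc_Yp sum.distrib smult_sum
     linear_opD[OF linear_op_Ym(1)] flip: smult_sum)
 qed
 finally show ?thesis .
qed

lemma Y_minus_vac: "lookup (Y_minus form a \<alpha> j v) ({#}, \<gamma>) = (if j = 0 then lookup v ({#}, \<gamma>) else 0)"
proof -
 let ?X = "\<lambda>n v. if n = 0 then 0 else smult (1 / of_nat n) (hmode form a \<alpha> (- int n) v)"
 have "lookup (op_pow ?X (Suc k) j v) ({#}, \<gamma>) = 0" for k by (auto simp: lookup_sum hmode_def lookup_osc intro!: sum.neutral)
 hence "lookup (op_pow ?X k j v) ({#}, \<gamma>) = (if k = 0 \<and> j = 0 then lookup v ({#}, \<gamma>) else 0)" for k by (cases k) simp_all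
 thus ?thesis by (auto simp: Y_minus_def op_exp_def lookup_sum if_distrib cong: if_cong)
qed

lemma Y_plus_vac: "Y_plus form a \<alpha> j (basis ({#}, \<gamma>)) = (if j = 0 then basis ({#}, \<gamma>) else 0)"
proof (cases "j = 0")
 case False
 thus ?thesis using Y_plus_eq_0[of "basis ({#}, \<gamma>)" 0 j] by (simp add: lookup_single when_def split: if_splits)
qed (simp add: Y_plus_def op_exp_def)

lemma Emode_vac:
 "lookup (Emode \<alpha> d (basis ({#}, \<gamma>))) ({#}, \<gamma>) = (if d = 0 then 1 else 0)"
proof -
 have "Emode \<alpha> d (basis ({#}, \<gamma>)) = (\<Sum>j\<in>{0}. Ym \<alpha> (d + j) (Yp \<alpha> j (basis ({#}, \<gamma>))))"
  by (rule Emode_superset) (auto simp: Yp_def Y_plus_vac)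
 thus ?thesis by (auto simp: Yp_def Ym_def Y_plus_vac Y_minus_vac)
qed

lemma sector_Emode:
 assumes "v \<in> sector \<gamma>"
 shows "Emode \<alpha> d v \<in> sector \<gamma>"
proof -
 obtain D where "\<forall>j. j \<notin> {0..int D} \<longrightarrow> Yp \<alpha> j v = 0" using Yp_bound by blast
 hence "Emode \<alpha> d v = (\<Sum>j\<in>{0..int D}. Ym \<alpha> (d + j) (Yp \<alpha> j v))" by (intro Emode_superset) auto
 also have "\<dots> \<in> sector \<gamma>" using assms by (intro sector_sum) (auto simp: Ym_def Yp_def intro!: sector_Y)
 finally show ?thesis .
qed

end

section \<open>Matrices of vertex operators\<close>

type_synonym fock_matrix = "nat multiset => nat multiset => complex"

definition exp_coeff :: "complex => nat => nat => nat => complex" where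
 "exp_coeff x n b c = fps_nth (fps_exp (x / of_nat n) * (fps_X - fps_const x) ^ c) b"

lemma exp_coeff_0_0 [simp]: "exp_coeff x n 0 0 = 1" by (simp add: exp_coeff_def)

lemma exp_coeff_raise:
 "of_nat (Suc b) * exp_coeff x n (Suc b) c = x / of_nat n * exp_coeff x n b c + of_nat c * exp_coeff x n b (c - 1)"
proof -
 let ?F = "fps_exp (x / of_nat n) * (fps_X - fps_const x) ^ c"
 have "of_nat (Suc b) * exp_coeff x n (Suc b) c = fps_nth (fps_deriv ?F) b" unfolding fps_deriv_nth exp_coeff_def by simp
 also have "fps_deriv ?F = fps_const (x / of_nat n) * ?F
  + fps_const (of_nat c) * (fps_exp (x / of_nat n) * (fps_X - fps_const x) ^ (c - 1))" by (simp add: fps_deriv_power' fps_of_nat algebra_simps)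
 finally show ?thesis by (simp add: exp_coeff_def del: fps_const_mult fps_mult_nth)
qed

lemma exp_coeff_lower:
 "exp_coeff x n b (Suc c) = (if b = 0 then 0 else exp_coeff x n (b - 1) c) - x * exp_coeff x n b c"
proof -
 have "exp_coeff x n b (Suc c) =
  fps_nth (fps_X * (fps_exp (x / of_nat n) * (fps_X - fps_const x) ^ c)
   - fps_const x * (fps_exp (x / of_nat n) * (fps_X - fps_const x) ^ c)) b" by (simp add: exp_coeff_def algebra_simps)
 thus ?thesis by (simp add: exp_coeff_def del: fps_mult_nth)
qed

definition exp_matrix :: "complex => fock_matrix" where
 "exp_matrix x \<mu> \<xi> = (\<Prod>n\<in>set_mset \<mu> \<union> set_mset \<xi>. exp_coeff x n (count \<mu> n) (count \<xi> n))"

lemma exp_matrix_superset: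
 assumes "finite S" "set_mset \<mu> \<union> set_mset \<xi> \<subseteq> S"
 shows "exp_matrix x \<mu> \<xi> = (\<Prod>n\<in>S. exp_coeff x n (count \<mu> n) (count \<xi> n))" unfolding exp_matrix_def
proof (rule prod.mono_neutral_left)
 show "\<forall>i\<in>S - (set_mset \<mu> \<union> set_mset \<xi>). exp_coeff x i (count \<mu> i) (count \<xi> i) = 1" by (auto simp: not_in_iff)
qed (use assms in auto)

lemma exp_matrix_split:
 assumes "finite S" "k \<in> S" "set_mset \<mu> \<union> set_mset \<xi> \<subseteq> S"
  and "\<And>n. n \<noteq> k ==> count \<mu> n = count \<mu>0 n" "\<And>n. n \<noteq> k ==> count \<xi> n = count \<xi>0 n"
 shows "exp_matrix x \<mu> \<xi> = exp_coeff x k (count \<mu> k) (count \<xi> k)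
  * (\<Prod>n\<in>S - {k}. exp_coeff x n (count \<mu>0 n) (count \<xi>0 n))" unfolding exp_matrix_superset[OF assms(1,3)]
 by (subst prod.remove[OF assms(1,2)]) (auto intro!: prod.cong simp: assms(4,5))

lemma exp_matrix_raise:
 assumes "k > 0"
 shows "of_nat k * of_nat (Suc (count \<mu> k)) * exp_matrix x (add_mset k \<mu>) \<xi> =
  of_nat k * of_nat (count \<xi> k) * exp_matrix x \<mu> (\<xi> - {#k#}) + x * exp_matrix x \<mu> \<xi>"
proof -
 define S where "S = insert k (set_mset \<mu> \<union> set_mset \<xi>)"
 have S: "finite S" "k \<in> S" by (auto simp: S_def)
 let ?R = "\<Prod>n\<in>S - {k}. exp_coeff x n (count \<mu> n) (count \<xi> n)"
 have "set_mset (\<xi> - {#k#}) \<subseteq> set_mset \<xi>" by (meson in_diffD subsetI)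
 hence e: "exp_matrix x (add_mset k \<mu>) \<xi> = exp_coeff x k (Suc (count \<mu> k)) (count \<xi> k) * ?R"
  "exp_matrix x \<mu> (\<xi> - {#k#}) = exp_coeff x k (count \<mu> k) (count \<xi> k - 1) * ?R"
  "exp_matrix x \<mu> \<xi> = exp_coeff x k (count \<mu> k) (count \<xi> k) * ?R"
  by (subst exp_matrix_split[OF S, of _ _ \<mu> \<xi>]; auto simp: S_def)+
 have "of_nat k * of_nat (Suc (count \<mu> k)) * exp_coeff x k (Suc (count \<mu> k)) (count \<xi> k)
  = of_nat k * of_nat (count \<xi> k) * exp_coeff x k (count \<mu> k) (count \<xi> k - 1)
   + x * exp_coeff x k (count \<mu> k) (count \<xi> k)" using exp_coeff_raise[of "count \<mu> k" x k "count \<xi> k"] assms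
  by (simp add: field_simps del: of_nat_Suc)
 from arg_cong[OF this, of "\<lambda>t. t * ?R"] show ?thesis unfolding e by (simp only: distrib_right mult.assoc)
qed

lemma exp_matrix_lower:
 "(if j \<in># \<mu> then exp_matrix x (\<mu> - {#j#}) \<xi> else 0) - exp_matrix x \<mu> (add_mset j \<xi>) = x * exp_matrix x \<mu> \<xi>"
proof -
 define S where "S = insert j (set_mset \<mu> \<union> set_mset \<xi>)"
 have S: "finite S" "j \<in> S" by (auto simp: S_def)
 let ?R = "\<Prod>n\<in>S - {j}. exp_coeff x n (count \<mu> n) (count \<xi> n)"
 have "set_mset (\<mu> - {#j#}) \<subseteq> set_mset \<mu>" by (meson in_diffD subsetI)
 hence e: "exp_matrix x (\<mu> - {#j#}) \<xi> = exp_coeff x j (count \<mu> j - 1) (count \<xi> j) * ?R"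
  "exp_matrix x \<mu> (add_mset j \<xi>) = exp_coeff x j (count \<mu> j) (Suc (count \<xi> j)) * ?R"
  "exp_matrix x \<mu> \<xi> = exp_coeff x j (count \<mu> j) (count \<xi> j) * ?R"
  by (subst exp_matrix_split[OF S, of _ _ \<mu> \<xi>]; auto simp: S_def)+
 have "(if j \<in># \<mu> then exp_coeff x j (count \<mu> j - 1) (count \<xi> j) else 0)
   - exp_coeff x j (count \<mu> j) (Suc (count \<xi> j)) = x * exp_coeff x j (count \<mu> j) (count \<xi> j)"
  using exp_coeff_lower[of x j "count \<mu> j" "count \<xi> j"] by (simp add: count_eq_zero_iff)
 from arg_cong[OF this, of "\<lambda>t. t * ?R"] show ?thesis unfolding e
  by (cases "j \<in># \<mu>") (simp_all only: if_True if_False left_diff_distrib mult.assoc mult_zero_left)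
qed

definition cre :: "nat => fock_matrix => fock_matrix" where
 "cre j A \<mu> \<xi> = (if j \<in># \<mu> then A (\<mu> - {#j#}) \<xi> else 0)"

definition ann :: "nat => fock_matrix => fock_matrix" where
 "ann k A \<mu> \<xi> = of_nat k * of_nat (count \<xi> k) * A \<mu> (\<xi> - {#k#})"

definition lmul :: "int => fock_matrix => fock_matrix" where
 "lmul k A \<mu> \<xi> = (if k < 0 then cre (nat (- k)) A \<mu> \<xi>
  else of_int k * of_nat (Suc (count \<mu> (nat k))) * A (add_mset (nat k) \<mu>) \<xi>)"

definition rmul :: "int => fock_matrix => fock_matrix" where
 "rmul k A \<mu> \<xi> = (if k < 0 then A \<mu> (add_mset (nat (- k)) \<xi>) else ann (nat k) A \<mu> \<xi>)"

definition comm :: "int => fock_matrix => fock_matrix" where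
 "comm k A \<mu> \<xi> = lmul k A \<mu> \<xi> - rmul k A \<mu> \<xi>"

lemma comm_exp_matrix: "k \<noteq> 0 ==> comm k (exp_matrix x) \<mu> \<xi> = x * exp_matrix x \<mu> \<xi>"
 using exp_matrix_raise[of "nat k" \<mu> x \<xi>] exp_matrix_lower[of "nat (- k)" \<mu> x \<xi>]
 by (cases "k < 0") (simp_all add: comm_def lmul_def rmul_def cre_def ann_def algebra_simps)

definition nord :: "(int => complex) => complex => fock_matrix => fock_matrix" where
 "nord c g A \<mu> \<xi> = (\<Sum>j\<in>set_mset \<mu>. c (- int j) * cre j A \<mu> \<xi>) + c 0 * g * A \<mu> \<xi>
  + (\<Sum>k\<in>set_mset \<xi>. c (int k) * ann k A \<mu> \<xi>)"

primrec vmat :: "complex => complex => nat list => fock_matrix" where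
 "vmat g x [] = exp_matrix x"
| "vmat g x (n # ns) = nord (\<lambda>k. of_int (- k - 1) gchoose (n - 1)) g (vmat g x ns)"

lemma nord_superset:
 assumes "finite F" "set_mset \<mu> \<union> set_mset \<xi> \<subseteq> F"
 shows "nord c g A \<mu> \<xi> = (\<Sum>j\<in>F. c (- int j) * cre j A \<mu> \<xi>) + c 0 * g * A \<mu> \<xi>
  + (\<Sum>k\<in>F. c (int k) * ann k A \<mu> \<xi>)"
proof -
 have "(\<Sum>j\<in>set_mset \<mu>. c (- int j) * cre j A \<mu> \<xi>) = (\<Sum>j\<in>F. c (- int j) * cre j A \<mu> \<xi>)"
  by (rule sum.mono_neutral_left) (use assms in \<open>auto simp: cre_def\<close>)
 moreover have "(\<Sum>k\<in>set_mset \<xi>. c (int k) * ann k A \<mu> \<xi>) = (\<Sum>k\<in>F. c (int k) * ann k A \<mu> \<xi>)"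
  by (rule sum.mono_neutral_left) (use assms in \<open>auto simp: ann_def not_in_iff\<close>)
 ultimately show ?thesis by (simp add: nord_def)
qed

lemma cre_cre: "cre i (cre j A) = cre j (cre i A)"
proof (intro ext)
 fix \<mu> \<xi>
 have m: "i \<in># \<mu> - {#j#} \<longleftrightarrow> i \<in># \<mu>" "j \<in># \<mu> - {#i#} \<longleftrightarrow> j \<in># \<mu>" if "i \<noteq> j"
  using that by (auto simp: in_diff_count split: if_splits)
 have c: "\<mu> - {#i#} - {#j#} = \<mu> - {#j#} - {#i#}" by (rule diff_right_commute)
 show "cre i (cre j A) \<mu> \<xi> = cre j (cre i A) \<mu> \<xi>" unfolding cre_def by (cases "i = j") (use m c in simp_all)
qed

lemma ann_ann: "ann i (ann j A) = ann j (ann i A)"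
proof (intro ext)
 fix \<mu> \<xi>
 have c: "\<xi> - {#i#} - {#j#} = \<xi> - {#j#} - {#i#}" by (rule diff_right_commute)
 show "ann i (ann j A) \<mu> \<xi> = ann j (ann i A) \<mu> \<xi>" unfolding ann_def by (cases "i = j") (use c in simp_all)
qed

lemma cre_ann: "cre i (ann j A) = ann j (cre i A)" by (intro ext) (simp add: cre_def ann_def)

lemma cre_nord:
 assumes "finite F" "set_mset \<mu> \<union> set_mset \<xi> \<subseteq> F"
 shows "cre i (nord c g A) \<mu> \<xi> = (\<Sum>j\<in>F. c (- int j) * cre i (cre j A) \<mu> \<xi>) + c 0 * g * cre i A \<mu> \<xi>
  + (\<Sum>k\<in>F. c (int k) * ann k (cre i A) \<mu> \<xi>)"
proof (cases "i \<in># \<mu>")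
 case True
 have "set_mset (\<mu> - {#i#}) \<union> set_mset \<xi> \<subseteq> F" using assms(2) by (auto dest: in_diffD)
 from nord_superset[OF assms(1) this, of c g A] True show ?thesis by (simp add: cre_def[of i] ann_def)
qed (simp add: cre_def[of i] ann_def)

lemma ann_nord:
 assumes "finite F" "set_mset \<mu> \<union> set_mset \<xi> \<subseteq> F"
 shows "ann i (nord c g A) \<mu> \<xi> = (\<Sum>j\<in>F. c (- int j) * cre j (ann i A) \<mu> \<xi>) + c 0 * g * ann i A \<mu> \<xi>
  + (\<Sum>k\<in>F. c (int k) * ann i (ann k A) \<mu> \<xi>)"
proof -
 have "set_mset \<mu> \<union> set_mset (\<xi> - {#i#}) \<subseteq> F" using assms(2) by (auto dest: in_diffD)
 from nord_superset[OF assms(1) this, of c g A] show ?thesis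
  unfolding ann_def[of i] cre_def by (simp add: algebra_simps sum_distrib_left if_distrib cong: if_cong)
qed

lemma nord_commute: "nord c g (nord d h A) = nord d h (nord c g A)"
proof (intro ext)
 fix \<mu> \<xi> :: "nat multiset"
 define F where "F = set_mset \<mu> \<union> set_mset \<xi>"
 have F: "finite F" "set_mset \<mu> \<union> set_mset \<xi> \<subseteq> F" by (auto simp: F_def)
 have sw1: "(\<Sum>j\<in>F. \<Sum>i\<in>F. c (- int j) * (d (- int i) * cre j (cre i A) \<mu> \<xi>))
  = (\<Sum>j\<in>F. \<Sum>i\<in>F. d (- int j) * (c (- int i) * cre j (cre i A) \<mu> \<xi>))" by (subst sum.swap) (simp add: cre_cre mult_ac)
 have sw2: "(\<Sum>j\<in>F. \<Sum>i\<in>F. c (int j) * (d (int i) * ann j (ann i A) \<mu> \<xi>))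
  = (\<Sum>j\<in>F. \<Sum>i\<in>F. d (int j) * (c (int i) * ann j (ann i A) \<mu> \<xi>))" by (subst sum.swap) (simp add: ann_ann mult_ac)
 have sw3: "(\<Sum>j\<in>F. \<Sum>i\<in>F. f (- int j) * (e (int i) * ann i (cre j A) \<mu> \<xi>))
  = (\<Sum>j\<in>F. \<Sum>i\<in>F. e (int j) * (f (- int i) * cre i (ann j A) \<mu> \<xi>))" for e f :: "int => complex"
  by (subst sum.swap) (simp add: cre_ann mult_ac)
 show "nord c g (nord d h A) \<mu> \<xi> = nord d h (nord c g A) \<mu> \<xi>"
  unfolding nord_superset[OF F, of c g "nord d h A"] nord_superset[OF F, of d h "nord c g A"]
   cre_nord[OF F] ann_nord[OF F] nord_superset[OF F, of c g A] nord_superset[OF F, of d h A] using sw1 sw2 sw3[of c d] sw3[of d c]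
  by (simp add: sum.distrib distrib_left sum_distrib_left mult_ac)
qed

lemma nord_comb:
 "nord c g (\<lambda>\<mu> \<xi>. A \<mu> \<xi> + B \<mu> \<xi>) \<mu> \<xi> = nord c g A \<mu> \<xi> + nord c g B \<mu> \<xi>"
 "nord c g (\<lambda>\<mu> \<xi>. y * A \<mu> \<xi>) \<mu> \<xi> = y * nord c g A \<mu> \<xi>"
 "nord c g (\<lambda>\<mu> \<xi>. 0) \<mu> \<xi> = 0"
proof -
 have "cre j (\<lambda>\<mu> \<xi>. A \<mu> \<xi> + B \<mu> \<xi>) \<mu> \<xi> = cre j A \<mu> \<xi> + cre j B \<mu> \<xi>"
  "ann j (\<lambda>\<mu> \<xi>. A \<mu> \<xi> + B \<mu> \<xi>) \<mu> \<xi> = ann j A \<mu> \<xi> + ann j B \<mu> \<xi>"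
  "cre j (\<lambda>\<mu> \<xi>. y * A \<mu> \<xi>) \<mu> \<xi> = y * cre j A \<mu> \<xi>" "ann j (\<lambda>\<mu> \<xi>. y * A \<mu> \<xi>) \<mu> \<xi> = y * ann j A \<mu> \<xi>"
  "cre j (\<lambda>\<mu> \<xi>. 0) \<mu> \<xi> = 0" "ann j (\<lambda>\<mu> \<xi>. 0) \<mu> \<xi> = 0" for j
  by (simp_all add: cre_def ann_def algebra_simps)
 thus "nord c g (\<lambda>\<mu> \<xi>. A \<mu> \<xi> + B \<mu> \<xi>) \<mu> \<xi> = nord c g A \<mu> \<xi> + nord c g B \<mu> \<xi>"
 "nord c g (\<lambda>\<mu> \<xi>. y * A \<mu> \<xi>) \<mu> \<xi> = y * nord c g A \<mu> \<xi>"
 "nord c g (\<lambda>\<mu> \<xi>. 0) \<mu> \<xi> = 0" by (simp_all add: nord_def distrib_left sum.distrib sum_distrib_left mult_ac)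
qed

lemma nord_sum: "nord c g (\<lambda>\<mu> \<xi>. \<Sum>i\<in>I. A i \<mu> \<xi>) \<mu> \<xi> = (\<Sum>i\<in>I. nord c g (A i) \<mu> \<xi>)"
 by (induction I rule: infinite_finite_induct) (simp_all add: nord_comb)

lemma nord_coeff_sum:
 assumes "\<And>k. c k = (\<Sum>i\<in>I. y i * d i k)"
 shows "nord c g A \<mu> \<xi> = (\<Sum>i\<in>I. y i * nord (d i) g A \<mu> \<xi>)" unfolding nord_def assms
 by (simp add: sum.distrib distrib_left sum_distrib_right sum_distrib_left mult_ac)
  (subst (1 2) sum.swap, simp)

lemma comm_comb:
 "comm k (\<lambda>\<mu> \<xi>. A \<mu> \<xi> + B \<mu> \<xi>) \<mu> \<xi> = comm k A \<mu> \<xi> + comm k B \<mu> \<xi>"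
 "comm k (\<lambda>\<mu> \<xi>. y * A \<mu> \<xi>) \<mu> \<xi> = y * comm k A \<mu> \<xi>"
 "comm k (\<lambda>\<mu> \<xi>. 0) \<mu> \<xi> = 0" by (simp_all add: comm_def lmul_def rmul_def cre_def ann_def algebra_simps)

lemma comm_sum: "comm k (\<lambda>\<mu> \<xi>. \<Sum>i\<in>I. A i \<mu> \<xi>) \<mu> \<xi> = (\<Sum>i\<in>I. comm k (A i) \<mu> \<xi>)"
 by (induction I rule: infinite_finite_induct) (simp_all add: comm_comb)

lemma lmul_neg: "k < 0 ==> lmul k A = cre (nat (- k)) A" by (intro ext) (simp add: lmul_def)

lemma rmul_nonneg: "k \<ge> 0 ==> rmul k A = ann (nat k) A" by (intro ext) (simp add: rmul_def)

lemma comm_cre: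
 assumes "k \<noteq> 0"
 shows "comm k (cre j A) \<mu> \<xi> = cre j (comm k A) \<mu> \<xi> + (if k = int j then of_int k * A \<mu> \<xi> else 0)"
proof (cases "k < 0")
 case True
 thus ?thesis by (simp add: comm_def lmul_neg rmul_def cre_cre[of "nat (- k)" j A])
   (simp add: cre_def[of j] comm_def lmul_neg rmul_def)
next
 case False
 with assms have k: "k > 0" by simp
 show ?thesis
 proof (cases "j \<in># \<mu>")
  case True
  then obtain \<nu> where "\<mu> = add_mset j \<nu>" by (meson mset_add)
  thus ?thesis using k by (cases "k = int j") (auto simp: comm_def lmul_def rmul_def cre_def ann_def add_mset_commute algebra_simps)
 next
  case False
  hence "count \<mu> j = 0" by (simp add: not_in_iff)
  with False show ?thesis using k by (cases "k = int j") (auto simp: comm_def lmul_def rmul_def cre_def ann_def)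
 qed
qed

lemma comm_ann:
 assumes "k \<noteq> 0"
 shows "comm k (ann j A) \<mu> \<xi> = ann j (comm k A) \<mu> \<xi> + (if k = - int j then of_int k * A \<mu> \<xi> else 0)"
proof (cases "k < 0")
 case False
 thus ?thesis using assms by (simp add: comm_def lmul_def rmul_nonneg ann_ann[of "nat k" j A])
   (simp add: ann_def[of j] comm_def lmul_def rmul_nonneg algebra_simps)
next
 case True
 show ?thesis
 proof (cases "j \<in># \<xi>")
  case T: True
  then obtain \<nu> where "\<xi> = add_mset j \<nu>" by (meson mset_add)
  thus ?thesis using True by (cases "k = - int j") (auto simp: comm_def lmul_def rmul_def cre_def ann_def add_mset_commute algebra_simps)
 next
  case False
  hence "count \<xi> j = 0" by (simp add: not_in_iff)
  with False show ?thesis using True by (cases "k = - int j") (auto simp: comm_def lmul_def rmul_def cre_def ann_def)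
 qed
qed

lemma comm_nord:
 assumes "k \<noteq> 0"
 shows "comm k (nord c g A) \<mu> \<xi> = nord c g (comm k A) \<mu> \<xi> + of_int k * c (- k) * A \<mu> \<xi>"
proof -
 define F where "F = {nat \<bar>k\<bar>} \<union> set_mset \<mu> \<union> set_mset \<xi>"
 have F: "finite F" "set_mset \<mu> \<union> set_mset \<xi> \<subseteq> F" "nat \<bar>k\<bar> \<in> F" by (auto simp: F_def)
 define N where "N = (\<lambda>\<mu> \<xi>. (\<Sum>j\<in>F. c (- int j) * cre j A \<mu> \<xi>) + c 0 * g * A \<mu> \<xi>
  + (\<Sum>k\<in>F. c (int k) * ann k A \<mu> \<xi>))"
 have N: "nord c g A \<mu>' \<xi>' = N \<mu>' \<xi>'" if "set_mset \<mu>' \<union> set_mset \<xi>' \<subseteq> F" for \<mu>' \<xi>'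
  unfolding N_def by (rule nord_superset[OF F(1) that])
 have "comm k (nord c g A) \<mu> \<xi> = comm k N \<mu> \<xi>"
 proof -
  have "set_mset (\<mu> - {#j#}) \<subseteq> F" "set_mset (\<xi> - {#j#}) \<subseteq> F" for j using F(2) by (auto dest: in_diffD)
  hence "lmul k (nord c g A) \<mu> \<xi> = lmul k N \<mu> \<xi>" "rmul k (nord c g A) \<mu> \<xi> = rmul k N \<mu> \<xi>"
   using F assms by (auto simp: lmul_def rmul_def cre_def ann_def N)
  thus ?thesis by (simp add: comm_def)
 qed
 also have "\<dots> = (\<Sum>j\<in>F. c (- int j) * comm k (cre j A) \<mu> \<xi>) + c 0 * g * comm k A \<mu> \<xi>
  + (\<Sum>j\<in>F. c (int j) * comm k (ann j A) \<mu> \<xi>)" unfolding N_def by (simp add: comm_comb comm_sum mult.assoc)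
 also have "\<dots> = nord c g (comm k A) \<mu> \<xi>
  + ((\<Sum>j\<in>F. if k = int j then c (- int j) * of_int k * A \<mu> \<xi> else 0)
  + (\<Sum>j\<in>F. if k = - int j then c (int j) * of_int k * A \<mu> \<xi> else 0))"
 proof -
  have e: "c (- int j) * comm k (cre j A) \<mu> \<xi> = c (- int j) * cre j (comm k A) \<mu> \<xi>
    + (if k = int j then c (- int j) * of_int k * A \<mu> \<xi> else 0)"
   "c (int j) * comm k (ann j A) \<mu> \<xi> = c (int j) * ann j (comm k A) \<mu> \<xi>
    + (if k = - int j then c (int j) * of_int k * A \<mu> \<xi> else 0)" for j by (auto simp: comm_cre[OF assms] comm_ann[OF assms] distrib_left)
  show ?thesis unfolding nord_superset[OF F(1,2)] e sum.distrib by (simp only: add_ac)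
 qed
 also have "(\<Sum>j\<in>F. if k = int j then c (- int j) * of_int k * A \<mu> \<xi> else 0)
  = (\<Sum>j\<in>F. if j = nat \<bar>k\<bar> then (if k > 0 then c (- k) * of_int k * A \<mu> \<xi> else 0) else 0)"
  by (rule sum.cong) (use assms in auto)
 also have "(\<Sum>j\<in>F. if k = - int j then c (int j) * of_int k * A \<mu> \<xi> else 0)
  = (\<Sum>j\<in>F. if j = nat \<bar>k\<bar> then (if k < 0 then c (- k) * of_int k * A \<mu> \<xi> else 0) else 0)"
  by (rule sum.cong) (use assms in auto)
 finally show ?thesis using F assms by (auto simp: mult_ac)
qed

lemma nord_int_sum:
 assumes "finite A" "(\<lambda>j. - int j) ` set_mset \<mu> \<subseteq> A" "int ` set_mset \<xi> \<subseteq> A" "0 \<in> A" "0 \<notin># \<mu>" "0 \<notin># \<xi>"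
 shows "(\<Sum>k\<in>A. c k * (if k < 0 then cre (nat (- k)) V \<mu> \<xi> else if k = 0 then g * V \<mu> \<xi> else ann (nat k) V \<mu> \<xi>))
  = nord c g V \<mu> \<xi>"
proof -
 let ?t = "\<lambda>k. c k * (if k < 0 then cre (nat (- k)) V \<mu> \<xi> else if k = 0 then g * V \<mu> \<xi> else ann (nat k) V \<mu> \<xi>)"
 let ?M = "(\<lambda>j. - int j) ` set_mset \<mu>" and ?K = "int ` set_mset \<xi>"
 have "sum ?t A = sum ?t (?M \<union> {0} \<union> ?K)"
 proof (rule sum.mono_neutral_right)
  show "\<forall>k\<in>A - (?M \<union> {0} \<union> ?K). ?t k = 0"
  proof
   fix k assume k: "k \<in> A - (?M \<union> {0} \<union> ?K)"
   show "?t k = 0"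
   proof (cases "k < 0")
    case True
    hence "k = - int (nat (- k))" by simp
    with k have "nat (- k) \<notin># \<mu>" by blast
    with True show ?thesis by (simp add: cre_def)
   next
    case False
    hence "k = int (nat k)" by simp
    with k have "nat k \<notin># \<xi>" by blast
    with k False show ?thesis by (simp add: ann_def not_in_iff)
   qed
  qed
 qed (use assms in auto)
 also have "\<dots> = sum ?t ?M + ?t 0 + sum ?t ?K"
 proof -
  have pos: "j > 0" if "j \<in># \<mu> \<or> j \<in># \<xi>" for j using that assms(5,6) by (cases j) auto
  have "- int j \<noteq> int k" if "j \<in># \<mu>" for j k using pos[of j] that by auto
  hence "(?M \<union> {0}) \<inter> ?K = {}" using assms(6) by auto
  moreover have "?M \<inter> {0} = {}" using assms(5) by auto
  ultimately show ?thesis by (simp add: sum.union_disjoint)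
 qed
 also have "sum ?t ?M = (\<Sum>j\<in>set_mset \<mu>. c (- int j) * cre j V \<mu> \<xi>)"
  by (subst sum.reindex) (use assms(5) in \<open>auto simp: inj_on_def intro!: sum.cong\<close>)
 also have "sum ?t ?K = (\<Sum>j\<in>set_mset \<xi>. c (int j) * ann j V \<mu> \<xi>)"
  by (subst sum.reindex) (use assms(6) in \<open>auto simp: inj_on_def intro!: sum.cong\<close>)
 finally show ?thesis by (simp add: nord_def mult.assoc)
qed

lemma sum_if_distrib: "(\<Sum>k\<in>A. if Q then e * t k else 0) = (if Q then e * (\<Sum>k\<in>A. t k) else (0::complex))"
 by (simp add: sum_distrib_left)

lemma if_mult_cong: "(Q ==> s = t) ==> (if Q then e * s else 0) = (if Q then e * t else (0::complex))" by simp

lemma lookup_Sum_any: "finite A ==> (\<And>k. k \<notin> A ==> T k = 0) ==>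
 lookup (Sum_any T) b = (\<Sum>k\<in>A. lookup (T k) b)" by (simp add: Sum_any_superset lookup_sum)

context
 fixes form :: "'h::ab_group_add => 'h => complex" and a :: 'h and eps :: "'h => 'h => complex"
begin

lemma lookup_Emode_vac:
 assumes "0 \<notin># \<xi>"
 shows "lookup (Emode form a \<alpha> d (basis (\<xi>, \<gamma>))) ({#}, \<gamma>) =
  (if - int (deg \<xi>) = d then exp_matrix (form a \<alpha>) {#} \<xi> else 0)" using assms
proof (induction \<xi> arbitrary: d)
 case empty
 thus ?case by (simp add: Emode_vac exp_matrix_def)
next
 case (add j \<xi>)
 hence j: "j > 0" and k: "0 \<notin># \<xi>" by (cases j; simp)+
 have "Emode form a \<alpha> d (basis (add_mset j \<xi>, \<gamma>)) = osc form a (- int j) (Emode form a \<alpha> d (basis (\<xi>, \<gamma>)))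
   - smult (form a \<alpha>) (Emode form a \<alpha> (d + int j) (basis (\<xi>, \<gamma>)))"
  using osc_Emode[of "- int j" form a \<alpha> d "basis (\<xi>, \<gamma>)"] j by (simp add: osc_basis)
 hence "lookup (Emode form a \<alpha> d (basis (add_mset j \<xi>, \<gamma>))) ({#}, \<gamma>)
   = - form a \<alpha> * lookup (Emode form a \<alpha> (d + int j) (basis (\<xi>, \<gamma>))) ({#}, \<gamma>)"
  using j by (simp add: lookup_minus lookup_osc)
 also have "\<dots> = (if - int (deg (add_mset j \<xi>)) = d then exp_matrix (form a \<alpha>) {#} (add_mset j \<xi>) else 0)"
  using add.IH[OF k] exp_matrix_lower[of j "{#}" "form a \<alpha>" \<xi>] by (auto simp: algebra_simps neg_eq_iff_add_eq_0)
 finally show ?case .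
qed

lemma lookup_Emode:
 assumes "0 \<notin># \<xi>"
 shows "lookup (Emode form a \<alpha> d (basis (\<xi>, \<gamma>))) (\<mu>, \<gamma>) =
  (if 0 \<notin># \<mu> \<and> int (deg \<mu>) - int (deg \<xi>) = d then exp_matrix (form a \<alpha>) \<mu> \<xi> else 0)"
proof (cases "0 \<in># \<mu>")
 case True
 thus ?thesis by (simp add: sector_lookup[OF sector_Emode[OF sector_basis[OF assms]]])
next
 case False
 thus ?thesis using assms
 proof (induction \<mu> arbitrary: d \<xi>)
  case empty
  thus ?case by (simp add: lookup_Emode_vac)
 next
  case (add k \<mu>)
  hence k: "k > 0" and m: "0 \<notin># \<mu>" by (cases k; simp)+
  have kk: "0 \<notin># \<xi> - {#k#}" using add.prems by (meson in_diffD)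
  let ?L = "\<lambda>d \<mu> \<xi>. lookup (Emode form a \<alpha> d (basis (\<xi>, \<gamma>))) (\<mu>, \<gamma>)"
  let ?E = "exp_matrix (form a \<alpha>)"
  have "lookup (osc form a (int k) (Emode form a \<alpha> d (basis (\<xi>, \<gamma>)))) (\<mu>, \<gamma>)
   = of_nat k * of_nat (count \<xi> k) * ?L d \<mu> (\<xi> - {#k#}) + form a \<alpha> * ?L (d - int k) \<mu> \<xi>"
   using osc_Emode[of "int k" form a \<alpha> d "basis (\<xi>, \<gamma>)"] k
   by (simp add: osc_basis lookup_add linear_opD[OF linear_op_Emode] del: smult_single)
  hence "of_nat k * of_nat (Suc (count \<mu> k)) * ?L d (add_mset k \<mu>) \<xi>
   = of_nat k * of_nat (count \<xi> k) * ?L d \<mu> (\<xi> - {#k#}) + form a \<alpha> * ?L (d - int k) \<mu> \<xi>"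
   using k by (simp add: lookup_osc)
  also have "\<dots> = (if int (deg (add_mset k \<mu>)) - int (deg \<xi>) = d
   then of_nat k * of_nat (count \<xi> k) * ?E \<mu> (\<xi> - {#k#}) + form a \<alpha> * ?E \<mu> \<xi> else 0)"
  proof -
   have "int (deg (\<xi> - {#k#})) = int (deg \<xi>) - int k" if "count \<xi> k \<noteq> 0"
    using that by (auto simp: count_eq_zero_iff sum_mset.remove[of k \<xi>])
   thus ?thesis using add.IH[OF m kk, of d] add.IH[OF m add.prems(2), of "d - int k"] m by (cases "count \<xi> k = 0") auto
  qed
  also have "\<dots> = of_nat k * of_nat (Suc (count \<mu> k)) *
    (if int (deg (add_mset k \<mu>)) - int (deg \<xi>) = d then ?E (add_mset k \<mu>) \<xi> else 0)"
   using exp_matrix_raise[OF k, of \<mu> "form a \<alpha>" \<xi>] by simp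
  finally show ?case using k m by (simp del: of_nat_Suc)
 qed
qed

lemma linear_op_exp_op [intro, simp]: "linear_op (exp_op eps \<alpha>)" by (simp add: exp_op_def)

lemma linear_op_z_pow [intro, simp]: "linear_op (z_pow form \<alpha> k)" by (simp add: z_pow_def)

lemma lookup_lin_ext_nonzero:
 assumes "lookup (lin_ext f v) b \<noteq> 0"
 shows "\<exists>b'. lookup v b' \<noteq> 0 \<and> lookup (f b') b \<noteq> 0"
proof -
 obtain b' where "b' \<in> keys v" "lookup (smult (lookup v b') (f b')) b \<noteq> 0"
  using assms unfolding lin_ext_def lookup_sum by (meson sum.not_neutral_contains_not_neutral)
 thus ?thesis by (intro exI[of _ b']) auto
qed

lemma exp_mode_support:
 "\<exists>D B. \<forall>m i j. Yterm form a eps \<alpha> m i j v \<noteq> 0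
  \<longrightarrow> j \<le> D \<and> int j - int i - m - 1 \<in> {- int B..int B}"
proof -
 obtain D where D: "\<forall>\<mu> \<gamma>. lookup v (\<mu>, \<gamma>) \<noteq> 0 \<longrightarrow> deg \<mu> \<le> (D::nat)"
  using degree_bound[of v] by auto
 define K where "K = {k. z_pow form \<alpha> k v \<noteq> 0}"
 have "K \<subseteq> (\<lambda>b. THE k::int. form \<alpha> (snd b) = of_int k) ` keys v"
 proof
  fix k assume "k \<in> K"
  then obtain b where "lookup (z_pow form \<alpha> k v) b \<noteq> 0" unfolding K_def mem_Collect_eq by (metis lookup_zero poly_mapping_eqI)
  then obtain b' where b': "lookup v b' \<noteq> 0" "form \<alpha> (snd b') = of_int k"
   unfolding z_pow_def by (auto dest!: lookup_lin_ext_nonzero split: prod.splits if_splits)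
  have "(THE k::int. form \<alpha> (snd b') = of_int k) = k" unfolding b'(2) of_int_eq_iff by (rule the_equality) (rule refl, erule sym)
  moreover have "b' \<in> keys v" using b'(1) by (simp add: in_keys_iff)
  ultimately show "k \<in> (\<lambda>b. THE k::int. form \<alpha> (snd b) = of_int k) ` keys v" by (rule image_eqI[OF sym])
 qed
 hence "finite K" by (rule finite_subset) simp
 hence "\<forall>k\<in>K. \<bar>k\<bar> \<le> (\<Sum>k\<in>K. \<bar>k\<bar>)" by (auto intro!: member_le_sum)
 moreover define B where "B = nat (\<Sum>k\<in>K. \<bar>k\<bar>)"
 moreover have "int B = (\<Sum>k\<in>K. \<bar>k\<bar>)" by (simp add: B_def sum_nonneg)
 ultimately have B: "\<forall>k\<in>K. \<bar>k\<bar> \<le> int B" by simp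
 have "j \<le> D \<and> int j - int i - m - 1 \<in> {- int B..int B}"
  if "Yterm form a eps \<alpha> m i j v \<noteq> 0" for m i j
 proof -
  let ?w = "exp_op eps \<alpha> (z_pow form \<alpha> (int j - int i - m - 1) v)"
  have "deg \<mu> \<le> D" if "lookup ?w (\<mu>, \<gamma>) \<noteq> 0" for \<mu> \<gamma>
  proof -
   from that obtain \<gamma>' where "lookup (z_pow form \<alpha> (int j - int i - m - 1) v) (\<mu>, \<gamma>') \<noteq> 0"
    unfolding exp_op_def by (auto simp: lookup_single when_def dest!: lookup_lin_ext_nonzero split: if_splits)
   then obtain \<gamma>'' where "lookup v (\<mu>, \<gamma>'') \<noteq> 0"
    unfolding z_pow_def by (auto simp: lookup_single when_def dest!: lookup_lin_ext_nonzero split: if_splits)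
   with D show ?thesis by blast
  qed
  with that have "j \<le> D" using Y_plus_eq_0[of ?w D j form a \<alpha>] linear_opD(3)[OF linear_op_Y(1)] by (metis not_le)
  moreover have "int j - int i - m - 1 \<in> K"
   using that by (auto simp: K_def linear_opD[OF linear_op_exp_op] linear_opD[OF linear_op_Y(1)] linear_opD[OF linear_op_Y(2)])
  ultimately show ?thesis using B by (auto simp: abs_le_iff)
 qed
 thus ?thesis by blast
qed

lemma finite_exp_mode_support:
 "finite {p. (case p of (i, j) => Yterm form a eps \<alpha> m i j v) \<noteq> 0}"
proof -
 obtain D B where *: "\<forall>i j. Yterm form a eps \<alpha> m i j v \<noteq> 0
  \<longrightarrow> j \<le> D \<and> int j - int i - m - 1 \<in> {- int B..int B}" using exp_mode_support[of \<alpha> v] by blast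
 have "i \<le> nat (int D + int B + \<bar>m\<bar>)" if "j \<le> D" "int j - int i - m - 1 \<in> {- int B..int B}" for i j using that by auto
 with * have **: "i \<in> {..nat (int D + int B + \<bar>m\<bar>)} \<and> j \<in> {..D}"
  if "Yterm form a eps \<alpha> m i j v \<noteq> 0" for i j using that by (metis atMost_iff)
 have "{p. (case p of (i, j) => Yterm form a eps \<alpha> m i j v) \<noteq> 0}
   \<subseteq> {..nat (int D + int B + \<bar>m\<bar>)} \<times> {..D}" using ** by (intro subsetI) (simp split: prod.splits)
 thus ?thesis by (rule finite_subset) simp
qed

lemma linear_op_exp_mode [intro, simp]: "linear_op (exp_mode form a eps \<alpha> m)" unfolding exp_mode_def [abs_def]
proof (rule linear_op_Sum_any)
 fix p :: "nat \<times> nat"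
 show "linear_op (\<lambda>v. case p of (i, j) => Yterm form a eps \<alpha> m i j v)" unfolding case_prod_unfold
  by (rule linear_op_compose[OF linear_op_Y(1) linear_op_compose[OF linear_op_Y(2) linear_op_compose[OF linear_op_exp_op linear_op_z_pow]]])
qed (rule finite_exp_mode_support)

lemma exp_mode_truncated: "\<exists>M. \<forall>m\<ge>M. exp_mode form a eps \<alpha> m v = 0"
proof -
 obtain D B where *: "\<forall>m i j. Yterm form a eps \<alpha> m i j v \<noteq> 0
  \<longrightarrow> j \<le> D \<and> int j - int i - m - 1 \<in> {- int B..int B}" using exp_mode_support[of \<alpha> v] by blast
 have "Yterm form a eps \<alpha> m i j v = 0"
  if "m \<ge> int D + int B" for m i j
 proof (rule ccontr)
  assume "\<not> ?thesis"
  from *[rule_format, OF this] that show False by auto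
 qed
 hence "\<forall>m\<ge>int D + int B. exp_mode form a eps \<alpha> m v = 0" by (simp add: exp_mode_def case_prod_unfold)
 thus ?thesis by blast
qed

lemma exp_mode_basis:
 assumes "form \<alpha> \<gamma> = of_int k"
 shows "exp_mode form a eps \<alpha> m (basis (\<xi>, \<gamma>)) =
  smult (eps \<alpha> \<gamma>) (Emode form a \<alpha> (- m - 1 - k) (basis (\<xi>, \<alpha> + \<gamma>)))"
proof -
 let ?d = "- m - 1 - k"
 let ?b = "basis (\<xi>, \<alpha> + \<gamma>)"
 have t: "Yterm form a eps \<alpha> m i j (basis (\<xi>, \<gamma>))
  = (if int i = ?d + int j then smult (eps \<alpha> \<gamma>) (Y_minus form a \<alpha> i (Y_plus form a \<alpha> j ?b)) else 0)" for i j
 proof -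
  have "single (\<xi>, \<alpha> + \<gamma>) (eps \<alpha> \<gamma>) = smult (eps \<alpha> \<gamma>) ?b" by simp
  moreover have "form \<alpha> \<gamma> = of_int (int j - int i - m - 1) \<longleftrightarrow> int i = ?d + int j"
   unfolding assms of_int_eq_iff by auto
  ultimately show ?thesis by (simp add: z_pow_def exp_op_def linear_opD[OF linear_op_Y(1)] linear_opD[OF linear_op_Y(2)]
     linear_opD[OF linear_op_lin_ext] del: smult_single)
 qed
 obtain D where D: "\<forall>j. j \<notin> {0..int D} \<longrightarrow> Yp form a \<alpha> j ?b = 0" using Yp_bound by blast
 define S where "S = {j. j \<le> D \<and> ?d + int j \<ge> 0}"
 have S: "finite S" by (simp add: S_def)
 let ?P = "(\<lambda>j. (nat (?d + int j), j)) ` S"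
 have "exp_mode form a eps \<alpha> m (basis (\<xi>, \<gamma>)) =
  (\<Sum>(i, j)\<in>?P. if int i = ?d + int j then smult (eps \<alpha> \<gamma>) (Y_minus form a \<alpha> i (Y_plus form a \<alpha> j ?b)) else 0)"
  unfolding exp_mode_def t
 proof (rule Sum_any_superset)
  fix p assume "p \<notin> ?P"
  moreover obtain i j where p: "p = (i, j)" by (cases p)
  ultimately have "j > D" if "int i = ?d + int j" using that by (force simp: S_def image_iff)
  hence "Y_plus form a \<alpha> j ?b = 0" if "int i = ?d + int j" using that D[rule_format, of "int j"] by (auto simp: Yp_def)
  thus "(case p of (i, j) => if int i = ?d + int j then smult (eps \<alpha> \<gamma>) (Y_minus form a \<alpha> i (Y_plus form a \<alpha> j ?b)) else 0) = 0"
   by (auto simp: p linear_opD[OF linear_op_Y(1)])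
 qed (simp add: S)
 also have "\<dots> = (\<Sum>j\<in>S. smult (eps \<alpha> \<gamma>) (Ym form a \<alpha> (?d + int j) (Yp form a \<alpha> (int j) ?b)))"
  by (subst sum.reindex) (auto simp: inj_on_def S_def Ym_def Yp_def intro!: sum.cong)
 also have "\<dots> = smult (eps \<alpha> \<gamma>) (\<Sum>j\<in>int ` S. Ym form a \<alpha> (?d + j) (Yp form a \<alpha> j ?b))"
  by (subst sum.reindex) (auto simp: smult_sum)
 also have "(\<Sum>j\<in>int ` S. Ym form a \<alpha> (?d + j) (Yp form a \<alpha> j ?b)) = (\<Sum>j\<in>{0..int D}. Ym form a \<alpha> (?d + j) (Yp form a \<alpha> j ?b))"
 proof (rule sum.mono_neutral_left)
  show "\<forall>j\<in>{0..int D} - int ` S. Ym form a \<alpha> (?d + j) (Yp form a \<alpha> j ?b) = 0"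
  proof
   fix j assume j: "j \<in> {0..int D} - int ` S"
   hence "j = int (nat j)" by auto
   with j have "nat j \<notin> S" by (metis DiffD2 image_eqI)
   with j have "?d + j < 0" by (auto simp: S_def)
   thus "Ym form a \<alpha> (?d + j) (Yp form a \<alpha> j ?b) = 0" by (simp add: Ym_def)
  qed
 qed (auto simp: S_def)
 also have "\<dots> = Emode form a \<alpha> ?d ?b" by (rule Emode_superset[symmetric]) (use D in auto)
 finally show ?thesis .
qed

lemma osc_eq_0: "\<exists>D. \<forall>k>int D. osc form a k v = 0"
proof -
 obtain D where D: "\<forall>\<mu> \<gamma>. lookup v (\<mu>, \<gamma>) \<noteq> 0 \<longrightarrow> deg \<mu> \<le> (D::nat)"
  using degree_bound[of v] by auto
 have "osc form a k v = 0" if "k > int D" for k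
 proof (rule poly_mapping_eqI, clarify)
  fix \<mu> \<gamma>
  have "\<not> deg (add_mset (nat k) \<mu>) \<le> D" using that by simp
  with D have "lookup v (add_mset (nat k) \<mu>, \<gamma>) = 0" by blast
  thus "lookup (osc form a k v) (\<mu>, \<gamma>) = lookup 0 (\<mu>, \<gamma>)" using that by (simp add: lookup_osc)
 qed
 thus ?thesis by blast
qed

definition list_mode_term :: "nat => nat list => 'h => int => int => 'h vec => 'h vec" where
 "list_mode_term n ns \<alpha> m k v = smult (of_int (- k - 1) gchoose (n - 1))
  (if k < 0 then osc form a k (list_mode form a eps ns \<alpha> (m - k - int n) v)
   else list_mode form a eps ns \<alpha> (m - k - int n) (osc form a k v))"

lemma list_mode_Cons: "list_mode form a eps (n # ns) \<alpha> m v = Sum_any (\<lambda>k. list_mode_term n ns \<alpha> m k v)"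
 by (simp add: list_mode_term_def)

lemma list_mode_linear_truncated:
 "linear_op (list_mode form a eps ns \<alpha> m)" (is "?lin ns m")
 "\<exists>M. \<forall>m\<ge>M. list_mode form a eps ns \<alpha> m v = 0" (is "?trunc ns v")
proof -
 have "(\<forall>m. ?lin ns m) \<and> (\<forall>v. ?trunc ns v)"
 proof (induction ns)
  case Nil
  thus ?case by (simp add: exp_mode_truncated)
 next
  case (Cons n ns)
  then obtain M where M: "\<And>v m. m \<ge> M v ==> list_mode form a eps ns \<alpha> m v = 0"
   and lin: "\<And>m. linear_op (list_mode form a eps ns \<alpha> m)" by metis
  obtain D where D: "\<And>v k. k > int (D v) ==> osc form a k v = 0" using osc_eq_0 by metis
  have z: "list_mode_term n ns \<alpha> m k v = 0"
   if "k \<ge> 0 \<longrightarrow> k > int (D v) \<or> m - k - int n \<ge> M (osc form a k v)" "k < 0 \<longrightarrow> m - k - int n \<ge> M v" for k v m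
   using that by (auto simp: list_mode_term_def D M linear_opD[OF lin] linear_opD[OF linear_op_osc])
  have "finite {k. list_mode_term n ns \<alpha> m k v \<noteq> 0}" for v m
   by (rule finite_subset[of _ "{m - int n - M v..int (D v)} \<union> {0..int (D v)}"]) (use z in force)+
  moreover have "linear_op (list_mode_term n ns \<alpha> m k)" for m k unfolding list_mode_term_def [abs_def]
   by (cases "k < 0") (simp_all add: linear_op_scaled linear_op_compose[OF linear_op_osc lin] linear_op_compose[OF lin linear_op_osc])
  ultimately have "linear_op (list_mode form a eps (n # ns) \<alpha> m)" for m unfolding list_mode_Cons [abs_def] by (intro linear_op_Sum_any)
  moreover have "?trunc (n # ns) v" for v
  proof -
   let ?B = "Max ((\<lambda>k. M (osc form a k v) + k) ` {0..int (D v)})"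
   have B: "M (osc form a k v) + k \<le> ?B" if "k \<in> {0..int (D v)}" for k by (rule Max_ge) (use that in auto)
   have "list_mode form a eps (n # ns) \<alpha> m v = 0" if "m \<ge> \<bar>?B\<bar> + \<bar>M v\<bar> + int n" for m
   proof -
    have "list_mode_term n ns \<alpha> m k v = 0" for k
    proof (rule z)
     show "k \<ge> 0 \<longrightarrow> k > int (D v) \<or> m - k - int n \<ge> M (osc form a k v)"
     proof (intro impI)
      assume "k \<ge> 0"
      show "k > int (D v) \<or> m - k - int n \<ge> M (osc form a k v)"
      proof (cases "k > int (D v)")
       case False
       with \<open>k \<ge> 0\<close> have "M (osc form a k v) + k \<le> ?B" by (intro B) simp
       thus ?thesis using that abs_ge_self[of ?B] abs_ge_zero[of "M v"] by linarith
      qed simp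
     qed
    qed (use that in force)
    thus ?thesis by (simp add: list_mode_Cons del: list_mode.simps)
   qed
   thus ?thesis by blast
  qed
  ultimately show ?case by blast
 qed
 thus "?lin ns m" "?trunc ns v" by blast+
qed

lemmas linear_op_list_mode [intro, simp] = list_mode_linear_truncated(1)

lemma list_mode_term_support: "finite {k. list_mode_term n ns \<alpha> m k v \<noteq> 0}"
proof -
 obtain M where M: "\<And>m. m \<ge> M ==> list_mode form a eps ns \<alpha> m v = 0" using list_mode_linear_truncated(2) by blast
 obtain D where D: "\<And>k. k > int D ==> osc form a k v = 0" using osc_eq_0 by blast
 have "list_mode_term n ns \<alpha> m k v = 0" if "k > int D \<or> k < 0 \<and> m - k - int n \<ge> M" for k
  using that by (auto simp: list_mode_term_def D M linear_opD[OF linear_op_list_mode] linear_opD[OF linear_op_osc])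
 hence "{k. list_mode_term n ns \<alpha> m k v \<noteq> 0} \<subseteq> {m - int n - M..int D} \<union> {0..int D}" by force
 thus ?thesis by (rule finite_subset) simp
qed

lemma lookup_list_mode:
 assumes "form \<alpha> \<gamma> = of_int k0" "0 \<notin># \<xi>" "0 \<notin> set ns"
 shows "lookup (list_mode form a eps ns \<alpha> m (basis (\<xi>, \<gamma>))) (\<mu>, \<delta>) =
  (if \<delta> = \<alpha> + \<gamma> \<and> 0 \<notin># \<mu> \<and> int (deg \<mu>) - int (deg \<xi>) - int (sum_list ns) + k0 = - m - 1
  then eps \<alpha> \<gamma> * vmat (form a \<gamma>) (form a \<alpha>) ns \<mu> \<xi> else 0)" using assms(2,3)
proof (induction ns arbitrary: m \<mu> \<xi>)
 case Nil
 have "lookup (Emode form a \<alpha> (- m - 1 - k0) (basis (\<xi>, \<alpha> + \<gamma>))) (\<mu>, \<delta>) = 0" if "\<delta> \<noteq> \<alpha> + \<gamma>"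
  by (rule sector_lookup[OF sector_Emode[OF sector_basis[OF Nil(1)]]]) (simp add: that)
 moreover have "int (deg \<mu>) - int (deg \<xi>) + k0 = - m - 1 \<longleftrightarrow> int (deg \<mu>) - int (deg \<xi>) = - m - 1 - k0" by auto
 ultimately show ?case using lookup_Emode[OF Nil(1), of \<alpha> "- m - 1 - k0" "\<alpha> + \<gamma>" \<mu>]
  by (cases "\<delta> = \<alpha> + \<gamma>") (simp_all add: exp_mode_basis[OF assms(1)])
next
 case (Cons n ns)
 have ns: "0 \<notin> set ns" and n: "n > 0" using Cons.prems by auto
 let ?b = "basis (\<xi>, \<gamma>)"
 let ?g = "form a \<gamma>" and ?V = "vmat (form a \<gamma>) (form a \<alpha>) ns"
 let ?c = "\<lambda>k::int. of_int (- k - 1) gchoose (n - 1) :: complex"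
 let ?Q = "\<delta> = \<alpha> + \<gamma> \<and> 0 \<notin># \<mu> \<and> int (deg \<mu>) - int (deg \<xi>) - int (sum_list (n # ns)) + k0 = - m - 1"
 let ?t = "\<lambda>k. ?c k * (if k < 0 then cre (nat (- k)) ?V \<mu> \<xi> else if k = 0 then ?g * ?V \<mu> \<xi> else ann (nat k) ?V \<mu> \<xi>)"
 have t: "lookup (list_mode_term n ns \<alpha> m k ?b) (\<mu>, \<delta>) = (if ?Q then eps \<alpha> \<gamma> * ?t k else 0)" for k
 proof (cases k "0::int" rule: linorder_cases)
  case less
  then obtain j where j: "k = - int j" "j > 0" by (metis neg_int_cases)
  have "lookup (list_mode_term n ns \<alpha> m k ?b) (\<mu>, \<delta>)
   = ?c k * (if j \<in># \<mu> then lookup (list_mode form a eps ns \<alpha> (m - k - int n) ?b) (\<mu> - {#j#}, \<delta>) else 0)"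
   using j by (simp add: list_mode_term_def lookup_osc)
  also have "\<dots> = (if ?Q then eps \<alpha> \<gamma> * ?t k else 0)"
  proof (cases "j \<in># \<mu>")
   case True
   then obtain \<nu> where "\<mu> = add_mset j \<nu>" by (meson mset_add)
   thus ?thesis using j True Cons.IH[OF Cons.prems(1) ns, of "m - k - int n" \<nu>] by (auto simp: cre_def)
  qed (use j in \<open>simp add: cre_def\<close>)
  finally show ?thesis .
 next
  case equal
  thus ?thesis using Cons.IH[OF Cons.prems(1) ns, of "m - int n" \<mu>]
   by (auto simp: list_mode_term_def osc_basis linear_opD[OF linear_op_list_mode] mult_ac simp del: smult_single)
 next
  case greater
  then obtain j where j: "k = int j" "j > 0" by (metis pos_int_cases)
  show ?thesis
  proof (cases "j \<in># \<xi>")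
   case True
   then obtain \<nu> where nu: "\<xi> = add_mset j \<nu>" by (meson mset_add)
   with Cons.prems have "0 \<notin># \<nu>" by simp
   from Cons.IH[OF this ns, of "m - k - int n" \<mu>] show ?thesis using j
    by (auto simp: list_mode_term_def osc_basis nu linear_opD[OF linear_op_list_mode] ann_def mult_ac simp del: smult_single of_nat_Suc)
  next
   case False
   hence "count \<xi> j = 0" by (simp add: not_in_iff)
   thus ?thesis using j by (simp add: list_mode_term_def osc_basis linear_opD[OF linear_op_list_mode] ann_def del: smult_single)
  qed
 qed
 define A where "A = {k. list_mode_term n ns \<alpha> m k ?b \<noteq> 0} \<union> (\<lambda>j. - int j) ` set_mset \<mu> \<union> int ` set_mset \<xi> \<union> {0}"
 have A: "finite A" by (simp add: A_def list_mode_term_support)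
 have "lookup (list_mode form a eps (n # ns) \<alpha> m ?b) (\<mu>, \<delta>)
  = (\<Sum>k\<in>A. lookup (list_mode_term n ns \<alpha> m k ?b) (\<mu>, \<delta>))"
  unfolding list_mode_Cons by (rule lookup_Sum_any[OF A]) (auto simp: A_def)
 also have "\<dots> = (if ?Q then eps \<alpha> \<gamma> * (\<Sum>k\<in>A. ?t k) else 0)" unfolding t by (rule sum_if_distrib)
 also have "\<dots> = (if ?Q then eps \<alpha> \<gamma> * nord ?c ?g ?V \<mu> \<xi> else 0)"
 proof (rule if_mult_cong)
  assume ?Q
  thus "(\<Sum>k\<in>A. ?t k) = nord ?c ?g ?V \<mu> \<xi>" by (intro nord_int_sum) (use A Cons.prems in \<open>auto simp: A_def\<close>)
 qed
 finally show ?case by (simp del: list_mode.simps)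
qed

end

section \<open>Square bracket modes\<close>

definition expm1 :: "complex fps" where "expm1 = fps_exp 1 - 1"

definition bern_exp :: "nat => complex" where "bern_exp k = fps_nth (fps_X / expm1) k"

lemma bernoulli_eq: "bernoulli k / fact k = bern_exp k" by (simp add: bernoulli_def bern_exp_def expm1_def)

lemma expm1_nth_0 [simp]: "fps_nth expm1 0 = 0" by (simp add: expm1_def)

lemma expm1_nth_1 [simp]: "fps_nth expm1 (Suc 0) = 1" by (simp add: expm1_def)

lemma expm1_nonzero [simp]: "expm1 \<noteq> 0" by (metis expm1_nth_1 fps_zero_nth zero_neq_one)

lemma subdegree_expm1 [simp]: "subdegree expm1 = 1" by (rule subdegreeI) auto

lemma deriv_expm1 [simp]: "fps_deriv expm1 = fps_exp 1" by (simp add: expm1_def)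

lemma exp_eq_expm1: "fps_exp 1 = 1 + expm1" by (simp add: expm1_def)

lemma X_div_expm1: "(fps_X / expm1) * expm1 = fps_X" by (rule dvd_div_mult_self) (simp add: fps_dvd_iff)

lemma bern_exp_odd:
 assumes "odd k"
 shows "bern_exp k = (if k = 1 then - 1 / 2 else 0)"
proof -
 let ?F = "fps_X / expm1"
 let ?N = "?F oo (- fps_X)"
 have "?N * (fps_exp (- 1) - 1) = - fps_X"
 proof -
  have "(?F * expm1) oo (- fps_X) = ?N * (expm1 oo (- fps_X))" by (rule fps_compose_mult_distrib) simp
  moreover have "expm1 oo (- fps_X) = fps_exp (- 1) - 1" by (simp add: expm1_def fps_compose_sub_distrib)
  ultimately show ?thesis by (simp add: X_div_expm1)
 qed
 hence "?N * ((fps_exp (- 1) - 1) * fps_exp 1) = - fps_X * fps_exp 1" by (simp only: mult.assoc[symmetric])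
 moreover have "(fps_exp (- 1) - 1) * fps_exp 1 = - expm1" by (simp add: expm1_def algebra_simps fps_exp_add_mult[symmetric])
 ultimately have "?N * expm1 = fps_X * (1 + expm1)" by (simp add: exp_eq_expm1)
 also have "\<dots> = (?F + fps_X) * expm1" by (simp only: distrib_right X_div_expm1) (simp add: algebra_simps)
 finally have "?N = ?F + fps_X" by simp
 from arg_cong[OF this, of "\<lambda>f. fps_nth f k"]
 have "fps_nth ?N k = bern_exp k + (if k = 1 then 1 else 0)" by (simp add: bern_exp_def)
 moreover have "fps_nth ?N k = - bern_exp k" using assms by (simp add: bern_exp_def fps_compose_uminus')
 ultimately have "2 * bern_exp k = - (if k = 1 then 1 else 0)" by (auto simp: eq_neg_iff_add_eq_0 algebra_simps)
 thus ?thesis by (cases "k = 1") (simp_all add: eq_neg_iff_add_eq_0 field_simps)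
qed

abbreviation (input) "fX \<equiv> fps_to_fls expm1"

lemma fX_nonzero [simp]: "fX \<noteq> 0" by simp

definition sqc :: "nat => int => complex" where
 "sqc r m = sq_coeff 1 m (- int r)"

abbreviation (input) sq2 :: "nat => nat => complex" where
 "sq2 r s \<equiv> (\<Sum>m=1..s. of_nat m * sqc r (int m) * sqc s (- int m))"

definition gco :: "nat => nat => complex" where
 "gco j n = fls_nth (fps_to_fls (fps_exp 1) * inverse fX ^ Suc j) (int n)"

lemma sqc_nonneg: "r \<ge> 1 ==> sqc r (int m) = gco m (r - 1)"
proof -
 assume r: "r \<ge> 1"
 have "- int m - 1 = - int (Suc m)" by simp
 hence "fX powi (- int m - 1) = inverse fX ^ Suc m" by (simp only: power_int_minus power_int_of_nat power_inverse)
 moreover have "- (- int r) - 1 = int (r - 1)" using r by simp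
 ultimately show ?thesis by (simp only: sqc_def sq_coeff_def gco_def expm1_def[symmetric])
qed

lemma sqc_neg:
 assumes "r \<ge> 1" "m \<ge> 1"
 shows "sqc r (- int m) = fps_nth (fps_exp 1 * expm1 ^ (m - 1)) (r - 1)"
proof -
 have "- (- int m) - 1 = int (m - 1)" using assms by simp
 hence "fX powi (- (- int m) - 1) = fX ^ (m - 1)" by (simp only: power_int_of_nat)
 moreover have "- (- int r) - 1 = int (r - 1)" using assms by simp
 ultimately have "sqc r (- int m) = fls_nth (fps_to_fls (fps_exp 1) * fX ^ (m - 1)) (int (r - 1))"
  by (simp only: sqc_def sq_coeff_def expm1_def[symmetric])
 thus ?thesis by (simp flip: fps_to_fls_power fls_times_fps_to_fls)
qed

lemma expm1_power_nth_eq_0: "n < m ==> fps_nth (expm1 ^ m) n = 0" by (intro nth_less_subdegree_zero) simp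

lemma sqc_eq_0: "r \<ge> 1 ==> m < - int r ==> sqc r m = 0"
proof -
 assume r: "r \<ge> 1" and m: "m < - int r"
 define k where "k = nat (- m)"
 have k: "m = - int k" "k > r" using m by (auto simp: k_def)
 have "fps_nth (fps_exp 1 * expm1 ^ (k - 1)) (r - 1) = 0" by (rule nth_less_subdegree_zero) (use k r in simp)
 thus ?thesis using sqc_neg[OF r, of k] k r by simp
qed

lemma fls_deriv_inverse_fX: "fls_deriv (inverse fX) = - fps_to_fls (fps_exp 1) * inverse fX ^ 2"
proof -
 have "fX * fls_deriv (inverse fX) + fls_deriv fX * inverse fX = 0" using fls_deriv_mult[of fX "inverse fX"] by simp
 hence "fX * fls_deriv (inverse fX) = - (fps_to_fls (fps_exp 1) * inverse fX)" by (simp add: fls_deriv_fps_to_fls eq_neg_iff_add_eq_0)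
 hence "inverse fX * (fX * fls_deriv (inverse fX)) = - (fps_to_fls (fps_exp 1) * inverse fX) * inverse fX" by (simp add: mult.commute)
 thus ?thesis by (simp add: mult.assoc[symmetric] power2_eq_square)
qed

lemma gco_deriv:
 "of_nat (Suc n) * gco j (Suc n) = - of_nat j * gco j n - of_nat (Suc j) * gco (Suc j) n"
proof -
 let ?Z = "inverse fX" and ?E = "fps_to_fls (fps_exp 1) :: complex fls"
 have EZ: "?E * ?Z = 1 + ?Z" by (simp add: exp_eq_expm1 distrib_right fps_to_fls_plus del: fls_of_nat)
 have "fls_deriv (?E * ?Z ^ Suc j) = ?E * ?Z ^ Suc j + ?E * (of_nat (Suc j) * ?Z ^ j * (- ?E * ?Z ^ 2))"
  by (simp only: fls_deriv_mult fls_deriv_power fls_deriv_inverse_fX fls_deriv_fps_to_fls) (simp add: mult_ac)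
 also have "?E * (of_nat (Suc j) * ?Z ^ j * (- ?E * ?Z ^ 2)) = - of_nat (Suc j) * (?E * ?Z ^ j * ?Z * (?E * ?Z))"
  by (simp add: power2_eq_square algebra_simps)
 also have "\<dots> = - of_nat (Suc j) * (?E * ?Z ^ Suc j) - of_nat (Suc j) * (?E * ?Z ^ Suc (Suc j))" unfolding EZ by (simp add: algebra_simps)
 finally have *: "fls_deriv (?E * ?Z ^ Suc j) = - of_nat j * (?E * ?Z ^ Suc j) - of_nat (Suc j) * (?E * ?Z ^ Suc (Suc j))"
  by (simp add: algebra_simps)
 have nn: "fls_nth (of_nat k * f) i = of_nat k * fls_nth f i" for k i and f :: "complex fls" by (simp add: fls_of_nat)
 have "of_int (int n + 1) * fls_nth (?E * ?Z ^ Suc j) (int n + 1) = fls_nth (fls_deriv (?E * ?Z ^ Suc j)) (int n)" by (simp only: fls_deriv_nth)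
 also have "\<dots> = - (of_nat j * gco j n) - of_nat (Suc j) * gco (Suc j) n"
  unfolding * gco_def by (simp only: fls_minus_nth fls_uminus_nth nn mult_minus_left)
 finally show ?thesis by (simp add: gco_def add.commute)
qed

definition eco :: "nat => nat => complex" where "eco s j = fps_nth (expm1 ^ j) s"

lemma eco_deriv: "of_nat (Suc s) * eco (Suc s) j = of_nat j * (eco s j + eco s (j - 1))"
proof (cases j)
 case 0
 thus ?thesis by (simp add: eco_def)
next
 case (Suc i)
 have "of_nat (Suc s) * eco (Suc s) j = fps_nth (fps_deriv (expm1 ^ j)) s" unfolding fps_deriv_nth eco_def by simp
 also have "fps_deriv (expm1 ^ j) = fps_const (of_nat j) * (expm1 ^ j + expm1 ^ i)"
  by (simp only: fps_deriv_power deriv_expm1 exp_eq_expm1) (simp add: Suc algebra_simps)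
 finally show ?thesis by (simp add: eco_def Suc del: of_nat_Suc)
qed

lemma eco_eq_0: "s < j ==> eco s j = 0" by (simp add: eco_def expm1_power_nth_eq_0)

lemma sum_eco_gco:
 "(\<Sum>j\<le>s. eco s j * gco j n) = (- 1) ^ s * of_nat ((n + s) choose s) * gco 0 (n + s)"
proof (induction s arbitrary: n)
 case 0
 thus ?case by (simp add: eco_def)
next
 case (Suc s)
 have "of_nat (Suc s) * (\<Sum>j\<le>Suc s. eco (Suc s) j * gco j n)
  = (\<Sum>j\<le>Suc s. of_nat j * eco s j * gco j n) + (\<Sum>j\<le>Suc s. of_nat j * eco s (j - 1) * gco j n)"
  unfolding sum_distrib_left sum.distrib[symmetric]
  by (rule sum.cong[OF refl]) (simp only: mult.assoc[symmetric] eco_deriv, simp add: algebra_simps)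
 also have "(\<Sum>j\<le>Suc s. of_nat j * eco s j * gco j n) = (\<Sum>j\<le>s. of_nat j * eco s j * gco j n)" by (simp add: eco_eq_0)
 also have "(\<Sum>j\<le>Suc s. of_nat j * eco s (j - 1) * gco j n) = (\<Sum>j\<le>s. of_nat (Suc j) * eco s j * gco (Suc j) n)"
  by (subst sum.atMost_Suc_shift) simp
 also have "(\<Sum>j\<le>s. of_nat j * eco s j * gco j n) + (\<Sum>j\<le>s. of_nat (Suc j) * eco s j * gco (Suc j) n)
  = - of_nat (Suc n) * (\<Sum>j\<le>s. eco s j * gco j (Suc n))" unfolding sum.distrib[symmetric] sum_distrib_left
 proof (rule sum.cong[OF refl])
  fix j
  have "eco s j * (of_nat (Suc n) * gco j (Suc n)) = eco s j * (- of_nat j * gco j n - of_nat (Suc j) * gco (Suc j) n)" by (simp only: gco_deriv)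
  thus "of_nat j * eco s j * gco j n + of_nat (Suc j) * eco s j * gco (Suc j) n = - of_nat (Suc n) * (eco s j * gco j (Suc n))" by algebra
 qed
 also have "\<dots> = (- 1) ^ Suc s * of_nat (Suc n * ((Suc n + s) choose s)) * gco 0 (n + Suc s)"
  by (simp only: Suc.IH[of "Suc n"] of_nat_mult) (simp del: of_nat_Suc)
 also have "Suc n * ((Suc n + s) choose s) = Suc s * ((n + Suc s) choose Suc s)"
 proof -
  have "Suc s * ((n + Suc s) choose Suc s) = (n + Suc s) * ((n + s) choose s)" using Suc_times_binomial_eq[of "n + s" s] by simp
  moreover have "Suc n * ((Suc n + s) choose s) = (n + Suc s) * ((n + s) choose s)"
   using Suc_times_binomial_eq[of "n + s" n] binomial_symmetric[of n "n + s"] binomial_symmetric[of s "Suc n + s"]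
    binomial_symmetric[of "Suc n" "Suc n + s"] by simp
  ultimately show ?thesis by simp
 qed
 finally have "of_nat (Suc s) * (\<Sum>j\<le>Suc s. eco (Suc s) j * gco j n)
  = of_nat (Suc s) * ((- 1) ^ Suc s * of_nat ((n + Suc s) choose Suc s) * gco 0 (n + Suc s))" by (simp only: of_nat_mult mult_ac)
 thus ?case by (simp only: mult_cancel_left of_nat_eq_0_iff nat.distinct simp_thms)
qed

lemma gco_0: "gco 0 n = bern_exp (Suc n) + (if n = 0 then 1 else 0)"
proof -
 have "fls_nth (inverse fX) (int n) = bern_exp (Suc n)"
 proof -
  have "fps_to_fls (fps_X / expm1) * fX = fls_X" by (simp only: fls_times_fps_to_fls[symmetric] X_div_expm1 fps_X_to_fls)
  hence "fps_to_fls (fps_X / expm1) * fX * inverse fX = fls_X * inverse fX" by simp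
  hence eq: "fps_to_fls (fps_X / expm1) = fls_X * inverse fX" by (simp add: mult.assoc)
  have "bern_exp (Suc n) = fls_nth (fps_to_fls (fps_X / expm1)) (int (Suc n))" by (simp add: bern_exp_def del: of_nat_Suc)
  also have "\<dots> = fls_nth (inverse fX) (int (Suc n) - 1)" unfolding eq by (simp add: fls_X_times_conv_shift del: of_nat_Suc)
  finally show ?thesis by simp
 qed
 moreover have "fps_to_fls (fps_exp 1) * inverse fX = 1 + inverse fX" by (simp add: exp_eq_expm1 distrib_right fps_to_fls_plus del: fls_of_nat)
 ultimately show ?thesis by (simp add: gco_def)
qed

lemma sum_sqc_sqc:
 assumes "r \<ge> 1" "s \<ge> 1"
 shows "(sq2 r s) =
  (- 1) ^ s * fact (r + s - 1) / (fact (r - 1) * fact (s - 1)) * bern_exp (r + s)"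
proof -
 have "of_nat m * sqc s (- int m) = of_nat s * eco s m" if "m \<ge> 1" for m
 proof -
  obtain i where i: "m = Suc i" using \<open>m \<ge> 1\<close> by (cases m) auto
  have s: "Suc (s - 1) = s" using assms by simp
  have "of_nat s * eco s m = fps_nth (fps_deriv (expm1 ^ m)) (s - 1)" unfolding fps_deriv_nth eco_def using assms(2) by simp
  also have "fps_deriv (expm1 ^ m) = fps_const (of_nat m) * (fps_exp 1 * expm1 ^ (m - 1))" by (simp only: fps_deriv_power deriv_expm1 mult.assoc)
  finally show ?thesis using sqc_neg[OF assms(2) that] by simp
 qed
 hence "(sq2 r s) = (\<Sum>m=1..s. of_nat s * (eco s m * gco m (r - 1)))" using assms by (intro sum.cong) (auto simp: sqc_nonneg mult_ac)
 also have "\<dots> = (\<Sum>m\<le>s. of_nat s * (eco s m * gco m (r - 1)))"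
  by (rule sum.mono_neutral_left) (use assms in \<open>auto simp: eco_def not_le\<close>)
 also have "\<dots> = of_nat s * ((- 1) ^ s * of_nat ((r - 1 + s) choose s) * gco 0 (r - 1 + s))"
  by (simp only: sum_distrib_left[symmetric] sum_eco_gco)
 also have "gco 0 (r - 1 + s) = bern_exp (r + s)" using assms by (simp add: gco_0)
 also have "of_nat ((r - 1 + s) choose s) = (fact (r + s - 1) / (fact s * fact (r - 1)) :: complex)" using assms by (subst binomial_fact) auto
 also have "(fact s :: complex) = of_nat s * fact (s - 1)" using assms by (subst fact_reduce) auto
 finally show ?thesis using assms by (simp add: field_simps)
qed

lemma sqc_symmetric:
 assumes "r \<ge> 1" "s \<ge> 1"
 shows "(sq2 r s) = (\<Sum>m=1..r. of_nat m * sqc s (int m) * sqc r (- int m))"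
proof (cases "odd (r + s)")
 case True
 hence "bern_exp (r + s) = 0" using assms bern_exp_odd[OF True] by auto
 thus ?thesis using sum_sqc_sqc[OF assms] sum_sqc_sqc[OF assms(2,1)] by (simp add: add.commute)
next
 case False
 hence "(- 1) ^ s = ((- 1) ^ r :: complex)" by (auto simp: minus_one_power_iff)
 thus ?thesis using sum_sqc_sqc[OF assms] sum_sqc_sqc[OF assms(2,1)] by (simp add: add.commute mult.commute)
qed

lemma binomial_compose_expm1: "fps_binomial y oo expm1 = fps_exp y"
proof -
 let ?B = "fps_binomial y"
 have "fps_deriv ?B * (1 + fps_X) = fps_const y * ?B"
 proof -
  have "fps_deriv ?B = fps_const y * ?B / (1 + fps_X)" by (rule fps_binomial_deriv)
  thus ?thesis by (simp add: fps_divide_unit mult.assoc inverse_mult_eq_1)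
 qed
 hence "(fps_deriv ?B * (1 + fps_X)) oo expm1 = (fps_const y * ?B) oo expm1" by simp
 hence "(fps_deriv ?B oo expm1) * fps_exp 1 = fps_const y * (?B oo expm1)"
  by (simp add: fps_compose_mult_distrib fps_compose_add_distrib exp_eq_expm1)
 hence "fps_deriv (?B oo expm1) = fps_const y * (?B oo expm1)" by (subst fps_compose_deriv) simp_all
 thus ?thesis unfolding fps_exp_unique_ODE by simp
qed

lemma sum_sqc_gchoose:
 assumes "r \<ge> 1"
 shows "(\<Sum>m=1..r. sqc r (- int m) * (of_int (- k - 1) gchoose (m - 1))) = (- of_int k) ^ (r - 1) / fact (r - 1)"
proof -
 let ?y = "of_int (- k - 1) :: complex"
 let ?n = "r - 1"
 have r: "Suc ?n = r" using assms by simp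
 have "(\<Sum>m=1..r. sqc r (- int m) * (?y gchoose (m - 1))) = (\<Sum>m=1..r. fps_nth (fps_exp 1 * expm1 ^ (m - 1)) ?n * (?y gchoose (m - 1)))"
  by (rule sum.cong) (simp_all add: sqc_neg[OF assms])
 also have "\<dots> = (\<Sum>i\<le>?n. fps_nth (fps_exp 1 * expm1 ^ i) ?n * (?y gchoose i))"
  by (rule sum.reindex_bij_witness[where i = Suc and j = "\<lambda>m. m - 1"]) (use assms in auto)
 also have "\<dots> = (\<Sum>i\<le>?n. \<Sum>j=0..?n. fps_nth (fps_exp 1) (?n - j) * ((?y gchoose i) * fps_nth (expm1 ^ i) j))"
  by (simp only: mult.commute[of "fps_exp 1"] fps_mult_nth) (simp only: sum_distrib_right sum_distrib_left mult_ac)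
 also have "\<dots> = (\<Sum>j=0..?n. fps_nth (fps_exp 1) (?n - j) * (\<Sum>i\<le>?n. (?y gchoose i) * fps_nth (expm1 ^ i) j))"
  by (subst sum.swap) (simp add: sum_distrib_left)
 also have "\<dots> = (\<Sum>j=0..?n. fps_nth (fps_exp 1) (?n - j) * fps_nth (fps_exp ?y) j)"
 proof (rule sum.cong[OF refl])
  fix j assume j: "j \<in> {0..?n}"
  have "(\<Sum>i\<le>?n. (?y gchoose i) * fps_nth (expm1 ^ i) j) = (\<Sum>i=0..j. (?y gchoose i) * fps_nth (expm1 ^ i) j)"
   by (rule sum.mono_neutral_right) (use j in \<open>auto simp: expm1_power_nth_eq_0\<close>)
  also have "\<dots> = fps_nth (fps_binomial ?y oo expm1) j" by (simp add: fps_compose_nth)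
  finally show "fps_nth (fps_exp 1) (?n - j) * (\<Sum>i\<le>?n. (?y gchoose i) * fps_nth (expm1 ^ i) j) = fps_nth (fps_exp 1) (?n - j) * fps_nth (fps_exp ?y) j"
   by (simp only: binomial_compose_expm1)
 qed
 also have "\<dots> = fps_nth (fps_exp ?y * fps_exp 1) ?n" by (subst fps_mult_nth) (simp only: mult.commute)
 also have "fps_exp ?y * fps_exp 1 = fps_exp (- of_int k :: complex)" by (simp add: fps_exp_add_mult[symmetric])
 finally show ?thesis by simp
qed

lemma sum_gchoose_sqc:
 assumes "r \<ge> 1"
 shows "(\<Sum>m=1..r. of_nat m * (of_int k gchoose m) * sqc r (- int m)) = of_int k ^ r / fact (r - 1)"
proof -
 have "of_nat m * (of_int k gchoose m) = (of_int k :: complex) * (of_int (- (- k) - 1) gchoose (m - 1))" if "m \<ge> 1" for m :: nat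
  using gbinomial_absorption[of "m - 1" "of_int k :: complex"] that by simp
 hence "(\<Sum>m=1..r. of_nat m * (of_int k gchoose m) * sqc r (- int m))
  = of_int k * (\<Sum>m=1..r. sqc r (- int m) * (of_int (- (- k) - 1) gchoose (m - 1)))"
  unfolding sum_distrib_left by (intro sum.cong) (auto simp: mult_ac)
 also have "\<dots> = of_int k * (of_int k ^ (r - 1) / fact (r - 1))" by (simp only: sum_sqc_gchoose[OF assms]) simp
 also have "\<dots> = of_int k ^ r / fact (r - 1)" using assms by (cases r) auto
 finally show ?thesis .
qed

lemma sum_mset_eq_sum_count: "sum_mset A = (\<Sum>j\<in>set_mset A. count A j * j :: nat)"
proof -
 have "sum_mset A = (\<Sum>j\<in>F. count A j * j)" if "finite F" "set_mset A \<subseteq> F" for F using that(2)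
 proof (induction A)
  case (add x A)
  have "(\<Sum>j\<in>F. count (add_mset x A) j * j) = (\<Sum>j\<in>F. count A j * j + (if x = j then j else 0))" by (rule sum.cong) auto
  thus ?case using add that(1) by (simp add: sum.distrib)
 qed simp
 thus ?thesis by simp
qed

locale lattice_voa = rank_one_even_lattice scale form L
 for scale :: "complex => 'h::ab_group_add => 'h" and form :: "'h => 'h => complex" and L :: "'h set" +
 fixes eps :: "'h => 'h => complex" and a :: 'h
 assumes a_norm: "form a a = 1" and cocycle: "cocycle form eps L"
begin

lemma form_add_right: "form x (y + w) = form x y + form x w" by (simp add: form_sym[of x] form_add_left)

lemma form_scale_right: "form x (scale c y) = c * form x y" by (simp add: form_sym[of x] form_scale_left)

lemma form_zero [simp]: "form 0 x = 0" "form x 0 = 0" using form_add_left[of 0 0 x] form_add_right[of x 0 0] by simp_all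

lemma L_closed: "0 \<in> L" "x \<in> L ==> y \<in> L ==> x + y \<in> L" "x \<in> L ==> - x \<in> L"
proof -
 obtain g where g: "L = (\<lambda>k::int. scale (of_int k) g) ` UNIV" using rank_one by blast
 show "0 \<in> L" unfolding g by (rule image_eqI[of _ _ 0]) simp_all
 show "x + y \<in> L" if "x \<in> L" "y \<in> L"
 proof -
  from that obtain k l :: int where "x = scale (of_int k) g" "y = scale (of_int l) g" by (auto simp: g)
  hence "x + y = scale (of_int (k + l)) g" by (simp add: scale_left_distrib)
  thus ?thesis unfolding g by blast
 qed
 show "- x \<in> L" if "x \<in> L"
 proof -
  from that obtain k :: int where "x = scale (of_int k) g" by (auto simp: g)
  hence "- x = scale (of_int (- k)) g" by simp
  thus ?thesis unfolding g by blast
 qed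
qed

lemma L_sum: "(\<And>i. i \<in> A ==> f i \<in> L) ==> sum f A \<in> L"
 by (induction A rule: infinite_finite_induct) (simp_all add: L_closed)

lemma form_int:
 assumes "x \<in> L" "y \<in> L"
 shows "\<exists>k::int. form x y = of_int k"
proof -
 obtain g where g: "L = (\<lambda>k::int. scale (of_int k) g) ` UNIV" using rank_one by blast
 from assms obtain k l :: int where kl: "x = scale (of_int k) g" "y = scale (of_int l) g" by (auto simp: g)
 have "g \<in> L" unfolding g by (rule image_eqI[of _ _ 1]) simp_all
 then obtain m :: int where "form g g = of_int (2 * m)" using even_form by blast
 hence "form x y = of_int (k * l * (2 * m))" by (simp add: kl form_scale_left form_scale_right)
 thus ?thesis by blast
qed

lemmas cocycleD = cocycle[unfolded cocycle_def, THEN conjunct1]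
 cocycle[unfolded cocycle_def, THEN conjunct2, THEN conjunct1]
 cocycle[unfolded cocycle_def, THEN conjunct2, THEN conjunct2, THEN conjunct1]
 cocycle[unfolded cocycle_def, THEN conjunct2, THEN conjunct2, THEN conjunct2]

lemma eps_values: "x \<in> L ==> y \<in> L ==> eps x y \<noteq> 0" using cocycleD(1) by force

lemma eps_add: "x \<in> L ==> y \<in> L ==> w \<in> L ==> eps x (y + w) = eps x y * eps x w"
 using cocycleD(2) by simp

lemma eps_neg_self: "x \<in> L ==> eps x (- x) = 1" "x \<in> L ==> eps x x = 1" using cocycleD(3) by simp_all

lemma eps_0_right: "x \<in> L ==> eps x 0 = 1" using eps_add[of x 0 0] eps_values[of x 0] L_closed(1) by simp

lemma eps_0_left:
 assumes "y \<in> L"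
 shows "eps 0 y = 1"
proof -
 define g where "g = - y"
 have g: "g \<in> L" "- g \<in> L" "- g = y" using assms L_closed by (auto simp: g_def)
 have "exp_op eps 0 (exp_op eps g (exp_op eps (- 0) (exp_op eps (- g) (basis ({#}, 0)))))
     = smult ((- 1) powi 0) (basis ({#}, 0))" by (rule cocycleD(4)[rule_format, OF L_closed(1) g(1) _ L_closed(1)]) simp
 hence "single ({#}, 0 :: 'h) (eps (- g) 0 * (eps 0 (- g) * (eps g (- g) * eps 0 0))) = basis ({#}, 0)" by (simp add: exp_op_def mult_ac)
 from arg_cong[OF this, of "\<lambda>v. lookup v ({#}, 0)"]
 have "eps (- g) 0 * (eps 0 (- g) * (eps g (- g) * eps 0 0)) = 1" by (simp only: lookup_single_eq)
 thus ?thesis using g eps_0_right[OF g(2)] eps_neg_self(1)[OF g(1)] eps_0_right[OF L_closed(1)] by simp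
qed

lemma exp_matrix_0:
 shows "exp_matrix 0 \<mu> \<xi> = (if \<mu> = \<xi> then 1 else 0)"
proof -
 have c: "exp_coeff 0 n b c = (if b = c then 1 else 0)" for n b c by (simp add: exp_coeff_def)
 show ?thesis
 proof (cases "\<mu> = \<xi>")
  case False
  then obtain n where n: "count \<mu> n \<noteq> count \<xi> n" by (meson multiset_eqI)
  hence "n \<in> set_mset \<mu> \<union> set_mset \<xi>" by (auto simp: not_in_iff)
  with n False show ?thesis by (auto simp: exp_matrix_def c intro!: prod_zero)
 qed (simp add: exp_matrix_def c)
qed

lemma exp_mode_zero_basis:
 assumes "0 \<notin># \<xi>" "\<gamma> \<in> L"
 shows "exp_mode form a eps 0 m (basis (\<xi>, \<gamma>)) = (if m = - 1 then basis (\<xi>, \<gamma>) else 0)"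
proof (rule poly_mapping_eqI)
 fix b :: "nat multiset \<times> 'h"
 obtain \<mu> \<delta> where b: "b = (\<mu>, \<delta>)" by (cases b)
 have "lookup (list_mode form a eps [] 0 m (basis (\<xi>, \<gamma>))) (\<mu>, \<delta>) =
  (if \<delta> = 0 + \<gamma> \<and> 0 \<notin># \<mu> \<and> int (deg \<mu>) - int (deg \<xi>) - int (sum_list []) + 0 = - m - 1
  then eps 0 \<gamma> * vmat (form a \<gamma>) (form a 0) [] \<mu> \<xi> else 0)" by (rule lookup_list_mode) (use assms in auto)
 thus "lookup (exp_mode form a eps 0 m (basis (\<xi>, \<gamma>))) b
  = lookup (if m = - 1 then basis (\<xi>, \<gamma>) else 0) b" using assms by (auto simp: b eps_0_left exp_matrix_0 lookup_single when_def)
qed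

lemma exp_mode_zero:
 assumes "v \<in> sector \<gamma>" "\<gamma> \<in> L"
 shows "exp_mode form a eps 0 m v = (if m = - 1 then v else 0)"
proof -
 have "exp_mode form a eps 0 m v = (\<lambda>v. if m = - 1 then v else 0) v"
 proof (rule linear_op_eqI[where S = "exp_mode form a eps 0 m" and T = "\<lambda>v. if m = - 1 then v else 0"])
  fix b assume "b \<in> keys v"
  with sector_keys[OF assms(1)] obtain \<mu> where "b = (\<mu>, \<gamma>)" "0 \<notin># \<mu>" by blast
  thus "exp_mode form a eps 0 m (basis b) = (if m = - 1 then basis b else 0)" using exp_mode_zero_basis assms(2) by simp
 next
  show "linear_op (\<lambda>v. if m = - 1 then v else 0)" by (cases "m = - 1") simp_all
 qed simp
 thus ?thesis by simp
qed

lemma list_mode_one: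
 assumes "v \<in> sector \<gamma>" "\<gamma> \<in> L"
 shows "list_mode form a eps [1] 0 m v = osc form a m v"
proof -
 have "list_mode_term form a eps 1 [] 0 m k v = (if k = m then osc form a m v else 0)" for k
  by (simp add: list_mode_term_def exp_mode_zero[OF assms] exp_mode_zero[OF sector_osc[OF assms(1)] assms(2)]
    linear_opD[OF linear_op_osc])
 thus ?thesis unfolding list_mode_Cons by simp
qed

lemma L0_basis:
 assumes "0 \<notin># \<xi>" "\<gamma> \<in> L"
 shows "L0 form a eps (basis (\<xi>, \<gamma>)) = smult (of_nat (deg \<xi>) + form a \<gamma> ^ 2 / 2) (basis (\<xi>, \<gamma>))"
proof -
 let ?b = "basis (\<xi>, \<gamma>)"
 let ?u = "\<lambda>k::int. if k = 0 then form a \<gamma> ^ 2 else of_int \<bar>k\<bar> * of_nat (count \<xi> (nat \<bar>k\<bar>))"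
 have "list_mode_term form a eps 1 [1] 0 1 k ?b = smult (?u k) ?b" for k
 proof -
  have b: "?b \<in> sector \<gamma>" by (rule sector_basis[OF assms(1)])
  have pos: "osc form a (- l) (osc form a l ?b) = smult (of_int l * of_nat (count \<xi> (nat l))) ?b" if "l > 0" for l
  proof (cases "nat l \<in># \<xi>")
   case False
   hence "count \<xi> (nat l) = 0" by (simp add: not_in_iff)
   thus ?thesis using that by (simp add: osc_basis linear_opD[OF linear_op_osc] del: smult_single)
  qed (use that in \<open>simp add: osc_basis linear_opD[OF linear_op_osc] del: smult_single\<close>)
  show ?thesis
  proof (cases k "0::int" rule: linorder_cases)
   case less
   thus ?thesis using pos[of "- k"]
    by (simp add: list_mode_term_def list_mode_one[OF b assms(2), unfolded One_nat_def] del: list_mode.simps smult_single)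
  next
   case equal
   thus ?thesis by (simp add: list_mode_term_def list_mode_one[OF b assms(2), unfolded One_nat_def] osc_basis linear_opD[OF linear_op_osc]
     list_mode_one[OF sector_smult[OF b] assms(2), unfolded One_nat_def] power2_eq_square del: list_mode.simps smult_single)
  next
   case greater
   thus ?thesis using pos[of k]
    by (simp add: list_mode_term_def list_mode_one[OF sector_osc[OF b] assms(2), unfolded One_nat_def] del: list_mode.simps smult_single)
  qed
 qed
 hence "list_mode form a eps [1, 1] 0 1 ?b = Sum_any (\<lambda>k. smult (?u k) ?b)" unfolding list_mode_Cons by simp
 also have "\<dots> = (\<Sum>k\<in>(\<lambda>j. - int j) ` set_mset \<xi> \<union> {0} \<union> int ` set_mset \<xi>. smult (?u k) ?b)"
 proof (rule Sum_any_superset)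
  fix k assume k: "k \<notin> (\<lambda>j. - int j) ` set_mset \<xi> \<union> {0} \<union> int ` set_mset \<xi>"
  have "k = - int (nat \<bar>k\<bar>) \<or> k = int (nat \<bar>k\<bar>)" by auto
  with k have "nat \<bar>k\<bar> \<notin># \<xi>" by (metis UnCI image_eqI)
  hence "count \<xi> (nat \<bar>k\<bar>) = 0" by (simp add: not_in_iff)
  with k show "smult (?u k) ?b = 0" by (simp del: smult_single)
 qed simp
 also have "\<dots> = smult (\<Sum>k\<in>(\<lambda>j. - int j) ` set_mset \<xi> \<union> {0} \<union> int ` set_mset \<xi>. ?u k) ?b"
  by (rule poly_mapping_eqI) (simp add: lookup_sum sum_distrib_right del: smult_single)
 also have "(\<Sum>k\<in>(\<lambda>j. - int j) ` set_mset \<xi> \<union> {0} \<union> int ` set_mset \<xi>. ?u k)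
  = (\<Sum>k\<in>(\<lambda>j. - int j) ` set_mset \<xi>. ?u k) + form a \<gamma> ^ 2 + (\<Sum>k\<in>int ` set_mset \<xi>. ?u k)"
 proof -
  have "j > 0" if "j \<in># \<xi>" for j using that assms(1) by (cases j) auto
  hence "- int j \<noteq> int k" if "j \<in># \<xi>" for j k using that by fastforce
  hence "((\<lambda>j. - int j) ` set_mset \<xi> \<union> {0}) \<inter> int ` set_mset \<xi> = {}"
   "(\<lambda>j. - int j) ` set_mset \<xi> \<inter> {0} = {}" using assms(1) by auto
  thus ?thesis by (simp add: sum.union_disjoint)
 qed
 also have "(\<Sum>k\<in>(\<lambda>j. - int j) ` set_mset \<xi>. ?u k) = of_nat (deg \<xi>)"
 proof -
  have "(\<Sum>k\<in>(\<lambda>j. - int j) ` set_mset \<xi>. ?u k) = (\<Sum>j\<in>set_mset \<xi>. of_nat j * of_nat (count \<xi> j))"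
   by (subst sum.reindex) (use assms(1) in \<open>auto simp: inj_on_def intro!: sum.cong\<close>)
  thus ?thesis by (simp add: sum_mset_eq_sum_count mult.commute)
 qed
 also have "(\<Sum>k\<in>int ` set_mset \<xi>. ?u k) = of_nat (deg \<xi>)"
 proof -
  have "(\<Sum>k\<in>int ` set_mset \<xi>. ?u k) = (\<Sum>j\<in>set_mset \<xi>. of_nat j * of_nat (count \<xi> j))"
   by (subst sum.reindex) (use assms(1) in \<open>auto simp: inj_on_def intro!: sum.cong\<close>)
  thus ?thesis by (simp add: sum_mset_eq_sum_count mult.commute)
 qed
 finally have "list_mode form a eps [1, 1] 0 1 ?b = smult (of_nat (deg \<xi>) + form a \<gamma> ^ 2 + of_nat (deg \<xi>)) ?b" .
 moreover have "sorted_list_of_multiset {#1, 1 :: nat#} = [1, 1]" by simp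
 ultimately show ?thesis unfolding L0_def vmode_def conformal_vector_def by (simp add: field_simps del: list_mode.simps)
qed

lemma weight_eq:
 assumes "0 \<notin># \<xi>" "\<gamma> \<in> L"
 shows "weight form a eps (\<xi>, \<gamma>) = of_nat (deg \<xi>) + form a \<gamma> ^ 2 / 2" unfolding weight_def L0_basis[OF assms]
proof (rule the_equality)
 fix w assume "smult (of_nat (deg \<xi>) + form a \<gamma> ^ 2 / 2) (basis (\<xi>, \<gamma>)) = smult w (basis (\<xi>, \<gamma>))"
 from arg_cong[OF this, of "\<lambda>v. lookup v (\<xi>, \<gamma>)"]
 show "w = of_nat (deg \<xi>) + form a \<gamma> ^ 2 / 2" by simp
qed simp

end

context
 fixes form :: "'h::ab_group_add => 'h => complex" and a :: 'h
begin

definition dop :: "(nat => complex) => 'h vec => 'h vec" where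
 "dop d = lin_ext (\<lambda>b. \<Sum>m\<in>set_mset (fst b) - {0}. smult (d m) (osc form a (int m) (basis b)))"

lemma linear_op_dop [intro, simp]: "linear_op (dop d)" by (simp add: dop_def)

lemma dop_basis:
 assumes "finite F" "set_mset \<mu> - {0} \<subseteq> F" "0 \<notin> F"
 shows "dop d (basis (\<mu>, \<gamma>)) = (\<Sum>m\<in>F. smult (d m) (osc form a (int m) (basis (\<mu>, \<gamma>))))"
proof -
 have "(\<Sum>m\<in>set_mset \<mu> - {0}. smult (d m) (osc form a (int m) (basis (\<mu>, \<gamma>))))
  = (\<Sum>m\<in>F. smult (d m) (osc form a (int m) (basis (\<mu>, \<gamma>))))"
 proof (rule sum.mono_neutral_left)
  show "\<forall>m\<in>F - (set_mset \<mu> - {0}). smult (d m) (osc form a (int m) (basis (\<mu>, \<gamma>))) = 0"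
  proof
   fix m assume "m \<in> F - (set_mset \<mu> - {0})"
   hence "m \<noteq> 0" "count \<mu> m = 0" using assms(3) by (metis Diff_iff, metis Diff_iff singletonD count_eq_zero_iff)
   thus "smult (d m) (osc form a (int m) (basis (\<mu>, \<gamma>))) = 0" by (simp add: osc_basis)
  qed
 qed (use assms in auto)
 thus ?thesis by (simp add: dop_def)
qed

lemma dop_eq_sum: "\<exists>D. \<forall>E\<ge>D. dop d v = (\<Sum>m\<in>{1..E}. smult (d m) (osc form a (int m) v))"
proof -
 obtain D where D: "\<forall>\<mu> \<gamma>. lookup v (\<mu>, \<gamma>) \<noteq> 0 \<longrightarrow> deg \<mu> \<le> (D::nat)"
  using degree_bound[of v] by auto
 have "dop d v = (\<Sum>m\<in>{1..E}. smult (d m) (osc form a (int m) v))" if E: "E \<ge> D" for E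
 proof (rule linear_op_eqI[where S = "dop d" and T = "\<lambda>v. \<Sum>m\<in>{1..E}. smult (d m) (osc form a (int m) v)"])
  fix b assume b: "b \<in> keys v"
  obtain \<mu> \<gamma> where "b = (\<mu>, \<gamma>)" by (cases b)
  have "m \<le> E" if "m \<in># \<mu>" for m
  proof -
   have "m \<le> deg \<mu>" using that by (auto dest!: multi_member_split)
   also have "\<dots> \<le> D" using D b \<open>b = (\<mu>, \<gamma>)\<close> by (auto simp: in_keys_iff)
   finally show ?thesis using E by simp
  qed
  hence "set_mset \<mu> - {0} \<subseteq> {1..E}" by auto
  thus "dop d (basis b) = (\<Sum>m\<in>{1..E}. smult (d m) (osc form a (int m) (basis b)))"
   unfolding \<open>b = (\<mu>, \<gamma>)\<close> by (intro dop_basis) auto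
 qed (auto intro!: linear_op_sum linear_op_scaled)
 thus ?thesis by blast
qed

lemma dop_osc_nonneg:
 assumes "m \<ge> 0"
 shows "dop d (osc form a m v) = osc form a m (dop d v)"
proof -
 obtain D1 D2 where "\<forall>E\<ge>D1. dop d v = (\<Sum>m\<in>{1..E}. smult (d m) (osc form a (int m) v))"
  "\<forall>E\<ge>D2. dop d (osc form a m v) = (\<Sum>l\<in>{1..E}. smult (d l) (osc form a (int l) (osc form a m v)))"
  using dop_eq_sum[of d v] dop_eq_sum[of d "osc form a m v"] by blast
 hence D: "dop d v = (\<Sum>m\<in>{1..D1 + D2}. smult (d m) (osc form a (int m) v))"
  "dop d (osc form a m v) = (\<Sum>l\<in>{1..D1 + D2}. smult (d l) (osc form a (int l) (osc form a m v)))" by auto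
 have "osc form a (int l) (osc form a m v) = osc form a m (osc form a (int l) v)" if "l \<in> {1..D1 + D2}" for l
  using that assms osc_commute[of form a "int l" m v] by simp
 thus ?thesis by (simp add: D linear_opD[OF linear_op_osc])
qed

lemma dop_dop: "dop d (dop e v) = dop e (dop d v)"
proof -
 obtain D1 D2 where "\<forall>E\<ge>D1. dop d v = (\<Sum>m\<in>{1..E}. smult (d m) (osc form a (int m) v))"
  "\<forall>E\<ge>D2. dop d (dop e v) = (\<Sum>m\<in>{1..E}. smult (d m) (osc form a (int m) (dop e v)))"
  using dop_eq_sum[of d v] dop_eq_sum[of d "dop e v"] by blast
 hence D: "dop d v = (\<Sum>m\<in>{1..D1 + D2}. smult (d m) (osc form a (int m) v))"
  "dop d (dop e v) = (\<Sum>m\<in>{1..D1 + D2}. smult (d m) (osc form a (int m) (dop e v)))" by auto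
 show ?thesis unfolding D by (simp add: linear_opD[OF linear_op_dop] dop_osc_nonneg)
qed

lemma dop_osc_neg:
 assumes "j > 0"
 shows "dop d (osc form a (- int j) v) = osc form a (- int j) (dop d v) + smult (of_nat j * d j) v"
proof -
 obtain D1 D2 where "\<forall>E\<ge>D1. dop d v = (\<Sum>m\<in>{1..E}. smult (d m) (osc form a (int m) v))"
  "\<forall>E\<ge>D2. dop d (osc form a (- int j) v) = (\<Sum>l\<in>{1..E}. smult (d l) (osc form a (int l) (osc form a (- int j) v)))"
  using dop_eq_sum[of d v] dop_eq_sum[of d "osc form a (- int j) v"] by blast
 hence D: "dop d v = (\<Sum>m\<in>{1..D1 + D2 + j}. smult (d m) (osc form a (int m) v))"
  "dop d (osc form a (- int j) v) = (\<Sum>l\<in>{1..D1 + D2 + j}. smult (d l) (osc form a (int l) (osc form a (- int j) v)))" by auto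
 have e: "smult (d l) (osc form a (int l) (osc form a (- int j) v)) =
   smult (d l) (osc form a (- int j) (osc form a (int l) v)) + (if l = j then smult (of_nat j * d j) v else 0)" for l
  using osc_commute[of form a "int l" "- int j" v] by (simp add: smult_add_right mult.commute)
 show ?thesis unfolding D e sum.distrib using assms by (simp add: linear_opD[OF linear_op_osc])
qed

lemma sector_dop:
 assumes "v \<in> sector \<gamma>"
 shows "dop d v \<in> sector \<gamma>"
proof -
 obtain D where "dop d v = (\<Sum>m\<in>{1..D}. smult (d m) (osc form a (int m) v))" using dop_eq_sum[of d v] by blast
 thus ?thesis using assms by (auto intro!: sector_sum sector_smult sector_osc)
qed

definition bneg :: "nat => 'h vec => 'h vec" where
 "bneg r v = (\<Sum>m\<in>{1..r}. smult (sqc r (- int m)) (osc form a (- int m) v))"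

definition bpos :: "nat => 'h vec => 'h vec" where
 "bpos r v = smult (sqc r 0) (osc form a 0 v) + dop (\<lambda>m. sqc r (int m)) v"

text \<open>\<open>bop r\<close> is the square bracket mode \<open>a[-r]\<close>; the value at \<open>r = 0\<close> is a convention
 that makes the family commute.\<close>

definition bop :: "nat => 'h vec => 'h vec" where
 "bop r v = (if r = 0 then v else bneg r v + bpos r v)"

lemma linear_op_bneg [intro, simp]: "linear_op (bneg r)" unfolding bneg_def [abs_def] by (intro linear_op_sum linear_op_scaled linear_op_osc)

lemma linear_op_bpos [intro, simp]: "linear_op (bpos r)"
 unfolding bpos_def [abs_def] by (intro linear_op_plus linear_op_scaled linear_op_osc linear_op_dop)

lemma linear_op_bop [intro, simp]: "linear_op (bop r)" by (cases "r = 0") (simp_all add: bop_def [abs_def] linear_op_plus)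

lemma sector_bop:
 assumes "v \<in> sector \<gamma>"
 shows "bop r v \<in> sector \<gamma>" using assms unfolding bop_def bneg_def bpos_def
 by (auto intro!: sector_add sector_sum sector_smult sector_osc sector_dop)

lemma dop_bneg:
 "dop d (bneg s v) = bneg s (dop d v) + smult (\<Sum>m=1..s. of_nat m * d m * sqc s (- int m)) v"
proof -
 have sum_smult: "smult (\<Sum>m\<in>A. f m) v = (\<Sum>m\<in>A. smult (f m) v)" for f :: "nat => complex" and A
  by (rule poly_mapping_eqI) (simp add: lookup_sum sum_distrib_right)
 have "dop d (bneg s v) = (\<Sum>m\<in>{1..s}. smult (sqc s (- int m)) (osc form a (- int m) (dop d v))
   + smult (of_nat m * d m * sqc s (- int m)) v)" unfolding bneg_def linear_opD[OF linear_op_dop]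
  by (rule sum.cong) (auto simp: dop_osc_neg smult_add_right mult_ac)
 thus ?thesis by (simp add: bneg_def sum.distrib sum_smult)
qed

lemma osc_0_bneg: "osc form a 0 (bneg s v) = bneg s (osc form a 0 v)" unfolding bneg_def linear_opD[OF linear_op_osc] by (simp add: osc_commute_zero)

lemma bneg_bneg: "bneg r (bneg s v) = bneg s (bneg r v)"
proof -
 have "bneg r (bneg s v) = (\<Sum>m\<in>{1..r}. \<Sum>l\<in>{1..s}. smult (sqc r (- int m) * sqc s (- int l)) (osc form a (- int m) (osc form a (- int l) v)))" for r s
  by (simp add: bneg_def linear_opD[OF linear_op_osc] smult_sum)
 moreover have "(\<Sum>m\<in>{1..r}. \<Sum>l\<in>{1..s}. smult (sqc r (- int m) * sqc s (- int l)) (osc form a (- int m) (osc form a (- int l) v)))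
  = (\<Sum>l\<in>{1..s}. \<Sum>m\<in>{1..r}. smult (sqc s (- int l) * sqc r (- int m)) (osc form a (- int l) (osc form a (- int m) v)))"
  by (subst sum.swap, intro sum.cong refl) (auto simp: osc_commute_neg mult.commute)
 ultimately show ?thesis by simp
qed

lemma bpos_bpos: "bpos r (bpos s v) = bpos s (bpos r v)"
proof -
 have "bpos r (bpos s v) = smult (sqc r 0 * sqc s 0) (osc form a 0 (osc form a 0 v))
  + smult (sqc r 0) (osc form a 0 (dop (\<lambda>m. sqc s (int m)) v)) + smult (sqc s 0) (osc form a 0 (dop (\<lambda>m. sqc r (int m)) v))
  + dop (\<lambda>m. sqc r (int m)) (dop (\<lambda>m. sqc s (int m)) v)" for r s
  by (simp add: bpos_def linear_opD[OF linear_op_osc] linear_opD[OF linear_op_dop] smult_add_right dop_osc_nonneg add_ac)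
 thus ?thesis by (simp add: dop_dop[of "\<lambda>m. sqc r (int m)" "\<lambda>m. sqc s (int m)"] mult.commute add_ac)
qed

lemma bpos_bneg:
 "bpos r (bneg s v) = bneg s (bpos r v) + smult (sq2 r s) v" by (simp add: bpos_def dop_bneg osc_0_bneg linear_opD[OF linear_op_bneg] add_ac)

lemma bpos_bop:
 assumes "s > 0"
 shows "bpos r (bop s v) = bop s (bpos r v) + smult (sq2 r s) v"
 using assms by (simp add: bop_def linear_opD[OF linear_op_bpos] bpos_bneg bpos_bpos[of r s] add_ac)

lemma dop_bop:
 assumes "s > 0"
 shows "dop d (bop s v) = bop s (dop d v) + smult (\<Sum>m=1..s. of_nat m * d m * sqc s (- int m)) v" using assms
 by (simp add: bop_def bpos_def linear_opD[OF linear_op_dop] dop_bneg dop_osc_nonneg dop_dop[of d] add_ac)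

lemma bop_bop: "bop r (bop s v) = bop s (bop r v)"
proof (cases "r = 0 \<or> s = 0")
 case False
 hence rs: "r \<ge> 1" "s \<ge> 1" by auto
 have e: "bop r (bop s v) = bneg r (bneg s v) + bneg r (bpos s v) + bneg s (bpos r v) + bpos r (bpos s v)
   + smult (sq2 r s) v" if "r \<ge> 1" "s \<ge> 1" for r s
  using that by (simp add: bop_def linear_opD[OF linear_op_bneg] linear_opD[OF linear_op_bpos] bpos_bneg add_ac)
 show ?thesis unfolding e[OF rs] e[OF rs(2,1)] sqc_symmetric[OF rs] by (simp add: bneg_bneg[of r s] bpos_bpos[of r s] add_ac)
qed (auto simp: bop_def)

interpretation bop: comp_fun_commute bop by standard (simp add: fun_eq_iff bop_bop)

definition fvec :: "'h => nat multiset => 'h vec" where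
 "fvec \<alpha> \<rho> = fold_mset bop (basis ({#}, \<alpha>)) \<rho>"

lemma fvec_empty [simp]: "fvec \<alpha> {#} = basis ({#}, \<alpha>)" by (simp add: fvec_def)

lemma fvec_add [simp]: "fvec \<alpha> (add_mset r \<rho>) = bop r (fvec \<alpha> \<rho>)" by (simp add: fvec_def)

lemma sector_fvec: "fvec \<alpha> \<rho> \<in> sector \<alpha>" by (induction \<rho>) (auto intro: sector_bop sector_basis)

lemma derivation_fvec:
 assumes D: "linear_op D" and DB: "\<And>s v. s > 0 ==> D (bop s v) = bop s (D v) + smult (d s) v"
  and D0: "D (basis ({#}, \<alpha>)) = smult y (basis ({#}, \<alpha>))" and "0 \<notin># \<rho>"
 shows "D (fvec \<alpha> \<rho>) = smult y (fvec \<alpha> \<rho>) + (\<Sum>s\<in>#\<rho>. smult (d s) (fvec \<alpha> (\<rho> - {#s#})))"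
 using assms(4)
proof (induction \<rho>)
 case empty
 thus ?case using D0 by simp
next
 case (add r \<rho>)
 hence r: "r > 0" and \<rho>: "0 \<notin># \<rho>" by (cases r; simp)+
 have bs: "bop r (\<Sum>s\<in>#\<sigma>. f s) = (\<Sum>s\<in>#\<sigma>. bop r (f s))" for \<sigma> :: "nat multiset" and f
  by (induction \<sigma>) (simp_all add: linear_opD[OF linear_op_bop])
 have "D (fvec \<alpha> (add_mset r \<rho>)) = smult y (fvec \<alpha> (add_mset r \<rho>))
  + (\<Sum>s\<in>#\<rho>. smult (d s) (bop r (fvec \<alpha> (\<rho> - {#s#})))) + smult (d r) (fvec \<alpha> \<rho>)"
  by (simp add: DB[OF r] add.IH[OF \<rho>] linear_opD[OF linear_op_bop] bs)
 also have "(\<Sum>s\<in>#\<rho>. smult (d s) (bop r (fvec \<alpha> (\<rho> - {#s#})))) = (\<Sum>s\<in>#\<rho>. smult (d s) (fvec \<alpha> (add_mset r \<rho> - {#s#})))"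
 proof (rule arg_cong[of _ _ sum_mset], rule image_mset_cong)
  fix s assume "s \<in># \<rho>"
  hence "add_mset r \<rho> - {#s#} = add_mset r (\<rho> - {#s#})" by simp
  thus "smult (d s) (bop r (fvec \<alpha> (\<rho> - {#s#}))) = smult (d s) (fvec \<alpha> (add_mset r \<rho> - {#s#}))" by simp
 qed
 finally show ?case by (simp add: add_ac)
qed

definition Vlin :: "complex => complex => 'h vec => fock_matrix" where
 "Vlin g x u \<mu> \<xi> = (\<Sum>b\<in>keys u. lookup u b * vmat g x (sorted_list_of_multiset (fst b)) \<mu> \<xi>)"

lemma Vlin_superset:
 assumes "finite A" "keys u \<subseteq> A"
 shows "Vlin g x u \<mu> \<xi> = (\<Sum>b\<in>A. lookup u b * vmat g x (sorted_list_of_multiset (fst b)) \<mu> \<xi>)" unfolding Vlin_def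
 by (rule sum.mono_neutral_left) (use assms in \<open>auto simp: in_keys_iff\<close>)

lemma Vlin_add: "Vlin g x (u + v) \<mu> \<xi> = Vlin g x u \<mu> \<xi> + Vlin g x v \<mu> \<xi>"
proof -
 let ?A = "keys u \<union> keys v"
 have "keys (u + v) \<subseteq> ?A" by (rule Poly_Mapping.keys_add)
 thus ?thesis by (simp add: Vlin_superset[of ?A] lookup_add distrib_right sum.distrib)
qed

lemma Vlin_smult: "Vlin g x (smult c v) \<mu> \<xi> = c * Vlin g x v \<mu> \<xi>"
proof -
 have "keys (smult c v) \<subseteq> keys v" by (auto simp: in_keys_iff)
 thus ?thesis by (simp add: Vlin_superset[of "keys v"] sum_distrib_left mult.assoc)
qed

lemma Vlin_zero [simp]: "Vlin g x 0 \<mu> \<xi> = 0" by (simp add: Vlin_def)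

lemma Vlin_sum: "Vlin g x (\<Sum>i\<in>A. f i) \<mu> \<xi> = (\<Sum>i\<in>A. Vlin g x (f i) \<mu> \<xi>)"
 by (induction A rule: infinite_finite_induct) (simp_all add: Vlin_add)

lemma Vlin_sum_mset: "Vlin g x (\<Sum>i\<in>#A. f i) \<mu> \<xi> = (\<Sum>i\<in>#A. Vlin g x (f i) \<mu> \<xi>)"
 by (induction A) (simp_all add: Vlin_add)

lemma Vlin_basis: "Vlin g x (basis b) = vmat g x (sorted_list_of_multiset (fst b))" by (intro ext) (simp add: Vlin_def)

lemma vmat_insort: "vmat g x (insort n ns) = nord (\<lambda>k. of_int (- k - 1) gchoose (n - 1)) g (vmat g x ns)"
 by (induction ns) (auto intro: nord_commute)

lemma Vlin_expand: "Vlin g x u = (\<lambda>\<mu> \<xi>. \<Sum>b\<in>keys u. lookup u b * Vlin g x (basis b) \<mu> \<xi>)"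
 by (intro ext) (simp add: Vlin_def[of g x u] Vlin_basis)

lemma nord_Vlin_expand:
 "nord c g' (Vlin g x u) \<mu> \<xi> = (\<Sum>b\<in>keys u. lookup u b * nord c g' (Vlin g x (basis b)) \<mu> \<xi>)"
 by (subst Vlin_expand) (simp add: nord_sum nord_comb)

lemma comm_Vlin_expand:
 "comm k (Vlin g x u) \<mu> \<xi> = (\<Sum>b\<in>keys u. lookup u b * comm k (Vlin g x (basis b)) \<mu> \<xi>)"
 by (subst Vlin_expand) (simp add: comm_sum comm_comb)

lemma Vlin_linear_expand:
 assumes "linear_op T"
 shows "Vlin g x (T u) \<mu> \<xi> = (\<Sum>b\<in>keys u. lookup u b * Vlin g x (T (basis b)) \<mu> \<xi>)"
 by (subst linear_op_expand[OF assms finite_keys order_refl]) (simp add: Vlin_sum Vlin_smult)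

lemma Vlin_osc_neg:
 assumes "m > 0"
 shows "Vlin g x (osc form a (- int m) u) \<mu> \<xi> = nord (\<lambda>k. of_int (- k - 1) gchoose (m - 1)) g (Vlin g x u) \<mu> \<xi>"
proof -
 have "Vlin g x (osc form a (- int m) (basis b)) = nord (\<lambda>k. of_int (- k - 1) gchoose (m - 1)) g (Vlin g x (basis b))" for b
  using assms by (cases b) (simp add: osc_basis Vlin_basis vmat_insort)
 thus ?thesis by (simp only: Vlin_linear_expand[OF linear_op_osc[of form a "- int m"], of g x u] nord_Vlin_expand[of _ g g x u])
qed

definition cyl :: "nat => int => complex" where
 "cyl r k = (- of_int k) ^ (r - 1) / fact (r - 1)"

lemma Vlin_bneg:
 assumes "r \<ge> 1"
 shows "Vlin g x (bneg r u) \<mu> \<xi> = nord (cyl r) g (Vlin g x u) \<mu> \<xi>"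
proof -
 have "nord (cyl r) g (Vlin g x u) \<mu> \<xi> = (\<Sum>m\<in>{1..r}. sqc r (- int m) * nord (\<lambda>k. of_int (- k - 1) gchoose (m - 1)) g (Vlin g x u) \<mu> \<xi>)"
  by (rule nord_coeff_sum) (simp only: cyl_def sum_sqc_gchoose[OF assms])
 thus ?thesis by (simp add: bneg_def Vlin_sum Vlin_smult Vlin_osc_neg)
qed

lemma comm_Vlin:
 assumes "u \<in> sector \<gamma>" "k \<noteq> 0"
 shows "comm k (Vlin g x u) \<mu> \<xi> = x * Vlin g x u \<mu> \<xi> + Vlin g x (dop (\<lambda>m. of_int k gchoose m) u) \<mu> \<xi>"
proof -
 let ?d = "\<lambda>m. of_int k gchoose m :: complex"
 have b: "comm k (Vlin g x (basis (\<nu>, \<gamma>))) \<mu> \<xi> = x * Vlin g x (basis (\<nu>, \<gamma>)) \<mu> \<xi> + Vlin g x (dop ?d (basis (\<nu>, \<gamma>))) \<mu> \<xi>"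
  if "0 \<notin># \<nu>" for \<nu> \<mu> \<xi> using that
 proof (induction \<nu> arbitrary: \<mu> \<xi>)
  case empty
  have "dop ?d (basis ({#}, \<gamma>)) = 0" by (simp add: dop_def)
  thus ?case using assms(2) by (simp add: Vlin_basis comm_exp_matrix)
 next
  case (add n \<nu>)
  hence n: "n > 0" and \<nu>: "0 \<notin># \<nu>" by (cases n; simp)+
  let ?b = "basis (\<nu>, \<gamma>)"
  let ?c = "\<lambda>k. of_int (- k - 1) gchoose (n - 1) :: complex"
  have ba: "basis (add_mset n \<nu>, \<gamma>) = osc form a (- int n) ?b" using n by (simp add: osc_basis)
  have V: "Vlin g x (osc form a (- int n) u) = nord ?c g (Vlin g x u)" for u by (intro ext) (rule Vlin_osc_neg[OF n])
  have IH: "comm k (Vlin g x ?b) = (\<lambda>\<mu> \<xi>. x * Vlin g x ?b \<mu> \<xi> + Vlin g x (dop ?d ?b) \<mu> \<xi>)"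
   by (intro ext) (rule add.IH[OF \<nu>])
  have "of_int k * ?c (- k) = of_nat n * ?d n" using gbinomial_absorption[of "n - 1" "of_int k :: complex"] n by simp
  thus ?case unfolding ba V comm_nord[OF assms(2)] IH nord_comb dop_osc_neg[OF n] Vlin_add Vlin_smult by (simp add: algebra_simps)
 qed
 have "comm k (Vlin g x u) \<mu> \<xi> = (\<Sum>b\<in>keys u. lookup u b *
   (x * Vlin g x (basis b) \<mu> \<xi> + Vlin g x (dop ?d (basis b)) \<mu> \<xi>))" unfolding comm_Vlin_expand[of k g x u]
 proof (rule sum.cong[OF refl])
  fix c assume "c \<in> keys u"
  with sector_keys[OF assms(1)] obtain \<nu> where "c = (\<nu>, \<gamma>)" "0 \<notin># \<nu>" by blast
  thus "lookup u c * comm k (Vlin g x (basis c)) \<mu> \<xi> = lookup u c *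
   (x * Vlin g x (basis c) \<mu> \<xi> + Vlin g x (dop ?d (basis c)) \<mu> \<xi>)" using b by simp
 qed
 moreover have "Vlin g x u \<mu> \<xi> = (\<Sum>b\<in>keys u. lookup u b * Vlin g x (basis b) \<mu> \<xi>)" by (subst Vlin_expand) (rule refl)
 ultimately show ?thesis
  by (simp only: Vlin_linear_expand[OF linear_op_dop, of g x ?d u] distrib_left sum.distrib sum_distrib_left mult.left_commute)
qed

definition wmat :: "complex => 'h => nat multiset => fock_matrix" where
 "wmat g \<alpha> \<rho> = Vlin g (form a \<alpha>) (fvec \<alpha> \<rho>)"

lemma wmat_add:
 assumes "r > 0" "0 \<notin># \<rho>"
 shows "wmat g \<alpha> (add_mset r \<rho>) \<mu> \<xi> = nord (cyl r) g (wmat g \<alpha> \<rho>) \<mu> \<xi> + sqc r 0 * form a \<alpha> * wmat g \<alpha> \<rho> \<mu> \<xi>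
  + (\<Sum>s\<in>#\<rho>. (sq2 r s) * wmat g \<alpha> (\<rho> - {#s#}) \<mu> \<xi>)"
proof -
 have "bpos r (fvec \<alpha> \<rho>) = smult (sqc r 0 * form a \<alpha>) (fvec \<alpha> \<rho>)
   + (\<Sum>s\<in>#\<rho>. smult (sq2 r s) (fvec \<alpha> (\<rho> - {#s#})))"
 proof (rule derivation_fvec)
  show "bpos r (basis ({#}, \<alpha>)) = smult (sqc r 0 * form a \<alpha>) (basis ({#}, \<alpha>))" by (simp add: bpos_def dop_def osc_basis)
 qed (use assms bpos_bop in auto)
 thus ?thesis using assms by (simp add: wmat_def bop_def Vlin_add Vlin_bneg Vlin_smult Vlin_sum_mset add_ac)
qed

lemma comm_wmat:
 assumes "k \<noteq> 0" "0 \<notin># \<rho>"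
 shows "comm k (wmat g \<alpha> \<rho>) \<mu> \<xi> = form a \<alpha> * wmat g \<alpha> \<rho> \<mu> \<xi>
  + (\<Sum>s\<in>#\<rho>. of_int k ^ s / fact (s - 1) * wmat g \<alpha> (\<rho> - {#s#}) \<mu> \<xi>)"
proof -
 have "dop (\<lambda>m. of_int k gchoose m) (fvec \<alpha> \<rho>) = smult 0 (fvec \<alpha> \<rho>)
   + (\<Sum>s\<in>#\<rho>. smult (of_int k ^ s / fact (s - 1)) (fvec \<alpha> (\<rho> - {#s#})))"
 proof (rule derivation_fvec)
  show "dop (\<lambda>m. of_int k gchoose m) (bop s v) = bop s (dop (\<lambda>m. of_int k gchoose m) v) + smult (of_int k ^ s / fact (s - 1)) v"
   if "s > 0" for s v unfolding dop_bop[OF that] using sum_gchoose_sqc[of s k] that by simp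
 qed (use assms in \<open>simp_all add: dop_def\<close>)
 thus ?thesis by (simp add: wmat_def comm_Vlin[OF sector_fvec assms(1)] Vlin_add Vlin_smult Vlin_sum_mset)
qed

end

context lattice_voa
begin

lemma sq_mode_eq_bop:
 assumes "r > 0" "v \<in> sector \<gamma>" "\<gamma> \<in> L"
 shows "sq_mode form a eps a_vec (- int r) v = bop form a r v"
proof -
 have "sorted_list_of_multiset {#1 :: nat#} = [1]" by simp
 hence vm: "vmode form a eps (basis ({#1#}, 0)) m v = osc form a m v" for m
  unfolding vmode_def by (simp add: list_mode_one[OF assms(2,3), unfolded One_nat_def] del: list_mode.simps)
 have w: "weight form a eps ({#1#}, 0) = 1" using weight_eq[of "{#1#}" 0] L_closed(1) by simp
 obtain D1 where D1: "\<forall>k>int D1. osc form a k v = 0" using osc_eq_0 by blast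
 obtain D2 where D2: "\<forall>E\<ge>D2. dop form a (\<lambda>m. sqc r (int m)) v = (\<Sum>m\<in>{1..E}. smult (sqc r (int m)) (osc form a (int m) v))"
  using dop_eq_sum by blast
 define E where "E = D1 + D2"
 let ?N = "(\<lambda>m. - int m) ` {1..r}" and ?P = "int ` {1..E}"
 let ?t = "\<lambda>m. smult (sqc r m) (osc form a m v)"
 have "sq_mode form a eps a_vec (- int r) v = Sum_any ?t"
  unfolding sq_mode_def a_vec_def by (simp add: vm[unfolded One_nat_def] w[unfolded One_nat_def] sqc_def)
 also have "\<dots> = (\<Sum>m\<in>?N \<union> {0} \<union> ?P. ?t m)"
 proof (rule Sum_any_superset)
  fix m assume m: "m \<notin> ?N \<union> {0} \<union> ?P"
  show "?t m = 0"
  proof (cases "m < 0")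
   case True
   have "m < - int r"
   proof (rule ccontr)
    assume "\<not> m < - int r"
    with True have "m \<in> ?N" by (intro image_eqI[of _ _ "nat (- m)"]) auto
    with m show False by blast
   qed
   thus ?thesis using sqc_eq_0[of r m] assms(1) by simp
  next
   case False
   have "m > int E"
   proof (rule ccontr)
    assume "\<not> m > int E"
    with False m have "m \<in> ?P" by (intro image_eqI[of _ _ "nat m"]) auto
    with m show False by blast
   qed
   thus ?thesis using D1 by (simp add: E_def)
  qed
 qed simp
 also have "\<dots> = (\<Sum>m\<in>?N. ?t m) + ?t 0 + (\<Sum>m\<in>?P. ?t m)"
 proof -
  have "(?N \<union> {0}) \<inter> ?P = {}" "?N \<inter> {0} = {}" by auto
  thus ?thesis by (simp add: sum.union_disjoint)
 qed
 also have "(\<Sum>m\<in>?N. ?t m) = bneg form a r v" unfolding bneg_def by (subst sum.reindex) (auto simp: inj_on_def)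
 also have "(\<Sum>m\<in>?P. ?t m) = dop form a (\<lambda>m. sqc r (int m)) v"
 proof -
  have "dop form a (\<lambda>m. sqc r (int m)) v = (\<Sum>m\<in>{1..E}. smult (sqc r (int m)) (osc form a (int m) v))"
   by (rule D2[rule_format]) (simp add: E_def)
  thus ?thesis by (subst sum.reindex) (simp_all add: inj_on_def)
 qed
 finally show ?thesis using assms(1) by (simp add: bop_def bpos_def add_ac)
qed

lemma fock_state_eq_fvec:
 assumes "\<alpha> \<in> L"
 shows "fock_state form a eps p e \<alpha> = fvec form a \<alpha> (\<Sum>m\<in>{1..p}. replicate_mset (e m) m)"
proof -
 have pw: "(sq_mode form a eps a_vec (- int m) ^^ k) (fvec form a \<alpha> \<rho>) = fvec form a \<alpha> (replicate_mset k m + \<rho>)"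
  if "m > 0" for m k \<rho> by (induction k) (simp_all add: sq_mode_eq_bop[OF that sector_fvec assms])
 have F: "foldr (\<lambda>m. sq_mode form a eps a_vec (- int m) ^^ e m) ms (basis ({#}, \<alpha>))
  = fvec form a \<alpha> (\<Sum>m\<leftarrow>ms. replicate_mset (e m) m)" if "\<forall>m\<in>set ms. m > 0" for ms
  using that by (induction ms) (simp_all add: pw)
 have e: "(\<Sum>m\<leftarrow>[1..<Suc p]. replicate_mset (e m) m) = (\<Sum>m\<in>{1..p}. replicate_mset (e m) m)"
  by (simp only: sum_list_distinct_conv_sum_set distinct_upt set_upt atLeastLessThanSuc_atLeastAtMost)
 have p: "\<forall>m\<in>set [1..<Suc p]. m > 0" by auto
 show ?thesis unfolding fock_state_def F[OF p] e by (rule refl)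
qed

end

section \<open>Lambert series of the elliptic functions\<close>

lemma summable_on_times:
 fixes f :: "'a => real" and g :: "'b => real"
 assumes "f summable_on A" "g summable_on B" "\<And>x. x \<in> A ==> f x \<ge> 0" "\<And>y. y \<in> B ==> g y \<ge> 0"
 shows "(\<lambda>(x, y). f x * g y) summable_on A \<times> B"
proof (rule summable_on_SigmaI)
 show "((\<lambda>y. case (x, y) of (x, y) => f x * g y) has_sum (f x * infsum g B)) B" for x
  using has_sum_cmult_right[OF has_sum_infsum[OF assms(2)], of "f x"] by simp
 show "(\<lambda>x. f x * infsum g B) summable_on A" by (rule summable_on_cmult_left[OF assms(1)])
qed (use assms in auto)

definition theta :: "complex fps => complex fps" where
 "theta F = fps_X * fps_deriv F"

lemma theta_nth: "fps_nth (theta F) n = of_nat n * fps_nth F n" by (cases n) (simp_all add: theta_def)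

lemma theta_power_nth: "fps_nth ((theta ^^ j) F) n = of_nat n ^ j * fps_nth F n" by (induction j) (simp_all add: theta_nth)

lemma conv_radius_theta: "fps_conv_radius (theta F) \<ge> fps_conv_radius F" unfolding theta_def
 using fps_conv_radius_mult[of fps_X "fps_deriv F"] fps_conv_radius_deriv[of F] by (simp add: min_def)

lemma conv_radius_theta_power: "fps_conv_radius ((theta ^^ j) F) \<ge> fps_conv_radius F" by (induction j) (auto intro: order_trans conv_radius_theta)

lemma has_field_derivative_eval_exp:
 assumes "ereal (norm (exp (s * u))) < fps_conv_radius F"
 shows "((\<lambda>u. eval_fps F (exp (s * u))) has_field_derivative s * eval_fps (theta F) (exp (s * u))) (at u)"
proof -
 have "eval_fps (theta F) (exp (s * u)) = exp (s * u) * eval_fps (fps_deriv F) (exp (s * u))" unfolding theta_def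
  by (subst eval_fps_mult) (use assms fps_conv_radius_deriv[of F] in auto)
 moreover have "((\<lambda>u. eval_fps F (exp (s * u))) has_field_derivative
   eval_fps (fps_deriv F) (exp (s * u)) * (exp (s * u) * s)) (at u)" by (rule DERIV_chain2[where f = "eval_fps F"])
   (use assms in \<open>auto intro!: has_field_derivative_eval_fps derivative_eq_intros\<close>)
 ultimately show ?thesis by (simp add: mult_ac)
qed

lemma open_exp_eball: "open {u. ereal (norm (exp (s * u :: complex))) < R}"
proof -
 have "{u. ereal (norm (exp (s * u :: complex))) < R} = (\<lambda>u. exp (s * u)) -` eball 0 R" by auto
 thus ?thesis by (simp add: open_vimage continuous_intros)
qed

lemma higher_deriv_eval_exp:
 assumes "ereal (norm (exp (s * u))) < fps_conv_radius F"
 shows "(deriv ^^ j) (\<lambda>u. eval_fps F (exp (s * u))) u = s ^ j * eval_fps ((theta ^^ j) F) (exp (s * u))" using assms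
proof (induction j arbitrary: u)
 case (Suc j)
 have ev: "eventually (\<lambda>u. (deriv ^^ j) (\<lambda>u. eval_fps F (exp (s * u))) u = s ^ j * eval_fps ((theta ^^ j) F) (exp (s * u))) (nhds u)"
  using eventually_nhds_in_open[OF open_exp_eball, of u s "fps_conv_radius F"] Suc.prems by (auto elim!: eventually_mono intro: Suc.IH)
 have "ereal (norm (exp (s * u))) < fps_conv_radius ((theta ^^ j) F)" using Suc.prems conv_radius_theta_power[of F j] by (rule less_le_trans)
 from DERIV_cmult[OF has_field_derivative_eval_exp[OF this], of "s ^ j"]
 have "deriv (\<lambda>u. s ^ j * eval_fps ((theta ^^ j) F) (exp (s * u))) u = s ^ j * (s * eval_fps (theta ((theta ^^ j) F)) (exp (s * u)))"
  by (rule DERIV_imp_deriv)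
 with deriv_cong_ev[OF ev refl] show ?case by (simp add: mult_ac)
qed simp

lemma eval_fps_infsum:
 assumes "ereal (norm w) < fps_conv_radius F" "fps_nth F 0 = 0"
 shows "eval_fps F w = (\<Sum>\<^sub>\<infinity>n\<in>{1..}. fps_nth F n * w ^ n)"
  "(\<lambda>n. norm (fps_nth F n * w ^ n)) summable_on {1..}"
proof -
 have s: "summable (\<lambda>n. norm (fps_nth F n * w ^ n))" by (rule norm_summable_fps[OF assms(1)])
 hence hs: "((\<lambda>n. fps_nth F n * w ^ n) has_sum eval_fps F w) UNIV" by (rule norm_summable_imp_has_sum[OF _ sums_eval_fps[OF assms(1)]])
 have "((\<lambda>n. fps_nth F n * w ^ n) has_sum eval_fps F w) {1..}"
 proof -
  have "((\<lambda>n. fps_nth F n * w ^ n) has_sum eval_fps F w) {1..} \<longleftrightarrow> ((\<lambda>n. fps_nth F n * w ^ n) has_sum eval_fps F w) UNIV"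
   by (rule has_sum_cong_neutral) (use assms(2) in \<open>auto simp: not_le\<close>)
  with hs show ?thesis by simp
 qed
 thus "eval_fps F w = (\<Sum>\<^sub>\<infinity>n\<in>{1..}. fps_nth F n * w ^ n)" by (simp add: infsumI)
 have "(\<lambda>n. norm (fps_nth F n * w ^ n)) summable_on UNIV" using s by (intro norm_summable_imp_summable_on) simp
 thus "(\<lambda>n. norm (fps_nth F n * w ^ n)) summable_on {1..}" by (rule summable_on_subset_banach) simp
qed

locale nome =
 fixes q :: complex
 assumes q_nonzero: "q \<noteq> 0" and q_less: "norm q < 1"
begin

lemma norm_q_power: "norm (q ^ n) \<le> 1" "n \<ge> 1 ==> norm (q ^ n) \<le> norm q"
 using q_less power_decreasing[of 1 n "norm q"] by (auto simp: norm_power power_le_one)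

lemma one_minus_q_power: "n \<ge> 1 ==> norm (1 - q ^ n) \<ge> 1 - norm q"
 using norm_triangle_ineq2[of 1 "q ^ n"] norm_q_power(2)[of n] by simp

lemma one_minus_q_power_nonzero: "n \<ge> 1 ==> 1 - q ^ n \<noteq> 0" using one_minus_q_power[of n] q_less by auto

lemma norm_inverse_one_minus: "n \<ge> 1 ==> norm (1 / (1 - q ^ n)) \<le> 1 / (1 - norm q)"
 using one_minus_q_power[of n] q_less by (simp add: norm_divide frac_le)

definition A_fps :: "complex fps" where "A_fps = Abs_fps (\<lambda>n. if n = 0 then 0 else 1 / (1 - q ^ n))"

definition B_fps :: "complex fps" where "B_fps = Abs_fps (\<lambda>n. if n = 0 then 0 else q ^ n / (1 - q ^ n))"

lemma conv_radius_A: "fps_conv_radius A_fps \<ge> 1" unfolding fps_conv_radius_def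
proof (rule conv_radius_geI_ex)
 fix r :: real assume r: "0 < r" "ereal r < 1"
 have "summable (\<lambda>n. norm (fps_nth A_fps n * of_real r ^ n))"
 proof (rule summable_comparison_test')
  show "summable (\<lambda>n. 1 / (1 - norm q) * r ^ n)" using r by (intro summable_mult summable_geometric) simp
  show "norm (norm (fps_nth A_fps n * of_real r ^ n)) \<le> 1 / (1 - norm q) * r ^ n" if "n \<ge> 0" for n
  proof (cases "n = 0")
   case False
   have "norm (fps_nth A_fps n * of_real r ^ n) = norm (1 / (1 - q ^ n)) * r ^ n"
    using False r by (simp add: A_fps_def norm_mult norm_power norm_divide)
   also have "\<dots> \<le> 1 / (1 - norm q) * r ^ n" using False r by (intro mult_right_mono norm_inverse_one_minus) auto
   finally show ?thesis by simp
  qed (use q_less in \<open>simp add: A_fps_def\<close>)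
 qed
 thus "\<exists>z. norm z = r \<and> summable (\<lambda>n. fps_nth A_fps n * z ^ n)"
  using r by (intro exI[of _ "of_real r"]) (auto dest: summable_norm_cancel)
qed

lemma conv_radius_B: "fps_conv_radius B_fps \<ge> ereal (1 / norm q)" unfolding fps_conv_radius_def
proof (rule conv_radius_geI_ex)
 fix r :: real assume r: "0 < r" "ereal r < ereal (1 / norm q)"
 have qr: "norm q * r < 1" using r q_nonzero by (simp add: field_simps)
 have "summable (\<lambda>n. norm (fps_nth B_fps n * of_real r ^ n))"
 proof (rule summable_comparison_test')
  show "summable (\<lambda>n. 1 / (1 - norm q) * (norm q * r) ^ n)" using r qr by (intro summable_mult summable_geometric) simp
  show "norm (norm (fps_nth B_fps n * of_real r ^ n)) \<le> 1 / (1 - norm q) * (norm q * r) ^ n" if "n \<ge> 0" for n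
  proof (cases "n = 0")
   case False
   have "norm (fps_nth B_fps n * of_real r ^ n) = norm (1 / (1 - q ^ n)) * (norm q * r) ^ n"
    using False r by (simp add: B_fps_def norm_mult norm_divide norm_power power_mult_distrib)
   also have "\<dots> \<le> 1 / (1 - norm q) * (norm q * r) ^ n" using False r by (intro mult_right_mono norm_inverse_one_minus) auto
   finally show ?thesis by simp
  qed (use q_less in \<open>simp add: B_fps_def\<close>)
 qed
 thus "\<exists>z. norm z = r \<and> summable (\<lambda>n. fps_nth B_fps n * z ^ n)"
  using r by (intro exI[of _ "of_real r"]) (auto dest: summable_norm_cancel)
qed

definition hterm :: "nat => complex => complex" where
 "hterm m y = q ^ Suc m * y / (1 - q ^ Suc m * y)"

definition hser :: "complex => complex" where "hser y = suminf (\<lambda>m. hterm m y)"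

lemma hterm_bound:
 assumes "norm q ^ M * R \<le> 1 / 2" "norm y \<le> R" "m \<ge> M"
 shows "norm (hterm m y) \<le> norm q ^ (m - M)" "q ^ Suc m * y \<noteq> 1"
proof -
 have "norm (q ^ Suc m * y) = norm q ^ Suc (m - M) * (norm q ^ M * norm y)"
  using assms(3) by (simp add: norm_mult norm_power power_add[symmetric] mult.assoc[symmetric])
 also have "\<dots> \<le> norm q ^ Suc (m - M) * (1 / 2)"
 proof (intro mult_left_mono)
  have "norm q ^ M * norm y \<le> norm q ^ M * R" using assms by (intro mult_left_mono) auto
  with assms(1) show "norm q ^ M * norm y \<le> 1 / 2" by linarith
 qed auto
 finally have b: "norm (q ^ Suc m * y) \<le> norm q ^ Suc (m - M) * (1 / 2)" .
 have p: "norm q ^ Suc (m - M) \<le> norm q ^ (m - M)" "norm q ^ (m - M) \<le> 1"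
  using q_less by (simp_all add: power_decreasing power_le_one mult_left_le_one_le)
 hence half: "norm (q ^ Suc m * y) \<le> 1 / 2" using b by linarith
 thus "q ^ Suc m * y \<noteq> 1" by auto
 have "norm (1 - q ^ Suc m * y) \<ge> 1 / 2" using norm_triangle_ineq2[of 1 "q ^ Suc m * y"] half by simp
 hence "norm (hterm m y) \<le> norm (q ^ Suc m * y) / (1 / 2)" unfolding hterm_def norm_divide by (intro divide_left_mono mult_pos_pos) auto
 also have "\<dots> \<le> norm q ^ (m - M)" using b p by simp
 finally show "norm (hterm m y) \<le> norm q ^ (m - M)" .
qed

lemma exists_M: "\<exists>M. norm q ^ M * R \<le> 1 / 2"
proof -
 have "(\<lambda>M. norm q ^ M * R) \<longlonglongrightarrow> 0 * R" by (intro tendsto_mult_right LIMSEQ_realpow_zero) (use q_less in auto)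
 hence "eventually (\<lambda>M. norm q ^ M * R < 1 / 2) sequentially" by (intro order_tendstoD) auto
 thus ?thesis by (auto simp: eventually_sequentially intro: less_imp_le)
qed

lemma summable_hterm: "summable (\<lambda>m. hterm m y)"
proof -
 obtain M where M: "norm q ^ M * norm y \<le> 1 / 2" using exists_M by blast
 have "summable (\<lambda>m. hterm (m + M) y)"
 proof (rule summable_comparison_test')
  show "summable (\<lambda>m. norm q ^ m)" using q_less by (intro summable_geometric) simp
  show "norm (hterm (m + M) y) \<le> norm q ^ m" if "m \<ge> 0" for m using hterm_bound(1)[OF M, of y "m + M"] by simp
 qed
 thus ?thesis by (rule iffD1[OF summable_iff_shift])
qed

lemma hser_differentiable:
 assumes "\<And>m. q ^ Suc m * y0 \<noteq> 1"
 shows "hser field_differentiable (at y0)"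
proof -
 define R where "R = norm y0 + 1"
 obtain M where M: "norm q ^ M * R \<le> 1 / 2" using exists_M by blast
 define T where "T = (\<lambda>y. suminf (\<lambda>m. hterm (m + M) y))"
 have "T holomorphic_on ball 0 R"
 proof (rule holomorphic_uniform_sequence)
  show "(\<lambda>y. \<Sum>m<n. hterm (m + M) y) holomorphic_on ball 0 R" for n unfolding hterm_def using hterm_bound(2)[OF M]
   by (intro holomorphic_intros) (auto simp del: power_Suc)
  show "\<exists>d>0. cball y d \<subseteq> ball 0 R \<and> uniform_limit (cball y d) (\<lambda>n y. \<Sum>m<n. hterm (m + M) y) T sequentially"
   if y: "y \<in> ball 0 R" for y
  proof -
   have "\<exists>d>0. cball y d \<subseteq> ball 0 R" using y by (meson open_ball open_contains_cball)
   then obtain d where d: "d > 0" "cball y d \<subseteq> ball 0 R" by blast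
   have "uniform_limit (cball y d) (\<lambda>n y. \<Sum>m<n. hterm (m + M) y) T sequentially" unfolding T_def
   proof (rule Weierstrass_m_test)
    show "summable (\<lambda>m. norm q ^ m)" using q_less by (intro summable_geometric) simp
    show "norm (hterm (m + M) u) \<le> norm q ^ m" if "u \<in> cball y d" for m u
    proof -
     have "u \<in> ball 0 R" using that d(2) by blast
     thus ?thesis using hterm_bound(1)[OF M, of u "m + M"] by simp
    qed
   qed
   with d show ?thesis by blast
  qed
 qed simp
 moreover have "y0 \<in> ball 0 R" by (simp add: R_def)
 ultimately have "T field_differentiable (at y0)" by (simp add: holomorphic_on_imp_differentiable_at)
 moreover have "(\<lambda>y. \<Sum>m<M. hterm m y) field_differentiable (at y0)" unfolding hterm_def using assms
  by (intro derivative_intros field_differentiable_sum field_differentiable_divide) (auto intro!: derivative_intros simp del: power_Suc)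
 moreover have "hser = (\<lambda>y. T y + (\<Sum>m<M. hterm m y))"
  unfolding hser_def T_def by (intro ext suminf_split_initial_segment summable_hterm)
 ultimately show ?thesis by (simp add: field_differentiable_add)
qed

lemma hser_eq_eval:
 assumes "norm q * norm y < 1"
 shows "hser y = eval_fps B_fps y"
proof -
 have S: "(\<lambda>(m, n). (q ^ Suc m * y) ^ Suc n) summable_on UNIV \<times> UNIV"
 proof (rule abs_summable_summable, rule summable_on_comparison_test)
  have "(\<lambda>m. norm q ^ m) summable_on UNIV" "(\<lambda>n. (norm q * norm y) ^ n) summable_on UNIV"
   using q_less assms by (auto intro!: norm_summable_imp_summable_on simp: summable_geometric)
  thus "(\<lambda>(m, n). norm q ^ m * (norm q * norm y) ^ n) summable_on UNIV \<times> UNIV" by (intro summable_on_times) auto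
  show "norm (case p of (m, n) => (q ^ Suc m * y) ^ Suc n) \<le> (case p of (m, n) => norm q ^ m * (norm q * norm y) ^ n)" for p :: "nat \<times> nat"
  proof -
   obtain m n where p: "p = (m, n)" by (cases p)
   have "norm ((q ^ Suc m * y) ^ Suc n) = norm q ^ (m * Suc n) * (norm q * norm y) ^ Suc n"
    by (simp only: norm_power norm_mult power_mult_distrib power_mult[symmetric])
     (simp add: power_add[symmetric] mult_ac add_ac)
   also have "\<dots> \<le> norm q ^ m * (norm q * norm y) ^ n" using q_less assms by (intro mult_mono power_decreasing) auto
   finally show ?thesis by (simp add: p)
  qed
 qed simp
 have g: "((\<lambda>n. x ^ Suc n) has_sum (x / (1 - x))) UNIV" if "norm x < 1" for x :: complex
 proof -
  have "(\<lambda>n. x * x ^ n) sums (x * (1 / (1 - x)))" using that by (intro sums_mult geometric_sums)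
  moreover have "summable (\<lambda>n. norm (x * x ^ n))" using that by (simp add: norm_mult norm_power summable_mult summable_geometric)
  ultimately have "((\<lambda>n. x * x ^ n) has_sum (x * (1 / (1 - x)))) UNIV" by (intro norm_summable_imp_has_sum)
  thus ?thesis by simp
 qed
 have ne: "norm (q ^ Suc m * y) < 1" for m
 proof -
  have "norm (q ^ Suc m * y) \<le> norm q * norm y" using norm_q_power(2)[of "Suc m"] by (simp only: norm_mult) (intro mult_right_mono, auto)
  with assms show ?thesis by simp
 qed
 have "(\<Sum>\<^sub>\<infinity>m. \<Sum>\<^sub>\<infinity>n. (q ^ Suc m * y) ^ Suc n) = (\<Sum>\<^sub>\<infinity>n. \<Sum>\<^sub>\<infinity>m. (q ^ Suc m * y) ^ Suc n)"
  by (rule infsum_swap_banach) (use S in simp)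
 also have "(\<lambda>n. \<Sum>\<^sub>\<infinity>m. (q ^ Suc m * y) ^ Suc n) = (\<lambda>n. fps_nth B_fps (Suc n) * y ^ Suc n)"
 proof
  fix n
  have "norm (q ^ Suc n) < 1" by (rule le_less_trans[OF norm_q_power(2) q_less]) simp
  from has_sum_cmult_left[OF g[OF this], of "y ^ Suc n"]
  have "((\<lambda>m. (q ^ Suc n) ^ Suc m * y ^ Suc n) has_sum (q ^ Suc n / (1 - q ^ Suc n) * y ^ Suc n)) UNIV" .
  moreover have "(\<lambda>m. (q ^ Suc n) ^ Suc m * y ^ Suc n) = (\<lambda>m. (q ^ Suc m * y) ^ Suc n)"
   by (intro ext) (simp only: power_mult_distrib power_mult[symmetric] mult.commute)
  ultimately have "((\<lambda>m. (q ^ Suc m * y) ^ Suc n) has_sum (q ^ Suc n / (1 - q ^ Suc n) * y ^ Suc n)) UNIV" by (simp only:)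
  thus "(\<Sum>\<^sub>\<infinity>m. (q ^ Suc m * y) ^ Suc n) = fps_nth B_fps (Suc n) * y ^ Suc n" by (simp add: infsumI B_fps_def del: power_Suc)
 qed
 also have "(\<lambda>m. \<Sum>\<^sub>\<infinity>n. (q ^ Suc m * y) ^ Suc n) = (\<lambda>m. hterm m y)"
  using infsumI[OF g[OF ne]] by (auto simp: hterm_def)
 finally have e: "(\<Sum>\<^sub>\<infinity>m. hterm m y) = (\<Sum>\<^sub>\<infinity>n. fps_nth B_fps (Suc n) * y ^ Suc n)" .
 have "ereal (norm y) < ereal (1 / norm q)" using assms q_nonzero by (simp add: field_simps)
 hence r: "ereal (norm y) < fps_conv_radius B_fps" using conv_radius_B by (rule less_le_trans)
 have "(\<Sum>\<^sub>\<infinity>m. hterm m y) = hser y"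
 proof -
  have "(\<lambda>m. \<Sum>\<^sub>\<infinity>n. (q ^ Suc m * y) ^ Suc n) summable_on UNIV"
   using summable_on_Sigma_banach[of "\<lambda>m n. (q ^ Suc m * y) ^ Suc n" UNIV "\<lambda>_. UNIV"] S by simp
  hence "(\<lambda>m. hterm m y) summable_on UNIV" using infsumI[OF g[OF ne]] by (simp add: hterm_def)
  hence "(\<lambda>m. hterm m y) sums (\<Sum>\<^sub>\<infinity>m. hterm m y)" by (intro has_sum_imp_sums) simp
  thus ?thesis by (simp add: hser_def sums_iff)
 qed
 moreover have "(\<Sum>\<^sub>\<infinity>n. fps_nth B_fps (Suc n) * y ^ Suc n) = eval_fps B_fps y"
 proof -
  have "(\<Sum>\<^sub>\<infinity>n. fps_nth B_fps (Suc n) * y ^ Suc n) = (\<Sum>\<^sub>\<infinity>n\<in>{1..}. fps_nth B_fps n * y ^ n)"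
   by (rule infsum_reindex_bij_witness[of _ "\<lambda>n. n - 1" Suc]) auto
  thus ?thesis using eval_fps_infsum(1)[OF r] by (simp add: B_fps_def)
 qed
 ultimately show ?thesis using e by simp
qed

end

context nome
begin

definition P1g :: "complex => complex" where
 "P1g z = 1 / 2 + 1 / (exp z - 1) + hser (exp (- z)) - hser (exp z)"

definition poles :: "complex set" where
 "poles = {z. exp z = 1 \<or> (\<exists>m. q ^ Suc m * exp z = 1 \<or> q ^ Suc m * exp (- z) = 1)}"

lemma P1g_differentiable: "z \<notin> poles ==> P1g field_differentiable (at z)"
proof -
 assume z: "z \<notin> poles"
 have e: "(\<lambda>x. exp (- x)) field_differentiable (at z)" "exp field_differentiable (at z)"
  unfolding field_differentiable_def by (auto intro!: exI derivative_eq_intros)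
 hence "(\<lambda>z. hser (exp (- z))) field_differentiable (at z)" "(\<lambda>z. hser (exp z)) field_differentiable (at z)"
 proof -
  have "hser field_differentiable (at (exp (- z)))" "hser field_differentiable (at (exp z))"
   by (rule hser_differentiable; use z in \<open>simp add: poles_def\<close>)+
  thus "(\<lambda>z. hser (exp (- z))) field_differentiable (at z)" "(\<lambda>z. hser (exp z)) field_differentiable (at z)"
   using field_differentiable_compose[OF e(1), of hser] field_differentiable_compose[OF e(2), of hser] by (simp_all add: o_def)
 qed
 moreover have "(\<lambda>z. 1 / (exp z - 1)) field_differentiable (at z)"
  using z e by (auto intro!: field_differentiable_divide field_differentiable_diff simp: poles_def)
 ultimately show ?thesis unfolding P1g_def [abs_def] by (intro field_differentiable_add field_differentiable_diff) auto
qed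

lemma conv_cond_A: "norm (w :: complex) < 1 ==> ereal (norm w) < fps_conv_radius A_fps"
 using conv_radius_A by (metis less_le_trans ereal_less(3))

lemma conv_cond_B: "norm q * norm (w :: complex) < 1 ==> ereal (norm w) < fps_conv_radius B_fps"
proof -
 assume "norm q * norm w < 1"
 hence "ereal (norm w) < ereal (1 / norm q)" using q_nonzero by (simp add: field_simps)
 thus ?thesis using conv_radius_B by (rule less_le_trans)
qed

lemma eval_A:
 assumes "norm w < 1"
 shows "eval_fps A_fps w = w / (1 - w) + eval_fps B_fps w"
proof -
 have wb: "norm q * norm w < 1" using assms q_less by (metis mult_less_le_imp_less mult_1 norm_ge_zero less_imp_le zero_less_one mult_le_less_imp_less mult_strict_mono')
 have "(\<lambda>n. w * w ^ n) sums (w * (1 / (1 - w)))" using assms by (intro sums_mult geometric_sums)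
 hence "(\<lambda>n. (if Suc n = 0 then 0 else w ^ Suc n)) sums (w * (1 / (1 - w)))" by simp
 hence "(\<lambda>n. if n = 0 then 0 else w ^ n) sums (w * (1 / (1 - w)) + 0)"
  using sums_Suc_iff[of "\<lambda>n. if n = 0 then 0 else w ^ n"] by simp
 moreover have "(\<lambda>n. fps_nth B_fps n * w ^ n) sums eval_fps B_fps w" by (rule sums_eval_fps[OF conv_cond_B[OF wb]])
 ultimately have "(\<lambda>n. (if n = 0 then 0 else w ^ n) + fps_nth B_fps n * w ^ n) sums (w * (1 / (1 - w)) + 0 + eval_fps B_fps w)"
  by (rule sums_add)
 moreover have "(if n = 0 then 0 else w ^ n) + fps_nth B_fps n * w ^ n = fps_nth A_fps n * w ^ n" for n
  using one_minus_q_power_nonzero[of n] by (simp add: A_fps_def B_fps_def field_simps)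
 ultimately show ?thesis using sums_eval_fps[OF conv_cond_A[OF assms]] sums_unique2 by fastforce
qed

lemma P1g_right:
 assumes "1 < norm (exp z)" "norm q * norm (exp z) < 1"
 shows "P1g z = 1 / 2 + eval_fps A_fps (exp (- z)) - eval_fps B_fps (exp z)"
proof -
 have n: "norm (exp (- z)) < 1" using assms(1) by simp
 have nq: "norm q * norm (exp (- z)) < 1"
  using n q_less by (metis mult_le_one norm_ge_zero less_imp_le mult_less_cancel_right2 mult_left_le_one_le le_less_trans)
 have "exp z \<noteq> 1" using assms(1) by (metis less_irrefl norm_one)
 hence "1 / (exp z - 1) = exp (- z) / (1 - exp (- z))" by (simp add: exp_minus field_simps)
 thus ?thesis unfolding P1g_def eval_A[OF n] hser_eq_eval[OF nq] hser_eq_eval[OF assms(2)] by simp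
qed

lemma P1g_odd: "exp z \<noteq> 1 ==> P1g (- z) = - P1g z"
proof -
 assume "exp z \<noteq> 1"
 hence "1 / (exp (- z) - 1) = - 1 - 1 / (exp z - 1)" by (simp add: exp_minus divide_simps) (simp add: algebra_simps)
 thus ?thesis by (simp add: P1g_def)
qed

lemma open_annulus: "open {z :: complex. 1 < norm (exp z) \<and> norm q * norm (exp z) < 1}"
 by (intro open_Collect_conj open_Collect_less continuous_intros holomorphic_on_imp_continuous_on[OF holomorphic_on_exp])

lemma theta_A0: "fps_nth ((theta ^^ j) A_fps) 0 = 0" "fps_nth ((theta ^^ j) B_fps) 0 = 0" by (simp_all add: theta_power_nth A_fps_def B_fps_def)

lemma analytic_eval_exp:
 assumes "ereal (norm (exp (s * z))) < fps_conv_radius F"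
 shows "(\<lambda>u. eval_fps F (exp (s * u))) analytic_on {z}"
proof -
 have "(\<lambda>u. eval_fps F (exp (s * u))) holomorphic_on {u. ereal (norm (exp (s * u))) < fps_conv_radius F}"
  unfolding holomorphic_on_open[OF open_exp_eball] using has_field_derivative_eval_exp by blast
 thus ?thesis using assms analytic_on_open[OF open_exp_eball] analytic_on_subset[of _ _ "{z}"] by blast
qed

lemma higher_deriv_P1g_right:
 assumes z: "1 < norm (exp z)" "norm q * norm (exp z) < 1"
 shows "(deriv ^^ j) P1g z = (if j = 0 then 1 / 2 else 0) + (- 1) ^ j * eval_fps ((theta ^^ j) A_fps) (exp (- z))
  - eval_fps ((theta ^^ j) B_fps) (exp z)"
proof -
 have n: "norm (exp (- 1 * z)) < 1" using z(1) by simp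
 have cA: "ereal (norm (exp (- 1 * z))) < fps_conv_radius A_fps" by (rule conv_cond_A[OF n])
 have cB: "ereal (norm (exp (1 * z))) < fps_conv_radius B_fps" using conv_cond_B[OF z(2)] by simp
 have cB': "ereal (norm (exp (1 * z))) < fps_conv_radius (- B_fps)" using cB by simp
 have ev: "eventually (\<lambda>w. P1g w = 1 / 2 + (eval_fps A_fps (exp (- 1 * w)) + eval_fps (- B_fps) (exp (1 * w)))) (nhds z)"
 proof -
  have "eventually (\<lambda>w. w \<in> {z. 1 < norm (exp z) \<and> norm q * norm (exp z) < 1}) (nhds z)"
   using z by (intro eventually_nhds_in_open[OF open_annulus]) simp
  thus ?thesis
  proof eventually_elim
   case (elim w)
   hence "eval_fps (- B_fps) (exp w) = - eval_fps B_fps (exp w)" by (intro eval_fps_minus conv_cond_B) simp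
   thus ?case using elim P1g_right[of w] by simp
  qed
 qed
 have "(deriv ^^ j) P1g z = (deriv ^^ j) (\<lambda>w. 1 / 2 + (eval_fps A_fps (exp (- 1 * w)) + eval_fps (- B_fps) (exp (1 * w)))) z"
  by (rule higher_deriv_cong_ev[OF ev refl])
 also have "\<dots> = (deriv ^^ j) (\<lambda>w. 1 / 2) z + ((deriv ^^ j) (\<lambda>w. eval_fps A_fps (exp (- 1 * w))) z
   + (deriv ^^ j) (\<lambda>w. eval_fps (- B_fps) (exp (1 * w))) z)"
  by (subst higher_deriv_add_at, (intro analytic_intros analytic_eval_exp cA cB' analytic_on_add)+)
   (subst higher_deriv_add_at, (intro analytic_intros analytic_eval_exp cA cB')+, rule refl)
 also have "(deriv ^^ j) (\<lambda>w. 1 / 2 :: complex) z = (if j = 0 then 1 / 2 else 0)" by (simp add: higher_deriv_const)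
 also have "(theta ^^ j) (- B_fps) = - (theta ^^ j) B_fps" by (rule fps_ext) (simp add: theta_power_nth)
 hence "(deriv ^^ j) (\<lambda>w. eval_fps (- B_fps) (exp (1 * w))) z = - eval_fps ((theta ^^ j) B_fps) (exp z)"
  unfolding higher_deriv_eval_exp[OF cB'] using cB conv_radius_theta_power[of B_fps j] by (simp add: eval_fps_minus less_le_trans)
 finally show ?thesis unfolding higher_deriv_eval_exp[OF cA] by simp
qed

lemma higher_deriv_P1g_odd:
 assumes z: "1 < norm (exp z)" "norm q * norm (exp z) < 1"
 shows "(deriv ^^ j) P1g (- z) = (- 1) ^ Suc j * (deriv ^^ j) P1g z" using z
proof (induction j arbitrary: z)
 case 0
 hence "exp z \<noteq> 1" by (metis less_irrefl norm_one)
 thus ?case by (simp add: P1g_odd)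
next
 case (Suc j)
 let ?U = "{z :: complex. 1 < norm (exp z) \<and> norm q * norm (exp z) < 1}"
 have z: "z \<in> ?U" using Suc.prems by simp
 have hol: "P1g holomorphic_on ?U"
 proof -
  have "w \<notin> poles" if "w \<in> ?U" for w
  proof
   assume "w \<in> poles"
   then consider "exp w = 1" | m where "q ^ Suc m * exp w = 1" | m where "q ^ Suc m * exp (- w) = 1" by (auto simp: poles_def)
   thus False
   proof cases
    case 1
    hence "norm (exp w) = norm (1 :: complex)" by (rule arg_cong)
    thus ?thesis using that by simp
   next
    case 2
    have "norm (q ^ Suc m * exp w) \<le> norm q * norm (exp w)"
     using norm_q_power(2)[of "Suc m"] by (simp only: norm_mult) (intro mult_right_mono, auto)
    with 2 that show ?thesis by simp
   next
    case 3
    hence "q ^ Suc m = exp w" by (simp add: exp_minus field_simps)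
    thus ?thesis using that norm_q_power(1)[of "Suc m"] by simp
   qed
  qed
  thus ?thesis unfolding holomorphic_on_def using P1g_differentiable field_differentiable_at_within by blast
 qed
 hence hol_j: "(deriv ^^ j) P1g holomorphic_on ?U" by (rule holomorphic_higher_deriv[OF _ open_annulus])
 have ev: "eventually (\<lambda>w. (deriv ^^ j) P1g w = (- 1) ^ Suc j * (deriv ^^ j) P1g (- w)) (nhds (- z))"
 proof -
  have "open (uminus -` ?U)" by (rule open_vimage[OF open_annulus]) (intro continuous_intros)
  moreover have "- z \<in> uminus -` ?U" using z by simp
  ultimately have "eventually (\<lambda>w. w \<in> uminus -` ?U) (nhds (- z))" by (rule eventually_nhds_in_open)
  thus ?thesis
  proof eventually_elim
   case (elim w)
   thus ?case using Suc.IH[of "- w"] by simp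
  qed
 qed
 have "deriv (\<lambda>w. (- 1) ^ Suc j * (deriv ^^ j) P1g (- w)) (- z) = (- 1) ^ Suc j * (deriv ((deriv ^^ j) P1g) z * (- 1))"
 proof (rule DERIV_imp_deriv, rule DERIV_cmult, rule DERIV_chain2[where f = "(deriv ^^ j) P1g"])
  show "((deriv ^^ j) P1g has_field_derivative deriv ((deriv ^^ j) P1g) z) (at (- (- z)))"
   using hol_j z by (simp add: holomorphic_derivI[OF _ open_annulus])
 qed (auto intro!: derivative_eq_intros)
 with deriv_cong_ev[OF ev refl] show ?case by simp
qed

end

context nome
begin

lemma sum_sigma:
 "(\<Sum>\<^sub>\<infinity>N\<in>{1..}. of_nat (sigma k N) * q ^ N) = (\<Sum>\<^sub>\<infinity>n\<in>{1..}. of_nat n ^ k * fps_nth B_fps n)"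
proof -
 let ?f = "\<lambda>(n, m). of_nat n ^ k * q ^ (n * m) :: complex"
 have sm: "?f summable_on {1..} \<times> {1..}"
 proof (rule abs_summable_summable, rule summable_on_comparison_test)
  have "summable (\<lambda>n. norm (fps_nth ((theta ^^ k) (Abs_fps (\<lambda>n. 1))) n * q ^ n))"
  proof (rule norm_summable_fps)
   have "fps_conv_radius (Abs_fps (\<lambda>n. 1) :: complex fps) \<ge> 1" unfolding fps_conv_radius_def
   proof (rule conv_radius_geI_ex)
    fix r :: real assume "0 < r" "ereal r < 1"
    thus "\<exists>z :: complex. norm z = r \<and> summable (\<lambda>n. fps_nth (Abs_fps (\<lambda>n. 1)) n * z ^ n)"
     by (intro exI[of _ "of_real r"]) (simp add: summable_geometric)
   qed
   hence "1 \<le> fps_conv_radius ((theta ^^ k) (Abs_fps (\<lambda>n. 1)))" using conv_radius_theta_power by (rule order_trans)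
   moreover have "ereal (norm q) < 1" using q_less by simp
   ultimately show "ereal (norm q) < fps_conv_radius ((theta ^^ k) (Abs_fps (\<lambda>n. 1)))" by (rule less_le_trans[rotated])
  qed
  hence "(\<lambda>n. norm (of_nat n ^ k * q ^ n)) summable_on UNIV" by (intro norm_summable_imp_summable_on) (simp add: theta_power_nth)
  hence a: "(\<lambda>n. norm (of_nat n ^ k * q ^ n)) summable_on {1..}" by (rule summable_on_subset_banach) simp
  have "(\<lambda>m. norm q ^ m) summable_on UNIV" using q_less by (intro norm_summable_imp_summable_on) (simp add: summable_geometric)
  hence "(\<lambda>m. norm q ^ (m - 1)) summable_on {1..}"
   by (subst summable_on_reindex_bij_witness[of _ Suc "\<lambda>m. m - 1" UNIV "\<lambda>m. norm q ^ m"]) auto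
  from summable_on_times[OF a this]
  show "(\<lambda>(n, m). norm (of_nat n ^ k * q ^ n) * norm q ^ (m - 1)) summable_on {1..} \<times> {1..}" by simp
  fix p :: "nat \<times> nat" assume "p \<in> {1..} \<times> {1..}"
  then obtain n m where p: "p = (Suc n, Suc m)" by (cases p; cases "fst p"; cases "snd p"; auto)
  have "norm q ^ (Suc n * Suc m) \<le> norm q ^ (Suc n + m)" using q_less by (intro power_decreasing) auto
  hence "of_nat (Suc n) ^ k * norm q ^ (Suc n * Suc m) \<le> of_nat (Suc n) ^ k * norm q ^ (Suc n + m)" by (intro mult_left_mono) auto
  thus "norm (?f p) \<le> (case p of (n, m) => norm (of_nat n ^ k * q ^ n) * norm q ^ (m - 1))"
   unfolding p by (simp add: norm_mult norm_power power_add mult_ac del: of_nat_Suc)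
 qed simp
 have "(\<Sum>\<^sub>\<infinity>n\<in>{1..}. of_nat n ^ k * fps_nth B_fps n) = (\<Sum>\<^sub>\<infinity>n\<in>{1..}. \<Sum>\<^sub>\<infinity>m\<in>{1..}. ?f (n, m))"
 proof (rule infsum_cong)
  fix n :: nat assume n: "n \<in> {1..}"
  have qn: "norm (q ^ n) < 1" using n by (intro le_less_trans[OF norm_q_power(2) q_less]) simp
  have "(\<lambda>m. q ^ n * (q ^ n) ^ m) sums (q ^ n * (1 / (1 - q ^ n)))" using qn by (intro sums_mult geometric_sums)
  moreover have "summable (\<lambda>m. norm (q ^ n * (q ^ n) ^ m))" using qn by (simp add: norm_mult norm_power summable_mult summable_geometric)
  ultimately have "((\<lambda>m. q ^ n * (q ^ n) ^ m) has_sum (q ^ n * (1 / (1 - q ^ n)))) UNIV" by (intro norm_summable_imp_has_sum)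
  hence "((\<lambda>m. (q ^ n) ^ m) has_sum (q ^ n * (1 / (1 - q ^ n)))) {1..}"
   by (subst has_sum_reindex_bij_witness[of _ Suc "\<lambda>m. m - 1" UNIV "\<lambda>m. q ^ n * (q ^ n) ^ m"]) (auto simp flip: power_Suc)
  from has_sum_cmult_right[OF this, of "of_nat n ^ k"]
  have "((\<lambda>m. ?f (n, m)) has_sum (of_nat n ^ k * fps_nth B_fps n)) {1..}" using n by (simp add: B_fps_def power_mult)
  thus "of_nat n ^ k * fps_nth B_fps n = (\<Sum>\<^sub>\<infinity>m\<in>{1..}. ?f (n, m))" by (simp add: infsumI)
 qed
 also have "\<dots> = infsum ?f ({1..} \<times> {1..})" by (rule infsum_Sigma_banach[OF sm])
 also have "\<dots> = infsum (\<lambda>(N, d). of_nat d ^ k * q ^ N) (SIGMA N:{1..}. {d. d dvd N})"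
  by (rule infsum_reindex_bij_witness[where i = "\<lambda>(N, d). (d, N div d)" and j = "\<lambda>(n, m). (n * m, n)"])
   (auto simp: dvd_div_eq_0_iff Suc_le_eq intro!: Nat.gr0I)
 also have "\<dots> = (\<Sum>\<^sub>\<infinity>N\<in>{1..}. \<Sum>\<^sub>\<infinity>d\<in>{d. d dvd N}. of_nat d ^ k * q ^ N)"
 proof -
  have "(\<lambda>(N, d). of_nat d ^ k * q ^ N) summable_on (SIGMA N:{1..}. {d. d dvd N})
   \<longleftrightarrow> ?f summable_on {1..} \<times> {1..}"
   by (rule summable_on_reindex_bij_witness[where j = "\<lambda>(N, d). (d, N div d)" and i = "\<lambda>(n, m). (n * m, n)"])
    (auto simp: dvd_div_eq_0_iff Suc_le_eq intro!: Nat.gr0I)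
  with sm have "(\<lambda>(N, d). of_nat d ^ k * q ^ N) summable_on (SIGMA N:{1..}. {d. d dvd N})" by simp
  from infsum_Sigma_banach[OF this] show ?thesis by simp
 qed
 also have "\<dots> = (\<Sum>\<^sub>\<infinity>N\<in>{1..}. of_nat (sigma k N) * q ^ N)"
 proof (rule infsum_cong)
  fix N :: nat assume "N \<in> {1..}"
  hence "finite {d. d dvd N}" by (simp add: finite_divisors_nat)
  thus "(\<Sum>\<^sub>\<infinity>d\<in>{d. d dvd N}. of_nat d ^ k * q ^ N) = of_nat (sigma k N) * q ^ N" by (simp add: sigma_def sum_distrib_right)
 qed
 finally show ?thesis by simp
qed

lemma eval_theta_B_1: "eval_fps ((theta ^^ k) B_fps) 1 = (\<Sum>\<^sub>\<infinity>N\<in>{1..}. of_nat (sigma k N) * q ^ N)"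
proof -
 have "ereal (norm (1 :: complex)) < fps_conv_radius ((theta ^^ k) B_fps)"
  using conv_cond_B[of 1] q_less conv_radius_theta_power[of B_fps k] by (simp add: less_le_trans)
 from eval_fps_infsum(1)[OF this theta_A0(2)] show ?thesis by (simp only: theta_power_nth power_one mult.right_neutral sum_sigma)
qed

definition E_fps :: "complex fps" where
 "E_fps = Abs_fps (\<lambda>k. if odd k then - bern_exp (Suc k) + 2 / fact k * (\<Sum>\<^sub>\<infinity>N\<in>{1..}. of_nat (sigma k N) * q ^ N) else 0)"

lemma P1g_expansion: "(\<lambda>z. if z = 0 then 0 else 1 / z - P1g z) has_fps_expansion E_fps"
proof -
 let ?H = "\<lambda>u. eval_fps B_fps (exp (1 * u)) - eval_fps B_fps (exp (- 1 * u))"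
 have c: "ereal (norm (exp (s * 0 :: complex))) < fps_conv_radius B_fps" for s using conv_cond_B[of 1] q_less by simp
 have an: "(\<lambda>u. eval_fps B_fps (exp (s * u))) analytic_on {0}" for s by (rule analytic_eval_exp[OF c])
 define HF where "HF = fps_expansion ?H 0"
 have H: "?H has_fps_expansion HF" unfolding HF_def by (rule analytic_at_imp_has_fps_expansion_0) (intro analytic_intros an)
 have Hk: "fps_nth HF k = (if odd k then 2 / fact k * (\<Sum>\<^sub>\<infinity>N\<in>{1..}. of_nat (sigma k N) * q ^ N) else 0)" for k
 proof -
  have "(deriv ^^ k) ?H 0 = eval_fps ((theta ^^ k) B_fps) 1 - (- 1) ^ k * eval_fps ((theta ^^ k) B_fps) 1"
   by (subst higher_deriv_diff_at[OF an an]) (subst (1 2) higher_deriv_eval_exp[OF c], simp)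
  thus ?thesis by (auto simp: HF_def fps_expansion_def eval_theta_B_1)
 qed
 have B1: "(\<lambda>z. if z = 0 then 1 else z / (exp z - 1)) has_fps_expansion (fps_X / expm1)"
 proof (rule has_fps_expansion_divide)
  show "(\<lambda>z :: complex. exp z - 1) has_fps_expansion expm1" unfolding expm1_def by (intro fps_expansion_intros)
 qed (auto intro!: fps_expansion_intros)
 have b0: "fps_nth (fps_X / expm1) 0 = 1" using B1 has_fps_expansion_imp_0_eq_fps_nth_0[OF B1] by simp
 have B2: "(\<lambda>z. if z = 0 then - bern_exp 1 else (1 - (if z = 0 then 1 else z / (exp z - 1))) / z)
  has_fps_expansion ((1 - fps_X / expm1) / fps_X)"
 proof (rule has_fps_expansion_divide)
  show "(\<lambda>z. 1 - (if z = 0 then 1 else z / (exp z - 1))) has_fps_expansion (1 - fps_X / expm1)" by (intro fps_expansion_intros B1)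
  show "subdegree (fps_X :: complex fps) \<le> subdegree (1 - fps_X / expm1)"
  proof (cases "1 - fps_X / expm1 = 0")
   case True
   have "fps_nth (1 - fps_X / expm1) 1 = - bern_exp 1" by (simp add: bern_exp_def)
   thus ?thesis using True bern_exp_odd[of 1] by simp
  next
   case False
   have "subdegree (1 - fps_X / expm1) \<noteq> 0" using False b0 by (simp add: subdegree_eq_0_iff)
   thus ?thesis by simp
  qed
 qed (auto intro!: fps_expansion_intros simp: bern_exp_def)
 let ?F = "(1 - fps_X / expm1) / fps_X - fps_const (1 / 2) + HF"
 have "(\<lambda>z. (if z = 0 then - bern_exp 1 else (1 - (if z = 0 then 1 else z / (exp z - 1))) / z) - 1 / 2 + ?H z) has_fps_expansion ?F"
  by (intro fps_expansion_intros B2 H)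
 also have "?F = E_fps"
 proof (rule fps_ext)
  fix k
  have "(1 - fps_X / expm1) / fps_X = fps_shift 1 (1 - fps_X / expm1)" by (rule fps_divide_X)
  hence "fps_nth ?F k = - bern_exp (Suc k) - (if k = 0 then 1 / 2 else 0) + fps_nth HF k" by (simp add: bern_exp_def)
  thus "fps_nth ?F k = fps_nth E_fps k" using bern_exp_odd[of "Suc k"] by (auto simp: E_fps_def Hk)
 qed
 finally have *: "(\<lambda>z. (if z = 0 then - bern_exp 1 else (1 - (if z = 0 then 1 else z / (exp z - 1))) / z) - 1 / 2 + ?H z) has_fps_expansion E_fps" .
 have "eventually (\<lambda>z :: complex. z \<in> {u. ereal (norm (exp (1 * u))) < fps_conv_radius B_fps} \<inter> {u. ereal (norm (exp (- 1 * u))) < fps_conv_radius B_fps}) (nhds 0)"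
  using c[of 1] c[of "- 1"] by (intro eventually_nhds_in_open open_Int open_exp_eball) auto
 moreover have "eventually (\<lambda>z :: complex. z \<in> {z. norm q * norm (exp (1 * z)) < 1} \<inter> {z. norm q * norm (exp (- 1 * z)) < 1} \<inter> ball 0 (2 * pi)) (nhds 0)"
  using q_less by (intro eventually_nhds_in_open open_Int) (auto intro!: open_Collect_less continuous_intros)
 ultimately have ev: "eventually (\<lambda>z. (if z = 0 then - bern_exp 1 else (1 - (if z = 0 then 1 else z / (exp z - 1))) / z) - 1 / 2 + ?H z
   = (if z = 0 then 0 else 1 / z - P1g z)) (nhds 0)"
 proof eventually_elim
  case (elim z)
  show ?case
  proof (cases "z = 0")
   case True
   thus ?thesis using bern_exp_odd[of 1] by simp
  next
   case False
   have "exp z \<noteq> 1"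
   proof
    assume "exp z = 1"
    then obtain n :: int where n: "Re z = 0" "Im z = of_int (2 * n) * pi" by (auto simp: exp_eq_1)
    have "\<bar>Im z\<bar> < 2 * pi" using elim(2) abs_Im_le_cmod[of z] by simp
    with n have "n = 0" by (auto simp: abs_mult)
    with n have "z = 0" by (simp add: complex_eq_iff)
    with False show False by simp
   qed
   hence "(1 - z / (exp z - 1)) / z = 1 / z - 1 / (exp z - 1)" using False by (simp add: field_simps)
   moreover have "hser (exp z) = eval_fps B_fps (exp (1 * z))" "hser (exp (- z)) = eval_fps B_fps (exp (- 1 * z))"
    using elim(2) hser_eq_eval[of "exp z"] hser_eq_eval[of "exp (- z)"] by auto
   ultimately show ?thesis using False by (simp add: P1g_def)
  qed
 qed
 from * show ?thesis by (rule has_fps_expansion_cong[OF ev refl, THEN iffD1])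
qed

end

lemma nome_exp: "Im \<tau> > 0 ==> nome (nom \<tau>)" by unfold_locales (simp_all add: norm_exp_eq_Re mult_pos_pos)

lemma period_lattice_closed:
 assumes "Im \<tau> > 0"
 shows "closed (period_lattice \<tau>)"
proof -
 define \<delta> where "\<delta> = 2 * pi * min (Im \<tau>) 1"
 have \<delta>: "\<delta> > 0" using assms by (simp add: \<delta>_def)
 have sep: "norm (2 * of_real pi * \<i> * (of_int k * \<tau> + of_int l)) \<ge> \<delta>" if "k \<noteq> 0 \<or> l \<noteq> 0" for k l :: int
 proof -
  have "norm (of_int k * \<tau> + of_int l) \<ge> min (Im \<tau>) 1"
  proof (cases "k = 0")
   case True
   hence "\<bar>l\<bar> \<ge> 1" using that by linarith
   hence "norm (of_int l :: complex) \<ge> 1" by simp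
   thus ?thesis using True by simp
  next
   case False
   hence "\<bar>k\<bar> \<ge> 1" by linarith
   hence "\<bar>of_int k :: real\<bar> \<ge> 1" by linarith
   hence "Im \<tau> \<le> \<bar>of_int k * Im \<tau>\<bar>" using assms by (simp add: abs_mult)
   also have "\<dots> = \<bar>Im (of_int k * \<tau> + of_int l)\<bar>" by simp
   also have "\<dots> \<le> norm (of_int k * \<tau> + of_int l)" by (rule abs_Im_le_cmod)
   finally show ?thesis by simp
  qed
  thus ?thesis by (simp add: norm_mult \<delta>_def)
 qed
 show ?thesis
 proof (rule discrete_imp_closed[OF \<delta>], intro ballI impI)
  fix x y assume "x \<in> period_lattice \<tau>" "y \<in> period_lattice \<tau>" and d: "dist y x < \<delta>"
  then obtain k l k' l' :: int where x: "x = 2 * of_real pi * \<i> * (of_int k * \<tau> + of_int l)"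
   and y: "y = 2 * of_real pi * \<i> * (of_int k' * \<tau> + of_int l')" by (auto simp: period_lattice_def)
  have "y - x = 2 * of_real pi * \<i> * (of_int (k' - k) * \<tau> + of_int (l' - l))" by (simp add: x y algebra_simps)
  hence "k' - k = 0 \<and> l' - l = 0" using d sep[of "k' - k" "l' - l"] by (auto simp: dist_norm)
  thus "y = x" by (simp add: x y)
 qed
qed

lemma period_lattice_countable: "countable (period_lattice \<tau>)"
proof -
 have "period_lattice \<tau> = (\<lambda>(k, l). 2 * of_real pi * \<i> * (of_int k * \<tau> + of_int l)) ` (UNIV :: (int \<times> int) set)"
  by (auto simp: period_lattice_def)
 thus ?thesis by simp
qed

lemma conv_radius_integral0:
 fixes F :: "complex fps"
 shows "fps_conv_radius F \<le> fps_conv_radius (fps_integral0 F)" unfolding fps_conv_radius_def[of "fps_integral0 F"]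
proof (rule conv_radius_geI_ex)
 fix r :: real assume r: "0 < r" "ereal r < fps_conv_radius F"
 have "summable (\<lambda>n. norm (fps_nth F n * of_real r ^ n))" by (rule norm_summable_fps) (use r in simp)
 hence s: "summable (\<lambda>n. r * norm (fps_nth F n * of_real r ^ n))" by (rule summable_mult)
 have "summable (\<lambda>n. fps_nth (fps_integral0 F) (Suc n) * of_real r ^ Suc n)"
 proof (rule summable_comparison_test'[OF s])
  fix n :: nat
  have "norm (fps_nth (fps_integral0 F) (Suc n) * of_real r ^ Suc n) = (r * norm (fps_nth F n * of_real r ^ n)) / real (Suc n)"
   using r(1) by (simp add: fps_integral_def norm_mult norm_power norm_inverse divide_inverse mult_ac del: of_nat_Suc)
  also have "\<dots> \<le> (r * norm (fps_nth F n * of_real r ^ n)) / 1" using r(1) by (intro divide_left_mono) auto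
  finally show "norm (fps_nth (fps_integral0 F) (Suc n) * of_real r ^ Suc n) \<le> r * norm (fps_nth F n * of_real r ^ n)" by simp
 qed
 hence "summable (\<lambda>n. fps_nth (fps_integral0 F) n * of_real r ^ n)" by (rule iffD1[OF summable_Suc_iff])
 thus "\<exists>z. norm z = r \<and> summable (\<lambda>n. fps_nth (fps_integral0 F) n * z ^ n)" using r(1) by (intro exI[of _ "of_real r"]) simp
qed

context
 fixes \<tau> :: complex
 assumes tau: "Im \<tau> > 0"
begin

interpretation nome "nom \<tau>" by (rule nome_exp[OF tau])

lemma period_lattice_iff:
 "z \<in> period_lattice \<tau> \<longleftrightarrow> (\<exists>k::int. exp z = nom \<tau> powi k)"
proof -
 have "nom \<tau> powi k = exp (of_int k * (2 * of_real pi * \<i> * \<tau>))" for k :: int by (simp add: exp_power_int mult.commute)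
 hence "(\<exists>k::int. exp z = nom \<tau> powi k) \<longleftrightarrow>
  (\<exists>k l :: int. z = of_int k * (2 * of_real pi * \<i> * \<tau>) + (2 * of_int l * of_real pi) * \<i>)" by (simp add: exp_eq)
 also have "\<dots> \<longleftrightarrow> z \<in> period_lattice \<tau>" unfolding period_lattice_def by (simp add: algebra_simps)
 finally show ?thesis by simp
qed

lemma poles_eq: "poles = period_lattice \<tau>"
proof -
 let ?q = "nom \<tau>"
 have "z \<in> poles \<longleftrightarrow> (\<exists>k::int. exp z = ?q powi k)" for z
 proof
  assume "z \<in> poles"
  then consider "exp z = 1" | m where "?q ^ Suc m * exp z = 1" | m where "?q ^ Suc m * exp (- z) = 1" by (auto simp: poles_def)
  thus "\<exists>k::int. exp z = ?q powi k"
  proof cases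
   case 1
   thus ?thesis by (intro exI[of _ 0]) simp
  next
   case 2
   hence "exp z = inverse (?q ^ Suc m)" by (simp add: field_simps del: power_Suc)
   hence "exp z = ?q powi (- int (Suc m))" by (simp only: power_int_minus power_int_of_nat)
   thus ?thesis by blast
  next
   case 3
   hence "exp z = ?q ^ Suc m" by (simp add: exp_minus field_simps del: power_Suc)
   hence "exp z = ?q powi (int (Suc m))" by (simp only: power_int_of_nat)
   thus ?thesis by blast
  qed
 next
  assume "\<exists>k::int. exp z = ?q powi k"
  then obtain k :: int where k: "exp z = ?q powi k" by blast
  consider "k = 0" | m where "k = int (Suc m)" | m where "k = - int (Suc m)" by (metis int_cases2 not0_implies_Suc of_nat_0 minus_zero)
  thus "z \<in> poles"
  proof cases
   case 1
   thus ?thesis using k by (simp add: poles_def)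
  next
   case 2
   hence "exp z = ?q ^ Suc m" using k by (simp only: power_int_of_nat)
   hence "?q ^ Suc m * exp (- z) = 1" by (metis exp_minus_inverse)
   thus ?thesis by (auto simp: poles_def)
  next
   case 3
   hence "exp z = inverse (?q ^ Suc m)" using k by (simp only: power_int_minus power_int_of_nat)
   hence "?q ^ Suc m * exp z = ?q ^ Suc m * inverse (?q ^ Suc m)" by (rule arg_cong)
   also have "\<dots> = 1" by (rule right_inverse) simp
   finally have "?q ^ Suc m * exp z = 1" .
   thus ?thesis by (auto simp: poles_def)
  qed
 qed
 thus ?thesis using period_lattice_iff by blast
qed

lemma E_fps_eq: "E_fps $ k = (if k = 0 then 0 else E_fun (Suc k) \<tau>)"
 by (auto simp: E_fps_def E_fun_def bernoulli_eq simp del: fact_Suc of_nat_Suc)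

lemma deriv_P0: "\<exists>r>0. \<forall>w\<in>ball 0 r - \<real>\<^sub>\<le>\<^sub>0. deriv (\<lambda>x. P0_fun x \<tau>) w = - P1g w"
proof -
 define R where "R = fps_conv_radius E_fps"
 have R: "R > 0" using P1g_expansion by (simp add: has_fps_expansion_def R_def)
 have "eventually (\<lambda>z. eval_fps E_fps z = (if z = 0 then 0 else 1 / z - P1g z)) (nhds 0)"
  using P1g_expansion by (simp add: has_fps_expansion_def)
 then obtain d where d: "d > 0" "\<And>z. dist z 0 < d ==> eval_fps E_fps z = (if z = 0 then 0 else 1 / z - P1g z)"
  unfolding eventually_nhds_metric by blast
 obtain r0 where r0: "r0 > 0" "ereal r0 < R" using R ereal_dense2[of 0 R] by auto
 define r where "r = min d r0"
 let ?G = "fps_integral0 E_fps"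
 have P0: "P0_fun x \<tau> = - Ln x + eval_fps ?G x" if "x \<in> ball 0 r" for x
 proof -
  have x: "ereal (norm x) < fps_conv_radius ?G"
  proof -
   have "ereal (norm x) < ereal r0" using that by (simp add: r_def)
   hence "ereal (norm x) < R" using r0(2) by (rule less_trans)
   also have "R \<le> fps_conv_radius ?G" unfolding R_def by (rule conv_radius_integral0)
   finally show ?thesis .
  qed
  have "eval_fps ?G x = (\<Sum>\<^sub>\<infinity>k\<in>{1..}. fps_nth ?G k * x ^ k)" by (rule eval_fps_infsum(1)[OF x]) simp
  also have "\<dots> = (\<Sum>\<^sub>\<infinity>k\<in>{2..}. E_fun k \<tau> / of_nat k * x ^ k)"
  proof (rule infsum_cong_neutral)
   fix k :: nat assume "k \<in> {1..} - {2..}"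
   hence "k = 1" by auto
   thus "fps_nth ?G k * x ^ k = 0" by (simp add: fps_integral_def E_fps_eq)
  next
   fix k :: nat assume "k \<in> {1..} \<inter> {2..}"
   then obtain j where "k = Suc (Suc j)" by (metis IntE atLeast_iff Suc_le_D numeral_2_eq_2 Suc_le_mono)
   thus "fps_nth ?G k * x ^ k = E_fun k \<tau> / of_nat k * x ^ k" unfolding \<open>k = Suc (Suc j)\<close> fps_integral_nth_0_Suc E_fps_eq
    by (simp only: nat.distinct if_False divide_inverse mult.commute)
  qed auto
  finally show ?thesis by (simp add: P0_fun_def)
 qed
 have "deriv (\<lambda>x. P0_fun x \<tau>) w = - P1g w" if w: "w \<in> ball 0 r - \<real>\<^sub>\<le>\<^sub>0" for w
 proof -
  have w': "w \<notin> \<real>\<^sub>\<le>\<^sub>0" "w \<noteq> 0" using w by auto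
  have ev: "eventually (\<lambda>x. P0_fun x \<tau> = - Ln x + eval_fps ?G x) (nhds w)"
   using eventually_nhds_in_open[of "ball 0 r" w] w P0 by (auto elim!: eventually_mono)
  have "ereal (norm w) < ereal r0" using w by (simp add: r_def)
  hence "ereal (norm w) < R" using r0(2) by (rule less_trans)
  also have "R \<le> fps_conv_radius ?G" unfolding R_def by (rule conv_radius_integral0)
  finally have "(eval_fps ?G has_field_derivative eval_fps (fps_deriv ?G) w) (at w)" by (rule has_field_derivative_eval_fps)
  hence dG: "(eval_fps ?G has_field_derivative eval_fps E_fps w) (at w)" by (simp only: fps_deriv_fps_integral)
  have "((\<lambda>x. - Ln x + eval_fps ?G x) has_field_derivative (- inverse w + eval_fps E_fps w)) (at w)"
   by (intro DERIV_add DERIV_minus has_field_derivative_Ln dG w')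
  hence "deriv (\<lambda>x. - Ln x + eval_fps ?G x) w = - inverse w + eval_fps E_fps w" by (rule DERIV_imp_deriv)
  also have "eval_fps E_fps w = 1 / w - P1g w" using d(2)[of w] w w' by (simp add: r_def)
  finally show ?thesis using deriv_cong_ev[OF ev refl] by (simp add: inverse_eq_divide)
 qed
 moreover have "r > 0" using d r0 by (simp add: r_def)
 ultimately show ?thesis by blast
qed

lemma holomorphic_P1g: "P1g holomorphic_on (- period_lattice \<tau>)" unfolding holomorphic_on_def using P1g_differentiable poles_eq
 by (auto intro: field_differentiable_at_within)

lemma P_fun_eq:
 assumes n: "n \<ge> 1" and z: "z \<notin> period_lattice \<tau>"
 shows "P_fun n z \<tau> = (- 1) ^ (n - 1) / fact (n - 1) * (deriv ^^ (n - 1)) P1g z"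
proof -
 let ?L = "period_lattice \<tau>"
 let ?h = "\<lambda>z. (- 1) ^ (n - 1) / fact (n - 1) * (deriv ^^ (n - 1)) P1g z"
 let ?f = "\<lambda>z. if z \<in> ?L then 0 else ?h z"
 let ?C = "\<lambda>f. f holomorphic_on (- ?L) \<and> (\<forall>w\<in>?L. f w = 0) \<and>
  (\<exists>r>0. \<forall>w\<in>ball 0 r - \<real>\<^sub>\<le>\<^sub>0. f w = (- 1) ^ n / fact (n - 1) * (deriv ^^ n) (\<lambda>x. P0_fun x \<tau>) w)"
 have op: "open (- ?L)" using period_lattice_closed[OF tau] by (simp add: open_Compl)
 have conn: "connected (- ?L)" using connected_open_diff_countable[of UNIV ?L] period_lattice_countable[of \<tau>] connected_UNIV
  by (simp add: Compl_eq_Diff_UNIV)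
 have cl: "closed (\<real>\<^sub>\<le>\<^sub>0 :: complex set)" by (rule closed_nonpos_Reals_complex)
 obtain r where r: "r > 0" "\<And>w. w \<in> ball 0 r - \<real>\<^sub>\<le>\<^sub>0 ==> deriv (\<lambda>x. P0_fun x \<tau>) w = - P1g w"
  using deriv_P0 by blast
 have "0 \<in> ?L" unfolding period_lattice_def by (auto intro!: exI[of _ "0::int"])
 obtain e where e: "e > 0" "ball 0 e \<inter> ?L \<subseteq> {0}"
 proof -
  define U where "U = - (?L - {0})"
  have "closed (?L - {0})"
  proof -
   have "?L - {0} = ?L \<inter> - ball 0 (pi * min (Im \<tau>) 1)"
   proof (intro equalityI subsetI IntI)
    fix x assume x: "x \<in> ?L - {0}"
    thus "x \<in> ?L" by simp
    from x obtain k l :: int where kl: "x = 2 * of_real pi * \<i> * (of_int k * \<tau> + of_int l)" by (auto simp: period_lattice_def)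
    have "norm (of_int k * \<tau> + of_int l) \<ge> min (Im \<tau>) 1"
    proof (cases "k = 0")
     case True
     hence "\<bar>l\<bar> \<ge> 1" using x kl by (cases "l = 0") auto
     hence "norm (of_int l :: complex) \<ge> 1" by simp
     thus ?thesis using True by simp
    next
     case False
     hence "\<bar>k\<bar> \<ge> 1" by linarith
     hence "\<bar>of_int k :: real\<bar> \<ge> 1" by linarith
     hence "Im \<tau> \<le> \<bar>of_int k * Im \<tau>\<bar>" using tau by (simp add: abs_mult)
     also have "\<dots> = \<bar>Im (of_int k * \<tau> + of_int l)\<bar>" by simp
     also have "\<dots> \<le> norm (of_int k * \<tau> + of_int l)" by (rule abs_Im_le_cmod)
     finally show ?thesis by simp
    qed
    hence "pi * min (Im \<tau>) 1 \<le> norm x" unfolding kl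
     using mult_left_mono[of "min (Im \<tau>) 1" "norm (of_int k * \<tau> + of_int l)" pi] pi_gt_zero
     by (simp add: norm_mult) (smt (verit) norm_ge_zero mult_nonneg_nonneg)
    thus "x \<in> - ball 0 (pi * min (Im \<tau>) 1)" by simp
   next
    fix x assume "x \<in> ?L \<inter> - ball 0 (pi * min (Im \<tau>) 1)"
    thus "x \<in> ?L - {0}" using tau by auto
   qed
   thus ?thesis using period_lattice_closed[OF tau] by (simp add: closed_Int closed_Compl)
  qed
  hence "open U" unfolding U_def by (rule open_Compl)
  moreover have "0 \<in> U" by (simp add: U_def)
  ultimately obtain e where "e > 0" "ball 0 e \<subseteq> U" unfolding open_contains_ball by blast
  thus ?thesis by (intro that[of e]) (auto simp: U_def)
 qed
 have f: "?C ?f"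
 proof (intro conjI)
  have "?h holomorphic_on (- ?L)" by (intro holomorphic_intros holomorphic_higher_deriv[OF holomorphic_P1g op])
  thus "?f holomorphic_on (- ?L)" by (rule holomorphic_transform) auto
  show "\<forall>w\<in>?L. ?f w = 0" by simp
  show "\<exists>r>0. \<forall>w\<in>ball 0 r - \<real>\<^sub>\<le>\<^sub>0. ?f w = (- 1) ^ n / fact (n - 1) * (deriv ^^ n) (\<lambda>x. P0_fun x \<tau>) w"
  proof (intro exI conjI ballI)
   show "min r e > 0" using r e by simp
   fix w :: complex assume w: "w \<in> ball 0 (min r e) - \<real>\<^sub>\<le>\<^sub>0"
   hence wL: "w \<notin> ?L" using e by auto
   let ?S = "(ball 0 r - \<real>\<^sub>\<le>\<^sub>0) \<inter> - ?L"
   have S: "open ?S" "w \<in> ?S" using w wL by (intro open_Int open_Diff open_ball cl op, simp)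
   have "(deriv ^^ n) (\<lambda>x. P0_fun x \<tau>) w = (deriv ^^ (n - 1)) (deriv (\<lambda>x. P0_fun x \<tau>)) w"
    using n by (cases n) (simp_all add: funpow_Suc_right del: funpow.simps)
   also have "\<dots> = (deriv ^^ (n - 1)) (\<lambda>x. - P1g x) w"
    by (rule higher_deriv_cong_ev[OF eventually_mono[OF eventually_nhds_in_open[OF S]] refl]) (use r in auto)
   also have "\<dots> = - (deriv ^^ (n - 1)) P1g w" by (rule higher_deriv_uminus[OF holomorphic_P1g op]) (use wL in simp)
   finally show "?f w = (- 1) ^ n / fact (n - 1) * (deriv ^^ n) (\<lambda>x. P0_fun x \<tau>) w" using n wL by (cases n) simp_all
  qed
 qed
 have "(THE f. ?C f) = ?f"
 proof (rule the_equality)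
  show "?C ?f" by (rule f)
 next
  fix g assume g: "?C g"
  then obtain r1 where r1: "r1 > 0" "\<And>w. w \<in> ball 0 r1 - \<real>\<^sub>\<le>\<^sub>0 ==> g w = (- 1) ^ n / fact (n - 1) * (deriv ^^ n) (\<lambda>x. P0_fun x \<tau>) w"
   by blast
  from f obtain r2 where r2: "r2 > 0" "\<And>w. w \<in> ball 0 r2 - \<real>\<^sub>\<le>\<^sub>0 ==> ?f w = (- 1) ^ n / fact (n - 1) * (deriv ^^ n) (\<lambda>x. P0_fun x \<tau>) w"
   by blast
  let ?S = "(ball 0 (min r1 r2) - \<real>\<^sub>\<le>\<^sub>0) \<inter> - ?L"
  define t where "t = min (min r1 r2) e / 2"
  have t: "t > 0" "t < r1" "t < r2" "t < e" using r1 r2 e by (auto simp: t_def)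
  have "of_real t \<notin> (\<real>\<^sub>\<le>\<^sub>0 :: complex set)" using t by (simp add: complex_nonpos_Reals_iff)
  moreover have "of_real t \<notin> ?L"
  proof
   assume "of_real t \<in> ?L"
   moreover have "(of_real t :: complex) \<in> ball 0 e" using t by simp
   ultimately have "(of_real t :: complex) = 0" using e(2) by blast
   thus False using t(1) by simp
  qed
  ultimately have "of_real t \<in> ?S" using t by simp
  hence ne: "?S \<noteq> {}" by blast
  have oS: "open ?S" by (intro open_Int open_Diff open_ball cl op)
  have eq: "g w = ?f w" if "w \<in> - ?L" for w
  proof (rule analytic_continuation_open[OF oS op ne conn, where f = g and g = "?f"])
   show "?S \<subseteq> - ?L" by (rule Int_lower2)
   show "g holomorphic_on (- ?L)" by (rule g[THEN conjunct1])
   show "?f holomorphic_on (- ?L)" by (rule f[THEN conjunct1])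
   show "g v = ?f v" if "v \<in> ?S" for v
   proof -
    have v: "v \<in> ball 0 r1 - \<real>\<^sub>\<le>\<^sub>0" "v \<in> ball 0 r2 - \<real>\<^sub>\<le>\<^sub>0" using that by auto
    show ?thesis unfolding r1(2)[OF v(1)] by (rule r2(2)[OF v(2), symmetric])
   qed
   show "w \<in> - ?L" by (rule that)
  qed
  show "g = ?f"
  proof (rule ext)
   fix w
   show "g w = ?f w"
   proof (cases "w \<in> ?L")
    case True
    hence "g w = 0" using g by blast
    thus ?thesis using True by simp
   next
    case False
    thus ?thesis by (intro eq) simp
   qed
  qed
 qed
 thus ?thesis unfolding P_fun_def using z by simp
qed

lemma annulus_not_pole:
 assumes "1 < norm (exp z)" "norm (nom \<tau>) * norm (exp z) < 1"
 shows "z \<notin> period_lattice \<tau>" "- z \<notin> period_lattice \<tau>"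
proof -
 let ?q = "nom \<tau>"
 have "w \<notin> poles" if w: "norm ?q < norm (exp w)" "norm ?q * norm (exp w) < 1" "norm (exp w) \<noteq> 1" for w
 proof
  assume "w \<in> poles"
  then consider "exp w = 1" | m where "?q ^ Suc m * exp w = 1" | m where "?q ^ Suc m * exp (- w) = 1" unfolding poles_def by blast
  thus False
  proof cases
   case 1
   hence "norm (exp w) = norm (1 :: complex)" by (rule arg_cong)
   thus ?thesis using w(3) by simp
  next
   case 2
   have "norm (?q ^ Suc m * exp w) \<le> norm ?q * norm (exp w)" unfolding norm_mult by (intro mult_right_mono norm_q_power(2)) auto
   thus ?thesis using w(2) unfolding 2 by simp
  next
   case 3
   have "?q ^ Suc m = ?q ^ Suc m * exp (- w) * exp w" by (simp add: exp_minus)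
   hence "exp w = ?q ^ Suc m" unfolding 3 by (simp only: mult_1_left)
   thus ?thesis using w(1) norm_q_power(2)[of "Suc m"] by simp
  qed
 qed note * = this
 have q1: "norm ?q < 1" by (rule q_less)
 show "z \<notin> period_lattice \<tau>" using *[of z] assms q1 unfolding poles_eq by linarith
 have "norm (exp (- z)) < 1" using assms(1) by simp
 moreover have "norm ?q < norm (exp (- z))"
 proof -
  have "norm ?q * norm (exp z) * norm (exp (- z)) < 1 * norm (exp (- z))" using assms(2) by (intro mult_strict_right_mono) auto
  moreover have "norm (exp z) * norm (exp (- z)) = 1" by (simp add: exp_minus_inverse flip: norm_mult)
  ultimately show ?thesis by (simp only: mult.assoc mult_1_left mult_1_right)
 qed
 moreover have "norm ?q * norm (exp (- z)) < 1" using calculation(1) q1 by (metis mult.right_neutral mult_strict_mono' norm_ge_zero)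
 ultimately show "- z \<notin> period_lattice \<tau>" using *[of "- z"] unfolding poles_eq by linarith
qed

lemma P_fun_odd:
 assumes "n \<ge> 1" "1 < norm (exp z)" "norm (nom \<tau>) * norm (exp z) < 1"
 shows "P_fun n (- z) \<tau> = (- 1) ^ n * P_fun n z \<tau>"
 unfolding P_fun_eq[OF assms(1) annulus_not_pole(1)[OF assms(2,3)]] P_fun_eq[OF assms(1) annulus_not_pole(2)[OF assms(2,3)]]
  higher_deriv_P1g_odd[OF assms(2,3)] using assms(1) by (cases n) simp_all

lemma P_fun_series:
 assumes "n \<ge> 1" "1 < norm (exp z)" "norm (nom \<tau>) * norm (exp z) < 1"
 defines "a \<equiv> \<lambda>k. of_nat k ^ (n - 1) / (1 - nom \<tau> ^ k) * exp (- z) ^ k"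
  and "b \<equiv> \<lambda>k. of_nat k ^ (n - 1) * nom \<tau> ^ k / (1 - nom \<tau> ^ k) * exp z ^ k"
 shows "P_fun n z \<tau> = (- 1) ^ (n - 1) / fact (n - 1) *
   ((if n = 1 then 1 / 2 else 0) + (- 1) ^ (n - 1) * infsum a {1..} - infsum b {1..})"
  "(\<lambda>k. norm (a k)) summable_on {1..}" "(\<lambda>k. norm (b k)) summable_on {1..}"
proof -
 let ?q = "nom \<tau>"
 have n: "norm (exp (- z)) < 1" using assms(2) by simp
 have cA: "ereal (norm (exp (- z))) < fps_conv_radius ((theta ^^ (n - 1)) A_fps)"
  by (rule less_le_trans[OF conv_cond_A[OF n] conv_radius_theta_power])
 have cB: "ereal (norm (exp z)) < fps_conv_radius ((theta ^^ (n - 1)) B_fps)"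
  by (rule less_le_trans[OF conv_cond_B[OF assms(3)] conv_radius_theta_power])
 have a: "fps_nth ((theta ^^ (n - 1)) A_fps) k * exp (- z) ^ k = a k" if "k \<in> {1..}" for k
  using that by (simp add: theta_power_nth A_fps_def a_def)
 have b: "fps_nth ((theta ^^ (n - 1)) B_fps) k * exp z ^ k = b k" if "k \<in> {1..}" for k using that by (simp add: theta_power_nth B_fps_def b_def)
 have "(\<lambda>k. norm (fps_nth ((theta ^^ (n - 1)) A_fps) k * exp (- z) ^ k)) summable_on {1..}" by (rule eval_fps_infsum(2)[OF cA theta_A0(1)])
 thus "(\<lambda>k. norm (a k)) summable_on {1..}" by (subst summable_on_cong[OF arg_cong[of _ _ norm]]) (erule a[symmetric], assumption)
 have "(\<lambda>k. norm (fps_nth ((theta ^^ (n - 1)) B_fps) k * exp z ^ k)) summable_on {1..}" by (rule eval_fps_infsum(2)[OF cB theta_A0(2)])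
 thus "(\<lambda>k. norm (b k)) summable_on {1..}" by (subst summable_on_cong[OF arg_cong[of _ _ norm]]) (erule b[symmetric], assumption)
 have ea: "eval_fps ((theta ^^ (n - 1)) A_fps) (exp (- z)) = infsum a {1..}"
  unfolding eval_fps_infsum(1)[OF cA theta_A0(1)] by (rule infsum_cong) (rule a)
 have eb: "eval_fps ((theta ^^ (n - 1)) B_fps) (exp z) = infsum b {1..}"
  unfolding eval_fps_infsum(1)[OF cB theta_A0(2)] by (rule infsum_cong) (rule b)
 have "n - 1 = 0 \<longleftrightarrow> n = 1" using assms(1) by auto
 thus "P_fun n z \<tau> = (- 1) ^ (n - 1) / fact (n - 1) *
   ((if n = 1 then 1 / 2 else 0) + (- 1) ^ (n - 1) * infsum a {1..} - infsum b {1..})"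
  unfolding P_fun_eq[OF assms(1) annulus_not_pole(1)[OF assms(2,3)]] higher_deriv_P1g_right[OF assms(2,3)] ea eb by simp
qed

lemma E_fun_series:
 assumes "k \<ge> 1"
 shows "E_fun k \<tau> = (if odd k then 0 else - bern_exp k + 2 / fact (k - 1) *
  (\<Sum>\<^sub>\<infinity>j\<in>{1..}. of_nat j ^ (k - 1) * nom \<tau> ^ j / (1 - nom \<tau> ^ j)))"
  "(\<lambda>j. norm (of_nat j ^ (k - 1) * nom \<tau> ^ j / (1 - nom \<tau> ^ j))) summable_on {1..}"
proof -
 let ?q = "nom \<tau>"
 have c: "ereal (norm (1 :: complex)) < fps_conv_radius ((theta ^^ (k - 1)) B_fps)"
  by (rule less_le_trans[OF conv_cond_B conv_radius_theta_power]) (use q_less in simp)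
 have b: "fps_nth ((theta ^^ (k - 1)) B_fps) j * 1 ^ j = of_nat j ^ (k - 1) * ?q ^ j / (1 - ?q ^ j)" if "j \<in> {1..}" for j
  using that by (simp add: theta_power_nth B_fps_def)
 have "(\<lambda>j. norm (fps_nth ((theta ^^ (k - 1)) B_fps) j * 1 ^ j)) summable_on {1..}" by (rule eval_fps_infsum(2)[OF c theta_A0(2)])
 thus "(\<lambda>j. norm (of_nat j ^ (k - 1) * ?q ^ j / (1 - ?q ^ j))) summable_on {1..}"
  by (subst summable_on_cong[OF arg_cong[of _ _ norm]]) (erule b[symmetric], assumption)
 have "(\<Sum>\<^sub>\<infinity>N\<in>{1..}. of_nat (sigma (k - 1) N) * ?q ^ N) = eval_fps ((theta ^^ (k - 1)) B_fps) 1"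
  by (rule eval_theta_B_1[symmetric])
 also have "\<dots> = (\<Sum>\<^sub>\<infinity>j\<in>{1..}. of_nat j ^ (k - 1) * ?q ^ j / (1 - ?q ^ j))"
  unfolding eval_fps_infsum(1)[OF c theta_A0(2)] by (rule infsum_cong) (rule b)
 finally show "E_fun k \<tau> = (if odd k then 0 else - bern_exp k + 2 / fact (k - 1) * (\<Sum>\<^sub>\<infinity>j\<in>{1..}. of_nat j ^ (k - 1) * ?q ^ j / (1 - ?q ^ j)))"
  by (simp only: E_fun_def minus_divide_left[symmetric] bernoulli_eq)
qed

end

section \<open>Summability of products and traces\<close>

definition Idx :: "nat multiset set" where "Idx = {\<mu>. 0 \<notin># \<mu>}"

lemma Idx_simps [simp]:
 "{#} \<in> Idx" "add_mset k \<mu> \<in> Idx \<longleftrightarrow> k > 0 \<and> \<mu> \<in> Idx" "\<mu> \<in> Idx ==> \<mu> - {#j#} \<in> Idx"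
 by (auto simp: Idx_def dest: in_diffD)

lemma Idx_pos: "\<mu> \<in> Idx ==> j \<in># \<mu> ==> j > 0" by (cases j) (auto simp: Idx_def)

definition nsq :: "nat multiset => real" where
 "nsq \<mu> = (\<Prod>n\<in>set_mset \<mu>. real n ^ count \<mu> n * fact (count \<mu> n))"

text \<open>The norm of the vector \<open>a(-n\<^sub>1) \<dots> a(-n\<^sub>k) \<one>\<close> for the contravariant Hermitian form.\<close>

definition wgt :: "nat multiset => real" where "wgt \<mu> = sqrt (nsq \<mu>)"

abbreviation (input) wr :: "real => nat multiset => real" where "wr r \<mu> \<equiv> wgt \<mu> * r ^ deg \<mu>"

lemma nsq_superset:
 assumes "finite S" "set_mset \<mu> \<subseteq> S"
 shows "nsq \<mu> = (\<Prod>n\<in>S. real n ^ count \<mu> n * fact (count \<mu> n))"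
 unfolding nsq_def by (rule prod.mono_neutral_left) (use assms in \<open>auto simp: not_in_iff\<close>)

lemma nsq_pos: "\<mu> \<in> Idx ==> nsq \<mu> > 0" unfolding nsq_def by (intro prod_pos) (auto dest: Idx_pos)

lemma wgt_pos [simp]: "\<mu> \<in> Idx ==> wgt \<mu> > 0" by (simp add: wgt_def nsq_pos)

lemma nsq_add: "nsq (add_mset k \<mu>) = nsq \<mu> * (real k * real (Suc (count \<mu> k)))"
proof -
 let ?S = "insert k (set_mset \<mu>)"
 have "nsq (add_mset k \<mu>) = (\<Prod>n\<in>?S. real n ^ count (add_mset k \<mu>) n * fact (count (add_mset k \<mu>) n))"
  by (rule nsq_superset) auto
 also have "\<dots> = (real k ^ Suc (count \<mu> k) * fact (Suc (count \<mu> k))) * (\<Prod>n\<in>?S - {k}. real n ^ count \<mu> n * fact (count \<mu> n))"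
  by (subst prod.remove[of _ k]) (auto intro!: prod.cong)
 also have "\<dots> = (real k * real (Suc (count \<mu> k))) * ((real k ^ count \<mu> k * fact (count \<mu> k)) * (\<Prod>n\<in>?S - {k}. real n ^ count \<mu> n * fact (count \<mu> n)))"
  by simp
 also have "(real k ^ count \<mu> k * fact (count \<mu> k)) * (\<Prod>n\<in>?S - {k}. real n ^ count \<mu> n * fact (count \<mu> n)) = nsq \<mu>"
  by (subst nsq_superset[of ?S]) (auto simp: prod.remove[of ?S k])
 finally show ?thesis by simp
qed

lemma wgt_add: "wgt (add_mset k \<mu>) = wgt \<mu> * sqrt (real k * real (Suc (count \<mu> k)))" by (simp only: wgt_def nsq_add real_sqrt_mult)

lemma count_le_sum: "k * count \<mu> k \<le> deg (\<mu> :: nat multiset)" by (induction \<mu>) auto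

lemma sqrt_le_degree: "sqrt (real k * real (Suc (count \<mu> k))) \<le> 1 + real (deg (add_mset k \<mu>))"
proof -
 have "k * Suc (count \<mu> k) \<le> deg (add_mset k \<mu>)" using count_le_sum[of k "add_mset k \<mu>"] by simp
 hence le: "real k * real (Suc (count \<mu> k)) \<le> real (deg (add_mset k \<mu>))" by (simp only: of_nat_mult[symmetric] of_nat_le_iff)
 have sq: "d \<le> (1 + d)\<^sup>2" if "d \<ge> 0" for d :: real using that by (simp add: power2_eq_square algebra_simps)
 have "real k * real (Suc (count \<mu> k)) \<le> (1 + real (deg (add_mset k \<mu>)))\<^sup>2" by (rule order_trans[OF le sq[OF of_nat_0_le_iff]])
 thus ?thesis by (rule real_le_lsqrt[rotated]) (rule add_nonneg_nonneg[OF zero_le_one of_nat_0_le_iff])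
qed

lemma card_set_mset_le: "\<mu> \<in> Idx ==> card (set_mset \<mu>) \<le> deg \<mu>"
proof (induction \<mu>)
 case (add k \<mu>)
 have "card (set_mset (add_mset k \<mu>)) \<le> Suc (card (set_mset \<mu>))" by (simp add: card_insert_if)
 thus ?case using add by (auto simp: Suc_le_eq intro: order_trans)
qed simp

lemma poly_geometric_bound:
 assumes "0 \<le> \<theta>" "\<theta> < 1"
 shows "\<exists>C>0. \<forall>n. (1 + real n) ^ m * \<theta> ^ n \<le> C"
proof -
 have "(\<lambda>n. (1 + real n) ^ m * \<theta> ^ n) \<longlonglongrightarrow> 0"
 proof (cases "\<theta> = 0")
  case True
  have "eventually (\<lambda>n. (1 + real n) ^ m * \<theta> ^ n = 0) sequentially"
   using eventually_gt_at_top[of 0] by eventually_elim (use True in simp)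
  thus ?thesis by (rule tendsto_eventually)
 next
  case False
  with assms show ?thesis by real_asymp
 qed
 hence "Bseq (\<lambda>n. (1 + real n) ^ m * \<theta> ^ n)" using convergent_imp_Bseq convergentI by blast
 then obtain K where "K > 0" "\<forall>n. norm ((1 + real n) ^ m * \<theta> ^ n) \<le> K" by (rule BseqE)
 thus ?thesis using assms by (auto simp: abs_mult)
qed

lemma finite_Idx_sum_bound:
 fixes t :: real
 assumes t: "0 \<le> t" "t < 1" and F: "finite F" "F \<subseteq> Idx"
 shows "(\<Sum>\<mu>\<in>F. t ^ deg \<mu>) \<le> exp (t / (1 - t) ^ 2)"
proof -
 define N where "N = Max (insert 0 (sum_mset ` F))"
 have N: "deg \<mu> \<le> N" if "\<mu> \<in> F" for \<mu> unfolding N_def using F that by (intro Max_ge) auto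
 let ?P = "PiE {1..N} (\<lambda>_. {..N})"
 let ?g = "\<lambda>\<mu>. restrict (count \<mu>) {1..N}"
 have el: "set_mset \<mu> \<subseteq> {1..N}" if "\<mu> \<in> F" for \<mu>
 proof
  fix k assume "k \<in># \<mu>"
  hence "k \<le> deg \<mu>" by (auto dest!: multi_member_split)
  thus "k \<in> {1..N}" using N[OF that] Idx_pos[OF _ \<open>k \<in># \<mu>\<close>] F that by (auto simp: Suc_le_eq)
 qed
 have inj: "inj_on ?g F"
 proof (rule inj_onI, rule multiset_eqI)
  fix \<mu> \<nu> n assume *: "\<mu> \<in> F" "\<nu> \<in> F" "?g \<mu> = ?g \<nu>"
  show "count \<mu> n = count \<nu> n"
  proof (cases "n \<in> {1..N}")
   case True
   thus ?thesis using fun_cong[OF *(3), of n] by simp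
  next
   case False
   hence "n \<notin># \<mu>" "n \<notin># \<nu>" using el * by blast+
   thus ?thesis by (simp add: not_in_iff)
  qed
 qed
 have im: "?g ` F \<subseteq> ?P"
 proof (rule image_subsetI)
  fix \<mu> assume \<mu>: "\<mu> \<in> F"
  have "count \<mu> n \<le> N" if "n \<in> {1..N}" for n
  proof -
   have "count \<mu> n \<le> n * count \<mu> n" using that by simp
   also have "\<dots> \<le> N" using count_le_sum[of n \<mu>] N[OF \<mu>] by linarith
   finally show ?thesis .
  qed
  thus "?g \<mu> \<in> ?P" by auto
 qed
 have deg: "t ^ deg \<mu> = (\<Prod>n\<in>{1..N}. t ^ (n * ?g \<mu> n))" if "\<mu> \<in> F" for \<mu>
 proof -
  have "deg \<mu> = (\<Sum>n\<in>{1..N}. count \<mu> n * n)"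
   unfolding sum_mset_eq_sum_count by (rule sum.mono_neutral_left) (use el[OF that] in \<open>auto simp: not_in_iff\<close>)
  also have "\<dots> = (\<Sum>n\<in>{1..N}. n * ?g \<mu> n)" by (rule sum.cong) auto
  finally show ?thesis by (simp add: power_sum)
 qed
 have "(\<Sum>\<mu>\<in>F. t ^ deg \<mu>) = (\<Sum>g\<in>?g ` F. \<Prod>n\<in>{1..N}. t ^ (n * g n))"
  by (subst sum.reindex[OF inj]) (auto simp: deg intro!: sum.cong)
 also have "\<dots> \<le> (\<Sum>g\<in>?P. \<Prod>n\<in>{1..N}. t ^ (n * g n))" using im t by (intro sum_mono2) (auto intro!: finite_PiE prod_nonneg)
 also have "\<dots> = (\<Prod>n\<in>{1..N}. \<Sum>b\<in>{..N}. t ^ (n * b))" by (rule prod_sum_PiE[symmetric]) auto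
 also have "\<dots> \<le> (\<Prod>n\<in>{1..N}. exp (t ^ n / (1 - t)))"
 proof (rule prod_mono, intro conjI)
  fix n assume n: "n \<in> {1..N}"
  show "0 \<le> (\<Sum>b\<in>{..N}. t ^ (n * b))" using t by (intro sum_nonneg) auto
  have tn: "0 \<le> t ^ n" "t ^ n \<le> t" using t n power_decreasing[of 1 n t] by auto
  have "(\<Sum>b\<in>{..N}. t ^ (n * b)) = (\<Sum>b<Suc N. (t ^ n) ^ b)" by (simp add: power_mult lessThan_Suc_atMost)
  also have "\<dots> \<le> suminf (\<lambda>b. (t ^ n) ^ b)" using tn t by (intro sum_le_suminf summable_geometric) auto
  also have "\<dots> = 1 / (1 - t ^ n)" using tn t by (intro suminf_geometric) auto
  also have "\<dots> = 1 + t ^ n / (1 - t ^ n)" using tn t by (simp add: field_simps)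
  also have "\<dots> \<le> 1 + t ^ n / (1 - t)" using tn t by (intro add_left_mono divide_left_mono mult_pos_pos) auto
  also have "\<dots> \<le> exp (t ^ n / (1 - t))" by (rule exp_ge_add_one_self)
  finally show "(\<Sum>b\<in>{..N}. t ^ (n * b)) \<le> exp (t ^ n / (1 - t))" .
 qed
 also have "\<dots> = exp (\<Sum>n\<in>{1..N}. t ^ n / (1 - t))" by (simp add: exp_sum)
 also have "\<dots> \<le> exp (t / (1 - t) ^ 2)"
 proof -
  have "(\<Sum>n\<in>{1..N}. t ^ n) = t * (\<Sum>n<N. t ^ n)"
   unfolding sum_distrib_left by (rule sum.reindex_bij_witness[where i = Suc and j = "\<lambda>n. n - 1"]) (auto simp flip: power_Suc)
  also have "\<dots> \<le> t * suminf (\<lambda>n. t ^ n)" using t by (intro mult_left_mono sum_le_suminf summable_geometric) auto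
  also have "\<dots> = t / (1 - t)" using t by (simp add: suminf_geometric)
  finally have "(\<Sum>n\<in>{1..N}. t ^ n) / (1 - t) \<le> t / (1 - t) / (1 - t)" using t by (intro divide_right_mono) auto
  thus ?thesis by (simp add: sum_divide_distrib power2_eq_square)
 qed
 finally show ?thesis .
qed

lemma summable_Idx:
 fixes t :: real
 assumes "0 \<le> t" "t < 1"
 shows "(\<lambda>\<mu>. t ^ deg \<mu>) summable_on Idx"
proof (rule nonneg_bdd_above_summable_on)
 show "bdd_above (sum (\<lambda>\<mu>. t ^ deg \<mu>) ` {F. F \<subseteq> Idx \<and> finite F})"
  by (rule bdd_aboveI2[of _ _ "exp (t / (1 - t) ^ 2)"]) (use finite_Idx_sum_bound[OF assms] in auto)
qed (use assms in auto)

definition bnd :: "fock_matrix => real => real => real => bool" where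
 "bnd A r s C \<longleftrightarrow> C \<ge> 0 \<and> (\<forall>\<mu>\<in>Idx. \<forall>\<xi>\<in>Idx. norm (A \<mu> \<xi>) * wr r \<mu> \<le> C * wr s \<xi>)"

text \<open>Pointwise bounds suffice for the summability of products and traces, because
 the partition generating function converges.\<close>

definition tame :: "fock_matrix => real => real => bool" where
 "tame A x y \<longleftrightarrow> 0 < x \<and> 0 < y \<and> (\<forall>r s. 0 < r \<longrightarrow> r < x \<longrightarrow> y < s \<longrightarrow> (\<exists>C. bnd A r s C))"

lemma tameD: "tame A x y ==> 0 < r ==> r < x ==> y < s ==> \<exists>C. bnd A r s C"
 by (simp add: tame_def)

lemma tame_mono: "tame A x y ==> 0 < x' ==> x' \<le> x ==> y \<le> y' ==> tame A x' y'"
 unfolding tame_def by (metis dual_order.strict_trans1 dual_order.strict_trans2)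

lemma bnd_add:
 assumes "bnd A r s C" "bnd B r s D" "r > 0"
 shows "bnd (\<lambda>\<mu> \<xi>. A \<mu> \<xi> + B \<mu> \<xi>) r s (C + D)" unfolding bnd_def
proof (intro conjI ballI)
 show "C + D \<ge> 0" using assms by (simp add: bnd_def)
 fix \<mu> \<xi> assume *: "\<mu> \<in> Idx" "\<xi> \<in> Idx"
 have "norm (A \<mu> \<xi> + B \<mu> \<xi>) * wr r \<mu> \<le> (norm (A \<mu> \<xi>) + norm (B \<mu> \<xi>)) * wr r \<mu>"
  using assms(3) * by (intro mult_right_mono norm_triangle_ineq mult_nonneg_nonneg) (auto intro: less_imp_le)
 also have "\<dots> \<le> C * wr s \<xi> + D * wr s \<xi>" unfolding distrib_right using assms * by (intro add_mono) (auto simp: bnd_def)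
 finally show "norm (A \<mu> \<xi> + B \<mu> \<xi>) * wr r \<mu> \<le> (C + D) * wr s \<xi>" by (simp add: distrib_right)
qed

lemma tameI: "0 < x ==> 0 < y ==> (\<And>r s. 0 < r ==> r < x ==> y < s ==> \<exists>C. bnd A r s C) ==> tame A x y"
 by (simp add: tame_def)

lemma tame_pos: "tame A x y ==> 0 < x" "tame A x y ==> 0 < y" by (simp_all add: tame_def)

lemma tame_add:
 assumes "tame A x y" "tame B x y"
 shows "tame (\<lambda>\<mu> \<xi>. A \<mu> \<xi> + B \<mu> \<xi>) x y"
proof (rule tameI)
 fix r s assume rs: "0 < r" "r < x" "y < s"
 obtain C D where "bnd A r s C" "bnd B r s D" using tameD[OF assms(1) rs] tameD[OF assms(2) rs] by blast
 thus "\<exists>C. bnd (\<lambda>\<mu> \<xi>. A \<mu> \<xi> + B \<mu> \<xi>) r s C" using bnd_add rs(1) by (intro exI)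
qed (use assms(1) in \<open>simp_all add: tame_def\<close>)

lemma bnd_scale: "bnd A r s C ==> bnd (\<lambda>\<mu> \<xi>. c * A \<mu> \<xi>) r s (norm c * C)"
 unfolding bnd_def by (auto simp: norm_mult mult.assoc intro!: mult_left_mono)

lemma tame_scale:
 assumes "tame A x y"
 shows "tame (\<lambda>\<mu> \<xi>. c * A \<mu> \<xi>) x y"
proof (rule tameI)
 fix r s assume rs: "0 < r" "r < x" "y < s"
 obtain C where "bnd A r s C" using tameD[OF assms rs] by blast
 thus "\<exists>C. bnd (\<lambda>\<mu> \<xi>. c * A \<mu> \<xi>) r s C" by (intro exI) (rule bnd_scale)
qed (use assms in \<open>simp_all add: tame_def\<close>)

lemma tame_zero: "0 < x ==> 0 < y ==> tame (\<lambda>\<mu> \<xi>. 0) x y"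
 unfolding tame_def bnd_def by (auto intro!: exI[of _ 0])

lemma tame_sum: "0 < x ==> 0 < y ==> (\<And>i. i \<in> S ==> tame (A i) x y) ==> tame (\<lambda>\<mu> \<xi>. \<Sum>i\<in>S. A i \<mu> \<xi>) x y"
 by (induction S rule: infinite_finite_induct) (auto intro: tame_add tame_zero)

lemma tame_le:
 assumes "tame B x y" "\<And>\<mu> \<xi>. \<mu> \<in> Idx ==> \<xi> \<in> Idx ==> norm (A \<mu> \<xi>) \<le> norm (B \<mu> \<xi>)"
 shows "tame A x y" unfolding tame_def
proof (intro conjI allI impI)
 fix r s assume rs: "0 < r" "r < x" "y < s"
 then obtain C where C: "bnd B r s C" using tameD[OF assms(1)] by blast
 have "bnd A r s C" unfolding bnd_def
 proof (intro conjI ballI)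
  fix \<mu> \<xi> assume *: "\<mu> \<in> Idx" "\<xi> \<in> Idx"
  have "norm (A \<mu> \<xi>) * wr r \<mu> \<le> norm (B \<mu> \<xi>) * wr r \<mu>"
   using assms(2) * rs by (intro mult_right_mono mult_nonneg_nonneg) (auto intro: less_imp_le)
  also have "\<dots> \<le> C * wr s \<xi>" using C * by (simp add: bnd_def)
  finally show "norm (A \<mu> \<xi>) * wr r \<mu> \<le> C * wr s \<xi>" .
 qed (use C in \<open>simp add: bnd_def\<close>)
 thus "\<exists>C. bnd A r s C" by blast
qed (use assms(1) in \<open>auto simp: tame_def\<close>)

lemma power_fact_le:
 fixes Z :: real assumes "Z \<ge> 0"
 shows "Z ^ u / fact u \<le> exp (4 * Z) / 4 ^ u"
proof -
 have "(4 * Z) ^ u / fact u \<le> exp (4 * Z)"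
 proof -
  have s: "(\<lambda>n. (4 * Z) ^ n /\<^sub>R fact n) sums exp (4 * Z)" by (rule exp_converges)
  have "(\<Sum>n\<in>{u}. (4 * Z) ^ n /\<^sub>R fact n) \<le> suminf (\<lambda>n. (4 * Z) ^ n /\<^sub>R fact n)"
   using assms by (intro sum_le_suminf sums_summable[OF s]) auto
  thus ?thesis using sums_unique[OF s] by (simp add: field_simps)
 qed
 thus ?thesis by (simp add: power_mult_distrib field_simps)
qed

lemma exp_coeff_eq:
 "exp_coeff x n b c = (\<Sum>j\<le>b. (x / of_nat n) ^ (b - j) / fact (b - j) * (of_nat (c choose j) * (- x) ^ (c - j)))"
proof -
 have "fps_nth ((fps_X + fps_const y) ^ c) j = (of_nat (c choose j) * y ^ (c - j) :: complex)" for y j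
 proof (induction c arbitrary: j)
  case (Suc c)
  have "fps_nth ((fps_X + fps_const y) ^ Suc c) j =
    (if j = 0 then 0 else fps_nth ((fps_X + fps_const y) ^ c) (j - 1)) + y * fps_nth ((fps_X + fps_const y) ^ c) j" by (simp add: distrib_right)
  also have "\<dots> = of_nat (Suc c choose j) * y ^ (Suc c - j)"
  proof (cases j)
   case (Suc i)
   have "y * (of_nat (c choose Suc i) * y ^ (c - Suc i)) = of_nat (c choose Suc i) * y ^ (c - i)"
    by (cases "i < c") (simp_all add: binomial_eq_0 Suc_diff_Suc flip: power_Suc)
   thus ?thesis by (simp add: Suc Suc.IH algebra_simps)
  qed (simp add: Suc.IH)
  finally show ?case .
 qed (auto simp: fps_one_nth)
 note nth = this
 have "fps_X - fps_const x = fps_X + fps_const (- x)" by (simp add: fps_eq_iff)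
 hence "fps_nth ((fps_X - fps_const x) ^ c) j = of_nat (c choose j) * (- x) ^ (c - j)" for j by (simp only: nth)
 thus ?thesis unfolding exp_coeff_def mult.commute[of "fps_exp _"] fps_mult_nth atLeast0AtMost
  by (intro sum.cong refl) (simp only: fps_exp_nth mult.commute of_nat_fact)
qed

lemma binomial_le_power:
 fixes \<epsilon> :: real assumes "\<epsilon> > 0"
 shows "real (b choose u) * \<epsilon> ^ u \<le> (1 + \<epsilon>) ^ b"
proof (cases "u \<le> b")
 case True
 have "(\<Sum>k\<in>{u}. real (b choose k) * \<epsilon> ^ k * 1 ^ (b - k)) \<le> (\<Sum>k\<le>b. real (b choose k) * \<epsilon> ^ k * 1 ^ (b - k))"
  using assms True by (intro sum_mono2) auto
 also have "\<dots> = (1 + \<epsilon>) ^ b" unfolding add.commute[of 1] binomial_ring ..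
 finally show ?thesis by simp
next
 case False
 thus ?thesis using assms by (simp add: binomial_eq_0)
qed

lemma exp_coeff_bound:
 assumes "R > 1" "n > 0" and Z: "Z = (norm x)\<^sup>2 / (R\<^sup>2 - 1)"
 shows "norm (exp_coeff x n b c) * sqrt (real n ^ b * fact b) \<le> 2 * exp (4 * Z) * R ^ (b + c) * sqrt (real n ^ c * fact c)"
proof -
 define \<epsilon> where "\<epsilon> = R\<^sup>2 - 1"
 have e: "\<epsilon> > 0" using assms(1) by (simp add: \<epsilon>_def power2_eq_square less_1_mult)
 have Z0: "Z \<ge> 0" using e by (simp add: Z \<epsilon>_def)
 define X where "X = norm x"
 have X: "X \<ge> 0" "X\<^sup>2 = Z * \<epsilon>" using e by (simp_all add: X_def Z \<epsilon>_def)
 have R2: "R\<^sup>2 = 1 + \<epsilon>" by (simp add: \<epsilon>_def)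
 define K where "K = exp (4 * Z)"
 have K: "K \<ge> 1" "K > 0" using Z0 by (simp_all add: K_def)
 let ?Q = "R ^ (b + c) * sqrt (real n ^ c * fact c)"
 define t where "t = (\<lambda>j. (X / real n) ^ (b - j) / fact (b - j) * (real (c choose j) * X ^ (c - j)))"
 have tm: "t j * sqrt (real n ^ b * fact b) \<le> K * (1 / 2) ^ (b - j) * ?Q" if "j \<le> b" for j
 proof (cases "j \<le> c")
  case False
  have "0 \<le> K * (1 / 2) ^ (b - j) * ?Q" using K assms(1) by simp
  thus ?thesis using False by (simp add: t_def binomial_eq_0)
 next
  case True
  define u v where "u = b - j" and "v = c - j"
  have bu: "b = j + u" and cv: "c = j + v" using that True by (simp_all add: u_def v_def)
  have fb: "(fact b :: real) = real (b choose u) * fact u * fact j"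
  proof -
   have "fact u * fact j * (b choose u) = (fact b :: nat)" using binomial_fact_lemma[of u b] by (simp add: bu)
   hence "real (fact u * fact j * (b choose u)) = real (fact b)" by (rule arg_cong)
   thus ?thesis by (simp add: mult_ac)
  qed
  have fc: "(fact c :: real) = real (c choose v) * fact v * fact j"
  proof -
   have "fact v * fact j * (c choose v) = (fact c :: nat)" using binomial_fact_lemma[of v c] by (simp add: cv)
   hence "real (fact v * fact j * (c choose v)) = real (fact c)" by (rule arg_cong)
   thus ?thesis by (simp add: mult_ac)
  qed
  have sym: "c choose j = c choose v" using cv binomial_symmetric[of j c] by simp
  have pos: "real (b choose u) > 0" "real (c choose v) > 0" using bu cv by (auto intro: zero_less_binomial)
  have n1: "real n \<ge> 1" using assms(2) by simp
  have bb: "real (b choose u) * Z ^ u * \<epsilon> ^ u / fact u \<le> (1 + \<epsilon>) ^ b * (K / 4 ^ u)"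
   using mult_mono[OF binomial_le_power[OF e, of b u] power_fact_le[OF Z0, of u]] e Z0 by (simp add: K_def mult_ac)
  have cc: "real (c choose v) * Z ^ v * \<epsilon> ^ v / fact v \<le> (1 + \<epsilon>) ^ c * K"
  proof -
   have "real (c choose v) * Z ^ v * \<epsilon> ^ v / fact v \<le> (1 + \<epsilon>) ^ c * (K / 4 ^ v)"
    using mult_mono[OF binomial_le_power[OF e, of c v] power_fact_le[OF Z0, of v]] e Z0 by (simp add: K_def mult_ac)
   also have "\<dots> \<le> (1 + \<epsilon>) ^ c * (K / 1)" using e K by (intro mult_left_mono divide_left_mono) auto
   finally show ?thesis by simp
  qed
  have "(t j * sqrt (real n ^ b * fact b))\<^sup>2 = (t j)\<^sup>2 * (real n ^ b * fact b)" by (simp add: power_mult_distrib)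
  also have "(t j)\<^sup>2 = (X\<^sup>2) ^ u / real n ^ (2 * u) / (fact u)\<^sup>2 * (real (c choose v))\<^sup>2 * (X\<^sup>2) ^ v"
   unfolding t_def u_def[symmetric] v_def[symmetric] sym by (simp add: power_mult_distrib power_divide power_mult[symmetric] mult_ac)
  also have "\<dots> * (real n ^ b * fact b) =
   (real (b choose u) * Z ^ u * \<epsilon> ^ u / fact u) * (real (c choose v) * Z ^ v * \<epsilon> ^ v / fact v) *
   (real n ^ c * fact c) / real n ^ (u + v)"
   unfolding fb fc X(2) using n1 by (simp add: bu cv power_mult_distrib power_add power_mult power2_eq_square field_simps)
  also have "\<dots> \<le> (real (b choose u) * Z ^ u * \<epsilon> ^ u / fact u) * (real (c choose v) * Z ^ v * \<epsilon> ^ v / fact v) *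
   (real n ^ c * fact c) / 1" using n1 Z0 e by (intro divide_left_mono mult_nonneg_nonneg) (auto intro: one_le_power)
  also have "\<dots> \<le> ((1 + \<epsilon>) ^ b * (K / 4 ^ u)) * ((1 + \<epsilon>) ^ c * K) * (real n ^ c * fact c) / 1"
   using n1 Z0 e K by (intro divide_right_mono mult_right_mono mult_mono[OF bb cc]) auto
  also have "\<dots> = (K * (1 / 2) ^ (b - j) * ?Q)\<^sup>2"
  proof -
   have "(K * (1 / 2) ^ u * ?Q)\<^sup>2 = K\<^sup>2 * ((1/2)\<^sup>2) ^ u * ((R\<^sup>2) ^ (b + c)) * (real n ^ c * fact c)"
    by (simp add: power_mult_distrib power_mult[symmetric] mult.commute[of 2] mult_ac)
   thus ?thesis unfolding u_def[symmetric] R2 by (simp add: power_add power2_eq_square power_divide power_one_over mult_ac)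
  qed
  finally show ?thesis by (rule power2_le_imp_le) (use K assms(1) in simp)
 qed
 have "norm (exp_coeff x n b c) \<le> (\<Sum>j\<le>b. t j)" unfolding exp_coeff_eq t_def X_def
  by (rule order_trans[OF norm_sum]) (simp add: norm_mult norm_divide norm_power)
 hence "norm (exp_coeff x n b c) * sqrt (real n ^ b * fact b) \<le> (\<Sum>j\<le>b. t j) * sqrt (real n ^ b * fact b)" by (rule mult_right_mono) simp
 also have "\<dots> = (\<Sum>j\<le>b. t j * sqrt (real n ^ b * fact b))" by (rule sum_distrib_right)
 also have "\<dots> \<le> (\<Sum>j\<le>b. K * (1 / 2) ^ (b - j) * ?Q)" by (rule sum_mono) (use tm in auto)
 also have "\<dots> = (\<Sum>j\<le>b. (1 / 2) ^ (b - j)) * (K * ?Q)" unfolding sum_distrib_right by (rule sum.cong) auto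
 also have "(\<Sum>j\<le>b. (1 / 2 :: real) ^ (b - j)) \<le> 2"
 proof -
  have "(\<Sum>j\<le>b. (1 / 2 :: real) ^ (b - j)) = (\<Sum>j\<le>b. (1 / 2) ^ j)"
   by (rule sum.reindex_bij_witness[of _ "\<lambda>j. b - j" "\<lambda>j. b - j"]) auto
  also have "\<dots> \<le> 2" by (simp add: sum_gp0)
  finally show ?thesis .
 qed
 finally show ?thesis using K assms(1) by (simp add: K_def mult_ac mult_right_mono)
qed

lemma tame_exp_matrix: "tame (exp_matrix x) 1 1"
proof (rule tameI)
 fix r s :: real assume rs: "0 < r" "r < 1" "1 < s"
 define t where "t = max r (1 / s)"
 have t: "0 < t" "t < 1" "r \<le> t" "1 / s \<le> t" using rs by (auto simp: t_def)
 define R where "R = 1 / sqrt t"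
 have R: "R > 1" using t by (simp add: R_def)
 have tR: "t * R < 1" "t * R > 0"
 proof -
  have "t * R = sqrt t" using t by (simp add: R_def real_div_sqrt)
  thus "t * R < 1" "t * R > 0" using t by simp_all
 qed
 define K where "K = 2 * exp (4 * ((norm x)\<^sup>2 / (R\<^sup>2 - 1)))"
 have K: "K \<ge> 1"
 proof -
  have "R\<^sup>2 - 1 \<ge> 0" using R by simp
  hence "exp (4 * ((norm x)\<^sup>2 / (R\<^sup>2 - 1))) \<ge> 1" by simp
  thus ?thesis unfolding K_def by linarith
 qed
 have "(\<lambda>n. K * t ^ n * R) \<longlonglongrightarrow> K * 0 * R" using t by (intro tendsto_intros LIMSEQ_power_zero) auto
 hence "eventually (\<lambda>n. K * t ^ n * R < 1) sequentially" by (intro order_tendstoD(2)[of _ 0]) auto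
 then obtain n0 where n0: "\<And>n. n \<ge> n0 ==> K * t ^ n * R < 1" unfolding eventually_sequentially by blast
 define g where "g = (\<lambda>n b c. norm (exp_coeff x n b c) * (sqrt (real n ^ b * fact b) * r ^ (n * b)))"
 define h where "h = (\<lambda>n c. sqrt (real n ^ c * fact c) * s ^ (n * c))"
 define k where "k = (\<lambda>n. if n < n0 then K else 1)"
 have mode: "g n b c \<le> k n * h n c" if n: "n > 0" for n b c
 proof (cases "b + c = 0")
  case True
  thus ?thesis using K by (simp add: g_def h_def k_def)
 next
  case False
  have "r ^ (n * b) \<le> t ^ (n * b)" using rs t by (intro power_mono) auto
  moreover have "(1 / s) ^ (n * c) \<le> t ^ (n * c)" using rs t by (intro power_mono) auto
  ultimately have p: "r ^ (n * b) * (1 / s) ^ (n * c) \<le> (t ^ n) ^ (b + c)"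
   using mult_mono[of "r ^ (n * b)" "t ^ (n * b)" "(1 / s) ^ (n * c)" "t ^ (n * c)"] rs t
   by (simp add: power_add power_mult[symmetric] del: power_one_over)
  have tn: "t ^ n \<le> t" using t n power_decreasing[of 1 n t] by simp
  have "t ^ n * R \<le> 1" using mult_right_mono[OF tn, of R] tR R by linarith
  hence le: "(t ^ n * R) ^ (b + c) \<le> t ^ n * R" using power_decreasing[of 1 "b + c" "t ^ n * R"] False t R by simp
  have kb: "K * (t ^ n * R) ^ (b + c) \<le> k n"
  proof (cases "n < n0")
   case True
   have "(t ^ n * R) ^ (b + c) \<le> 1" using le \<open>t ^ n * R \<le> 1\<close> by linarith
   thus ?thesis using True K mult_left_mono[of _ 1 K] by (simp add: k_def)
  next
   case False
   have "K * (t ^ n * R) ^ (b + c) \<le> K * (t ^ n * R)" using le K by (intro mult_left_mono) auto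
   also have "\<dots> \<le> 1" using n0[of n] False by (simp add: mult_ac)
   finally show ?thesis using False by (simp add: k_def)
  qed
  have "g n b c \<le> K * R ^ (b + c) * sqrt (real n ^ c * fact c) * r ^ (n * b)" unfolding g_def mult.assoc[symmetric] K_def
   by (rule mult_right_mono[OF exp_coeff_bound[OF R n refl]]) (use rs in simp)
  also have "\<dots> = K * R ^ (b + c) * (r ^ (n * b) * (1 / s) ^ (n * c)) * h n c" using rs by (simp add: h_def power_divide)
  also have "\<dots> \<le> K * R ^ (b + c) * (t ^ n) ^ (b + c) * h n c" using p K R rs by (intro mult_right_mono mult_left_mono) (auto simp: h_def)
  also have "\<dots> = K * (t ^ n * R) ^ (b + c) * h n c" by (simp add: power_mult_distrib mult_ac)
  also have "\<dots> \<le> k n * h n c" using kb rs by (intro mult_right_mono) (auto simp: h_def)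
  finally show ?thesis .
 qed
 have "bnd (exp_matrix x) r s (K ^ n0)" unfolding bnd_def
 proof (intro conjI ballI)
  show "0 \<le> K ^ n0" using K by simp
  fix \<mu> \<xi> assume \<mu>: "\<mu> \<in> Idx" and \<xi>: "\<xi> \<in> Idx"
  define S where "S = set_mset \<mu> \<union> set_mset \<xi>"
  have S: "finite S" "set_mset \<mu> \<subseteq> S" "set_mset \<xi> \<subseteq> S" "\<And>n. n \<in> S ==> n > 0"
   using \<mu> \<xi> by (auto simp: S_def dest: Idx_pos)
  have wg: "wr y \<nu> = (\<Prod>n\<in>S. sqrt (real n ^ count \<nu> n * fact (count \<nu> n)) * y ^ (n * count \<nu> n))"
   if "set_mset \<nu> \<subseteq> S" for \<nu> y
  proof -
   have "deg \<nu> = (\<Sum>n\<in>S. count \<nu> n * n)"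
    unfolding sum_mset_eq_sum_count by (rule sum.mono_neutral_left) (use S that in \<open>auto simp: not_in_iff\<close>)
   hence "y ^ deg \<nu> = (\<Prod>n\<in>S. y ^ (n * count \<nu> n))" by (simp add: power_sum mult.commute)
   moreover have "wgt \<nu> = (\<Prod>n\<in>S. sqrt (real n ^ count \<nu> n * fact (count \<nu> n)))"
    unfolding wgt_def nsq_superset[OF S(1) that] by (induction S rule: infinite_finite_induct) (simp_all add: real_sqrt_mult)
   ultimately show ?thesis by (simp add: prod.distrib)
  qed
  have "norm (exp_matrix x \<mu> \<xi>) * wr r \<mu> = (\<Prod>n\<in>S. g n (count \<mu> n) (count \<xi> n))"
   unfolding wg[OF S(2)] exp_matrix_superset[OF S(1), of \<mu> \<xi>, unfolded S_def, OF order_refl] S_def[symmetric] g_def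
   by (simp add: prod.distrib prod_norm)
  also have "\<dots> \<le> (\<Prod>n\<in>S. k n * h n (count \<xi> n))" using S(4) rs by (intro prod_mono conjI mode) (auto simp: g_def)
  also have "\<dots> = (\<Prod>n\<in>S. k n) * wr s \<xi>" unfolding wg[OF S(3)] by (simp add: h_def prod.distrib)
  also have "(\<Prod>n\<in>S. k n) \<le> K ^ n0"
  proof -
   have "(\<Prod>n\<in>S. k n) = (\<Prod>n\<in>S \<inter> {..<n0}. k n) * (\<Prod>n\<in>S - {..<n0}. k n)" using prod.Int_Diff[OF S(1)] by blast
   also have "\<dots> = K ^ card (S \<inter> {..<n0})" by (simp add: k_def)
   also have "\<dots> \<le> K ^ n0" using K card_mono[of "{..<n0}" "S \<inter> {..<n0}"] by (intro power_increasing) auto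
   finally show ?thesis .
  qed
  finally show "norm (exp_matrix x \<mu> \<xi>) * wr r \<mu> \<le> K ^ n0 * wr s \<xi>" using \<xi> rs by (simp add: mult_right_mono less_imp_le)
 qed
 thus "\<exists>C. bnd (exp_matrix x) r s C" by blast
qed simp_all

declare of_nat_sum_mset [simp del]

lemma tame_poly:
 assumes xy: "0 < x" "0 < y"
  and *: "\<And>r s. 0 < r ==> r < x ==> y < s ==> \<exists>C m. C \<ge> 0 \<and> (\<forall>\<mu>\<in>Idx. \<forall>\<xi>\<in>Idx. norm (B \<mu> \<xi>) * wr r \<mu>
   \<le> C * dg \<mu> ^ m * dg \<xi> ^ m * wr s \<xi>)"
 shows "tame B x y"
proof (rule tameI)
 fix r s assume rs: "0 < r" "r < x" "y < s"
 obtain r' where r': "r < r'" "r' < x" using dense rs(2) by blast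
 obtain s' where s': "y < s'" "s' < s" using dense rs(3) by blast
 obtain C m where C: "C \<ge> 0" "\<And>\<mu> \<xi>. \<mu> \<in> Idx ==> \<xi> \<in> Idx ==> norm (B \<mu> \<xi>) * wr r' \<mu>
   \<le> C * dg \<mu> ^ m * dg \<xi> ^ m * wr s' \<xi>" using *[of r' s'] rs r' s' by auto
 have pos: "0 < r'" "0 < s'" "0 < s" using rs r' s' xy by auto
 obtain K1 where K1: "K1 > 0" "\<And>n. (1 + real n) ^ m * (r / r') ^ n \<le> K1" using poly_geometric_bound[of "r / r'" m] rs r' pos by auto
 obtain K2 where K2: "K2 > 0" "\<And>n. (1 + real n) ^ m * (s' / s) ^ n \<le> K2" using poly_geometric_bound[of "s' / s" m] s' pos by auto
 have "bnd B r s (C * K1 * K2)" unfolding bnd_def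
 proof (intro conjI ballI)
  show "0 \<le> C * K1 * K2" using C K1 K2 by simp
  fix \<mu> \<xi> assume I: "\<mu> \<in> Idx" "\<xi> \<in> Idx"
  define d where "d = deg \<mu>"
  define d' where "d' = deg \<xi>"
  have "norm (B \<mu> \<xi>) * (wgt \<mu> * r ^ d) = norm (B \<mu> \<xi>) * (wgt \<mu> * r' ^ d) * (r / r') ^ d"
   using pos by (simp add: power_divide)
  also have "\<dots> \<le> C * (1 + real d) ^ m * (1 + real d') ^ m * (wgt \<xi> * s' ^ d') * (r / r') ^ d"
   using C(2)[OF I] rs pos by (intro mult_right_mono) (simp_all add: d_def d'_def)
  also have "\<dots> = C * ((1 + real d) ^ m * (r / r') ^ d) * ((1 + real d') ^ m * (s' / s) ^ d') * (wgt \<xi> * s ^ d')"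
   using pos by (simp add: power_divide)
  also have "\<dots> \<le> C * K1 * K2 * (wgt \<xi> * s ^ d')"
   using C(1) K1 K2 rs pos I wgt_pos[of \<xi>] by (intro mult_right_mono mult_mono) (auto intro: less_imp_le)
  finally show "norm (B \<mu> \<xi>) * wr r \<mu> \<le> C * K1 * K2 * wr s \<xi>" by (simp add: d_def d'_def)
 qed
 thus "\<exists>C. bnd B r s C" by blast
qed (use xy in auto)

context
 fixes A :: fock_matrix and r s C :: real
 assumes r: "r > 0" and s: "s > 0" and bnd: "bnd A r s C"
begin

private lemma bndD: "\<mu> \<in> Idx ==> \<xi> \<in> Idx ==> norm (A \<mu> \<xi>) * wr r \<mu> \<le> C * wr s \<xi>"
 using bnd by (simp add: bnd_def)

private lemma C_nonneg: "C \<ge> 0" using bnd by (simp add: bnd_def)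

private lemma rhs_nonneg: "\<xi> \<in> Idx ==> 0 \<le> C * wr s \<xi>"
 using C_nonneg s wgt_pos[of \<xi>] by (intro mult_nonneg_nonneg) (auto intro: less_imp_le)

lemma cre_bound:
 assumes "\<mu> \<in> Idx" "\<xi> \<in> Idx"
 shows "norm (cre j A \<mu> \<xi>) * wr r \<mu> \<le> r ^ j * (dg \<mu> * (C * wr s \<xi>))"
proof (cases "j \<in># \<mu>")
 case True
 then obtain \<nu> where \<nu>: "\<mu> = add_mset j \<nu>" by (blast dest: multi_member_split)
 have I: "\<nu> \<in> Idx" using assms by (simp add: \<nu>)
 have "norm (cre j A \<mu> \<xi>) * wr r \<mu>
   = r ^ j * (sqrt (real j * real (Suc (count \<nu> j))) * (norm (A \<nu> \<xi>) * wr r \<nu>))"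
  by (simp add: \<nu> cre_def wgt_add power_add mult_ac)
 also have "\<dots> \<le> r ^ j * (dg \<mu> * (C * wr s \<xi>))"
  unfolding \<nu> by (rule mult_left_mono[OF mult_mono[OF sqrt_le_degree bndD[OF I assms(2)]]])
   (use r less_imp_le[OF wgt_pos[OF I]] in auto)
 finally show ?thesis .
next
 case False
 thus ?thesis using r rhs_nonneg[OF assms(2)] by (simp add: cre_def)
qed

lemma ann_bound:
 assumes "\<mu> \<in> Idx" "\<xi> \<in> Idx"
 shows "norm (ann k A \<mu> \<xi>) * wr r \<mu> \<le> (1 / s) ^ k * (dg \<xi> * (C * wr s \<xi>))"
proof (cases "k \<in># \<xi>")
 case True
 then obtain \<nu> where \<nu>: "\<xi> = add_mset k \<nu>" by (blast dest: multi_member_split)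
 have I: "\<nu> \<in> Idx" using assms by (simp add: \<nu>)
 let ?X = "real k * real (Suc (count \<nu> k))"
 have n: "norm (ann k A \<mu> \<xi>) = ?X * norm (A \<mu> \<nu>)" unfolding ann_def by (simp only: norm_mult norm_of_nat) (simp add: \<nu>)
 have "norm (ann k A \<mu> \<xi>) * wr r \<mu> \<le> ?X * (C * wr s \<nu>)" unfolding n mult.assoc[of ?X] by (intro mult_left_mono bndD I assms) simp
 also have "\<dots> = (1 / s) ^ k * (sqrt ?X * (C * wr s \<xi>))"
 proof -
  have "(1 / s) ^ k * (sqrt ?X * (C * wr s \<xi>)) = (sqrt ?X * sqrt ?X) * (C * wr s \<nu>)"
   using s by (simp add: \<nu> wgt_add power_add power_divide del: real_sqrt_mult_self)
  moreover have "sqrt ?X * sqrt ?X = ?X" by simp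
  ultimately show ?thesis by (simp only:)
 qed
 also have "\<dots> \<le> (1 / s) ^ k * (dg \<xi> * (C * wr s \<xi>))"
 proof -
  have "sqrt ?X \<le> 1 + real (deg \<xi>)" unfolding \<nu> by (rule sqrt_le_degree)
  thus ?thesis using s rhs_nonneg[OF assms(2)] by (intro mult_left_mono mult_right_mono) auto
 qed
 finally show ?thesis .
next
 case False
 hence "ann k A \<mu> \<xi> = 0" by (simp add: ann_def not_in_iff)
 thus ?thesis using s rhs_nonneg[OF assms(2)] by simp
qed

lemma raise_bound:
 assumes "\<mu> \<in> Idx" "\<xi> \<in> Idx" "k > 0"
 shows "norm (of_nat k * of_nat (Suc (count \<mu> k)) * A (add_mset k \<mu>) \<xi>) * wr r \<mu>
  \<le> (1 / r) ^ k * ((1 + real (deg (add_mset k \<mu>))) * (C * wr s \<xi>))"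
proof -
 let ?X = "real k * real (Suc (count \<mu> k))"
 have "(1 / r) ^ k * (sqrt ?X * (norm (A (add_mset k \<mu>) \<xi>) * (wgt (add_mset k \<mu>) * r ^ deg (add_mset k \<mu>))))
  = (sqrt ?X * sqrt ?X) * (norm (A (add_mset k \<mu>) \<xi>) * wr r \<mu>)"
  using r by (simp add: wgt_add power_add power_divide del: real_sqrt_mult_self)
 hence "norm (of_nat k * of_nat (Suc (count \<mu> k)) * A (add_mset k \<mu>) \<xi>) * wr r \<mu>
  = (1 / r) ^ k * (sqrt ?X * (norm (A (add_mset k \<mu>) \<xi>) * (wgt (add_mset k \<mu>) * r ^ deg (add_mset k \<mu>))))"
  by (simp only: norm_mult norm_of_nat) simp
 also have "\<dots> \<le> (1 / r) ^ k * ((1 + real (deg (add_mset k \<mu>))) * (C * wr s \<xi>))"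
  by (rule mult_left_mono[OF mult_mono[OF sqrt_le_degree bndD]])
   (use r assms less_imp_le[OF wgt_pos[of "add_mset k \<mu>"]] in auto)
 finally show ?thesis .
qed

lemma lower_bound:
 assumes "\<mu> \<in> Idx" "\<xi> \<in> Idx" "k > 0"
 shows "norm (A \<mu> (add_mset k \<xi>)) * wr r \<mu>
  \<le> s ^ k * ((1 + real (deg (add_mset k \<xi>))) * (C * wr s \<xi>))"
proof -
 have "norm (A \<mu> (add_mset k \<xi>)) * wr r \<mu> \<le> C * (wgt (add_mset k \<xi>) * s ^ deg (add_mset k \<xi>))"
  using assms by (intro bndD) auto
 also have "\<dots> = s ^ k * (sqrt (real k * real (Suc (count \<xi> k))) * (C * wr s \<xi>))" by (simp add: wgt_add power_add)
 also have "\<dots> \<le> s ^ k * ((1 + real (deg (add_mset k \<xi>))) * (C * wr s \<xi>))"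
  using s rhs_nonneg[OF assms(2)] by (intro mult_left_mono mult_right_mono sqrt_le_degree) auto
 finally show ?thesis .
qed

lemma lmul_bound:
 assumes "k \<noteq> 0"
 shows "\<exists>K\<ge>0. \<forall>\<mu>\<in>Idx. \<forall>\<xi>\<in>Idx. norm (lmul k A \<mu> \<xi>) * wr r \<mu>
  \<le> K * dg \<mu> ^ 1 * dg \<xi> ^ 1 * wr s \<xi>"
proof (intro exI[of _ "(r powi (- k)) * (1 + real (nat \<bar>k\<bar>)) * C"] conjI ballI)
 show "0 \<le> (r powi (- k)) * (1 + real (nat \<bar>k\<bar>)) * C" using r C_nonneg by simp
 fix \<mu> \<xi> assume I: "\<mu> \<in> Idx" "\<xi> \<in> Idx"
 have "norm (lmul k A \<mu> \<xi>) * wr r \<mu> \<le>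
  r powi (- k) * (((1 + real (nat \<bar>k\<bar>)) * dg \<mu>) * (C * wr s \<xi>))"
 proof (cases "k < 0")
  case True
  have "norm (lmul k A \<mu> \<xi>) * wr r \<mu> \<le> r ^ nat (- k) * (dg \<mu> * (C * wr s \<xi>))"
   using cre_bound[OF I, of "nat (- k)"] True by (simp add: lmul_neg)
  also have "\<dots> \<le> r ^ nat (- k) * (((1 + real (nat \<bar>k\<bar>)) * dg \<mu>) * (C * wr s \<xi>))"
   using r rhs_nonneg[OF I(2)] by (intro mult_left_mono mult_right_mono) (auto simp: algebra_simps)
  finally show ?thesis using True by (simp add: power_int_def)
 next
  case False
  hence k: "k = int (nat k)" "nat k > 0" using assms by auto
  have "norm (lmul k A \<mu> \<xi>) * wr r \<mu> \<le> (1 / r) ^ nat k * ((1 + real (deg (add_mset (nat k) \<mu>))) * (C * wr s \<xi>))"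
   using raise_bound[OF I k(2)] False by (simp add: lmul_def)
  also have "\<dots> \<le> (1 / r) ^ nat k * (((1 + real (nat \<bar>k\<bar>)) * dg \<mu>) * (C * wr s \<xi>))"
   using r False rhs_nonneg[OF I(2)] by (intro mult_left_mono mult_right_mono) (auto simp: algebra_simps simp flip: of_nat_mult)
  finally show ?thesis using False assms by (simp add: power_int_def divide_simps)
 qed
 also have "\<dots> = (r powi (- k) * (1 + real (nat \<bar>k\<bar>)) * C) * dg \<mu> ^ 1 * 1 * wr s \<xi>" by simp
 also have "\<dots> \<le> (r powi (- k) * (1 + real (nat \<bar>k\<bar>)) * C) * dg \<mu> ^ 1 * dg \<xi> ^ 1 * wr s \<xi>"
  using r s C_nonneg less_imp_le[OF wgt_pos[OF I(2)]] by (intro mult_right_mono mult_left_mono) auto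
 finally show "norm (lmul k A \<mu> \<xi>) * wr r \<mu>
  \<le> (r powi (- k) * (1 + real (nat \<bar>k\<bar>)) * C) * dg \<mu> ^ 1 * dg \<xi> ^ 1 * wr s \<xi>" .
qed

lemma rmul_bound:
 assumes "k \<noteq> 0"
 shows "\<exists>K\<ge>0. \<forall>\<mu>\<in>Idx. \<forall>\<xi>\<in>Idx. norm (rmul k A \<mu> \<xi>) * wr r \<mu>
  \<le> K * dg \<mu> ^ 1 * dg \<xi> ^ 1 * wr s \<xi>"
proof (intro exI[of _ "(s powi (- k)) * (1 + real (nat \<bar>k\<bar>)) * C"] conjI ballI)
 show "0 \<le> (s powi (- k)) * (1 + real (nat \<bar>k\<bar>)) * C" using s C_nonneg by simp
 fix \<mu> \<xi> assume I: "\<mu> \<in> Idx" "\<xi> \<in> Idx"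
 have "norm (rmul k A \<mu> \<xi>) * wr r \<mu> \<le>
  s powi (- k) * (((1 + real (nat \<bar>k\<bar>)) * dg \<xi>) * (C * wr s \<xi>))"
 proof (cases "k < 0")
  case True
  hence k: "nat (- k) > 0" by simp
  have "norm (rmul k A \<mu> \<xi>) * wr r \<mu> \<le> s ^ nat (- k) * ((1 + real (deg (add_mset (nat (- k)) \<xi>))) * (C * wr s \<xi>))"
   using lower_bound[OF I k] True by (simp add: rmul_def)
  also have "\<dots> \<le> s ^ nat (- k) * (((1 + real (nat \<bar>k\<bar>)) * dg \<xi>) * (C * wr s \<xi>))"
   using s True rhs_nonneg[OF I(2)] by (intro mult_left_mono mult_right_mono) (auto simp: algebra_simps intro!: mult_nonpos_nonneg)
  finally show ?thesis using True by (simp add: power_int_def)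
 next
  case False
  have "norm (rmul k A \<mu> \<xi>) * wr r \<mu> \<le> (1 / s) ^ nat k * (dg \<xi> * (C * wr s \<xi>))"
   using ann_bound[OF I, of "nat k"] False by (simp add: rmul_nonneg)
  also have "\<dots> \<le> (1 / s) ^ nat k * (((1 + real (nat \<bar>k\<bar>)) * dg \<xi>) * (C * wr s \<xi>))"
   using s rhs_nonneg[OF I(2)] by (intro mult_left_mono mult_right_mono) (auto simp: algebra_simps)
  finally show ?thesis using False assms by (simp add: power_int_def divide_simps)
 qed
 also have "\<dots> = (s powi (- k) * (1 + real (nat \<bar>k\<bar>)) * C) * 1 * dg \<xi> ^ 1 * wr s \<xi>" by simp
 also have "\<dots> \<le> (s powi (- k) * (1 + real (nat \<bar>k\<bar>)) * C) * dg \<mu> ^ 1 * dg \<xi> ^ 1 * wr s \<xi>"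
  using s C_nonneg less_imp_le[OF wgt_pos[OF I(2)]] by (intro mult_right_mono mult_left_mono) auto
 finally show "norm (rmul k A \<mu> \<xi>) * wr r \<mu>
  \<le> (s powi (- k) * (1 + real (nat \<bar>k\<bar>)) * C) * dg \<mu> ^ 1 * dg \<xi> ^ 1 * wr s \<xi>" .
qed

lemma nord_bound:
 assumes c: "\<And>k. norm (c k) \<le> K * (1 + real_of_int \<bar>k\<bar>) ^ m * x powi k" and rs: "r < x" "x < s"
  and I: "\<mu> \<in> Idx" "\<xi> \<in> Idx"
 shows "norm (nord c g A \<mu> \<xi>) * wr r \<mu> \<le> (2 * K + norm (c 0 * g)) * C * dg \<mu> ^ (m + 2)
  * dg \<xi> ^ (m + 2) * wr s \<xi>"
proof -
 let ?w = "wr r \<mu>" and ?T = "C * wr s \<xi>"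
 let ?d = "1 + real (deg \<mu>)" and ?d' = "1 + real (deg \<xi>)"
 have x: "x > 0" using r rs by simp
 have K: "K \<ge> 0" using c[of 0] order_trans[OF norm_ge_zero c[of 0]] by simp
 have T: "?T \<ge> 0" by (rule rhs_nonneg[OF I(2)])
 have w: "?w \<ge> 0" using r less_imp_le[OF wgt_pos[OF I(1)]] by simp
 have le: "j \<le> deg \<nu>" if "j \<in># \<nu>" for j and \<nu> :: "nat multiset" using that by (auto dest!: multi_member_split)
 have cre: "norm (c (- int j) * cre j A \<mu> \<xi>) * ?w \<le> K * ?d ^ (m + 1) * ?T" if j: "j \<in># \<mu>" for j
 proof -
  have "norm (c (- int j) * cre j A \<mu> \<xi>) * ?w \<le> (K * (1 + real j) ^ m * x powi (- int j)) * (r ^ j * (?d * ?T))"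
   unfolding norm_mult mult.assoc[of "norm (c _)"] using c[of "- int j"] w K x by (intro mult_mono cre_bound I) auto
  also have "\<dots> = (K * (1 + real j) ^ m) * (r / x) ^ j * (?d * ?T)" using x by (simp add: power_int_minus power_divide divide_simps)
  also have "\<dots> \<le> (K * ?d ^ m) * 1 * (?d * ?T)"
   using K T r rs x le[OF j] by (intro mult_right_mono mult_mono mult_left_mono power_mono power_le_one) auto
  finally show ?thesis by (simp add: mult_ac)
 qed
 have ann: "norm (c (int k) * ann k A \<mu> \<xi>) * ?w \<le> K * ?d' ^ (m + 1) * ?T" if k: "k \<in># \<xi>" for k
 proof -
  have "norm (c (int k) * ann k A \<mu> \<xi>) * ?w \<le> (K * (1 + real k) ^ m * x powi (int k)) * ((1 / s) ^ k * (?d' * ?T))"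
   unfolding norm_mult mult.assoc[of "norm (c _)"] using c[of "int k"] w K x by (intro mult_mono ann_bound I) auto
  also have "\<dots> = (K * (1 + real k) ^ m) * (x / s) ^ k * (?d' * ?T)" using x s by (simp add: power_divide divide_simps)
  also have "\<dots> \<le> (K * ?d' ^ m) * 1 * (?d' * ?T)"
   using K T s rs x le[OF k] by (intro mult_right_mono mult_mono mult_left_mono power_mono power_le_one) auto
  finally show ?thesis by (simp add: mult_ac)
 qed
 have d: "?d \<ge> 1" "?d' \<ge> 1" by auto
 have sc: "(\<Sum>j\<in>set_mset \<mu>. norm (c (- int j) * cre j A \<mu> \<xi>) * ?w) \<le> K * ?d ^ (m + 2) * ?T"
 proof -
  have "(\<Sum>j\<in>set_mset \<mu>. norm (c (- int j) * cre j A \<mu> \<xi>) * ?w) \<le> real (card (set_mset \<mu>)) * (K * ?d ^ (m + 1) * ?T)"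
   by (rule sum_bounded_above) (rule cre)
  also have "\<dots> \<le> ?d * (K * ?d ^ (m + 1) * ?T)" using card_set_mset_le[OF I(1)] K T by (intro mult_right_mono) auto
  finally show ?thesis by (simp add: mult_ac)
 qed
 have sa: "(\<Sum>j\<in>set_mset \<xi>. norm (c (int j) * ann j A \<mu> \<xi>) * ?w) \<le> K * ?d' ^ (m + 2) * ?T"
 proof -
  have "(\<Sum>j\<in>set_mset \<xi>. norm (c (int j) * ann j A \<mu> \<xi>) * ?w) \<le> real (card (set_mset \<xi>)) * (K * ?d' ^ (m + 1) * ?T)"
   by (rule sum_bounded_above) (rule ann)
  also have "\<dots> \<le> ?d' * (K * ?d' ^ (m + 1) * ?T)" using card_set_mset_le[OF I(2)] K T by (intro mult_right_mono) auto
  finally show ?thesis by (simp add: mult_ac)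
 qed
 have "norm (nord c g A \<mu> \<xi>) \<le> (\<Sum>j\<in>set_mset \<mu>. norm (c (- int j) * cre j A \<mu> \<xi>)) + norm (c 0 * g * A \<mu> \<xi>)
   + (\<Sum>j\<in>set_mset \<xi>. norm (c (int j) * ann j A \<mu> \<xi>))"
  unfolding nord_def by (intro order_trans[OF norm_triangle_ineq] add_mono norm_sum order_refl)
 hence "norm (nord c g A \<mu> \<xi>) * ?w \<le> ((\<Sum>j\<in>set_mset \<mu>. norm (c (- int j) * cre j A \<mu> \<xi>)) + norm (c 0 * g * A \<mu> \<xi>)
   + (\<Sum>j\<in>set_mset \<xi>. norm (c (int j) * ann j A \<mu> \<xi>))) * ?w" using w by (rule mult_right_mono)
 also have "\<dots> = (\<Sum>j\<in>set_mset \<mu>. norm (c (- int j) * cre j A \<mu> \<xi>) * ?w) + norm (c 0 * g) * (norm (A \<mu> \<xi>) * ?w)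
   + (\<Sum>j\<in>set_mset \<xi>. norm (c (int j) * ann j A \<mu> \<xi>) * ?w)"
  by (simp only: distrib_right sum_distrib_right norm_mult mult.assoc)
 also have "\<dots> \<le> K * ?d ^ (m + 2) * ?T + norm (c 0 * g) * ?T + K * ?d' ^ (m + 2) * ?T" by (intro add_mono sc sa mult_left_mono bndD I) auto
 also have "\<dots> \<le> K * (?d ^ (m + 2) * ?d' ^ (m + 2)) * ?T + norm (c 0 * g) * ((?d ^ (m + 2) * ?d' ^ (m + 2)) * ?T) + K * (?d ^ (m + 2) * ?d' ^ (m + 2)) * ?T"
 proof -
  have p: "1 \<le> ?d ^ (m + 2)" "1 \<le> ?d' ^ (m + 2)" by (rule one_le_power[OF d(1)] one_le_power[OF d(2)])+
  have "?d ^ (m + 2) * 1 \<le> ?d ^ (m + 2) * ?d' ^ (m + 2)" "1 * ?d' ^ (m + 2) \<le> ?d ^ (m + 2) * ?d' ^ (m + 2)"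
   using p by (intro mult_left_mono mult_right_mono; simp)+
  moreover from this have "1 \<le> ?d ^ (m + 2) * ?d' ^ (m + 2)" using p by linarith
  moreover from this have "1 * ?T \<le> (?d ^ (m + 2) * ?d' ^ (m + 2)) * ?T" using T by (rule mult_right_mono)
  ultimately show ?thesis using K T by (intro add_mono mult_right_mono mult_left_mono) auto
 qed
 finally show ?thesis by (simp add: algebra_simps)
qed

end

lemma tame_lmul:
 assumes A: "tame A x y" and k: "k \<noteq> 0"
 shows "tame (lmul k A) x y"
proof (rule tame_poly)
 fix r s assume rs: "0 < r" "r < x" "y < s"
 obtain C where "bnd A r s C" using tameD[OF A rs] by blast
 from lmul_bound[OF rs(1) _ this k] tame_pos[OF A] rs
 show "\<exists>C m. C \<ge> 0 \<and> (\<forall>\<mu>\<in>Idx. \<forall>\<xi>\<in>Idx. norm (lmul k A \<mu> \<xi>) * wr r \<mu>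
   \<le> C * dg \<mu> ^ m * dg \<xi> ^ m * wr s \<xi>)" by (meson less_trans)
qed (use tame_pos[OF A] in auto)

lemma tame_rmul:
 assumes A: "tame A x y" and k: "k \<noteq> 0"
 shows "tame (rmul k A) x y"
proof (rule tame_poly)
 fix r s assume rs: "0 < r" "r < x" "y < s"
 obtain C where "bnd A r s C" using tameD[OF A rs] by blast
 from rmul_bound[OF rs(1) _ this k] tame_pos[OF A] rs
 show "\<exists>C m. C \<ge> 0 \<and> (\<forall>\<mu>\<in>Idx. \<forall>\<xi>\<in>Idx. norm (rmul k A \<mu> \<xi>) * wr r \<mu>
   \<le> C * dg \<mu> ^ m * dg \<xi> ^ m * wr s \<xi>)" by (meson less_trans)
qed (use tame_pos[OF A] in auto)

lemma tame_comm:
 assumes "tame A x y" "k \<noteq> 0"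
 shows "tame (comm k A) x y"
proof -
 have "comm k A = (\<lambda>\<mu> \<xi>. lmul k A \<mu> \<xi> + - 1 * rmul k A \<mu> \<xi>)" by (simp add: fun_eq_iff comm_def)
 thus ?thesis using assms by (simp only:) (intro tame_add tame_scale tame_lmul tame_rmul)
qed

lemma tame_nord:
 assumes A: "tame A x x" and c: "\<And>k. norm (c k) \<le> K * (1 + real_of_int \<bar>k\<bar>) ^ m * x powi k"
 shows "tame (nord c g A) x x"
proof (rule tame_poly)
 fix r s assume rs: "0 < r" "r < x" "x < s"
 obtain C where C: "bnd A r s C" using tameD[OF A rs] by blast
 have "K \<ge> 0" using order_trans[OF norm_ge_zero c[of 0]] by simp
 hence "0 \<le> (2 * K + norm (c 0 * g)) * C" using C by (simp add: bnd_def)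
 thus "\<exists>C m. C \<ge> 0 \<and> (\<forall>\<mu>\<in>Idx. \<forall>\<xi>\<in>Idx. norm (nord c g A \<mu> \<xi>) * wr r \<mu>
   \<le> C * dg \<mu> ^ m * dg \<xi> ^ m * wr s \<xi>)"
  using nord_bound[OF rs(1) _ C c rs(2,3)] rs by (intro exI[of _ "(2 * K + norm (c 0 * g)) * C"] exI[of _ "m + 2"]) auto
qed (use tame_pos[OF A] in auto)

definition qconj :: "complex => fock_matrix => fock_matrix" where
 "qconj z A \<mu> \<xi> = exp (z * (of_nat (deg \<mu>) - of_nat (deg \<xi>))) * A \<mu> \<xi>"

lemma tame_conj:
 assumes "tame A 1 1"
 shows "tame (qconj z A) (exp (- Re z)) (exp (- Re z))"
proof (rule tameI)
 let ?X = "exp (- Re z)"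
 fix r s assume rs: "0 < r" "r < ?X" "?X < s"
 obtain C where C: "bnd A (r / ?X) (s / ?X) C" using tameD[OF assms, of "r / ?X" "s / ?X"] rs by auto
 have "bnd (qconj z A) r s C" unfolding bnd_def
 proof (intro conjI ballI)
  show "C \<ge> 0" using C by (simp add: bnd_def)
  fix \<mu> \<xi> assume I: "\<mu> \<in> Idx" "\<xi> \<in> Idx"
  have "norm (exp (z * (of_nat (deg \<mu>) - of_nat (deg \<xi>)))) = ?X ^ deg \<xi> / ?X ^ deg \<mu>"
   by (simp add: exp_of_nat_mult[symmetric] exp_diff[symmetric] algebra_simps)
  hence "norm (qconj z A \<mu> \<xi>) * wr r \<mu>
    = (norm (A \<mu> \<xi>) * (wgt \<mu> * (r / ?X) ^ deg \<mu>)) * ?X ^ deg \<xi>" by (simp add: qconj_def norm_mult power_divide)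
  also have "\<dots> \<le> (C * (wgt \<xi> * (s / ?X) ^ deg \<xi>)) * ?X ^ deg \<xi>" using C I by (intro mult_right_mono) (auto simp: bnd_def)
  also have "\<dots> = C * wr s \<xi>" by (simp add: power_divide)
  finally show "norm (qconj z A \<mu> \<xi>) * wr r \<mu> \<le> C * wr s \<xi>" .
 qed
 thus "\<exists>C. bnd (qconj z A) r s C" by blast
qed auto

lemma qconj_nord: "qconj z (nord c g A) = nord (\<lambda>k. c k * exp (- z * of_int k)) g (qconj z A)"
proof (intro ext)
 fix \<mu> \<xi> :: "nat multiset"
 have cre: "qconj z (cre j A) \<mu> \<xi> = exp (z * of_nat j) * cre j (qconj z A) \<mu> \<xi>" if "j \<in># \<mu>" for j
  using that by (auto dest!: multi_member_split simp: qconj_def cre_def simp flip: exp_add) (simp add: algebra_simps)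
 have ann: "qconj z (ann j A) \<mu> \<xi> = exp (- z * of_nat j) * ann j (qconj z A) \<mu> \<xi>" if "j \<in># \<xi>" for j
  using that by (auto dest!: multi_member_split simp: qconj_def ann_def simp flip: exp_add) (simp add: algebra_simps flip: exp_add)
 have "qconj z (nord c g A) \<mu> \<xi> = (\<Sum>j\<in>set_mset \<mu>. c (- int j) * qconj z (cre j A) \<mu> \<xi>) + c 0 * g * qconj z A \<mu> \<xi>
  + (\<Sum>k\<in>set_mset \<xi>. c (int k) * qconj z (ann k A) \<mu> \<xi>)"
  by (simp add: qconj_def nord_def distrib_left sum_distrib_left mult_ac)
 also have "\<dots> = nord (\<lambda>k. c k * exp (- z * of_int k)) g (qconj z A) \<mu> \<xi>" unfolding nord_def by (simp add: cre ann mult_ac)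
 finally show "qconj z (nord c g A) \<mu> \<xi> = nord (\<lambda>k. c k * exp (- z * of_int k)) g (qconj z A) \<mu> \<xi>" .
qed

lemma lmul_conj: "lmul k (qconj z A) \<mu> \<xi> = exp (z * of_int k) * qconj z (lmul k A) \<mu> \<xi>"
 by (auto simp: lmul_def cre_def qconj_def mult_ac dest!: multi_member_split simp flip: exp_add)
  (simp_all add: algebra_simps flip: exp_add)

lemma rmul_conj: "rmul k (qconj z A) \<mu> \<xi> = exp (z * of_int k) * qconj z (rmul k A) \<mu> \<xi>"
proof (cases "k < 0")
 case True
 thus ?thesis by (simp add: rmul_def qconj_def mult_ac flip: exp_add) (simp add: algebra_simps)
next
 case False
 show ?thesis
 proof (cases "nat k \<in># \<xi>")
  case True
  thus ?thesis using False
   by (auto dest!: multi_member_split simp: rmul_def ann_def qconj_def simp flip: exp_add) (simp add: algebra_simps flip: exp_add)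
 next
  case F: False
  thus ?thesis using False by (simp add: rmul_def ann_def qconj_def not_in_iff)
 qed
qed

lemma comm_conj: "comm k (qconj z A) \<mu> \<xi> = exp (z * of_int k) * qconj z (comm k A) \<mu> \<xi>"
 unfolding comm_def lmul_conj rmul_conj by (simp add: qconj_def algebra_simps)

lemma norm_gbinomial_le: "norm ((of_int (- k - 1) :: complex) gchoose n) \<le> (1 + real_of_int \<bar>k\<bar>) ^ n"
proof -
 have "norm ((of_int (- k - 1) :: complex) gchoose n) = (\<Prod>i<n. norm ((of_int (- k - 1) - of_nat i :: complex))) / fact n"
  by (simp add: gbinomial_prod_rev norm_divide prod_norm[symmetric] atLeast0LessThan)
 also have "\<dots> \<le> (\<Prod>i<n. (1 + real_of_int \<bar>k\<bar>) * real (Suc i)) / fact n"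
 proof (intro divide_right_mono prod_mono conjI)
  fix i
  have "of_int (- k - 1) - of_nat i = (of_int (- (k + 1 + int i)) :: complex)" by simp
  hence "norm (of_int (- k - 1) - of_nat i :: complex) = real_of_int \<bar>k + 1 + int i\<bar>"
   by (simp only: norm_of_int norm_minus_cancel of_int_abs of_int_minus)
  also have "\<dots> \<le> real_of_int ((1 + \<bar>k\<bar>) * (1 + int i))"
  proof (subst of_int_le_iff)
   have "0 \<le> \<bar>k\<bar> * int i" by simp
   moreover have "(1 + \<bar>k\<bar>) * (1 + int i) = 1 + \<bar>k\<bar> + int i + \<bar>k\<bar> * int i" by (simp add: algebra_simps)
   ultimately show "\<bar>k + 1 + int i\<bar> \<le> (1 + \<bar>k\<bar>) * (1 + int i)" by linarith
  qed
  finally show "norm (of_int (- k - 1) - of_nat i :: complex) \<le> (1 + real_of_int \<bar>k\<bar>) * real (Suc i)" by simp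
 qed auto
 also have "\<dots> = (1 + real_of_int \<bar>k\<bar>) ^ n" by (simp add: prod.distrib fact_prod_Suc atLeast0LessThan)
 finally show ?thesis .
qed

lemma tame_vmat: "tame (vmat g x ns) 1 1"
proof (induction ns)
 case Nil
 thus ?case by (simp add: tame_exp_matrix)
next
 case (Cons n ns)
 show ?case unfolding vmat.simps by (rule tame_nord[OF Cons, of _ 1 "n - 1"]) (use norm_gbinomial_le in simp)
qed

lemma tame_Vlin: "tame (Vlin g x u) 1 1" unfolding Vlin_def[abs_def] by (intro tame_sum tame_scale tame_vmat) auto

lemma tame_wmat: "tame (wmat form a g \<alpha> \<rho>) 1 1" unfolding wmat_def by (rule tame_Vlin)

definition mm :: "fock_matrix => fock_matrix => fock_matrix" where
 "mm A B \<mu> \<xi> = (if \<mu> \<in> Idx \<and> \<xi> \<in> Idx then \<Sum>\<^sub>\<infinity>\<nu>\<in>Idx. A \<mu> \<nu> * B \<nu> \<xi> else 0)"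

definition idm :: fock_matrix where
 "idm \<mu> \<xi> = (if \<mu> \<in> Idx \<and> \<mu> = \<xi> then 1 else 0)"

definition tr :: "complex => fock_matrix => complex" where
 "tr q A = (\<Sum>\<^sub>\<infinity>\<mu>\<in>Idx. A \<mu> \<mu> * q ^ deg \<mu>)"

lemma wgt_nonneg [simp]: "\<mu> \<in> Idx ==> 0 \<le> wgt \<mu>" by (simp add: less_imp_le)

lemma bnd_le: "bnd A r s C ==> \<mu> \<in> Idx ==> \<xi> \<in> Idx ==> norm (A \<mu> \<xi>) * wr r \<mu> \<le> C * wr s \<xi>"
 by (simp add: bnd_def)

lemma bnd_entry:
 assumes "bnd A r s C" "r > 0" "\<mu> \<in> Idx" "\<xi> \<in> Idx"
 shows "norm (A \<mu> \<xi>) \<le> C * (wr s \<xi> / wr r \<mu>)" using assms wgt_pos[OF assms(3)] by (auto simp: bnd_def pos_le_divide_eq)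

lemma summable_Idx_pair:
 fixes t u :: real
 assumes "0 \<le> t" "t < 1" "0 \<le> u" "u < 1"
 shows "(\<lambda>(\<mu>, \<nu>). t ^ deg \<mu> * u ^ deg \<nu>) summable_on Idx \<times> Idx"
 using summable_on_times[OF summable_Idx[OF assms(1,2)] summable_Idx[OF assms(3,4)]] assms by simp

lemma tame_choose:
 assumes "tame A x y" "tame B x' y'" "y < x'"
 obtains s r' where "y < s" "s < r'" "r' < x'" "0 < s" "0 < r'"
proof -
 obtain s where s: "y < s" "s < x'" using dense assms(3) by blast
 obtain r' where r': "s < r'" "r' < x'" using dense s(2) by blast
 show ?thesis using that[of s r'] s r' tame_pos[OF assms(1)] by auto
qed

lemma mm_bound:
 assumes "bnd A r s C" "bnd B r' s' D" "0 < r" "0 < r'" "0 < s" "\<mu> \<in> Idx" "\<xi> \<in> Idx" "\<nu> \<in> Idx"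
 shows "norm (A \<mu> \<nu> * B \<nu> \<xi>) * wr r \<mu> \<le> (C * D * wr s' \<xi>) * (s / r') ^ deg \<nu>"
proof -
 have "norm (A \<mu> \<nu> * B \<nu> \<xi>) * wr r \<mu> = (norm (A \<mu> \<nu>) * wr r \<mu>) * norm (B \<nu> \<xi>)" by (simp add: norm_mult)
 also have "\<dots> \<le> (C * wr s \<nu>) * (D * (wr s' \<xi> / wr r' \<nu>))"
  by (rule mult_mono[OF bnd_le[OF assms(1,6,8)] bnd_entry[OF assms(2,4,8,7)]])
   (use assms in \<open>auto simp: bnd_def intro!: mult_nonneg_nonneg\<close>)
 also have "\<dots> = (C * D * wr s' \<xi>) * (s / r') ^ deg \<nu>" using wgt_pos[OF assms(8)] by (simp add: power_divide)
 finally show ?thesis .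
qed

lemma mm_abs_summable:
 assumes A: "tame A x y" and B: "tame B x' y'" and "y < x'" and I: "\<mu> \<in> Idx" "\<xi> \<in> Idx"
 shows "(\<lambda>\<nu>. norm (A \<mu> \<nu> * B \<nu> \<xi>)) summable_on Idx"
proof -
 obtain s r' where sr: "y < s" "s < r'" "r' < x'" "0 < s" "0 < r'" using tame_choose[OF assms(1-3)] .
 obtain r where r: "0 < r" "r < x" using dense tame_pos[OF A] by blast
 have s': "y' < y' + 1" by simp
 obtain C D where C: "bnd A r s C" and D: "bnd B r' (y' + 1) D" using tameD[OF A r sr(1)] tameD[OF B sr(5,3) s'] by blast
 let ?w = "wr r \<mu>"
 have w: "?w > 0" using wgt_pos[OF I(1)] r by simp
 let ?M = "C * D * (wgt \<xi> * (y' + 1) ^ deg \<xi>)"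
 show ?thesis
 proof (rule summable_on_comparison_test)
  show "(\<lambda>\<nu>. ?M / ?w * (s / r') ^ deg \<nu>) summable_on Idx" using sr by (intro summable_on_cmult_right summable_Idx) auto
  fix \<nu> assume "\<nu> \<in> Idx"
  hence "norm (A \<mu> \<nu> * B \<nu> \<xi>) \<le> (?M * (s / r') ^ deg \<nu>) / ?w"
   by (subst pos_le_divide_eq[OF w]) (rule mm_bound[OF C D r(1) sr(5,4) I])
  thus "norm (A \<mu> \<nu> * B \<nu> \<xi>) \<le> ?M / ?w * (s / r') ^ deg \<nu>" by (simp only: times_divide_eq_left)
 qed simp
qed

lemma mm_summable:
 assumes "tame A x y" "tame B x' y'" "y < x'" "\<mu> \<in> Idx" "\<xi> \<in> Idx"
 shows "(\<lambda>\<nu>. A \<mu> \<nu> * B \<nu> \<xi>) summable_on Idx" by (rule abs_summable_summable[OF mm_abs_summable[OF assms]])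

lemma tame_mm:
 assumes A: "tame A x y" and B: "tame B x' y'" and "y < x'"
 shows "tame (mm A B) x y'"
proof (rule tameI)
 fix r s' assume r: "0 < r" "r < x" and s': "y' < s'"
 obtain s r' where sr: "y < s" "s < r'" "r' < x'" "0 < s" "0 < r'" using tame_choose[OF assms] .
 obtain C D where C: "bnd A r s C" and D: "bnd B r' s' D" using tameD[OF A r sr(1)] tameD[OF B sr(5,3) s'] by blast
 let ?t = "\<lambda>\<nu>. (s / r') ^ deg \<nu>"
 have t: "?t summable_on Idx" using sr by (intro summable_Idx) auto
 have "bnd (mm A B) r s' (C * D * (\<Sum>\<^sub>\<infinity>\<nu>\<in>Idx. ?t \<nu>))" unfolding bnd_def
 proof (intro conjI ballI)
  show "0 \<le> C * D * (\<Sum>\<^sub>\<infinity>\<nu>\<in>Idx. ?t \<nu>)" using C D sr by (auto simp: bnd_def intro!: mult_nonneg_nonneg infsum_nonneg)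
  fix \<mu> \<xi> assume I: "\<mu> \<in> Idx" "\<xi> \<in> Idx"
  let ?w = "wr r \<mu>"
  have w: "?w > 0" using wgt_pos[OF I(1)] r by simp
  note S = mm_abs_summable[OF assms I]
  have "norm (mm A B \<mu> \<xi>) * ?w \<le> (\<Sum>\<^sub>\<infinity>\<nu>\<in>Idx. norm (A \<mu> \<nu> * B \<nu> \<xi>)) * ?w"
   using w I S by (intro mult_right_mono) (auto simp: mm_def norm_infsum_bound)
  also have "\<dots> = (\<Sum>\<^sub>\<infinity>\<nu>\<in>Idx. norm (A \<mu> \<nu> * B \<nu> \<xi>) * ?w)" by (rule infsum_cmult_left'[symmetric])
  also have "\<dots> \<le> (\<Sum>\<^sub>\<infinity>\<nu>\<in>Idx. (C * D * wr s' \<xi>) * ?t \<nu>)" using mm_bound[OF C D r(1) sr(5,4) I]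
   by (intro infsum_mono summable_on_cmult_left[OF S] summable_on_cmult_right[OF t])
  also have "\<dots> = C * D * (\<Sum>\<^sub>\<infinity>\<nu>\<in>Idx. ?t \<nu>) * wr s' \<xi>" by (simp add: infsum_cmult_right')
  finally show "norm (mm A B \<mu> \<xi>) * ?w \<le> C * D * (\<Sum>\<^sub>\<infinity>\<nu>\<in>Idx. ?t \<nu>) * wr s' \<xi>" .
 qed
 thus "\<exists>C. bnd (mm A B) r s' C" by blast
qed (use tame_pos[OF A] tame_pos[OF B] in auto)

lemma tame_idm: "0 < x ==> x \<le> y ==> tame idm x y"
proof (rule tameI)
 fix r s assume *: "0 < x" "x \<le> y" "0 < r" "r < x" "y < s"
 have "bnd idm r s 1" unfolding bnd_def
 proof (intro conjI ballI)
  fix \<mu> \<xi> assume "\<mu> \<in> Idx" "\<xi> \<in> Idx"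
  thus "norm (idm \<mu> \<xi>) * wr r \<mu> \<le> 1 * wr s \<xi>" using * wgt_pos[of \<xi>] power_mono[of r s "deg \<xi>"]
   by (auto simp: idm_def intro!: mult_nonneg_nonneg)
 qed simp
 thus "\<exists>C. bnd idm r s C" by blast
qed auto

lemma mm_assoc:
 assumes A: "tame A x y" and B: "tame B x' y'" and C: "tame C x'' y''" and "y < x'" "y' < x''"
 shows "mm (mm A B) C = mm A (mm B C)"
proof (intro ext)
 fix \<mu> \<xi>
 show "mm (mm A B) C \<mu> \<xi> = mm A (mm B C) \<mu> \<xi>"
 proof (cases "\<mu> \<in> Idx \<and> \<xi> \<in> Idx")
  case True
  obtain s r' where sr: "y < s" "s < r'" "r' < x'" "0 < s" "0 < r'" using tame_choose[OF A B assms(4)] .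
  obtain s' r'' where sr': "y' < s'" "s' < r''" "r'' < x''" "0 < s'" "0 < r''" using tame_choose[OF B C assms(5)] .
  obtain r where r: "0 < r" "r < x" using dense tame_pos[OF A] by blast
  have s'': "y'' < y'' + 1" by simp
  obtain K K' K'' where K: "bnd A r s K" "bnd B r' s' K'" "bnd C r'' (y'' + 1) K''"
   using tameD[OF A r sr(1)] tameD[OF B sr(5,3) sr'(1)] tameD[OF C sr'(5,3) s''] by blast
  let ?f = "\<lambda>\<nu> \<rho>. A \<mu> \<nu> * B \<nu> \<rho> * C \<rho> \<xi>"
  let ?M = "K * K' * K'' * (wgt \<xi> * (y'' + 1) ^ deg \<xi>) / wr r \<mu>"
  have "(\<lambda>p. norm ((\<lambda>(\<nu>, \<rho>). ?f \<nu> \<rho>) p)) summable_on Idx \<times> Idx"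
  proof (rule summable_on_comparison_test)
   show "(\<lambda>(\<nu>, \<rho>). ?M * ((s / r') ^ deg \<nu> * (s' / r'') ^ deg \<rho>)) summable_on Idx \<times> Idx"
    using summable_on_cmult_right[OF summable_Idx_pair[of "s / r'" "s' / r''"], of ?M] sr sr' by (simp add: case_prod_unfold)
   fix p assume "p \<in> Idx \<times> Idx"
   then obtain \<nu> \<rho> where p: "p = (\<nu>, \<rho>)" "\<nu> \<in> Idx" "\<rho> \<in> Idx" by auto
   have "norm (?f \<nu> \<rho>) \<le> K * (wr s \<nu> / wr r \<mu>)
     * (K' * (wr s' \<rho> / wr r' \<nu>))
     * (K'' * ((wgt \<xi> * (y'' + 1) ^ deg \<xi>) / wr r'' \<rho>))"
    unfolding norm_mult using True p sr sr' r K wgt_pos[of \<mu>] wgt_pos[of \<nu>] wgt_pos[of \<rho>] wgt_pos[of \<xi>] tame_pos[OF C]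
    by (intro mult_mono bnd_entry) (auto simp: bnd_def intro!: mult_nonneg_nonneg divide_nonneg_nonneg less_imp_le[OF wgt_pos])
   also have "\<dots> = ?M * ((s / r') ^ deg \<nu> * (s' / r'') ^ deg \<rho>)"
    using wgt_pos[OF p(2)] wgt_pos[OF p(3)] sr sr' by (simp add: power_divide mult_ac)
   finally show "norm ((\<lambda>(\<nu>, \<rho>). ?f \<nu> \<rho>) p) \<le> (\<lambda>(\<nu>, \<rho>). ?M * ((s / r') ^ deg \<nu> * (s' / r'') ^ deg \<rho>)) p"
    by (simp add: p)
  qed auto
  hence S: "(\<lambda>(\<nu>, \<rho>). ?f \<nu> \<rho>) summable_on Idx \<times> Idx" by (rule abs_summable_summable)
  have "mm (mm A B) C \<mu> \<xi> = (\<Sum>\<^sub>\<infinity>\<rho>\<in>Idx. \<Sum>\<^sub>\<infinity>\<nu>\<in>Idx. ?f \<nu> \<rho>)"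
   using True by (simp add: mm_def infsum_cmult_left'[symmetric] cong: infsum_cong)
  also have "\<dots> = (\<Sum>\<^sub>\<infinity>\<nu>\<in>Idx. \<Sum>\<^sub>\<infinity>\<rho>\<in>Idx. ?f \<nu> \<rho>)" by (rule infsum_swap_banach[OF S, symmetric])
  also have "\<dots> = mm A (mm B C) \<mu> \<xi>" using True by (simp add: mm_def infsum_cmult_right'[symmetric] mult.assoc cong: infsum_cong)
  finally show ?thesis .
 next
  case False
  thus ?thesis unfolding mm_def[of _ _ \<mu> \<xi>] by (simp only: if_False)
 qed
qed

lemma mm_add_left:
 assumes "tame A x y" "tame A' x y" "tame B x' y'" "y < x'"
 shows "mm (\<lambda>\<mu> \<xi>. A \<mu> \<xi> + A' \<mu> \<xi>) B \<mu> \<xi> = mm A B \<mu> \<xi> + mm A' B \<mu> \<xi>"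
 using mm_summable[OF assms(1,3,4), of \<mu> \<xi>] mm_summable[OF assms(2,3,4), of \<mu> \<xi>] by (auto simp: mm_def distrib_right infsum_add)

lemma mm_add_right:
 assumes "tame A x y" "tame B x' y'" "tame B' x' y'" "y < x'"
 shows "mm A (\<lambda>\<mu> \<xi>. B \<mu> \<xi> + B' \<mu> \<xi>) \<mu> \<xi> = mm A B \<mu> \<xi> + mm A B' \<mu> \<xi>"
 using mm_summable[OF assms(1,2,4), of \<mu> \<xi>] mm_summable[OF assms(1,3,4), of \<mu> \<xi>] by (auto simp: mm_def distrib_left infsum_add)

lemma mm_sum_left:
 assumes "\<And>i. i \<in> S ==> tame (A i) x y" "tame B x' y'" "y < x'" "0 < x" "0 < y"
 shows "mm (\<lambda>\<mu> \<xi>. \<Sum>i\<in>S. A i \<mu> \<xi>) B \<mu> \<xi> = (\<Sum>i\<in>S. mm (A i) B \<mu> \<xi>)" using assms(1)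
proof (induction S rule: infinite_finite_induct)
 case (insert i S)
 have "mm (\<lambda>\<mu> \<xi>. A i \<mu> \<xi> + (\<Sum>j\<in>S. A j \<mu> \<xi>)) B \<mu> \<xi> = mm (A i) B \<mu> \<xi> + mm (\<lambda>\<mu> \<xi>. \<Sum>j\<in>S. A j \<mu> \<xi>) B \<mu> \<xi>"
  using insert.prems assms by (intro mm_add_left[OF _ tame_sum assms(2,3)]) auto
 thus ?case using insert by simp
qed (simp_all add: mm_def)

lemma mm_sum_right:
 assumes "\<And>i. i \<in> S ==> tame (B i) x' y'" "tame A x y" "y < x'" "0 < x'" "0 < y'"
 shows "mm A (\<lambda>\<mu> \<xi>. \<Sum>i\<in>S. B i \<mu> \<xi>) \<mu> \<xi> = (\<Sum>i\<in>S. mm A (B i) \<mu> \<xi>)" using assms(1)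
proof (induction S rule: infinite_finite_induct)
 case (insert i S)
 have "mm A (\<lambda>\<mu> \<xi>. B i \<mu> \<xi> + (\<Sum>j\<in>S. B j \<mu> \<xi>)) \<mu> \<xi> = mm A (B i) \<mu> \<xi> + mm A (\<lambda>\<mu> \<xi>. \<Sum>j\<in>S. B j \<mu> \<xi>) \<mu> \<xi>"
  using insert.prems assms by (intro mm_add_right[OF assms(2) _ tame_sum[of x' y'] assms(3)]) auto
 thus ?case using insert by simp
qed (simp_all add: mm_def)

lemma infsum_Idx_add_mset:
 fixes f :: "nat multiset => complex"
 assumes "j > 0"
 shows "(\<Sum>\<^sub>\<infinity>\<nu>\<in>Idx. f (add_mset j \<nu>)) = (\<Sum>\<^sub>\<infinity>\<nu>\<in>Idx. if j \<in># \<nu> then f \<nu> else 0)"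
proof -
 have "bij_betw (add_mset j) Idx {\<nu> \<in> Idx. j \<in># \<nu>}" using assms by (intro bij_betwI[of _ _ _ "\<lambda>\<nu>. \<nu> - {#j#}"]) auto
 from infsum_reindex_bij_betw[OF this, of f]
 have "(\<Sum>\<^sub>\<infinity>\<nu>\<in>Idx. f (add_mset j \<nu>)) = (\<Sum>\<^sub>\<infinity>\<nu>\<in>{\<nu> \<in> Idx. j \<in># \<nu>}. f \<nu>)" .
 also have "\<dots> = (\<Sum>\<^sub>\<infinity>\<nu>\<in>Idx. if j \<in># \<nu> then f \<nu> else 0)" by (rule infsum_cong_neutral) auto
 finally show ?thesis .
qed

lemma diff_notin_Idx: "\<mu> \<notin> Idx ==> j > 0 ==> \<mu> - {#j#} \<notin> Idx" by (auto simp: Idx_def in_diff_count)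

lemma lmul_mm:
 assumes "k \<noteq> 0"
 shows "lmul k (mm A B) = mm (lmul k A) B"
proof (intro ext)
 fix \<mu> \<xi>
 show "lmul k (mm A B) \<mu> \<xi> = mm (lmul k A) B \<mu> \<xi>"
 proof (cases "\<xi> \<in> Idx")
  case \<xi>: True
  show ?thesis
  proof (cases "k < 0")
   case True
   hence j: "nat (- k) > 0" by simp
   thus ?thesis using True \<xi> diff_notin_Idx[of \<mu> "nat (- k)"]
    by (cases "nat (- k) \<in># \<mu>"; cases "\<mu> \<in> Idx") (simp_all add: lmul_neg cre_def mm_def)
  next
   case False
   hence j: "nat k > 0" using assms by simp
   let ?c = "of_int k * of_nat (Suc (count \<mu> (nat k))) :: complex"
   have "lmul k (mm A B) \<mu> \<xi> = ?c * mm A B (add_mset (nat k) \<mu>) \<xi>" using False by (simp add: lmul_def)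
   also have "\<dots> = mm (lmul k A) B \<mu> \<xi>"
    using False \<xi> j infsum_cmult_right'[of ?c "\<lambda>\<nu>. A (add_mset (nat k) \<mu>) \<nu> * B \<nu> \<xi>" Idx]
    by (simp add: mm_def lmul_def mult.assoc)
   finally show ?thesis .
  qed
 qed (simp add: lmul_def cre_def mm_def)
qed

lemma rmul_mm:
 assumes "k \<noteq> 0"
 shows "rmul k (mm A B) = mm A (rmul k B)"
proof (intro ext)
 fix \<mu> \<xi>
 show "rmul k (mm A B) \<mu> \<xi> = mm A (rmul k B) \<mu> \<xi>"
 proof (cases "k < 0")
  case True
  hence "nat (- k) > 0" by simp
  thus ?thesis using True by (simp add: rmul_def mm_def)
 next
  case False
  hence j: "nat k > 0" using assms by simp
  let ?c = "of_nat (nat k) * of_nat (count \<xi> (nat k)) :: complex"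
  have "rmul k (mm A B) \<mu> \<xi> = ?c * mm A B \<mu> (\<xi> - {#nat k#})" using False by (simp add: rmul_nonneg ann_def)
  also have "\<dots> = mm A (rmul k B) \<mu> \<xi>"
  proof (cases "\<mu> \<in> Idx \<and> \<xi> \<in> Idx")
   case True
   have "(\<Sum>\<^sub>\<infinity>\<nu>\<in>Idx. A \<mu> \<nu> * (?c * B \<nu> (\<xi> - {#nat k#}))) = ?c * (\<Sum>\<^sub>\<infinity>\<nu>\<in>Idx. A \<mu> \<nu> * B \<nu> (\<xi> - {#nat k#}))"
    unfolding infsum_cmult_right'[symmetric] by (rule infsum_cong) (simp only: mult_ac)
   thus ?thesis using True False by (simp add: mm_def rmul_nonneg ann_def)
  next
   case I: False
   thus ?thesis using diff_notin_Idx[OF _ j, of \<xi>] by (auto simp: mm_def)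
  qed
  finally show ?thesis .
 qed
qed

lemma mm_rmul_lmul:
 assumes "k \<noteq> 0"
 shows "mm (rmul k A) B = mm A (lmul k B)"
proof (intro ext)
 fix \<mu> \<xi>
 show "mm (rmul k A) B \<mu> \<xi> = mm A (lmul k B) \<mu> \<xi>"
 proof (cases "\<mu> \<in> Idx \<and> \<xi> \<in> Idx")
  case I: True
  show ?thesis
  proof (cases "k < 0")
   case True
   hence k: "nat (- k) > 0" by simp
   let ?f = "\<lambda>\<nu>. A \<mu> \<nu> * B (\<nu> - {#nat (- k)#}) \<xi>"
   have "(\<Sum>\<^sub>\<infinity>\<nu>\<in>Idx. rmul k A \<mu> \<nu> * B \<nu> \<xi>) = (\<Sum>\<^sub>\<infinity>\<nu>\<in>Idx. ?f (add_mset (nat (- k)) \<nu>))"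
    using True by (intro infsum_cong) (simp add: rmul_def)
   also have "\<dots> = (\<Sum>\<^sub>\<infinity>\<nu>\<in>Idx. if nat (- k) \<in># \<nu> then ?f \<nu> else 0)" by (rule infsum_Idx_add_mset[OF k])
   also have "\<dots> = (\<Sum>\<^sub>\<infinity>\<nu>\<in>Idx. A \<mu> \<nu> * lmul k B \<nu> \<xi>)"
    using True by (intro infsum_cong) (simp add: lmul_neg cre_def)
   finally have "(\<Sum>\<^sub>\<infinity>\<nu>\<in>Idx. rmul k A \<mu> \<nu> * B \<nu> \<xi>) = (\<Sum>\<^sub>\<infinity>\<nu>\<in>Idx. A \<mu> \<nu> * lmul k B \<nu> \<xi>)" .
   thus ?thesis using I by (simp add: mm_def)
  next
   case False
   hence k: "nat k > 0" using assms by simp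
   let ?f = "\<lambda>\<nu>. rmul k A \<mu> \<nu> * B \<nu> \<xi>"
   have "(\<Sum>\<^sub>\<infinity>\<nu>\<in>Idx. A \<mu> \<nu> * lmul k B \<nu> \<xi>) = (\<Sum>\<^sub>\<infinity>\<nu>\<in>Idx. ?f (add_mset (nat k) \<nu>))"
    using False by (intro infsum_cong) (simp add: lmul_def rmul_nonneg ann_def mult_ac)
   also have "\<dots> = (\<Sum>\<^sub>\<infinity>\<nu>\<in>Idx. if nat k \<in># \<nu> then ?f \<nu> else 0)" by (rule infsum_Idx_add_mset[OF k])
   also have "\<dots> = (\<Sum>\<^sub>\<infinity>\<nu>\<in>Idx. ?f \<nu>)"
    using False by (intro infsum_cong) (auto simp: rmul_nonneg ann_def not_in_iff)
   finally show ?thesis using I by (simp add: mm_def)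
  qed
 qed (auto simp: mm_def)
qed

lemma tr_rmul:
 assumes "k \<noteq> 0" "q \<noteq> 0"
 shows "tr q (rmul k A) = q powi k * tr q (lmul k A)"
proof (cases "k < 0")
 case True
 define j where "j = nat (- k)"
 have j: "j > 0" "k = - int j" using True by (auto simp: j_def)
 have "tr q (lmul k A) = (\<Sum>\<^sub>\<infinity>\<mu>\<in>Idx. if j \<in># \<mu> then A (\<mu> - {#j#}) \<mu> * q ^ deg \<mu> else 0)"
  unfolding tr_def by (intro infsum_cong) (simp add: j lmul_def cre_def)
 also have "\<dots> = (\<Sum>\<^sub>\<infinity>\<mu>\<in>Idx. A \<mu> (add_mset j \<mu>) * q ^ deg (add_mset j \<mu>))"
  by (subst infsum_Idx_add_mset[OF j(1), symmetric]) simp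
 also have "\<dots> = (\<Sum>\<^sub>\<infinity>\<mu>\<in>Idx. q ^ j * (rmul k A \<mu> \<mu> * q ^ deg \<mu>))"
  using j by (intro infsum_cong) (simp add: rmul_def power_add)
 also have "\<dots> = q ^ j * tr q (rmul k A)" by (simp add: tr_def infsum_cmult_right')
 finally show ?thesis using assms by (simp add: j power_int_minus)
next
 case False
 define j where "j = nat k"
 have j: "j > 0" "k = int j" using False assms by (auto simp: j_def)
 let ?f = "\<lambda>\<mu>. rmul k A \<mu> \<mu> * q ^ deg \<mu>"
 have "tr q (rmul k A) = (\<Sum>\<^sub>\<infinity>\<mu>\<in>Idx. if j \<in># \<mu> then ?f \<mu> else 0)"
  unfolding tr_def by (intro infsum_cong) (auto simp: j rmul_nonneg ann_def not_in_iff)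
 also have "\<dots> = (\<Sum>\<^sub>\<infinity>\<mu>\<in>Idx. ?f (add_mset j \<mu>))" by (rule infsum_Idx_add_mset[OF j(1), symmetric])
 also have "\<dots> = (\<Sum>\<^sub>\<infinity>\<mu>\<in>Idx. q ^ j * (lmul k A \<mu> \<mu> * q ^ deg \<mu>))"
  using j by (intro infsum_cong) (simp add: rmul_nonneg ann_def lmul_def power_add)
 also have "\<dots> = q ^ j * tr q (lmul k A)" by (simp add: tr_def infsum_cmult_right')
 finally show ?thesis by (simp add: j)
qed

lemma tr_abs_summable:
 assumes A: "tame A x y" and q: "norm q * y < x"
 shows "(\<lambda>\<mu>. norm (A \<mu> \<mu> * q ^ deg \<mu>)) summable_on Idx"
proof -
 obtain s where s: "y < s" "norm q * s < x"
 proof (cases "q = 0")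
  case True
  thus ?thesis using that[of "y + 1"] tame_pos[OF A] by simp
 next
  case False
  hence "y < x / norm q" using q by (simp add: field_simps)
  then obtain s where "y < s" "s < x / norm q" using dense by blast
  thus ?thesis using that[of s] False by (simp add: field_simps)
 qed
 have s0: "s > 0" using s tame_pos[OF A] by simp
 have "max 0 (norm q * s) < x" using s tame_pos[OF A] by simp
 then obtain r where r: "max 0 (norm q * s) < r" "r < x" using dense by blast
 hence r': "0 < r" "norm q * s < r" by simp_all
 obtain C where C: "bnd A r s C" using tameD[OF A r'(1) r(2) s(1)] by blast
 show ?thesis
 proof (rule summable_on_comparison_test)
  show "(\<lambda>\<mu>. C * (norm q * s / r) ^ deg \<mu>) summable_on Idx" using r' s0 by (intro summable_on_cmult_right summable_Idx) auto
  fix \<mu> assume I: "\<mu> \<in> Idx"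
  have "norm (A \<mu> \<mu> * q ^ deg \<mu>) \<le> C * (wr s \<mu> / wr r \<mu>) * norm q ^ deg \<mu>"
   unfolding norm_mult norm_power by (intro mult_right_mono bnd_entry[OF C r'(1) I I]) simp
  also have "\<dots> = C * (norm q * s / r) ^ deg \<mu>" using wgt_pos[OF I] by (simp add: power_divide power_mult_distrib)
  finally show "norm (A \<mu> \<mu> * q ^ deg \<mu>) \<le> C * (norm q * s / r) ^ deg \<mu>" .
 qed simp
qed

lemma tr_add:
 assumes "tame A x y" "tame B x y" "norm q * y < x"
 shows "tr q (\<lambda>\<mu> \<xi>. A \<mu> \<xi> + B \<mu> \<xi>) = tr q A + tr q B" unfolding tr_def distrib_right
 by (rule infsum_add[OF abs_summable_summable[OF tr_abs_summable[OF assms(1,3)]] abs_summable_summable[OF tr_abs_summable[OF assms(2,3)]]])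

lemma tr_sum:
 assumes "\<And>i. i \<in> S ==> tame (A i) x y" "norm q * y < x" "0 < x" "0 < y"
 shows "tr q (\<lambda>\<mu> \<xi>. \<Sum>i\<in>S. A i \<mu> \<xi>) = (\<Sum>i\<in>S. tr q (A i))" using assms(1)
proof (induction S rule: infinite_finite_induct)
 case (insert i S)
 have "tr q (\<lambda>\<mu> \<xi>. A i \<mu> \<xi> + (\<Sum>j\<in>S. A j \<mu> \<xi>)) = tr q (A i) + tr q (\<lambda>\<mu> \<xi>. \<Sum>j\<in>S. A j \<mu> \<xi>)"
  using insert.prems assms by (intro tr_add[OF _ tame_sum assms(2)]) auto
 thus ?case using insert by simp
qed (simp_all add: tr_def)

section \<open>Moving modes around the trace\<close>

definition prodf :: "(nat => fock_matrix) => nat list => fock_matrix" where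
 "prodf W is = foldr (\<lambda>i. mm (W i)) is idm"

lemma prodf_simps [simp]: "prodf W [] = idm" "prodf W (i # is) = mm (W i) (prodf W is)" by (simp_all add: prodf_def)

lemma prodf_cong: "(\<And>i. i \<in> set is ==> W i = V i) ==> prodf W is = prodf V is" by (induction "is") auto

definition chain :: "(nat => fock_matrix) => (nat => real) => real => real => nat list => bool" where
 "chain W x lo hi is \<longleftrightarrow> 0 < lo \<and> lo < hi \<and> (\<forall>i\<in>set is. lo < x i \<and> x i < hi \<and> tame (W i) (x i) (x i))
  \<and> sorted_wrt (\<lambda>i j. x i < x j) is"

lemma chain_upd: "chain W x lo hi is ==> tame A (x l) (x l) ==> chain (W(l := A)) x lo hi is" by (auto simp: chain_def)

lemma chain_tame: "chain W x lo hi is ==> i \<in> set is ==> tame (W i) (x i) (x i)" by (simp add: chain_def)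

lemma chain_split:
 assumes "chain W x lo hi (as @ bs)"
 obtains m m' where "m < m'" "chain W x lo m as" "chain W x m' hi bs"
proof -
 define M where "M = Max (insert lo (x ` set as))"
 define N where "N = Min (insert hi (x ` set bs))"
 have c: "0 < lo" "lo < hi" "\<And>i. i \<in> set as \<union> set bs ==> lo < x i \<and> x i < hi \<and> tame (W i) (x i) (x i)"
  "sorted_wrt (\<lambda>i j. x i < x j) as" "sorted_wrt (\<lambda>i j. x i < x j) bs"
  "\<And>i j. i \<in> set as ==> j \<in> set bs ==> x i < x j" using assms by (auto simp: chain_def sorted_wrt_append)
 have "M \<in> insert lo (x ` set as)" unfolding M_def by (rule Max_in) auto
 moreover have "N \<in> insert hi (x ` set bs)" unfolding N_def by (rule Min_in) auto
 ultimately have "M < N" using c by auto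
 then obtain m where m: "M < m" "m < N" using dense by blast
 obtain m' where m': "m < m'" "m' < N" using dense m(2) by blast
 have "lo \<le> M" "\<And>i. i \<in> set as ==> x i \<le> M" unfolding M_def by (auto intro!: Max_ge)
 moreover have "N \<le> hi" "\<And>i. i \<in> set bs ==> N \<le> x i" unfolding N_def by (auto intro!: Min_le)
 ultimately have "chain W x lo m as" "chain W x m' hi bs" using c m m' unfolding chain_def by (fastforce)+
 with m'(1) show ?thesis by (rule that)
qed

lemma chain_Cons:
 assumes "chain W x lo hi (i # bs)"
 obtains m where "x i < m" "chain W x m hi bs" "tame (W i) (x i) (x i)" "lo < x i"
proof -
 obtain m m' where "m < m'" "chain W x lo m [i]" "chain W x m' hi bs" using chain_split[of W x lo hi "[i]" bs] assms by auto
 thus ?thesis by (intro that[of m']) (auto simp: chain_def)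
qed

lemma tame_prodf: "chain W x lo hi is ==> tame (prodf W is) lo hi"
proof (induction "is" arbitrary: lo)
 case Nil
 thus ?case by (auto simp: chain_def intro: tame_idm)
next
 case (Cons i "is")
 obtain m where m: "x i < m" "chain W x m hi is" "tame (W i) (x i) (x i)" "lo < x i" using chain_Cons[OF Cons.prems] .
 have "tame (mm (W i) (prodf W is)) (x i) hi" by (rule tame_mm[OF m(3) Cons.IH[OF m(2)] m(1)])
 thus ?case using Cons.prems m(4) by (auto simp: chain_def elim!: tame_mono)
qed

lemma mm_idm_left:
 assumes "\<And>\<mu> \<xi>. \<not> (\<mu> \<in> Idx \<and> \<xi> \<in> Idx) ==> P \<mu> \<xi> = 0"
 shows "mm idm P = P"
proof (intro ext)
 fix \<mu> \<xi>
 have "(\<Sum>\<^sub>\<infinity>\<nu>\<in>Idx. idm \<mu> \<nu> * P \<nu> \<xi>) = P \<mu> \<xi>" if "\<mu> \<in> Idx"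
 proof -
  have "(\<Sum>\<^sub>\<infinity>\<nu>\<in>Idx. idm \<mu> \<nu> * P \<nu> \<xi>) = (\<Sum>\<^sub>\<infinity>\<nu>\<in>{\<mu>}. P \<nu> \<xi>)"
   by (rule infsum_cong_neutral) (use that in \<open>auto simp: idm_def\<close>)
  thus ?thesis by simp
 qed
 thus "mm idm P \<mu> \<xi> = P \<mu> \<xi>" using assms[of \<mu> \<xi>] by (auto simp: mm_def)
qed

lemma prodf_outside: "\<not> (\<mu> \<in> Idx \<and> \<xi> \<in> Idx) ==> prodf W is \<mu> \<xi> = 0"
 by (cases "is") (auto simp: mm_def idm_def)

lemma prodf_append: "chain W x lo hi (as @ bs) ==> mm (prodf W as) (prodf W bs) = prodf W (as @ bs)"
proof (induction as arbitrary: lo)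
 case Nil
 show ?case by (simp add: mm_idm_left prodf_outside)
next
 case (Cons i as)
 obtain m where m: "x i < m" "chain W x m hi (as @ bs)" "tame (W i) (x i) (x i)" using chain_Cons[of W x lo hi i "as @ bs"] Cons.prems by auto
 obtain k k' where k: "k < k'" "chain W x m k as" "chain W x k' hi bs" using chain_split[OF m(2)] .
 show ?case using mm_assoc[OF m(3) tame_prodf[OF k(2)] tame_prodf[OF k(3)] m(1) k(1)] Cons.IH[OF m(2)] by simp
qed

lemma lmul_idm: "k \<noteq> 0 ==> lmul k idm = rmul k idm"
proof (intro ext)
 fix \<mu> \<xi> assume k: "k \<noteq> 0"
 show "lmul k idm \<mu> \<xi> = rmul k idm \<mu> \<xi>"
 proof (cases "k < 0")
  case True
  hence j: "nat (- k) > 0" by simp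
  have "nat (- k) \<in># \<mu> \<and> \<mu> - {#nat (- k)#} \<in> Idx \<and> \<mu> - {#nat (- k)#} = \<xi> \<longleftrightarrow> \<mu> \<in> Idx \<and> \<mu> = add_mset (nat (- k)) \<xi>"
   using diff_notin_Idx[OF _ j, of \<mu>] by auto
  thus ?thesis using True by (auto simp: lmul_neg cre_def rmul_def idm_def)
 next
  case False
  hence j: "nat k > 0" using k by simp
  have "add_mset (nat k) \<mu> = \<xi> \<longleftrightarrow> nat k \<in># \<xi> \<and> \<mu> = \<xi> - {#nat k#}" by auto
  moreover have "nat k \<notin># \<xi> ==> count \<xi> (nat k) = 0" by (simp add: not_in_iff)
  ultimately show ?thesis using False j by (auto simp: lmul_def rmul_nonneg ann_def idm_def)
 qed
qed

lemma lmul_prodf: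
 assumes k: "k \<noteq> 0"
 shows "chain W x lo hi is ==> distinct is ==>
  lmul k (prodf W is) = (\<lambda>\<mu> \<xi>. rmul k (prodf W is) \<mu> \<xi> + (\<Sum>l\<in>set is. prodf (W(l := comm k (W l))) is \<mu> \<xi>))"
proof (induction "is" arbitrary: lo)
 case Nil
 thus ?case by (simp add: lmul_idm[OF k])
next
 case (Cons i "is")
 obtain m where m: "x i < m" "chain W x m hi is" "tame (W i) (x i) (x i)" using chain_Cons[OF Cons.prems(1)] .
 have i: "i \<notin> set is" "distinct is" using Cons.prems(2) by auto
 define P where "P = prodf W is"
 define Q where "Q = (\<lambda>l. prodf (W(l := comm k (W l))) is)"
 have P: "tame P m hi" unfolding P_def by (rule tame_prodf[OF m(2)])
 have Q: "tame (Q l) m hi" if "l \<in> set is" for l unfolding Q_def using m(2) that k by (intro tame_prodf[of _ x] chain_upd tame_comm chain_tame)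
 have mh: "0 < m" "0 < hi" using m(2) by (auto simp: chain_def)
 have e1: "lmul k (W i) = (\<lambda>\<mu> \<xi>. rmul k (W i) \<mu> \<xi> + comm k (W i) \<mu> \<xi>)" by (simp add: comm_def fun_eq_iff)
 show ?case
 proof (intro ext)
  fix \<mu> \<xi>
  have "lmul k (prodf W (i # is)) \<mu> \<xi> = mm (lmul k (W i)) P \<mu> \<xi>" by (simp add: lmul_mm[OF k] P_def)
  also have "\<dots> = mm (rmul k (W i)) P \<mu> \<xi> + mm (comm k (W i)) P \<mu> \<xi>"
   unfolding e1 by (rule mm_add_left[OF tame_rmul[OF m(3) k] tame_comm[OF m(3) k] P m(1)])
  also have "mm (rmul k (W i)) P = mm (W i) (lmul k P)" by (rule mm_rmul_lmul[OF k])
  also have "lmul k P = (\<lambda>\<mu> \<xi>. rmul k P \<mu> \<xi> + (\<Sum>l\<in>set is. Q l \<mu> \<xi>))"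
   unfolding P_def Q_def by (rule Cons.IH[OF m(2) i(2)])
  also have "mm (W i) \<dots> \<mu> \<xi> = mm (W i) (rmul k P) \<mu> \<xi> + mm (W i) (\<lambda>\<mu> \<xi>. \<Sum>l\<in>set is. Q l \<mu> \<xi>) \<mu> \<xi>"
   by (rule mm_add_right[OF m(3) tame_rmul[OF P k] tame_sum[OF mh Q] m(1)])
  also have "mm (W i) (\<lambda>\<mu> \<xi>. \<Sum>l\<in>set is. Q l \<mu> \<xi>) \<mu> \<xi> = (\<Sum>l\<in>set is. mm (W i) (Q l) \<mu> \<xi>)"
   by (rule mm_sum_right[OF Q m(3) m(1) mh])
  also have "mm (W i) (rmul k P) = rmul k (prodf W (i # is))" by (simp add: rmul_mm[OF k] P_def)
  also have "(\<Sum>l\<in>set is. mm (W i) (Q l) \<mu> \<xi>) = (\<Sum>l\<in>set is. prodf (W(l := comm k (W l))) (i # is) \<mu> \<xi>)"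
   using i(1) by (intro sum.cong) (auto simp: Q_def)
  also have "mm (comm k (W i)) P = prodf (W(i := comm k (W i))) (i # is)"
  proof -
   have "prodf (W(i := comm k (W i))) is = P" unfolding P_def by (rule prodf_cong) (use i in auto)
   thus ?thesis by simp
  qed
  finally show "lmul k (prodf W (i # is)) \<mu> \<xi> = rmul k (prodf W (i # is)) \<mu> \<xi> + (\<Sum>l\<in>set (i # is). prodf (W(l := comm k (W l))) (i # is) \<mu> \<xi>)"
   using i(1) by (simp add: add_ac del: prodf_simps fun_upd_apply)
 qed
qed

text \<open>Moving \<open>a(k)\<close> once around the trace.\<close>

lemma tr_boundary:
 assumes c: "chain W x lo hi (as @ bs)" and d: "distinct (as @ bs)" and q: "norm q * hi < lo" "q \<noteq> 0" and k: "k \<noteq> 0"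
 shows "(1 - q powi k) * tr q (mm (prodf W as) (lmul k (prodf W bs))) =
  (\<Sum>l\<in>set bs. tr q (prodf (W(l := comm k (W l))) (as @ bs)))
  + q powi k * (\<Sum>l\<in>set as. tr q (prodf (W(l := comm k (W l))) (as @ bs)))"
proof -
 obtain m m' where m: "m < m'" "chain W x lo m as" "chain W x m' hi bs" using chain_split[OF c] .
 define A where "A = prodf W as"
 define B where "B = prodf W bs"
 let ?W = "\<lambda>l. W(l := comm k (W l))"
 have A: "tame A lo m" unfolding A_def by (rule tame_prodf[OF m(2)])
 have B: "tame B m' hi" unfolding B_def by (rule tame_prodf[OF m(3)])
 have Wc: "chain (?W l) x lo hi (as @ bs)" if "l \<in> set (as @ bs)" for l using c that k by (intro chain_upd tame_comm chain_tame)
 have A': "tame (prodf (?W l) as) lo m" if "l \<in> set as" for l using m(2) that k by (intro tame_prodf[of _ x] chain_upd tame_comm chain_tame)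
 have B': "tame (prodf (?W l) bs) m' hi" if "l \<in> set bs" for l using m(3) that k by (intro tame_prodf[of _ x] chain_upd tame_comm chain_tame)
 have pos: "0 < lo" "0 < hi" "0 < m" "0 < m'" using m by (auto simp: chain_def)
 have Ae: "prodf (?W l) as = A" if "l \<in> set bs" for l unfolding A_def using d that by (intro prodf_cong) auto
 have Be: "prodf (?W l) bs = B" if "l \<in> set as" for l unfolding B_def using d that by (intro prodf_cong) auto
 have eb: "mm A (prodf (?W l) bs) = prodf (?W l) (as @ bs)" if "l \<in> set bs" for l using prodf_append[OF Wc, of l] that by (simp add: Ae)
 have ea: "mm (prodf (?W l) as) B = prodf (?W l) (as @ bs)" if "l \<in> set as" for l using prodf_append[OF Wc, of l] that by (simp add: Be)
 have 1: "mm A (lmul k B) = (\<lambda>\<mu> \<xi>. rmul k (mm A B) \<mu> \<xi> + (\<Sum>l\<in>set bs. prodf (?W l) (as @ bs) \<mu> \<xi>))"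
 proof (intro ext)
  fix \<mu> \<xi>
  have "lmul k B = (\<lambda>\<mu> \<xi>. rmul k B \<mu> \<xi> + (\<Sum>l\<in>set bs. prodf (?W l) bs \<mu> \<xi>))"
   unfolding B_def by (rule lmul_prodf[OF k m(3)]) (use d in auto)
  hence "mm A (lmul k B) \<mu> \<xi> = mm A (rmul k B) \<mu> \<xi> + mm A (\<lambda>\<mu> \<xi>. \<Sum>l\<in>set bs. prodf (?W l) bs \<mu> \<xi>) \<mu> \<xi>"
   by (simp only:) (rule mm_add_right[OF A tame_rmul[OF B k] tame_sum[OF pos(4,2) B'] m(1)])
  also have "mm A (\<lambda>\<mu> \<xi>. \<Sum>l\<in>set bs. prodf (?W l) bs \<mu> \<xi>) \<mu> \<xi> = (\<Sum>l\<in>set bs. mm A (prodf (?W l) bs) \<mu> \<xi>)"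
   by (rule mm_sum_right[OF B' A m(1) pos(4,2)])
  also have "\<dots> = (\<Sum>l\<in>set bs. prodf (?W l) (as @ bs) \<mu> \<xi>)" using eb by (intro sum.cong) auto
  finally show "mm A (lmul k B) \<mu> \<xi> = rmul k (mm A B) \<mu> \<xi> + (\<Sum>l\<in>set bs. prodf (?W l) (as @ bs) \<mu> \<xi>)"
   by (simp only: rmul_mm[OF k])
 qed
 have 2: "lmul k (mm A B) = (\<lambda>\<mu> \<xi>. mm A (lmul k B) \<mu> \<xi> + (\<Sum>l\<in>set as. prodf (?W l) (as @ bs) \<mu> \<xi>))"
 proof (intro ext)
  fix \<mu> \<xi>
  have "lmul k A = (\<lambda>\<mu> \<xi>. rmul k A \<mu> \<xi> + (\<Sum>l\<in>set as. prodf (?W l) as \<mu> \<xi>))"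
   unfolding A_def by (rule lmul_prodf[OF k m(2)]) (use d in auto)
  hence "mm (lmul k A) B \<mu> \<xi> = mm (rmul k A) B \<mu> \<xi> + mm (\<lambda>\<mu> \<xi>. \<Sum>l\<in>set as. prodf (?W l) as \<mu> \<xi>) B \<mu> \<xi>"
   by (simp only:) (rule mm_add_left[OF tame_rmul[OF A k] tame_sum[OF pos(1,3) A'] B m(1)])
  also have "mm (\<lambda>\<mu> \<xi>. \<Sum>l\<in>set as. prodf (?W l) as \<mu> \<xi>) B \<mu> \<xi> = (\<Sum>l\<in>set as. mm (prodf (?W l) as) B \<mu> \<xi>)"
   by (rule mm_sum_left[OF A' B m(1) pos(1,3)])
  also have "\<dots> = (\<Sum>l\<in>set as. prodf (?W l) (as @ bs) \<mu> \<xi>)" using ea by (intro sum.cong) auto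
  finally show "lmul k (mm A B) \<mu> \<xi> = mm A (lmul k B) \<mu> \<xi> + (\<Sum>l\<in>set as. prodf (?W l) (as @ bs) \<mu> \<xi>)"
   by (simp only: lmul_mm[OF k] mm_rmul_lmul[OF k])
 qed
 have T: "tame (prodf (?W l) (as @ bs)) lo hi" if "l \<in> set as \<union> set bs" for l using tame_prodf[OF Wc] that by simp
 have M: "tame (mm A B) lo hi" "tame (mm A (lmul k B)) lo hi" by (intro tame_mm[OF A _ m(1)] tame_lmul B k)+
 have t1: "tr q (mm A (lmul k B)) = tr q (rmul k (mm A B)) + (\<Sum>l\<in>set bs. tr q (prodf (?W l) (as @ bs)))"
  unfolding 1 using T pos by (subst tr_add[OF tame_rmul[OF M(1) k] tame_sum q(1)]) (auto intro!: tr_sum[OF _ q(1)])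
 have t2: "tr q (lmul k (mm A B)) = tr q (mm A (lmul k B)) + (\<Sum>l\<in>set as. tr q (prodf (?W l) (as @ bs)))"
  unfolding 2 using T pos by (subst tr_add[OF M(2) tame_sum q(1)]) (auto intro!: tr_sum[OF _ q(1)])
 show ?thesis using t1 unfolding tr_rmul[OF k q(2)] t2 A_def[symmetric] B_def[symmetric] by (simp add: algebra_simps)
qed

lemma tr_prodf_slot:
 assumes c: "chain W x lo hi (as @ i # bs)" and "distinct (as @ i # bs)" and A: "tame A (x i) (x i)"
 shows "tr q (prodf (W(i := A)) (as @ i # bs)) = tr q (mm (prodf W as) (mm A (prodf W bs)))"
proof -
 have "mm (prodf (W(i := A)) as) (prodf (W(i := A)) (i # bs)) = prodf (W(i := A)) (as @ i # bs)" by (rule prodf_append[OF chain_upd[OF c A]])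
 moreover have "prodf (W(i := A)) as = prodf W as" "prodf (W(i := A)) bs = prodf W bs" using assms(2) by (auto intro!: prodf_cong)
 ultimately show ?thesis by simp
qed

lemma lmul_outside:
 assumes "\<And>\<mu> \<xi>. \<not> (\<mu> \<in> Idx \<and> \<xi> \<in> Idx) ==> P \<mu> \<xi> = 0" "k \<noteq> 0" "\<not> (\<mu> \<in> Idx \<and> \<xi> \<in> Idx)"
 shows "lmul k P \<mu> \<xi> = 0"
 using assms(1)[of "\<mu> - {#nat (- k)#}" \<xi>] assms(1)[of "add_mset (nat k) \<mu>" \<xi>] assms(2,3) diff_notin_Idx[of \<mu> "nat (- k)"]
 by (auto simp: lmul_def cre_def)

lemma tr_slot_rmul:
 assumes c: "chain W x lo hi (as @ i # bs)" and d: "distinct (as @ i # bs)" and q: "norm q * hi < lo" "q \<noteq> 0" and k: "k \<noteq> 0"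
 defines "T \<equiv> \<lambda>V. tr q (prodf V (as @ i # bs))"
 shows "(1 - q powi k) * T (W(i := rmul k (W i))) =
  (\<Sum>l\<in>set bs. T (W(l := comm k (W l)))) + q powi k * (\<Sum>l\<in>insert i (set as). T (W(l := comm k (W l))))"
proof -
 obtain m m' where m: "m < m'" "chain W x lo m as" "chain W x m' hi (i # bs)" using chain_split[OF c] .
 obtain m'' where m'': "x i < m''" "chain W x m'' hi bs" "tame (W i) (x i) (x i)" "m' < x i" using chain_Cons[OF m(3)] .
 let ?X = "prodf W as" and ?Y = "prodf W bs"
 have X: "tame ?X lo m" by (rule tame_prodf[OF m(2)])
 have Y: "tame ?Y m'' hi" by (rule tame_prodf[OF m''(2)])
 obtain y y' where y: "x i < y" "y < y'" "y' < m''" using dense m''(1) by (metis less_trans)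
 have pos: "0 < y" "0 < x i" using m(3) y m''(4) by (auto simp: chain_def)
 have mx: "m < x i" using m(1) m''(4) by simp
 have I: "tame idm y y" using pos by (simp add: tame_idm)
 have Z: "tame (lmul k ?Y) m'' hi" by (rule tame_lmul[OF Y k])
 have "mm (prodf W (as @ [i])) (lmul k ?Y) = mm (mm ?X (mm (W i) idm)) (lmul k ?Y)"
  using prodf_append[of W x lo hi as "[i]"] c by (simp add: chain_def sorted_wrt_append)
 also have "\<dots> = mm ?X (mm (mm (W i) idm) (lmul k ?Y))" using mx y by (intro mm_assoc[OF X tame_mm[OF m''(3) I] Z]) auto
 also have "mm (mm (W i) idm) (lmul k ?Y) = mm (W i) (mm idm (lmul k ?Y))" using y by (intro mm_assoc[OF m''(3) I Z]) auto
 also have "mm idm (lmul k ?Y) = lmul k ?Y" by (intro mm_idm_left lmul_outside[OF prodf_outside k])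
 also have "mm (W i) (lmul k ?Y) = mm (rmul k (W i)) ?Y" by (rule mm_rmul_lmul[OF k, symmetric])
 finally have "tr q (mm (prodf W (as @ [i])) (lmul k ?Y)) = T (W(i := rmul k (W i)))"
  unfolding T_def by (subst tr_prodf_slot[OF c d tame_rmul[OF m''(3) k]]) simp
 thus ?thesis using tr_boundary[of W x lo hi "as @ [i]" bs q k] c d q k by (simp add: T_def)
qed

lemma tr_slot_sum:
 assumes c: "chain W x lo hi (as @ i # bs)" and d: "distinct (as @ i # bs)" and q: "norm q * hi < lo"
  and A: "\<And>j. j \<in> S ==> tame (A j) (x i) (x i)"
 shows "tr q (prodf (W(i := \<lambda>\<mu> \<xi>. \<Sum>j\<in>S. y j * A j \<mu> \<xi>)) (as @ i # bs)) = (\<Sum>j\<in>S. y j * tr q (prodf (W(i := A j)) (as @ i # bs)))"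
proof -
 obtain m m' where m: "m < m'" "chain W x lo m as" "chain W x m' hi (i # bs)" using chain_split[OF c] .
 obtain m'' where m'': "x i < m''" "chain W x m'' hi bs" "tame (W i) (x i) (x i)" "m' < x i" using chain_Cons[OF m(3)] .
 let ?X = "prodf W as" and ?Y = "prodf W bs"
 have X: "tame ?X lo m" by (rule tame_prodf[OF m(2)])
 have Y: "tame ?Y m'' hi" by (rule tame_prodf[OF m''(2)])
 have pos: "0 < x i" "0 < lo" "0 < hi" using m(2,3) m''(4) by (auto simp: chain_def)
 have mx: "m < x i" using m(1) m''(4) by simp
 have yA: "tame (\<lambda>\<mu> \<xi>. y j * A j \<mu> \<xi>) (x i) (x i)" if "j \<in> S" for j by (rule tame_scale[OF A[OF that]])
 have sc: "mm (\<lambda>\<mu> \<xi>. c * V \<mu> \<xi>) R = (\<lambda>\<mu> \<xi>. c * mm V R \<mu> \<xi>)" "mm R (\<lambda>\<mu> \<xi>. c * V \<mu> \<xi>) = (\<lambda>\<mu> \<xi>. c * mm R V \<mu> \<xi>)"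
  "tr q (\<lambda>\<mu> \<xi>. c * V \<mu> \<xi>) = c * tr q V" for c V R
  by (auto simp: mm_def tr_def mult.assoc mult.left_commute[of _ c] infsum_cmult_right' fun_eq_iff)
 have "mm (\<lambda>\<mu> \<xi>. \<Sum>j\<in>S. y j * A j \<mu> \<xi>) ?Y = (\<lambda>\<mu> \<xi>. \<Sum>j\<in>S. y j * mm (A j) ?Y \<mu> \<xi>)"
  using mm_sum_left[OF yA Y m''(1) pos(1,1)] by (intro ext) (simp add: sc)
 hence "mm ?X (mm (\<lambda>\<mu> \<xi>. \<Sum>j\<in>S. y j * A j \<mu> \<xi>) ?Y) = mm ?X (\<lambda>\<mu> \<xi>. \<Sum>j\<in>S. y j * mm (A j) ?Y \<mu> \<xi>)" by simp
 also have "\<dots> = (\<lambda>\<mu> \<xi>. \<Sum>j\<in>S. y j * mm ?X (mm (A j) ?Y) \<mu> \<xi>)"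
 proof (intro ext)
  fix \<mu> \<xi>
  show "mm ?X (\<lambda>\<mu> \<xi>. \<Sum>j\<in>S. y j * mm (A j) ?Y \<mu> \<xi>) \<mu> \<xi> = (\<Sum>j\<in>S. y j * mm ?X (mm (A j) ?Y) \<mu> \<xi>)"
   using mm_sum_right[of S "\<lambda>j \<mu> \<xi>. y j * mm (A j) ?Y \<mu> \<xi>" "x i" hi ?X lo m \<mu> \<xi>, OF tame_scale[OF tame_mm[OF A Y m''(1)]] X mx pos(1,3)]
   by (simp add: sc)
 qed
 finally have "tr q (mm ?X (mm (\<lambda>\<mu> \<xi>. \<Sum>j\<in>S. y j * A j \<mu> \<xi>) ?Y)) = tr q (\<lambda>\<mu> \<xi>. \<Sum>j\<in>S. y j * mm ?X (mm (A j) ?Y) \<mu> \<xi>)" by simp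
 also have "\<dots> = (\<Sum>j\<in>S. tr q (\<lambda>\<mu> \<xi>. y j * mm ?X (mm (A j) ?Y) \<mu> \<xi>))"
  by (rule tr_sum[OF tame_scale[OF tame_mm[OF X tame_mm[OF A Y m''(1)] mx]] q pos(2,3)])
 finally have e: "tr q (mm ?X (mm (\<lambda>\<mu> \<xi>. \<Sum>j\<in>S. y j * A j \<mu> \<xi>) ?Y)) = (\<Sum>j\<in>S. y j * tr q (mm ?X (mm (A j) ?Y)))"
  by (simp add: sc)
 have "tame (\<lambda>\<mu> \<xi>. \<Sum>j\<in>S. y j * A j \<mu> \<xi>) (x i) (x i)" by (rule tame_sum[OF pos(1,1) yA])
 thus ?thesis by (subst tr_prodf_slot[OF c d], assumption, subst e) (intro sum.cong refl, simp add: tr_prodf_slot[OF c d A])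
qed

lemma choose_q:
 fixes q :: complex
 assumes "norm q * y < x" "0 < x" "0 < y"
 obtains s r where "y < s" "norm q * s < r" "0 < r" "r < x"
proof -
 have "((\<lambda>s. norm q * s) \<longlongrightarrow> norm q * y) (at_right y)" by (intro tendsto_intros)
 hence "eventually (\<lambda>s. norm q * s < x) (at_right y)" using assms(1) by (rule order_tendstoD(2))
 moreover have "eventually (\<lambda>s. y < s) (at_right y)" by (rule eventually_at_right_less)
 ultimately have "eventually (\<lambda>s. y < s \<and> norm q * s < x) (at_right y)" by eventually_elim simp
 then obtain s where s: "y < s" "norm q * s < x" using eventually_happens[of _ "at_right y"] by auto
 obtain r where "max 0 (norm q * s) < r" "r < x" using dense[of "max 0 (norm q * s)" x] s assms by auto
 thus ?thesis using s by (intro that[of s r]) auto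
qed

context
 fixes X Y :: fock_matrix and q :: complex and x0 x1 y y' z0 z1 :: real
 assumes X: "tame X x0 x1" and Y: "tame Y z0 z1" and l: "x1 < y" "y' < z0" "norm q * z1 < x0"
begin

private abbreviation "cyc A \<equiv> (\<lambda>(\<xi>, \<mu>, \<nu>). X \<xi> \<mu> * (A \<mu> \<nu> * Y \<nu> \<xi>) * q ^ deg \<xi>)"

lemma cyc_summable:
 assumes A: "tame A y y'"
 shows "(\<lambda>t. norm (cyc A t)) summable_on Idx \<times> Idx \<times> Idx"
proof -
 obtain s1 r1 where 1: "x1 < s1" "s1 < r1" "r1 < y" "0 < s1" "0 < r1" using tame_choose[OF X A l(1)] .
 obtain s2 r2 where 2: "y' < s2" "s2 < r2" "r2 < z0" "0 < s2" "0 < r2" using tame_choose[OF A Y l(2)] .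
 obtain s3 r3 where 3: "z1 < s3" "norm q * s3 < r3" "0 < r3" "r3 < x0" using choose_q[OF l(3) tame_pos(1)[OF X] tame_pos(2)[OF Y]] .
 have s3: "s3 > 0" using 3 tame_pos[OF Y] by simp
 obtain K1 K2 K3 where K: "bnd X r3 s1 K1" "bnd A r1 s2 K2" "bnd Y r2 s3 K3"
  using tameD[OF X 3(3,4) 1(1)] tameD[OF A 1(5,3) 2(1)] tameD[OF Y 2(5,3) 3(1)] by blast
 let ?g = "\<lambda>\<xi>. (norm q * s3 / r3) ^ deg \<xi>" and ?h = "\<lambda>\<mu>. (s1 / r1) ^ deg \<mu>" and ?k = "\<lambda>\<nu>. (s2 / r2) ^ deg \<nu>"
 show ?thesis
 proof (rule summable_on_comparison_test)
  have g: "?g summable_on Idx" "?h summable_on Idx" "?k summable_on Idx" using 1 2 3 s3 by (auto intro!: summable_Idx)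
  have gg: "(\<lambda>(\<xi>, \<mu>, \<nu>). ?g \<xi> * (?h \<mu> * ?k \<nu>)) summable_on Idx \<times> Idx \<times> Idx"
   using summable_on_times[OF g(1) summable_on_times[OF g(2,3)]] 1 2 3 s3 by (simp add: case_prod_unfold)
  show "(\<lambda>(\<xi>, \<mu>, \<nu>). K1 * K2 * K3 * (?g \<xi> * (?h \<mu> * ?k \<nu>))) summable_on Idx \<times> Idx \<times> Idx"
   using summable_on_cmult_right[OF gg, of "K1 * K2 * K3"] by (simp add: case_prod_unfold)
  fix t assume "t \<in> Idx \<times> Idx \<times> Idx"
  then obtain \<xi> \<mu> \<nu> where t: "t = (\<xi>, \<mu>, \<nu>)" and I: "\<xi> \<in> Idx" "\<mu> \<in> Idx" "\<nu> \<in> Idx" by auto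
  have "norm (cyc A t) = norm (X \<xi> \<mu>) * (norm (A \<mu> \<nu>) * norm (Y \<nu> \<xi>)) * norm q ^ deg \<xi>"
   by (simp add: t norm_mult norm_power)
  also have "\<dots> \<le> K1 * ((wgt \<mu> * s1 ^ deg \<mu>) / (wgt \<xi> * r3 ^ deg \<xi>))
    * (K2 * ((wgt \<nu> * s2 ^ deg \<nu>) / (wgt \<mu> * r1 ^ deg \<mu>)) *
     (K3 * ((wgt \<xi> * s3 ^ deg \<xi>) / (wgt \<nu> * r2 ^ deg \<nu>)))) * norm q ^ deg \<xi>" using I 1 2 3 s3 K
   by (intro mult_right_mono mult_mono bnd_entry) (auto simp: bnd_def intro!: mult_nonneg_nonneg divide_nonneg_nonneg)
  also have "\<dots> = K1 * K2 * K3 * (?g \<xi> * (?h \<mu> * ?k \<nu>))"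
   using wgt_pos[OF I(1)] wgt_pos[OF I(2)] wgt_pos[OF I(3)] by (simp add: power_divide power_mult_distrib mult_ac)
  finally show "norm (cyc A t) \<le> (\<lambda>(\<xi>, \<mu>, \<nu>). K1 * K2 * K3 * (?g \<xi> * (?h \<mu> * ?k \<nu>))) t" by (simp add: t)
 qed simp
qed

lemma tr_eq_cyc:
 assumes A: "tame A y y'"
 shows "tr q (mm X (mm A Y)) = infsum (cyc A) (Idx \<times> Idx \<times> Idx)"
proof -
 note S = cyc_summable[OF A]
 have S1: "(\<lambda>(\<xi>, p). cyc A (\<xi>, p)) summable_on Idx \<times> (Idx \<times> Idx)"
  using abs_summable_summable[OF S] by (simp add: case_prod_unfold)
 have S2: "(\<lambda>(\<mu>, \<nu>). X \<xi> \<mu> * (A \<mu> \<nu> * Y \<nu> \<xi>) * q ^ deg \<xi>) summable_on Idx \<times> Idx" if "\<xi> \<in> Idx" for \<xi>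
  using summable_on_SigmaD1[OF S1 that] by simp
 have "infsum (cyc A) (Idx \<times> Idx \<times> Idx) = (\<Sum>\<^sub>\<infinity>\<xi>\<in>Idx. \<Sum>\<^sub>\<infinity>p\<in>Idx \<times> Idx. cyc A (\<xi>, p))"
  using infsum_Sigma'_banach[OF S1] by (simp add: case_prod_unfold)
 also have "\<dots> = (\<Sum>\<^sub>\<infinity>\<xi>\<in>Idx. \<Sum>\<^sub>\<infinity>\<mu>\<in>Idx. \<Sum>\<^sub>\<infinity>\<nu>\<in>Idx. X \<xi> \<mu> * (A \<mu> \<nu> * Y \<nu> \<xi>) * q ^ deg \<xi>)"
  by (rule infsum_cong) (use infsum_Sigma'_banach[OF S2] in simp)
 also have "\<dots> = tr q (mm X (mm A Y))" unfolding tr_def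
  by (rule infsum_cong) (simp add: mm_def infsum_cmult_left' infsum_cmult_right' cong: infsum_cong)
 finally show ?thesis ..
qed

lemma tr_slot_infsum:
 assumes D: "tame D y y'"
  and s: "\<And>\<mu> \<nu>. \<mu> \<in> Idx ==> \<nu> \<in> Idx ==> (\<lambda>j. norm (A j \<mu> \<nu>)) summable_on J"
  and le: "\<And>\<mu> \<nu>. \<mu> \<in> Idx ==> \<nu> \<in> Idx ==> (\<Sum>\<^sub>\<infinity>j\<in>J. norm (A j \<mu> \<nu>)) \<le> norm (D \<mu> \<nu>)"
  and B: "\<And>\<mu> \<nu>. \<mu> \<in> Idx ==> \<nu> \<in> Idx ==> B \<mu> \<nu> = (\<Sum>\<^sub>\<infinity>j\<in>J. A j \<mu> \<nu>)"
 shows "((\<lambda>j. tr q (mm X (mm (A j) Y))) has_sum tr q (mm X (mm B Y))) J"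
proof -
 let ?I = "Idx \<times> Idx \<times> Idx"
 have A: "tame (A j) y y'" if "j \<in> J" for j
 proof (rule tame_le[OF D])
  fix \<mu> \<nu> assume I: "\<mu> \<in> Idx" "\<nu> \<in> Idx"
  have "(\<Sum>j\<in>{j}. norm (A j \<mu> \<nu>)) \<le> (\<Sum>\<^sub>\<infinity>j\<in>J. norm (A j \<mu> \<nu>))"
   using that by (intro finite_sum_le_infsum s I) auto
  thus "norm (A j \<mu> \<nu>) \<le> norm (D \<mu> \<nu>)" using le[OF I] by simp
 qed
 have B': "tame B y y'"
 proof (rule tame_le[OF D])
  fix \<mu> \<nu> assume I: "\<mu> \<in> Idx" "\<nu> \<in> Idx"
  show "norm (B \<mu> \<nu>) \<le> norm (D \<mu> \<nu>)" unfolding B[OF I] using norm_infsum_bound[OF s[OF I]] le[OF I] by linarith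
 qed
 define F where "F = (\<lambda>(t, j). cyc (A j) t)"
 have "(\<lambda>p. norm (F p)) summable_on ?I \<times> J"
 proof (rule Infinite_Sum.abs_summable_on_Sigma_iff[THEN iffD2], intro conjI ballI)
  fix t assume "t \<in> ?I"
  then obtain \<xi> \<mu> \<nu> where t: "t = (\<xi>, \<mu>, \<nu>)" and I: "\<xi> \<in> Idx" "\<mu> \<in> Idx" "\<nu> \<in> Idx" by auto
  show "(\<lambda>j. norm (F (t, j))) summable_on J"
   using summable_on_cmult_right[OF s[OF I(2,3)], of "norm (X \<xi> \<mu>) * norm (Y \<nu> \<xi>) * norm (q ^ deg \<xi>)"]
   by (simp add: F_def t norm_mult mult_ac)
 next
  show "(\<lambda>t. norm (\<Sum>\<^sub>\<infinity>j\<in>J. norm (F (t, j)))) summable_on ?I"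
  proof (rule summable_on_comparison_test[OF cyc_summable[OF D]])
   fix t assume "t \<in> ?I"
   then obtain \<xi> \<mu> \<nu> where t: "t = (\<xi>, \<mu>, \<nu>)" and I: "\<xi> \<in> Idx" "\<mu> \<in> Idx" "\<nu> \<in> Idx" by auto
   let ?c = "norm (X \<xi> \<mu>) * norm (Y \<nu> \<xi>) * norm (q ^ deg \<xi>)"
   have "(\<Sum>\<^sub>\<infinity>j\<in>J. norm (F (t, j))) = ?c * (\<Sum>\<^sub>\<infinity>j\<in>J. norm (A j \<mu> \<nu>))"
    by (simp add: F_def t norm_mult infsum_cmult_right'[symmetric] mult_ac)
   also have "\<dots> \<le> ?c * norm (D \<mu> \<nu>)" by (intro mult_left_mono le I) auto
   also have "\<dots> = norm (cyc D t)" by (simp add: t norm_mult mult_ac)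
   finally show "norm (\<Sum>\<^sub>\<infinity>j\<in>J. norm (F (t, j))) \<le> norm (cyc D t)" by (simp add: infsum_nonneg)
  qed simp
 qed
 hence F: "F summable_on ?I \<times> J" by (rule abs_summable_summable)
 hence F': "(\<lambda>(j, t). F (t, j)) summable_on J \<times> ?I" using summable_on_swap by blast
 have Aj: "(\<Sum>\<^sub>\<infinity>t\<in>?I. F (t, j)) = tr q (mm X (mm (A j) Y))" if "j \<in> J" for j
  using tr_eq_cyc[OF A[OF that]] by (simp add: F_def)
 have "(\<Sum>\<^sub>\<infinity>j\<in>J. tr q (mm X (mm (A j) Y))) = (\<Sum>\<^sub>\<infinity>j\<in>J. \<Sum>\<^sub>\<infinity>t\<in>?I. F (t, j))"
  by (intro infsum_cong) (simp add: Aj)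
 also have "\<dots> = (\<Sum>\<^sub>\<infinity>t\<in>?I. \<Sum>\<^sub>\<infinity>j\<in>J. F (t, j))" by (rule infsum_swap_banach[OF F'])
 also have "\<dots> = infsum (cyc B) ?I"
 proof (rule infsum_cong)
  fix t assume "t \<in> ?I"
  then obtain \<xi> \<mu> \<nu> where t: "t = (\<xi>, \<mu>, \<nu>)" and I: "\<xi> \<in> Idx" "\<mu> \<in> Idx" "\<nu> \<in> Idx" by auto
  show "(\<Sum>\<^sub>\<infinity>j\<in>J. F (t, j)) = cyc B t" by (simp add: F_def t B[OF I(2,3)] infsum_cmult_left' infsum_cmult_right')
 qed
 also have "\<dots> = tr q (mm X (mm B Y))" by (rule tr_eq_cyc[OF B', symmetric])
 finally have eq: "(\<Sum>\<^sub>\<infinity>j\<in>J. tr q (mm X (mm (A j) Y))) = tr q (mm X (mm B Y))" .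
 have "(\<lambda>j. \<Sum>\<^sub>\<infinity>t\<in>?I. F (t, j)) summable_on J" by (rule summable_on_Sigma_banach[OF F'])
 hence "(\<lambda>j. tr q (mm X (mm (A j) Y))) summable_on J" by (rule summable_on_cong[THEN iffD1, rotated]) (simp add: Aj)
 thus ?thesis unfolding eq[symmetric] by (rule has_sum_infsum)
qed

end

definition half :: "complex => int => fock_matrix => fock_matrix" where
 "half g k A = (if k < 0 then lmul k A else if k = 0 then (\<lambda>\<mu> \<xi>. g * A \<mu> \<xi>) else rmul k A)"

lemma half_support:
 assumes "finite S" "(\<lambda>j. - int j) ` set_mset \<mu> \<subseteq> S" "int ` set_mset \<xi> \<subseteq> S" "0 \<in> S" "k \<notin> S"
 shows "half g k A \<mu> \<xi> = 0"
proof (cases "k < 0")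
 case True
 hence "k = - int (nat (- k))" by simp
 hence "nat (- k) \<notin># \<mu>" using assms(2,5) by (metis image_subset_iff)
 thus ?thesis using True by (simp add: half_def lmul_neg cre_def)
next
 case False
 hence "k = int (nat k)" "k \<noteq> 0" using assms(4,5) by auto
 hence "nat k \<notin># \<xi>" using assms(3,5) by (metis image_subset_iff)
 thus ?thesis using False \<open>k \<noteq> 0\<close> by (simp add: half_def rmul_nonneg ann_def not_in_iff)
qed

lemma tr_slot_nord:
 assumes c: "chain W x lo hi (as @ i # bs)" and d: "distinct (as @ i # bs)" and q: "norm q * hi < lo"
  and co: "\<And>k. norm (co k) \<le> K * (1 + real_of_int \<bar>k\<bar>) ^ m * x i powi k"
 shows "((\<lambda>k. co k * tr q (prodf (W(i := half g k (W i))) (as @ i # bs))) has_sum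
  tr q (prodf (W(i := nord co g (W i))) (as @ i # bs))) UNIV"
proof -
 obtain m1 m' where m: "m1 < m'" "chain W x lo m1 as" "chain W x m' hi (i # bs)" using chain_split[OF c] .
 obtain m'' where m'': "x i < m''" "chain W x m'' hi bs" "tame (W i) (x i) (x i)" "m' < x i" using chain_Cons[OF m(3)] .
 let ?X = "prodf W as" and ?Y = "prodf W bs"
 have X: "tame ?X lo m1" by (rule tame_prodf[OF m(2)])
 have Y: "tame ?Y m'' hi" by (rule tame_prodf[OF m''(2)])
 have mx: "m1 < x i" using m(1) m''(4) by simp
 let ?A = "\<lambda>k \<mu> \<xi>. co k * half g k (W i) \<mu> \<xi>"
 let ?N = "\<lambda>\<mu> \<xi>. complex_of_real (norm (W i \<mu> \<xi>))"
 define D where "D = nord (\<lambda>k. complex_of_real (norm (co k))) (of_real (norm g)) ?N"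
 have N: "tame ?N (x i) (x i)" by (rule tame_le[OF m''(3)]) simp
 have D: "tame D (x i) (x i)" unfolding D_def by (rule tame_nord[OF N]) (use co in simp)
 have fin: "\<exists>S. finite S \<and> (\<forall>k. k \<notin> S \<longrightarrow> half g k (W i) \<mu> \<xi> = 0) \<and> (\<Sum>k\<in>S. ?A k \<mu> \<xi>) = nord co g (W i) \<mu> \<xi>
   \<and> (\<Sum>k\<in>S. complex_of_real (norm (?A k \<mu> \<xi>))) = D \<mu> \<xi>" if I: "\<mu> \<in> Idx" "\<xi> \<in> Idx" for \<mu> \<xi>
 proof -
  define S where "S = (\<lambda>j. - int j) ` set_mset \<mu> \<union> int ` set_mset \<xi> \<union> {0}"
  have S: "finite S" "(\<lambda>j. - int j) ` set_mset \<mu> \<subseteq> S" "int ` set_mset \<xi> \<subseteq> S" "0 \<in> S" by (auto simp: S_def)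
  have I': "0 \<notin># \<mu>" "0 \<notin># \<xi>" using I by (auto simp: Idx_def)
  have h: "half g k V \<mu> \<xi> = (if k < 0 then cre (nat (- k)) V \<mu> \<xi> else if k = 0 then g * V \<mu> \<xi> else ann (nat k) V \<mu> \<xi>)" for g k V
   by (simp add: half_def lmul_neg rmul_nonneg)
  have h': "complex_of_real (norm (half g k (W i) \<mu> \<xi>)) = half (of_real (norm g)) k ?N \<mu> \<xi>" for k
   unfolding h by (simp add: cre_def ann_def norm_mult)
  have s1: "(\<Sum>k\<in>S. ?A k \<mu> \<xi>) = nord co g (W i) \<mu> \<xi>" unfolding h by (rule nord_int_sum[OF S I'])
  have s2: "(\<Sum>k\<in>S. complex_of_real (norm (?A k \<mu> \<xi>))) = D \<mu> \<xi>"
   unfolding D_def norm_mult of_real_mult h' unfolding h by (rule nord_int_sum[OF S I'])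
  show ?thesis by (intro exI[of _ S] conjI allI impI S(1) s1 s2 half_support[OF S])
 qed
 have "((\<lambda>k. tr q (mm ?X (mm (?A k) ?Y))) has_sum tr q (mm ?X (mm (nord co g (W i)) ?Y))) UNIV"
 proof (rule tr_slot_infsum[OF X Y mx m''(1) q D])
  fix \<mu> \<xi> assume I: "\<mu> \<in> Idx" "\<xi> \<in> Idx"
  obtain S where S: "finite S" "\<And>k. k \<notin> S ==> half g k (W i) \<mu> \<xi> = 0" "(\<Sum>k\<in>S. ?A k \<mu> \<xi>) = nord co g (W i) \<mu> \<xi>"
   "(\<Sum>k\<in>S. complex_of_real (norm (?A k \<mu> \<xi>))) = D \<mu> \<xi>" using fin[OF I] by blast
  have n: "((\<lambda>k. norm (?A k \<mu> \<xi>)) has_sum (\<Sum>k\<in>S. norm (?A k \<mu> \<xi>))) UNIV"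
   by (rule has_sum_finite_neutralI[OF S(1)]) (use S(2) in auto)
  thus "(\<lambda>k. norm (?A k \<mu> \<xi>)) summable_on UNIV" by (rule has_sum_imp_summable)
  have "D \<mu> \<xi> = complex_of_real (\<Sum>k\<in>S. norm (?A k \<mu> \<xi>))" unfolding S(4)[symmetric] by simp
  hence "norm (D \<mu> \<xi>) = (\<Sum>k\<in>S. norm (?A k \<mu> \<xi>))" by (simp only: norm_of_real) (simp add: sum_nonneg)
  thus "(\<Sum>\<^sub>\<infinity>k\<in>UNIV. norm (?A k \<mu> \<xi>)) \<le> norm (D \<mu> \<xi>)" using infsumI[OF n] by simp
  have "((\<lambda>k. ?A k \<mu> \<xi>) has_sum (\<Sum>k\<in>S. ?A k \<mu> \<xi>)) UNIV"
   by (rule has_sum_finite_neutralI[OF S(1)]) (use S(2) in auto)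
  thus "nord co g (W i) \<mu> \<xi> = (\<Sum>\<^sub>\<infinity>k\<in>UNIV. ?A k \<mu> \<xi>)" unfolding S(3)[symmetric] by (rule infsumI[symmetric])
 qed
 moreover have "tame (half g k (W i)) (x i) (x i)" for k unfolding half_def using m''(3) by (auto intro: tame_lmul tame_rmul tame_scale)
 hence "tr q (mm ?X (mm (?A k) ?Y)) = co k * tr q (prodf (W(i := half g k (W i))) (as @ i # bs))" for k
  using tr_slot_sum[OF c d q, of "{k}" "\<lambda>k. half g k (W i)" co] tr_prodf_slot[OF c d tame_scale, of "half g k (W i)" q "co k"] by simp
 moreover have "tame (nord co g (W i)) (x i) (x i)" by (rule tame_nord[OF m''(3) co])
 ultimately show ?thesis using tr_prodf_slot[OF c d] by simp
qed

section \<open>The recursion\<close>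

lemma has_sum_nonzero_int:
 fixes f :: "int => complex"
 assumes "((\<lambda>k::nat. f (int k)) has_sum A) {1..}" "((\<lambda>k::nat. f (- int k)) has_sum B) {1..}"
 shows "(f has_sum (A + B)) (- {0})"
proof -
 have "(f has_sum A) (int ` {1..})" using assms(1) by (subst has_sum_reindex) (auto simp: o_def)
 moreover have "(f has_sum B) ((\<lambda>k. - int k) ` {1..})" using assms(2) by (subst has_sum_reindex) (auto simp: o_def inj_on_def)
 moreover have "int ` {1..} \<inter> (\<lambda>k. - int k) ` {1..} = {}" by auto
 ultimately have "(f has_sum (A + B)) (int ` {1..} \<union> (\<lambda>k. - int k) ` {1..})" by (rule has_sum_Un_disjoint)
 also have "int ` {1..} \<union> (\<lambda>k. - int k) ` {1..} = - {0}"
 proof (intro equalityI subsetI)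
  fix x :: int assume "x \<in> - {0}"
  hence "x = int (nat x) \<and> nat x \<ge> 1 \<or> x = - int (nat (- x)) \<and> nat (- x) \<ge> 1" by auto
  thus "x \<in> int ` {1..} \<union> (\<lambda>k. - int k) ` {1..}" by (metis UnI1 UnI2 atLeast_iff image_eqI)
 qed auto
 finally show ?thesis .
qed

lemma nome_power_neq_1:
 assumes "0 < norm q" "norm (q :: complex) < 1" "k \<noteq> 0"
 shows "q powi k \<noteq> 1"
proof
 assume *: "q powi k = 1"
 have "norm q ^ nat \<bar>k\<bar> = 1"
 proof (cases "k \<ge> 0")
  case True
  thus ?thesis using arg_cong[OF *, of norm] by (simp add: power_int_def norm_power)
 next
  case False
  hence "inverse q ^ nat (- k) = 1" using * by (simp add: power_int_def)
  hence "q ^ nat (- k) = 1" using inverse_eq_1_iff[of "q ^ nat (- k)"] by (simp add: power_inverse)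
  thus ?thesis using arg_cong[of _ _ norm] False by (metis abs_of_neg norm_one norm_power not_le)
 qed
 moreover have "norm q ^ nat \<bar>k\<bar> < 1" using assms by (simp add: power_less_one_iff)
 ultimately show False by simp
qed

context
 fixes \<tau> :: complex and r s :: nat and q :: complex
 assumes tau: "Im \<tau> > 0" and r: "r \<ge> 1"
 defines "q \<equiv> nom \<tau>"
begin

private lemma q: "q \<noteq> 0" "0 < norm q" "norm q < 1" using nome_exp[OF tau] by (auto simp: q_def nome_def)

private lemma q_neg:
 assumes "k \<ge> 1"
 shows "X / (1 - q powi (- int k)) = - X * q ^ k / (1 - q ^ k)"
proof -
 have "1 - q ^ k \<noteq> 0" using nome_power_neq_1[OF q(2,3), of "int k"] assms by simp
 moreover have "q powi (- int k) = 1 / q ^ k" by (simp add: power_int_minus inverse_eq_divide)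
 hence "1 - q powi (- int k) = - ((1 - q ^ k) / q ^ k)" using q(1) by (simp add: diff_divide_distrib)
 ultimately show ?thesis using q(1) by simp
qed

private lemma cyl_pos: "cyl r (int k) * of_int (int k) ^ s = (- 1) ^ (r - 1) / fact (r - 1) * of_nat k ^ (r + s - 1)"
 using r by (cases r) (simp_all add: cyl_def power_minus[of "of_nat k"] power_add)

private lemma cyl_neg: "cyl r (- int k) * of_int (- int k) ^ s = (- 1) ^ s / fact (r - 1) * of_nat k ^ (r + s - 1)"
 using r by (cases r) (simp_all add: cyl_def power_minus[of "of_nat k"] power_add)

lemma D_fun_sum:
 assumes w: "1 < norm (exp w)" "norm q * norm (exp w) < 1"
 shows "((\<lambda>k. cyl r k * of_int k ^ s * exp (- w * of_int k) / (1 - q powi k)) has_sum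
  (if s = 0 then D_fun r 0 w \<tau> - (if r = 1 then 1 / 2 else 0) else fact (s - 1) * D_fun r s w \<tau>)) (- {0})"
proof -
 have n: "r + s \<ge> 1" using r by simp
 let ?a = "\<lambda>k. of_nat k ^ (r + s - 1) / (1 - q ^ k) * exp (- w) ^ k"
 let ?b = "\<lambda>k. of_nat k ^ (r + s - 1) * q ^ k / (1 - q ^ k) * exp w ^ k"
 let ?f = "\<lambda>k. cyl r k * of_int k ^ s * exp (- w * of_int k) / (1 - q powi k)"
 define A where "A = infsum ?a {1..}"
 define B where "B = infsum ?b {1..}"
 note P = P_fun_series[OF tau n w[unfolded q_def], folded q_def]
 have a: "(?a has_sum A) {1..}" "(?b has_sum B) {1..}" unfolding A_def B_def
  using abs_summable_summable[OF P(2)] abs_summable_summable[OF P(3)] by simp_all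
 have "((\<lambda>k. ?f (int k)) has_sum ((- 1) ^ (r - 1) / fact (r - 1) * A)) {1..}"
 proof (rule has_sum_cong[THEN iffD2, OF _ has_sum_cmult_right[OF a(1)]])
  fix k :: nat
  have "exp (- w * of_int (int k)) = exp (- w) ^ k" by (simp add: exp_of_nat_mult[symmetric] mult.commute)
  thus "?f (int k) = (- 1) ^ (r - 1) / fact (r - 1) * ?a k" unfolding cyl_pos by simp
 qed
 moreover have "((\<lambda>k. ?f (- int k)) has_sum (- ((- 1) ^ s) / fact (r - 1) * B)) {1..}"
 proof (rule has_sum_cong[THEN iffD2, OF _ has_sum_cmult_right[OF a(2)]])
  fix k :: nat assume "k \<in> {1..}"
  hence k: "k \<ge> 1" by simp
  have "exp (- w * of_int (- int k)) = exp w ^ k" by (simp add: exp_of_nat_mult[symmetric] mult.commute)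
  thus "?f (- int k) = - ((- 1) ^ s) / fact (r - 1) * ?b k" unfolding cyl_neg q_neg[OF k] by simp
 qed
 ultimately have "(?f has_sum ((- 1) ^ (r - 1) / fact (r - 1) * A + - ((- 1) ^ s) / fact (r - 1) * B)) (- {0})" by (rule has_sum_nonzero_int)
 moreover have "(- 1) ^ (r - 1) / fact (r - 1) * A + - ((- 1) ^ s) / fact (r - 1) * B =
  (if s = 0 then D_fun r 0 w \<tau> - (if r = 1 then 1 / 2 else 0) else fact (s - 1) * D_fun r s w \<tau>)"
 proof -
  obtain r' where r': "r = Suc r'" using r by (cases r) auto
  have Pe: "P_fun (r + s) w \<tau> = (- 1) ^ (r + s - 1) / fact (r + s - 1) * ((if r + s = 1 then 1 / 2 else 0) + (- 1) ^ (r + s - 1) * A - B)"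
   using P(1) unfolding A_def B_def .
  show ?thesis
  proof (cases "s = 0")
   case True
   thus ?thesis using Pe unfolding r' D_fun_def by (cases "even r'") (auto simp: divide_simps)
  next
   case False
   hence "r + s \<noteq> 1" using r by simp
   hence "D_fun r s w \<tau> = (- 1) ^ (r + 1) / (fact (r - 1) * fact (s - 1)) * ((- 1) ^ (r + s - 1) * ((- 1) ^ (r + s - 1) * A - B))"
    unfolding D_fun_def Pe using False by (simp add: divide_simps)
   thus ?thesis using False unfolding r' by (cases "even r'"; cases "even s") (simp_all add: divide_simps algebra_simps)
  qed
 qed
 ultimately show ?thesis by simp
qed

lemma D_fun_sum':
 assumes w: "1 < norm (exp w)" "norm q * norm (exp w) < 1"
 shows "((\<lambda>k. cyl r k * of_int k ^ s * exp (w * of_int k) * q powi k / (1 - q powi k)) has_sum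
  (if s = 0 then D_fun r 0 (- w) \<tau> + (if r = 1 then 1 / 2 else 0) else fact (s - 1) * D_fun r s (- w) \<tau>)) (- {0})"
proof -
 let ?V = "if s = 0 then D_fun r 0 w \<tau> - (if r = 1 then 1 / 2 else 0) else fact (s - 1) * D_fun r s w \<tau>"
 let ?f = "\<lambda>k. cyl r k * of_int k ^ s * exp (- w * of_int k) / (1 - q powi k)"
 have "bij_betw uminus (- {0 :: int}) (- {0})" by (rule bij_betwI[of _ _ _ uminus]) auto
 hence "((\<lambda>k. ?f (- k)) has_sum ?V) (- {0})" using D_fun_sum[OF w] by (subst has_sum_reindex_bij_betw)
 hence "((\<lambda>k. (- 1) ^ (r + s) * ?f (- k)) has_sum ((- 1) ^ (r + s) * ?V)) (- {0})" by (rule has_sum_cmult_right)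
 also have "(- 1) ^ (r + s) * ?V = (if s = 0 then D_fun r 0 (- w) \<tau> + (if r = 1 then 1 / 2 else 0) else fact (s - 1) * D_fun r s (- w) \<tau>)"
  using P_fun_odd[OF tau _ w[unfolded q_def], of "r + s"] r by (auto simp: D_fun_def algebra_simps)
 finally show ?thesis
 proof (rule has_sum_cong[THEN iffD1, rotated])
  fix k :: int assume k: "k \<in> - {0}"
  have "1 - q powi k \<noteq> 0" using nome_power_neq_1[OF q(2,3), of k] k by simp
  hence "1 / (1 - q powi (- k)) = - (q powi k / (1 - q powi k))" using q(1) by (simp add: power_int_minus field_simps)
  moreover have "(- 1) ^ (r + s) * (cyl r (- k) * of_int (- k) ^ s) = - (cyl r k * of_int k ^ s)"
   using r by (cases r) (simp_all add: cyl_def power_minus[of "of_int k"] power_add mult_ac)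
  moreover have "(- 1) ^ (r + s) * ?f (- k) = ((- 1) ^ (r + s) * (cyl r (- k) * of_int (- k) ^ s)) * exp (w * of_int k) * (1 / (1 - q powi (- k)))"
   by simp
  ultimately show "(- 1) ^ (r + s) * ?f (- k) = cyl r k * of_int k ^ s * exp (w * of_int k) * q powi k / (1 - q powi k)" by (simp only:) simp
 qed
qed

lemma C_fun_sum:
 "((\<lambda>k. cyl r k * of_int k ^ s * (if k < 0 then 1 else q powi k) / (1 - q powi k)) has_sum
  (if s = 0 then C_fun r 0 \<tau> + (if r = 1 then 1 / 2 else 0) - sqc r 0
  else fact (s - 1) * (C_fun r s \<tau> - (sq2 r s)))) (- {0})"
proof -
 have n: "r + s \<ge> 1" using r by simp
 let ?c = "\<lambda>k. of_nat k ^ (r + s - 1) * q ^ k / (1 - q ^ k)"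
 let ?f = "\<lambda>k. cyl r k * of_int k ^ s * (if k < 0 then 1 else q powi k) / (1 - q powi k)"
 define A where "A = infsum ?c {1..}"
 note E = E_fun_series[OF tau n, folded q_def]
 have a: "(?c has_sum A) {1..}" unfolding A_def using abs_summable_summable[OF E(2)] by simp
 have "((\<lambda>k. ?f (int k)) has_sum ((- 1) ^ (r - 1) / fact (r - 1) * A)) {1..}"
  by (rule has_sum_cong[THEN iffD2, OF _ has_sum_cmult_right[OF a]]) (unfold cyl_pos, simp)
 moreover have "((\<lambda>k. ?f (- int k)) has_sum (- ((- 1) ^ s) / fact (r - 1) * A)) {1..}"
 proof (rule has_sum_cong[THEN iffD2, OF _ has_sum_cmult_right[OF a]])
  fix k :: nat assume "k \<in> {1..}"
  hence k: "k \<ge> 1" by simp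
  show "?f (- int k) = - ((- 1) ^ s) / fact (r - 1) * ?c k" unfolding cyl_neg q_neg[OF k] using k by simp
 qed
 ultimately have "(?f has_sum ((- 1) ^ (r - 1) / fact (r - 1) * A + - ((- 1) ^ s) / fact (r - 1) * A)) (- {0})" by (rule has_sum_nonzero_int)
 moreover have "(- 1) ^ (r - 1) / fact (r - 1) * A + - ((- 1) ^ s) / fact (r - 1) * A =
  (if s = 0 then C_fun r 0 \<tau> + (if r = 1 then 1 / 2 else 0) - sqc r 0
  else fact (s - 1) * (C_fun r s \<tau> - (sq2 r s)))"
 proof -
  obtain r' where r': "r = Suc r'" using r by (cases r) auto
  have Ee: "E_fun (r + s) \<tau> = (if odd (r + s) then 0 else - bern_exp (r + s) + 2 / fact (r + s - 1) * A)" using E(1) unfolding A_def .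
  have s0: "sqc r 0 = bern_exp r + (if r = 1 then 1 else 0)" using sqc_nonneg[OF r, of 0] gco_0[of "r - 1"] r by simp
  show ?thesis
  proof (cases "s = 0")
   case True
   show ?thesis
   proof (cases "odd r")
    case True
    thus ?thesis using Ee \<open>s = 0\<close> bern_exp_odd[of r] unfolding s0 by (auto simp: C_fun_def r')
   next
    case False
    thus ?thesis using Ee \<open>s = 0\<close> unfolding s0 by (auto simp: C_fun_def r' divide_simps algebra_simps)
   qed
  next
   case False
   hence s: "s \<ge> 1" by simp
   show ?thesis
   proof (cases "odd (r + s)")
    case True
    hence "bern_exp (r + s) = 0" using bern_exp_odd[of "r + s"] r s by auto
    thus ?thesis using Ee True False unfolding sum_sqc_sqc[OF r s] by (auto simp: C_fun_def r')
   next
    case F: False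
    hence sg: "(- 1) ^ (r - 1) = (- ((- 1) ^ s) :: complex)" "(- 1) ^ (r + 1) = (- ((- 1) ^ s) :: complex)" by (auto simp: r' minus_one_power_iff)
    have Ce: "C_fun r s \<tau> = (- 1) ^ (r + 1) * fact (r + s - 1) / (fact (r - 1) * fact (s - 1)) * (- bern_exp (r + s) + 2 / fact (r + s - 1) * A)"
     using Ee F False by (simp add: C_fun_def)
    have nz: "fact (r + s - 1) \<noteq> (0 :: complex)" "fact (r - 1) \<noteq> (0 :: complex)" "fact (s - 1) \<noteq> (0 :: complex)" by simp_all
    have "- \<sigma> / g * A + - \<sigma> / g * A = h * (- \<sigma> * f / (g * h) * (- b + 2 / f * A) - \<sigma> * f / (g * h) * b)"
     if "f \<noteq> 0" "g \<noteq> 0" "h \<noteq> 0" for \<sigma> f g h b :: complex using that by (simp add: field_simps)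
    from this[OF nz, of "(- 1) ^ s" "bern_exp (r + s)"] show ?thesis unfolding if_not_P[OF False] sum_sqc_sqc[OF r s] Ce sg .
   qed
  qed
 qed
 ultimately show ?thesis by simp
qed

end

lemma has_sum_finite_sum:
 fixes f :: "'i => 'b => 'c :: topological_comm_monoid_add"
 assumes "\<And>i. i \<in> S ==> (f i has_sum v i) A"
 shows "((\<lambda>x. \<Sum>i\<in>S. f i x) has_sum (\<Sum>i\<in>S. v i)) A"
 using assms by (induction S rule: infinite_finite_induct) (auto intro: has_sum_add)

lemma sum_mset_eq_sum_count_mult:
 fixes h :: "'b => complex"
 shows "(\<Sum>s\<in>#M. h s) = (\<Sum>s\<in>set_mset M. of_nat (count M s) * h s)"
proof (induction M)
 case (add x M)
 have "(\<Sum>s\<in>set_mset (add_mset x M). of_nat (count (add_mset x M) s) * h s)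
   = (\<Sum>s\<in>insert x (set_mset M). of_nat (count M s) * h s + (if s = x then h s else 0))" by (rule sum.cong) (auto simp: algebra_simps)
 also have "\<dots> = (\<Sum>s\<in>insert x (set_mset M). of_nat (count M s) * h s) + h x" by (simp add: sum.distrib)
 also have "(\<Sum>s\<in>insert x (set_mset M). of_nat (count M s) * h s) = (\<Sum>s\<in>set_mset M. of_nat (count M s) * h s)"
  by (rule sum.mono_neutral_right) (auto simp: not_in_iff)
 finally show ?case using add by simp
qed simp

locale genus_one = lattice_voa scale form L eps a
 for scale :: "complex => 'h::ab_group_add => 'h" and form :: "'h => 'h => complex" and L :: "'h set"
  and eps :: "'h => 'h => complex" and a :: 'h +
 fixes n :: nat and \<alpha> :: "nat => 'h" and \<beta> :: 'h and z :: "nat => complex" and \<tau> :: complex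
 assumes n_pos: "1 \<le> n"
  and beta: "\<beta> \<in> L"
  and alpha: "\<And>i. i \<in> {1..n} ==> \<alpha> i \<in> L"
  and neutral: "(\<Sum>i=1..n. \<alpha> i) = 0"
  and tau: "0 < Im \<tau>"
  and radial: "\<And>i j. 1 \<le> i ==> i < j ==> j \<le> n ==> norm (exp (z j)) < norm (exp (z i))"
  and annulus: "norm (nom \<tau> * exp (z 1)) < norm (exp (z n))"
begin

definition q :: complex where "q = nom \<tau>"

definition xs :: "nat => real" where "xs i = exp (- Re (z i))"

abbreviation (input) sites :: "nat list" where "sites \<equiv> [1..<Suc n]"

text \<open>The momentum of the vectors on which the vertex operator of site \<open>i\<close> acts.\<close>

definition mom :: "nat => complex" where "mom i = form a \<beta> + (\<Sum>l\<in>{i<..n}. form a (\<alpha> l))"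

definition vop :: "nat => nat multiset => fock_matrix" where
 "vop i \<rho> = qconj (z i) (wmat form a (mom i) (\<alpha> i) \<rho>)"

definition vops :: "(nat => nat multiset) => nat => fock_matrix" where
 "vops \<rho> i = vop i (\<rho> i)"

definition T :: "(nat => fock_matrix) => complex" where
 "T V = tr q (prodf V sites)"

definition F :: "(nat => nat multiset) => complex" where
 "F \<rho> = T (vops \<rho>)"

lemma q: "q \<noteq> 0" "0 < norm q" "norm q < 1" using nome_exp[OF tau] by (auto simp: q_def nome_def)

lemma tame_vop: "tame (vop i \<rho>) (xs i) (xs i)" unfolding vop_def xs_def by (intro tame_conj tame_wmat)

lemma vops_upd: "(vops \<rho>)(i := vop i \<sigma>) = vops (\<rho>(i := \<sigma>))" by (auto simp: vops_def)

lemma T_vop: "T ((vops \<rho>)(i := vop i \<sigma>)) = F (\<rho>(i := \<sigma>))" by (simp add: F_def vops_upd)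

lemma norm_exp_ratio:
 assumes "i \<in> {1..n}" "j \<in> {1..n}" "i < j"
 shows "1 < norm (exp (z i - z j))" "norm q * norm (exp (z i - z j)) < 1"
proof -
 have pos: "norm (exp (z k)) > 0" for k by simp
 show "1 < norm (exp (z i - z j))" using radial[of i j] assms by (simp add: exp_diff norm_divide)
 have "norm (exp (z i)) \<le> norm (exp (z 1))" using radial[of 1 i] assms by (cases "i = 1") auto
 moreover have "norm (exp (z n)) \<le> norm (exp (z j))" using radial[of j n] assms by (cases "j = n") auto
 moreover have "norm q * norm (exp (z 1)) < norm (exp (z n))" using annulus by (simp add: norm_mult q_def)
 ultimately have "norm q * norm (exp (z i)) < norm (exp (z j))" using mult_left_mono[of "norm (exp (z i))" "norm (exp (z 1))" "norm q"] q by linarith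
 thus "norm q * norm (exp (z i - z j)) < 1" using pos[of j] by (simp add: exp_diff norm_divide)
qed

lemma chain_vops:
 obtains lo hi where "norm q * hi < lo" "\<And>\<rho>. chain (vops \<rho>) xs lo hi sites"
proof -
 have xs_less: "xs i < xs j" if "1 \<le> i" "i < j" "j \<le> n" for i j using radial[OF that] by (simp add: xs_def)
 have "norm q * norm (exp (z 1)) < norm (exp (z n))" using annulus by (simp add: norm_mult q_def)
 hence "norm q * xs n < xs 1" by (simp add: xs_def exp_minus field_simps)
 then obtain s r where sr: "xs n < s" "norm q * s < r" "0 < r" "r < xs 1" by (rule choose_q) (auto simp: xs_def)
 have "xs 1 \<le> xs i" "xs i \<le> xs n" if "i \<in> {1..n}" for i
  using xs_less[of 1 i] xs_less[of i n] that by (cases "i = 1"; cases "i = n"; force)+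
 hence b: "r < xs i" "xs i < s" if "i \<in> {1..n}" for i using that sr by fastforce+
 have "r < s" using b[of 1] n_pos by simp
 moreover have "sorted_wrt (\<lambda>i j. xs i < xs j) sites" by (rule sorted_wrt_mono_rel[OF _ sorted_wrt_upt]) (auto intro: xs_less)
 ultimately have "chain (vops \<rho>) xs r s sites" for \<rho> unfolding chain_def vops_def using b sr tame_vop by auto
 thus ?thesis using sr(2) by (intro that[of s r])
qed

lemma sites_split: "i \<in> {1..n} ==> sites = [1..<i] @ i # [Suc i..<Suc n]"
 using upt_add_eq_append[of 1 i "Suc n - i"] upt_conv_Cons[of i "Suc n"] by auto

lemma T_slot_sum:
 assumes i: "i \<in> {1..n}" and A: "\<And>j. j \<in> S ==> tame (A j) (xs i) (xs i)"
 shows "T ((vops \<rho>)(i := \<lambda>\<mu> \<xi>. \<Sum>j\<in>S. y j * A j \<mu> \<xi>)) = (\<Sum>j\<in>S. y j * T ((vops \<rho>)(i := A j)))"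
proof -
 obtain lo hi where c: "norm q * hi < lo" "\<And>\<rho>. chain (vops \<rho>) xs lo hi sites" using chain_vops by metis
 have d: "distinct ([1..<i] @ i # [Suc i..<Suc n])" by (subst sites_split[OF i, symmetric]) simp
 show ?thesis unfolding T_def sites_split[OF i] by (rule tr_slot_sum[OF c(2)[unfolded sites_split[OF i]] d c(1) A])
qed

lemma T_slot_add_sum:
 assumes i: "i \<in> {1..n}" and A: "tame A (xs i) (xs i)" and B: "\<And>j. j \<in> S ==> tame (B j) (xs i) (xs i)" and "finite S"
 shows "T ((vops \<rho>)(i := \<lambda>\<mu> \<xi>. A \<mu> \<xi> + (\<Sum>j\<in>S. y j * B j \<mu> \<xi>))) = T ((vops \<rho>)(i := A)) + (\<Sum>j\<in>S. y j * T ((vops \<rho>)(i := B j)))"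
proof -
 let ?S = "insert None (Some ` S)"
 let ?y = "\<lambda>j. case j of None => 1 | Some j => y j" and ?A = "\<lambda>j. case j of None => A | Some j => B j"
 have "T ((vops \<rho>)(i := \<lambda>\<mu> \<xi>. \<Sum>j\<in>?S. ?y j * ?A j \<mu> \<xi>)) = (\<Sum>j\<in>?S. ?y j * T ((vops \<rho>)(i := ?A j)))"
  by (rule T_slot_sum[OF i]) (use A B in auto)
 thus ?thesis using assms(4) by (simp add: sum.reindex)
qed

abbreviation (input) mult0 :: "nat multiset => nat => complex" where
 "mult0 M s \<equiv> (if s = 0 then 1 else of_nat (count M s))"

text \<open>The value \<open>0\<close> of \<open>s\<close> stands for the contraction with the exponential; then \<open>M - {#s#} = M\<close>.\<close>

lemma sum_mset_insert_0:
 fixes h :: "nat => complex"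
 assumes "0 \<notin># M"
 shows "h 0 + (\<Sum>s\<in>#M. h s) = (\<Sum>s\<in>insert 0 (set_mset M). mult0 M s * h s)"
proof -
 have "(\<Sum>s\<in>set_mset M. of_nat (count M s) * h s) = (\<Sum>s\<in>set_mset M. mult0 M s * h s)" using assms by (intro sum.cong) auto
 thus ?thesis using assms by (simp add: sum_mset_eq_sum_count_mult)
qed

definition wick :: "nat => nat => complex" where
 "wick l s = (if s = 0 then form a (\<alpha> l) else 1 / fact (s - 1))"

lemma T_comm:
 assumes l: "l \<in> {1..n}" and k: "k \<noteq> 0" and \<rho>: "0 \<notin># \<rho> l"
 shows "T ((vops \<rho>)(l := comm k (vops \<rho> l))) =
  (\<Sum>s\<in>insert 0 (set_mset (\<rho> l)). mult0 (\<rho> l) s * wick l s * F (\<rho>(l := \<rho> l - {#s#})) * (of_int k ^ s * exp (z l * of_int k)))"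
proof -
 let ?S = "insert 0 (set_mset (\<rho> l))"
 let ?y = "\<lambda>s. exp (z l * of_int k) * (mult0 (\<rho> l) s * wick l s * of_int k ^ s)"
 let ?w = "wmat form a (mom l) (\<alpha> l)"
 have "comm k (?w (\<rho> l)) \<mu> \<xi> = (\<Sum>s\<in>?S. mult0 (\<rho> l) s * wick l s * of_int k ^ s * ?w (\<rho> l - {#s#}) \<mu> \<xi>)" for \<mu> \<xi>
 proof -
  have "comm k (?w (\<rho> l)) \<mu> \<xi> = wick l 0 * of_int k ^ 0 * ?w (\<rho> l - {#0#}) \<mu> \<xi> + (\<Sum>s\<in>#\<rho> l. wick l s * of_int k ^ s * ?w (\<rho> l - {#s#}) \<mu> \<xi>)"
   unfolding comm_wmat[OF k \<rho>] using \<rho> by (auto simp: wick_def intro!: arg_cong[of _ _ sum_mset] image_mset_cong)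
  also have "\<dots> = (\<Sum>s\<in>?S. mult0 (\<rho> l) s * (wick l s * of_int k ^ s * ?w (\<rho> l - {#s#}) \<mu> \<xi>))"
   by (rule sum_mset_insert_0[OF \<rho>, where h = "\<lambda>s. wick l s * of_int k ^ s * ?w (\<rho> l - {#s#}) \<mu> \<xi>"])
  finally show ?thesis by (simp only: mult.assoc)
 qed
 hence "comm k (vops \<rho> l) = (\<lambda>\<mu> \<xi>. \<Sum>s\<in>?S. ?y s * vop l (\<rho> l - {#s#}) \<mu> \<xi>)"
  by (intro ext) (simp add: vops_def vop_def comm_conj qconj_def sum_distrib_left mult_ac)
 hence "T ((vops \<rho>)(l := comm k (vops \<rho> l))) = (\<Sum>s\<in>?S. ?y s * T ((vops \<rho>)(l := vop l (\<rho> l - {#s#}))))"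
  by (simp only:) (rule T_slot_sum[OF l tame_vop])
 thus ?thesis unfolding T_vop by (simp add: mult_ac)
qed

definition side :: "nat => nat => int => complex" where
 "side i l k = (if l > i then 1 else if l < i then q powi k else if k < 0 then 1 else q powi k)"

lemma T_half:
 assumes i: "i \<in> {1..n}" and k: "k \<noteq> 0"
 shows "T ((vops \<rho>)(i := half g k (vops \<rho> i))) = (\<Sum>l\<in>{1..n}. side i l k / (1 - q powi k) * T ((vops \<rho>)(l := comm k (vops \<rho> l))))"
proof -
 obtain lo hi where c: "norm q * hi < lo" "\<And>\<rho>. chain (vops \<rho>) xs lo hi sites" using chain_vops by metis
 have d: "distinct ([1..<i] @ i # [Suc i..<Suc n])" by (subst sites_split[OF i, symmetric]) simp
 let ?G = "\<lambda>l. T ((vops \<rho>)(l := comm k (vops \<rho> l)))"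
 have r: "(1 - q powi k) * T ((vops \<rho>)(i := rmul k (vops \<rho> i))) =
   (\<Sum>l\<in>{Suc i..n}. ?G l) + q powi k * (\<Sum>l\<in>insert i {1..<i}. ?G l)"
 proof -
  have S: "set [Suc i..<Suc n] = {Suc i..n}" "set [1..<i] = {1..<i}" by auto
  show ?thesis unfolding T_def sites_split[OF i] by (rule tr_slot_rmul[OF c(2)[of \<rho>, unfolded sites_split[OF i]] d c(1) q(1) k, unfolded S])
 qed
 have nz: "1 - q powi k \<noteq> 0" using nome_power_neq_1[OF q(2,3) k] by simp
 have "(1 - q powi k) * T ((vops \<rho>)(i := half g k (vops \<rho> i))) =
   (\<Sum>l\<in>{Suc i..n}. ?G l) + (if k < 0 then 1 else q powi k) * ?G i + q powi k * (\<Sum>l\<in>{1..<i}. ?G l)"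
 proof (cases "k < 0")
  case True
  have "lmul k (vops \<rho> i) = (\<lambda>\<mu> \<xi>. rmul k (vops \<rho> i) \<mu> \<xi> + (\<Sum>j\<in>{()}. 1 * comm k (vops \<rho> i) \<mu> \<xi>))"
   by (simp add: fun_eq_iff comm_def)
  hence "T ((vops \<rho>)(i := lmul k (vops \<rho> i))) = T ((vops \<rho>)(i := rmul k (vops \<rho> i))) + (\<Sum>j\<in>{()}. 1 * ?G i)"
   by (simp only:) (intro T_slot_add_sum i tame_rmul tame_comm k; simp add: vops_def tame_vop)
  thus ?thesis using True r by (simp add: half_def algebra_simps)
 next
  case False
  thus ?thesis using k r by (simp add: half_def algebra_simps)
 qed
 also have "\<dots> = (\<Sum>l\<in>{1..n}. side i l k * ?G l)"
 proof -
  have "{1..n} = {1..<i} \<union> {i} \<union> {Suc i..n}" using i by auto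
  hence "(\<Sum>l\<in>{1..n}. side i l k * ?G l) = (\<Sum>l\<in>{1..<i}. side i l k * ?G l) + side i i k * ?G i + (\<Sum>l\<in>{Suc i..n}. side i l k * ?G l)"
   by (simp only:) (subst sum.union_disjoint | force)+
  thus ?thesis by (simp add: side_def sum_distrib_left)
 qed
 finally have "T ((vops \<rho>)(i := half g k (vops \<rho> i))) = (\<Sum>l\<in>{1..n}. side i l k * ?G l) / (1 - q powi k)"
  using nz by (simp add: field_simps)
 thus ?thesis by (simp add: sum_divide_distrib)
qed

definition gam1 :: "nat => nat => complex" where
 "gam1 i r = (if r = 1 then form a \<beta> else 0) + C_fun r 0 \<tau> * form a (\<alpha> i)
  + (\<Sum>l\<in>{1..n} - {i}. D_fun r 0 (z i - z l) \<tau> * form a (\<alpha> l))"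

definition gam2 :: "nat => nat => nat => nat => complex" where
 "gam2 i r l s = (if i \<noteq> l then D_fun r s (z i - z l) \<tau> else C_fun r s \<tau>)"

definition kap :: "nat => nat => nat => nat => complex" where
 "kap i r l s = (if s = 0 then gam2 i r l 0 + (if r = 1 then if l > i then - 1 / 2 else 1 / 2 else 0) - (if l = i then sqc r 0 else 0)
  else fact (s - 1) * (gam2 i r l s - (if l = i then (sq2 r s) else 0)))"

lemma kap_has_sum:
 assumes i: "i \<in> {1..n}" and l: "l \<in> {1..n}" and r: "r \<ge> 1"
 shows "((\<lambda>k. cyl r k * exp (- z i * of_int k) * (side i l k / (1 - q powi k)) * (of_int k ^ s * exp (z l * of_int k))) has_sum kap i r l s) (- {0})"
proof -
 have e: "exp (- z i * of_int k) * exp (z l * of_int k) = exp ((z l - z i) * of_int k)" for k :: int by (simp add: exp_add[symmetric] algebra_simps)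
 let ?f = "\<lambda>k. cyl r k * of_int k ^ s * exp ((z l - z i) * of_int k) * side i l k / (1 - q powi k)"
 have "(?f has_sum kap i r l s) (- {0})"
 proof (cases rule: linorder_cases[of l i])
  case less
  have v: "kap i r l s = (if s = 0 then D_fun r 0 (z i - z l) \<tau> + (if r = 1 then 1 / 2 else 0) else fact (s - 1) * D_fun r s (z i - z l) \<tau>)"
   using less by (auto simp: kap_def gam2_def)
  have "side i l k = q powi k" for k using less by (simp add: side_def)
  thus ?thesis unfolding v
   using D_fun_sum'[OF tau r norm_exp_ratio[OF l i less, unfolded q_def], folded q_def, of s, unfolded minus_diff_eq] by simp
 next
  case equal
  have v: "kap i r l s = (if s = 0 then C_fun r 0 \<tau> + (if r = 1 then 1 / 2 else 0) - sqc r 0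
  else fact (s - 1) * (C_fun r s \<tau> - (sq2 r s)))" using equal by (simp add: kap_def gam2_def)
  have "exp ((z l - z i) * of_int k) * side i l k = (if k < 0 then 1 else q powi k)" for k :: int using equal by (simp add: side_def)
  thus ?thesis unfolding v mult.assoc[of _ "exp _"] using C_fun_sum[OF tau r, folded q_def, of s] by simp
 next
  case greater
  have v: "kap i r l s = (if s = 0 then D_fun r 0 (z i - z l) \<tau> - (if r = 1 then 1 / 2 else 0) else fact (s - 1) * D_fun r s (z i - z l) \<tau>)"
   using greater by (auto simp: kap_def gam2_def)
  have "side i l k = 1" for k using greater by (simp add: side_def)
  thus ?thesis unfolding v
   using D_fun_sum[OF tau r norm_exp_ratio[OF i l greater, unfolded q_def], folded q_def, of s, unfolded minus_diff_eq] by simp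
 qed
 thus ?thesis by (rule has_sum_cong[THEN iffD1, rotated]) (simp only: e[symmetric], simp add: mult_ac)
qed

lemma norm_cyl_exp_le: "norm (cyl r k * exp (- z i * of_int k)) \<le> 1 * (1 + real_of_int \<bar>k\<bar>) ^ (r - 1) * xs i powi k"
proof -
 have "norm (exp (- z i * of_int k)) = xs i powi k" by (simp add: xs_def exp_power_int mult.commute)
 moreover have "norm (cyl r k) \<le> (1 + real_of_int \<bar>k\<bar>) ^ (r - 1)"
 proof -
  have "norm (cyl r k) = real_of_int \<bar>k\<bar> ^ (r - 1) / fact (r - 1)" by (simp add: cyl_def norm_divide norm_power)
  also have "\<dots> \<le> real_of_int \<bar>k\<bar> ^ (r - 1) / 1" by (intro divide_left_mono) (auto simp: fact_ge_1)
  also have "\<dots> \<le> (1 + real_of_int \<bar>k\<bar>) ^ (r - 1)" by (simp add: power_mono)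
  finally show ?thesis .
 qed
 ultimately show ?thesis by (simp add: norm_mult mult_right_mono xs_def)
qed

lemma T_nord:
 assumes i: "i \<in> {1..n}" and r: "r \<ge> 1" and \<rho>: "\<And>l. 0 \<notin># \<rho> l"
 shows "T ((vops \<rho>)(i := nord (\<lambda>k. cyl r k * exp (- z i * of_int k)) (mom i) (vops \<rho> i))) =
  (if r = 1 then mom i * F \<rho> else 0) +
  (\<Sum>l\<in>{1..n}. \<Sum>s\<in>insert 0 (set_mset (\<rho> l)). mult0 (\<rho> l) s * wick l s * F (\<rho>(l := \<rho> l - {#s#})) * kap i r l s)"
  (is "?N = ?z + ?R")
proof -
 obtain lo hi where c: "norm q * hi < lo" "\<And>\<rho>. chain (vops \<rho>) xs lo hi sites" using chain_vops by metis
 have d: "distinct ([1..<i] @ i # [Suc i..<Suc n])" by (subst sites_split[OF i, symmetric]) simp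
 let ?co = "\<lambda>k. cyl r k * exp (- z i * of_int k)"
 note co = norm_cyl_exp_le[of r _ i]
 let ?f = "\<lambda>k. ?co k * T ((vops \<rho>)(i := half (mom i) k (vops \<rho> i)))"
 have N: "(?f has_sum ?N) UNIV" unfolding T_def sites_split[OF i] by (rule tr_slot_nord[OF c(2)[unfolded sites_split[OF i]] d c(1) co])
 have "((\<lambda>k. \<Sum>l\<in>{1..n}. \<Sum>s\<in>insert 0 (set_mset (\<rho> l)). mult0 (\<rho> l) s * wick l s * F (\<rho>(l := \<rho> l - {#s#})) *
   (cyl r k * exp (- z i * of_int k) * (side i l k / (1 - q powi k)) * (of_int k ^ s * exp (z l * of_int k)))) has_sum ?R) (- {0})"
  by (intro has_sum_finite_sum has_sum_cmult_right kap_has_sum i r)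
 hence "(?f has_sum ?R) (- {0})"
 proof (rule has_sum_cong[THEN iffD1, rotated])
  fix k :: int assume "k \<in> - {0}"
  hence k: "k \<noteq> 0" by simp
  show "(\<Sum>l\<in>{1..n}. \<Sum>s\<in>insert 0 (set_mset (\<rho> l)). mult0 (\<rho> l) s * wick l s * F (\<rho>(l := \<rho> l - {#s#})) *
   (cyl r k * exp (- z i * of_int k) * (side i l k / (1 - q powi k)) * (of_int k ^ s * exp (z l * of_int k)))) = ?f k"
   unfolding T_half[OF i k] sum_distrib_left
  proof (rule sum.cong[OF refl])
   fix l assume l: "l \<in> {1..n}"
   show "(\<Sum>s\<in>insert 0 (set_mset (\<rho> l)). mult0 (\<rho> l) s * wick l s * F (\<rho>(l := \<rho> l - {#s#})) *
    (cyl r k * exp (- z i * of_int k) * (side i l k / (1 - q powi k)) * (of_int k ^ s * exp (z l * of_int k))))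
    = ?co k * (side i l k / (1 - q powi k) * T ((vops \<rho>)(l := comm k (vops \<rho> l))))"
    unfolding T_comm[of l k \<rho>, OF l k \<rho>] sum_distrib_left by (rule sum.cong[OF refl]) (simp only: mult_ac)
  qed
 qed
 moreover have "(?f has_sum ?z) {0}"
 proof (rule has_sum_finiteI)
  have "(\<lambda>\<mu> \<xi>. mom i * vops \<rho> i \<mu> \<xi>) = (\<lambda>\<mu> \<xi>. \<Sum>j\<in>{()}. mom i * vops \<rho> i \<mu> \<xi>)" by simp
  hence "T ((vops \<rho>)(i := \<lambda>\<mu> \<xi>. mom i * vops \<rho> i \<mu> \<xi>)) = (\<Sum>j\<in>{()}. mom i * T ((vops \<rho>)(i := vops \<rho> i)))"
   by (simp only:) (rule T_slot_sum[OF i], simp add: vops_def tame_vop)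
  thus "?z = sum ?f {0}" using r by (cases "r = 1") (simp_all add: half_def cyl_def F_def)
 qed simp
 ultimately have "(?f has_sum (?z + ?R)) ({0} \<union> - {0})" by (intro has_sum_Un_disjoint) auto
 moreover have "{0} \<union> - {0} = (UNIV :: int set)" by auto
 ultimately have "(?f has_sum (?z + ?R)) UNIV" by (simp only:)
 from has_sum_unique[OF N this] show ?thesis .
qed

lemma F_add:
 assumes i: "i \<in> {1..n}" and r: "r \<ge> 1" and \<rho>: "\<And>l. 0 \<notin># \<rho> l"
 shows "F (\<rho>(i := add_mset r (\<rho> i))) = gam1 i r * F \<rho> + (\<Sum>l\<in>{1..n}. \<Sum>s\<in>#\<rho> l. gam2 i r l s * F (\<rho>(l := \<rho> l - {#s#})))"
proof -
 let ?co = "\<lambda>k. cyl r k * exp (- z i * of_int k)"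
 let ?w = "wmat form a (mom i) (\<alpha> i)"
 let ?S = "\<lambda>s. if s = 0 then sqc r 0 * form a (\<alpha> i) else (sq2 r s)"
 let ?N = "nord ?co (mom i) (vops \<rho> i)"
 have r0: "r > 0" using r by simp
 have "?w (add_mset r (\<rho> i)) \<mu> \<xi> = nord (cyl r) (mom i) (?w (\<rho> i)) \<mu> \<xi> + (\<Sum>s\<in>insert 0 (set_mset (\<rho> i)). mult0 (\<rho> i) s * (?S s * ?w (\<rho> i - {#s#}) \<mu> \<xi>))" for \<mu> \<xi>
 proof -
  have "?w (add_mset r (\<rho> i)) \<mu> \<xi> = nord (cyl r) (mom i) (?w (\<rho> i)) \<mu> \<xi> + (?S 0 * ?w (\<rho> i - {#0#}) \<mu> \<xi> + (\<Sum>s\<in>#\<rho> i. ?S s * ?w (\<rho> i - {#s#}) \<mu> \<xi>))"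
   unfolding wmat_add[OF r0 \<rho>] using \<rho>[of i] by (auto intro!: arg_cong[of _ _ sum_mset] image_mset_cong)
  thus ?thesis unfolding sum_mset_insert_0[OF \<rho>, where h = "\<lambda>s. ?S s * ?w (\<rho> i - {#s#}) \<mu> \<xi>"] .
 qed
 hence "vop i (add_mset r (\<rho> i)) = (\<lambda>\<mu> \<xi>. qconj (z i) (nord (cyl r) (mom i) (?w (\<rho> i))) \<mu> \<xi> + (\<Sum>s\<in>insert 0 (set_mset (\<rho> i)). (mult0 (\<rho> i) s * ?S s) * vop i (\<rho> i - {#s#}) \<mu> \<xi>))"
  by (intro ext) (simp add: vop_def qconj_def distrib_left sum_distrib_left mult_ac)
 also have "qconj (z i) (nord (cyl r) (mom i) (?w (\<rho> i))) = ?N" by (simp add: qconj_nord vops_def vop_def)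
 finally have v: "vop i (add_mset r (\<rho> i)) = (\<lambda>\<mu> \<xi>. ?N \<mu> \<xi> + (\<Sum>s\<in>insert 0 (set_mset (\<rho> i)). (mult0 (\<rho> i) s * ?S s) * vop i (\<rho> i - {#s#}) \<mu> \<xi>))" .
 note co = norm_cyl_exp_le[of r _ i]
 have tN: "tame ?N (xs i) (xs i)" by (rule tame_nord[OF _ co]) (simp add: vops_def tame_vop)
 have "F (\<rho>(i := add_mset r (\<rho> i))) = T ((vops \<rho>)(i := ?N)) + (\<Sum>s\<in>insert 0 (set_mset (\<rho> i)). (mult0 (\<rho> i) s * ?S s) * F (\<rho>(i := \<rho> i - {#s#})))"
  unfolding T_vop[symmetric] v by (intro T_slot_add_sum i tN tame_vop) simp
 also have "(\<Sum>s\<in>insert 0 (set_mset (\<rho> i)). (mult0 (\<rho> i) s * ?S s) * F (\<rho>(i := \<rho> i - {#s#})))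
  = (\<Sum>l\<in>{1..n}. \<Sum>s\<in>insert 0 (set_mset (\<rho> l)). mult0 (\<rho> l) s * ((if l = i then ?S s else 0) * F (\<rho>(l := \<rho> l - {#s#}))))"
  using i by (subst sum.remove[of _ i]) (auto simp: mult.assoc intro!: sum.cong)
 also have "T ((vops \<rho>)(i := ?N)) + \<dots> = (if r = 1 then mom i * F \<rho> else 0) + (\<Sum>l\<in>{1..n}. \<Sum>s\<in>insert 0 (set_mset (\<rho> l)). mult0 (\<rho> l) s *
   ((wick l s * kap i r l s + (if l = i then ?S s else 0)) * F (\<rho>(l := \<rho> l - {#s#}))))"
  unfolding T_nord[OF i r \<rho>] by (simp only: add.assoc sum.distrib[symmetric]) (simp add: algebra_simps)
 also have "\<dots> = (if r = 1 then mom i * F \<rho> else 0) + (\<Sum>l\<in>{1..n}. (wick l 0 * kap i r l 0 + (if l = i then ?S 0 else 0)) * F \<rho>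
   + (\<Sum>s\<in>#\<rho> l. (wick l s * kap i r l s + (if l = i then ?S s else 0)) * F (\<rho>(l := \<rho> l - {#s#}))))"
 proof -
  define c where "c = (\<lambda>l s. wick l s * kap i r l s + (if l = i then ?S s else 0))"
  have "(\<Sum>s\<in>insert 0 (set_mset (\<rho> l)). mult0 (\<rho> l) s * (c l s * F (\<rho>(l := \<rho> l - {#s#})))) =
   c l 0 * F \<rho> + (\<Sum>s\<in>#\<rho> l. c l s * F (\<rho>(l := \<rho> l - {#s#})))" for l
   using sum_mset_insert_0[OF \<rho>[of l], where h = "\<lambda>s. c l s * F (\<rho>(l := \<rho> l - {#s#}))"] \<rho>[of l] by simp
  thus ?thesis unfolding c_def by (simp only:)
 qed
 also have "\<dots> = (if r = 1 then mom i * F \<rho> else 0) + (\<Sum>l\<in>{1..n}. form a (\<alpha> l) * (gam2 i r l 0 + (if r = 1 then if l > i then - 1 / 2 else 1 / 2 else 0))) * F \<rho>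
   + (\<Sum>l\<in>{1..n}. \<Sum>s\<in>#\<rho> l. gam2 i r l s * F (\<rho>(l := \<rho> l - {#s#})))"
 proof -
  have 1: "wick l 0 * kap i r l 0 + (if l = i then ?S 0 else 0) = form a (\<alpha> l) * (gam2 i r l 0 + (if r = 1 then if l > i then - 1 / 2 else 1 / 2 else 0))" for l
   by (simp add: wick_def kap_def algebra_simps)
  have 2: "(\<Sum>s\<in>#\<rho> l. (wick l s * kap i r l s + (if l = i then ?S s else 0)) * F (\<rho>(l := \<rho> l - {#s#}))) = (\<Sum>s\<in>#\<rho> l. gam2 i r l s * F (\<rho>(l := \<rho> l - {#s#})))" for l
   using \<rho>[of l] by (intro arg_cong[of _ _ sum_mset] image_mset_cong) (auto simp: wick_def kap_def)
  show ?thesis unfolding 1 2 sum.distrib sum_distrib_right by (simp only: add.assoc)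
 qed
 also have "(\<Sum>l\<in>{1..n}. form a (\<alpha> l) * (gam2 i r l 0 + (if r = 1 then if l > i then - 1 / 2 else 1 / 2 else 0)))
  = gam1 i r - (if r = 1 then mom i else 0)"
 proof -
  have g: "(\<Sum>l\<in>{1..n}. form a (\<alpha> l) * gam2 i r l 0) = gam1 i r - (if r = 1 then form a \<beta> else 0)"
   using i by (subst sum.remove[of _ i]) (auto simp: gam1_def gam2_def mult.commute intro!: sum.cong)
  have z: "(\<Sum>l\<in>{1..n}. form a (\<alpha> l)) = 0"
  proof -
   have "(\<Sum>l\<in>S. form a (\<alpha> l)) = form a (\<Sum>l\<in>S. \<alpha> l)" for S
    by (induction S rule: infinite_finite_induct) (simp_all add: form_add_right form_zero)
   thus ?thesis using neutral by (simp add: form_zero)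
  qed
  have "(\<Sum>l\<in>{1..n}. form a (\<alpha> l) * (if l > i then - 1 / 2 else 1 / 2)) = (\<Sum>l\<in>{1..n}. form a (\<alpha> l)) / 2 - (\<Sum>l\<in>{1..n}. if l > i then form a (\<alpha> l) else 0)"
   by (simp add: sum_divide_distrib sum_subtractf[symmetric]) (rule sum.cong, auto)
  also have "(\<Sum>l\<in>{1..n}. if l > i then form a (\<alpha> l) else 0) = (\<Sum>l\<in>{i<..n}. form a (\<alpha> l))"
   by (rule sum.mono_neutral_cong_right) (use i in auto)
  finally have "(\<Sum>l\<in>{1..n}. form a (\<alpha> l) * (if l > i then - 1 / 2 else 1 / 2)) = form a \<beta> - mom i"
   unfolding z by (simp add: mom_def)
  thus ?thesis using g by (cases "r = 1") (simp_all add: distrib_left sum.distrib)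
 qed
 also have "(if r = 1 then mom i * F \<rho> else 0) + (gam1 i r - (if r = 1 then mom i else 0)) * F \<rho> = gam1 i r * F \<rho>"
  by (simp add: left_diff_distrib)
 finally show ?thesis .
qed

end

section \<open>Sums over involutions\<close>

lemma orbit_involution:
 assumes "\<phi> \<circ> \<phi> = id"
 shows "orbit \<phi> x = {x, \<phi> x}"
proof
 have i: "\<phi> (\<phi> y) = y" for y using assms by (metis comp_apply id_apply)
 show "orbit \<phi> x \<subseteq> {x, \<phi> x}"
 proof
  fix y assume "y \<in> orbit \<phi> x"
  thus "y \<in> {x, \<phi> x}" by induction (auto simp: i)
 qed
 have "\<phi> x \<in> orbit \<phi> x" by (rule orbit.base)
 moreover from orbit.step[OF this] have "x \<in> orbit \<phi> x" by (simp add: i)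
 ultimately show "{x, \<phi> x} \<subseteq> orbit \<phi> x" by simp
qed

lemma finite_Inv: "finite \<Phi> ==> finite (Inv \<Phi>)" unfolding Inv_def by (rule finite_subset[OF _ finite_permutations]) auto

lemma InvD:
 assumes "\<phi> \<in> Inv \<Phi>"
 shows "\<phi> permutes \<Phi>" "\<phi> (\<phi> x) = x" "x \<notin> \<Phi> ==> \<phi> x = x" "x \<in> \<Phi> ==> \<phi> x \<in> \<Phi>" "orbit \<phi> x = {x, \<phi> x}"
proof -
 show p: "\<phi> permutes \<Phi>" using assms by (simp add: Inv_def)
 show "orbit \<phi> x = {x, \<phi> x}" using assms by (intro orbit_involution) (simp add: Inv_def)
 show "\<phi> (\<phi> x) = x" using assms unfolding Inv_def by (metis (mono_tags) comp_apply id_apply mem_Collect_eq)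
 show "x \<notin> \<Phi> ==> \<phi> x = x" "x \<in> \<Phi> ==> \<phi> x \<in> \<Phi>"
  using p by (auto simp: permutes_not_in permutes_in_image)
qed

lemma InvI:
 assumes "\<And>x. \<phi> (\<phi> x) = x" "\<And>x. x \<notin> \<Phi> ==> \<phi> x = x"
 shows "\<phi> \<in> Inv \<Phi>"
proof -
 have "\<phi> permutes \<Phi>" unfolding permutes_def using assms by metis
 thus ?thesis using assms by (auto simp: Inv_def fun_eq_iff)
qed

definition swap_in :: "'a => 'a => ('a => 'a) => 'a => 'a" where
 "swap_in x y \<phi> = \<phi>(x := y, y := x)"

lemma Inv_insert:
 assumes "x \<notin> \<Phi>"
 shows "Inv (insert x \<Phi>) = Inv \<Phi> \<union> (\<Union>y\<in>\<Phi>. swap_in x y ` Inv (\<Phi> - {y}))"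
proof (intro equalityI subsetI)
 fix \<phi> assume \<phi>: "\<phi> \<in> Inv (insert x \<Phi>)"
 show "\<phi> \<in> Inv \<Phi> \<union> (\<Union>y\<in>\<Phi>. swap_in x y ` Inv (\<Phi> - {y}))"
 proof (cases "\<phi> x = x")
  case True
  have "\<phi> \<in> Inv \<Phi>"
  proof (rule InvI)
   show "\<phi> z = z" if "z \<notin> \<Phi>" for z using that InvD(3)[OF \<phi>, of z] True by (cases "z = x") auto
  qed (rule InvD(2)[OF \<phi>])
  thus ?thesis by blast
 next
  case False
  define y where "y = \<phi> x"
  have y: "y \<in> \<Phi>" "\<phi> y = x" "y \<noteq> x" using InvD(2,4)[OF \<phi>, of x] False by (auto simp: y_def)
  define \<psi> where "\<psi> = \<phi>(x := x, y := y)"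
  have ne: "\<phi> z \<noteq> x" "\<phi> z \<noteq> y" if "z \<noteq> x" "z \<noteq> y" for z using that InvD(2)[OF \<phi>, of z] y y_def by auto
  have "\<psi> \<in> Inv (\<Phi> - {y})"
  proof (rule InvI)
   show "\<psi> (\<psi> z) = z" for z using ne[of z] InvD(2)[OF \<phi>, of z] y by (auto simp: \<psi>_def)
   show "\<psi> z = z" if "z \<notin> \<Phi> - {y}" for z using that InvD(3)[OF \<phi>, of z] by (auto simp: \<psi>_def)
  qed
  moreover have "\<phi> = swap_in x y \<psi>" using y by (auto simp: swap_in_def \<psi>_def y_def fun_eq_iff)
  ultimately show ?thesis using y by blast
 qed
next
 fix \<phi> assume "\<phi> \<in> Inv \<Phi> \<union> (\<Union>y\<in>\<Phi>. swap_in x y ` Inv (\<Phi> - {y}))"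
 then consider "\<phi> \<in> Inv \<Phi>" | y \<psi> where "y \<in> \<Phi>" "\<psi> \<in> Inv (\<Phi> - {y})" "\<phi> = swap_in x y \<psi>" by blast
 thus "\<phi> \<in> Inv (insert x \<Phi>)"
 proof cases
  case 1
  show ?thesis by (rule InvI) (use InvD(2,3)[OF 1] in auto)
 next
  case 2
  have "\<psi> x = x" "\<psi> y = y" using InvD(3)[OF 2(2)] assms by auto
  hence "\<psi> z \<noteq> x \<and> \<psi> z \<noteq> y" if "z \<noteq> x" "z \<noteq> y" for z using that InvD(2)[OF 2(2), of z] by auto
  thus ?thesis using 2 InvD(2)[OF 2(2)] InvD(3)[OF 2(2)] by (intro InvI) (auto simp: swap_in_def)
 qed
qed

definition orbit_weight :: "('a => complex) => ('a => 'a => complex) => 'a set => complex" where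
 "orbit_weight g1 g2 \<Xi> = (let (x, y) = (SOME (x, y). \<Xi> = {x, y}) in if x = y then g1 x else g2 x y)"

definition inv_sum :: "('a set => complex) => 'a set => complex" where
 "inv_sum w \<Phi> = (\<Sum>\<phi>\<in>Inv \<Phi>. \<Prod>\<Xi>\<in>orbit \<phi> ` \<Phi>. w \<Xi>)"

lemma orbit_weight_singleton: "orbit_weight g1 g2 {x} = g1 x"
proof -
 have "(SOME p. case p of (y, z) => {x} = {y, z}) = (x, x)" by (rule some_equality) (auto simp: doubleton_eq_iff)
 thus ?thesis by (simp add: orbit_weight_def)
qed

lemma orbit_weight_pair:
 assumes "x \<noteq> y" "g2 x y = g2 y x"
 shows "orbit_weight g1 g2 {x, y} = g2 x y"
proof -
 define p where "p = (SOME p. case p of (u, v) => {x, y} = {u, v})"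
 have "case p of (u, v) => {x, y} = {u, v}" unfolding p_def by (rule someI[of _ "(x, y)"]) simp
 hence "p = (x, y) \<or> p = (y, x)" by (cases p) (auto simp: doubleton_eq_iff)
 thus ?thesis using assms unfolding orbit_weight_def p_def[symmetric] by auto
qed

lemma inv_sum_insert:
 assumes fin: "finite \<Phi>" and x: "x \<notin> \<Phi>"
 shows "inv_sum w (insert x \<Phi>) = w {x} * inv_sum w \<Phi> + (\<Sum>y\<in>\<Phi>. w {x, y} * inv_sum w (\<Phi> - {y}))"
proof -
 let ?G = "\<lambda>\<Phi> \<phi>. \<Prod>\<Xi>\<in>orbit \<phi> ` \<Phi>. w \<Xi>"
 have fix_: "?G (insert x \<Phi>) \<phi> = w {x} * ?G \<Phi> \<phi>" if "\<phi> \<in> Inv \<Phi>" for \<phi>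
 proof -
  have "\<phi> x = x" using InvD(3)[OF that x] .
  hence o: "orbit \<phi> x = {x}" using InvD(5)[OF that, of x] by simp
  have "{x} \<notin> orbit \<phi> ` \<Phi>" using InvD(5)[OF that] x by auto
  thus ?thesis using fin by (simp add: o)
 qed
 have swap: "?G (insert x \<Phi>) (swap_in x y \<psi>) = w {x, y} * ?G (\<Phi> - {y}) \<psi>"
  if y: "y \<in> \<Phi>" and \<psi>: "\<psi> \<in> Inv (\<Phi> - {y})" for y \<psi>
 proof -
  have xy: "x \<noteq> y" using x y by auto
  let ?\<phi> = "swap_in x y \<psi>"
  have \<phi>: "?\<phi> \<in> Inv (insert x \<Phi>)" using Inv_insert[OF x] y \<psi> by blast
  have "insert x \<Phi> = insert x (insert y (\<Phi> - {y}))" using y by auto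
  hence "orbit ?\<phi> ` insert x \<Phi> = orbit ?\<phi> ` insert x (insert y (\<Phi> - {y}))" by (rule arg_cong)
  also have "\<dots> = insert (orbit ?\<phi> x) (insert (orbit ?\<phi> y) (orbit ?\<phi> ` (\<Phi> - {y})))" by (simp only: image_insert)
  also have "orbit ?\<phi> x = {x, y}" using InvD(5)[OF \<phi>] xy by (simp add: swap_in_def)
  also have "orbit ?\<phi> y = {x, y}" using InvD(5)[OF \<phi>] xy by (auto simp: swap_in_def)
  also have "orbit ?\<phi> ` (\<Phi> - {y}) = orbit \<psi> ` (\<Phi> - {y})"
  proof (rule image_cong[OF refl])
   fix z assume "z \<in> \<Phi> - {y}"
   hence "?\<phi> z = \<psi> z" using x by (auto simp: swap_in_def)
   thus "orbit ?\<phi> z = orbit \<psi> z" using InvD(5)[OF \<phi>] InvD(5)[OF \<psi>] by simp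
  qed
  finally have "orbit ?\<phi> ` insert x \<Phi> = insert {x, y} (orbit \<psi> ` (\<Phi> - {y}))" by simp
  moreover have "{x, y} \<notin> orbit \<psi> ` (\<Phi> - {y})"
  proof
   assume "{x, y} \<in> orbit \<psi> ` (\<Phi> - {y})"
   then obtain z where z: "z \<in> \<Phi> - {y}" "{x, y} = orbit \<psi> z" by blast
   have "orbit \<psi> z \<subseteq> \<Phi>" using InvD(5)[OF \<psi>, of z] InvD(4)[OF \<psi> z(1)] z(1) by auto
   thus False using z x by auto
  qed
  ultimately show ?thesis using fin by simp
 qed
 have sx: "\<phi> x = y" if "\<phi> \<in> swap_in x y ` A" "y \<in> \<Phi>" for \<phi> y A using that x by (auto simp: swap_in_def)
 have inj: "inj_on (swap_in x y) (Inv (\<Phi> - {y}))" if "y \<in> \<Phi>" for y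
 proof (rule inj_onI)
  fix \<phi> \<psi> assume *: "\<phi> \<in> Inv (\<Phi> - {y})" "\<psi> \<in> Inv (\<Phi> - {y})" "swap_in x y \<phi> = swap_in x y \<psi>"
  show "\<phi> = \<psi>"
  proof
   fix z
   show "\<phi> z = \<psi> z"
   proof (cases "z = x \<or> z = y")
    case True
    thus ?thesis using InvD(3)[OF *(1), of z] InvD(3)[OF *(2), of z] x by auto
   next
    case False
    thus ?thesis using fun_cong[OF *(3), of z] by (simp add: swap_in_def)
   qed
  qed
 qed
 have f: "finite (Inv (\<Phi> - {y}))" for y using fin by (intro finite_Inv) auto
 have "inv_sum w (insert x \<Phi>) = (\<Sum>\<phi>\<in>Inv \<Phi>. ?G (insert x \<Phi>) \<phi>)
   + (\<Sum>\<phi>\<in>(\<Union>y\<in>\<Phi>. swap_in x y ` Inv (\<Phi> - {y})). ?G (insert x \<Phi>) \<phi>)"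
  unfolding inv_sum_def Inv_insert[OF x]
 proof (rule sum.union_disjoint)
  show "Inv \<Phi> \<inter> (\<Union>y\<in>\<Phi>. swap_in x y ` Inv (\<Phi> - {y})) = {}"
  proof (rule ccontr)
   assume "Inv \<Phi> \<inter> (\<Union>y\<in>\<Phi>. swap_in x y ` Inv (\<Phi> - {y})) \<noteq> {}"
   then obtain \<phi> y where "\<phi> \<in> Inv \<Phi>" "y \<in> \<Phi>" "\<phi> \<in> swap_in x y ` Inv (\<Phi> - {y})" by blast
   with sx[OF this(3,2)] InvD(3)[OF this(1) x] x show False by auto
  qed
 qed (use fin f in \<open>auto intro: finite_Inv\<close>)
 also have "(\<Sum>\<phi>\<in>(\<Union>y\<in>\<Phi>. swap_in x y ` Inv (\<Phi> - {y})). ?G (insert x \<Phi>) \<phi>)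
  = (\<Sum>y\<in>\<Phi>. \<Sum>\<phi>\<in>swap_in x y ` Inv (\<Phi> - {y}). ?G (insert x \<Phi>) \<phi>)"
 proof (rule sum.UNION_disjoint)
  show "\<forall>i\<in>\<Phi>. \<forall>j\<in>\<Phi>. i \<noteq> j \<longrightarrow> swap_in x i ` Inv (\<Phi> - {i}) \<inter> swap_in x j ` Inv (\<Phi> - {j}) = {}"
  proof (intro ballI impI, rule ccontr)
   fix i j assume ij: "i \<in> \<Phi>" "j \<in> \<Phi>" "i \<noteq> j" "swap_in x i ` Inv (\<Phi> - {i}) \<inter> swap_in x j ` Inv (\<Phi> - {j}) \<noteq> {}"
   then obtain \<phi> where "\<phi> \<in> swap_in x i ` Inv (\<Phi> - {i})" "\<phi> \<in> swap_in x j ` Inv (\<Phi> - {j})" by blast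
   with sx[OF this(1) ij(1)] sx[OF this(2) ij(2)] ij(3) show False by simp
  qed
 qed (use fin f in auto)
 also have "\<dots> = (\<Sum>y\<in>\<Phi>. w {x, y} * inv_sum w (\<Phi> - {y}))"
 proof (rule sum.cong[OF refl])
  fix y assume y: "y \<in> \<Phi>"
  have "(\<Sum>\<phi>\<in>swap_in x y ` Inv (\<Phi> - {y}). ?G (insert x \<Phi>) \<phi>) = (\<Sum>\<psi>\<in>Inv (\<Phi> - {y}). ?G (insert x \<Phi>) (swap_in x y \<psi>))"
   by (simp only: sum.reindex[OF inj[OF y]] o_def)
  also have "\<dots> = (\<Sum>\<psi>\<in>Inv (\<Phi> - {y}). w {x, y} * ?G (\<Phi> - {y}) \<psi>)" by (rule sum.cong[OF refl], rule swap[OF y])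
  finally show "(\<Sum>\<phi>\<in>swap_in x y ` Inv (\<Phi> - {y}). ?G (insert x \<Phi>) \<phi>) = w {x, y} * inv_sum w (\<Phi> - {y})"
   by (simp only: inv_sum_def sum_distrib_left)
 qed
 also have "(\<Sum>\<phi>\<in>Inv \<Phi>. ?G (insert x \<Phi>) \<phi>) = w {x} * inv_sum w \<Phi>"
  unfolding inv_sum_def sum_distrib_left by (rule sum.cong[OF refl], rule fix_)
 finally show ?thesis .
qed

lemma inv_sum_empty: "inv_sum w {} = 1"
proof -
 have "Inv {} = {id :: 'a => 'a}" by (auto simp: Inv_def)
 thus ?thesis by (simp add: inv_sum_def)
qed

context genus_one
begin

lemma gamma_two_eq: "gamma_two z \<tau> (i, r, j) (l, s, j') = gam2 i r l s" by (simp add: gamma_two_def gam2_def)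

lemma form_sum_right: "form x (\<Sum>l\<in>S. f l) = (\<Sum>l\<in>S. form x (f l))"
 by (induction S rule: infinite_finite_induct) (simp_all add: form_add_right)

lemma gamma_one_eq: "gamma_one scale form a n \<alpha> \<beta> z \<tau> (i, r, j) = gam1 i r"
 by (simp add: gamma_one_def gam1_def form_add_right form_scale_right form_sum_right)

lemma gam2_sym:
 assumes "i \<in> {1..n}" "l \<in> {1..n}" "r \<ge> 1" "s \<ge> 1"
 shows "gam2 i r l s = gam2 l s i r"
proof (cases "i = l")
 case True
 have "(- 1) ^ (r + 1) * E_fun (r + s) \<tau> = (- 1) ^ (s + 1) * E_fun (r + s) \<tau>"
  by (cases "odd (r + s)") (auto simp: E_fun_def minus_one_power_iff)
 thus ?thesis using True assms by (simp add: gam2_def C_fun_def add.commute[of s r] mult_ac)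
next
 case False
 have sym: "D_fun s r (- w) \<tau> = D_fun r s w \<tau>" if "1 < norm (exp w)" "norm q * norm (exp w) < 1" "r \<ge> 1" "s \<ge> 1" for r s w
 proof -
  have "P_fun (r + s) (- w) \<tau> = (- 1) ^ (r + s) * P_fun (r + s) w \<tau>"
   using that P_fun_odd[OF tau _ that(1) that(2)[unfolded q_def], of "r + s"] by simp
  moreover have "(- 1) ^ (s + 1) * (- 1) ^ (r + s) = ((- 1) ^ (r + 1) :: complex)" by (simp add: minus_one_power_iff)
  ultimately show ?thesis using that by (simp add: D_fun_def add.commute[of s r] mult_ac)
 qed
 show ?thesis
 proof (cases "i < l")
  case True
  show ?thesis using sym[OF norm_exp_ratio[OF assms(1,2) True] assms(3,4)] False by (simp add: gam2_def)
 next
  case l: False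
  thus ?thesis using sym[OF norm_exp_ratio[OF assms(2,1)] assms(4,3)] False by (simp add: gam2_def)
 qed
qed

definition labels :: "(nat \<times> nat \<times> nat) set => nat => nat multiset" where
 "labels \<Phi> i = image_mset (fst \<circ> snd) (mset_set {x \<in> \<Phi>. fst x = i})"

lemma labels_insert:
 assumes "finite \<Phi>" "x \<notin> \<Phi>"
 shows "labels (insert x \<Phi>) = (labels \<Phi>)(fst x := add_mset (fst (snd x)) (labels \<Phi> (fst x)))"
proof
 fix i
 have "{y \<in> insert x \<Phi>. fst y = i} = (if fst x = i then insert x {y \<in> \<Phi>. fst y = i} else {y \<in> \<Phi>. fst y = i})" by auto
 thus "labels (insert x \<Phi>) i = ((labels \<Phi>)(fst x := add_mset (fst (snd x)) (labels \<Phi> (fst x)))) i"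
  using assms by (simp add: labels_def)
qed

lemma labels_remove:
 assumes "finite \<Phi>" "y \<in> \<Phi>"
 shows "labels (\<Phi> - {y}) = (labels \<Phi>)(fst y := labels \<Phi> (fst y) - {#fst (snd y)#})"
 using labels_insert[of "\<Phi> - {y}" y] assms by (auto simp: insert_absorb fun_eq_iff)

lemma F_labels:
 assumes "finite \<Phi>" "\<And>x. x \<in> \<Phi> ==> fst x \<in> {1..n} \<and> fst (snd x) \<ge> 1"
 shows "F (labels \<Phi>) = inv_sum (orbit_weight (gamma_one scale form a n \<alpha> \<beta> z \<tau>) (gamma_two z \<tau>)) \<Phi> * F (\<lambda>_. {#})"
 using assms
proof (induction "card \<Phi>" arbitrary: \<Phi> rule: less_induct)
 case less
 let ?w = "orbit_weight (gamma_one scale form a n \<alpha> \<beta> z \<tau>) (gamma_two z \<tau>)"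
 show ?case
 proof (cases "\<Phi> = {}")
  case True
  have "labels {} = (\<lambda>_. {#})" by (simp add: labels_def fun_eq_iff)
  thus ?thesis using True by (simp add: inv_sum_empty)
 next
  case False
  then obtain x where x: "x \<in> \<Phi>" by blast
  define \<Psi> where "\<Psi> = \<Phi> - {x}"
  obtain i r j where xe: "x = (i, r, j)" by (cases x)
  have fin: "finite \<Psi>" using less.prems by (simp add: \<Psi>_def)
  have \<Phi>: "\<Phi> = insert x \<Psi>" "x \<notin> \<Psi>" using x by (auto simp: \<Psi>_def)
  have i: "i \<in> {1..n}" "r \<ge> 1" using less.prems(2)[OF x] by (auto simp: xe)
  have pr: "fst y \<in> {1..n} \<and> fst (snd y) \<ge> 1" if "y \<in> \<Psi>" for y using less.prems(2)[of y] that by (simp add: \<Phi>)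
  have z: "0 \<notin># labels \<Psi> l" for l using pr fin by (force simp: labels_def)
  have lt: "card \<Psi> < card \<Phi>" using fin \<Phi> by simp
  have IH: "F (labels \<Psi>) = inv_sum ?w \<Psi> * F (\<lambda>_. {#})" by (rule less.hyps[OF lt fin pr])
  have IH': "F (labels (\<Psi> - {y})) = inv_sum ?w (\<Psi> - {y}) * F (\<lambda>_. {#})" if "y \<in> \<Psi>" for y
  proof (rule less.hyps)
   show "card (\<Psi> - {y}) < card \<Phi>" using card_Diff1_le[of \<Psi> y] lt by linarith
  qed (use fin pr in auto)
  have "F (labels \<Phi>) = gam1 i r * F (labels \<Psi>) + (\<Sum>l\<in>{1..n}. \<Sum>s\<in>#labels \<Psi> l. gam2 i r l s * F ((labels \<Psi>)(l := labels \<Psi> l - {#s#})))"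
   using F_add[OF i z] labels_insert[OF fin \<Phi>(2)] by (simp add: xe \<Phi>(1))
  also have "(\<Sum>l\<in>{1..n}. \<Sum>s\<in>#labels \<Psi> l. gam2 i r l s * F ((labels \<Psi>)(l := labels \<Psi> l - {#s#})))
   = (\<Sum>l\<in>{1..n}. \<Sum>y\<in>{y \<in> \<Psi>. fst y = l}. ?w {x, y} * (inv_sum ?w (\<Psi> - {y}) * F (\<lambda>_. {#})))"
  proof (rule sum.cong[OF refl])
   fix l assume l: "l \<in> {1..n}"
   have "(\<Sum>s\<in>#labels \<Psi> l. gam2 i r l s * F ((labels \<Psi>)(l := labels \<Psi> l - {#s#})))
    = (\<Sum>y\<in>{y \<in> \<Psi>. fst y = l}. gam2 i r l (fst (snd y)) * F ((labels \<Psi>)(l := labels \<Psi> l - {#fst (snd y)#})))"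
    unfolding labels_def[of \<Psi> l] image_mset.compositionality by (simp add: sum_unfold_sum_mset image_mset.compositionality o_def)
   also have "\<dots> = (\<Sum>y\<in>{y \<in> \<Psi>. fst y = l}. ?w {x, y} * (inv_sum ?w (\<Psi> - {y}) * F (\<lambda>_. {#})))"
   proof (rule sum.cong[OF refl])
    fix y assume "y \<in> {y \<in> \<Psi>. fst y = l}"
    hence y: "y \<in> \<Psi>" "fst y = l" by auto
    obtain s j' where ye: "y = (l, s, j')" using y by (cases y) auto
    have s: "s \<ge> 1" using pr[OF y(1)] by (simp add: ye)
    have "x \<noteq> y" using \<Phi>(2) y by auto
    hence "?w {x, y} = gam2 i r l s"
     using orbit_weight_pair[of x y "gamma_two z \<tau>"] gam2_sym[OF i(1) l i(2) s] by (simp add: xe ye gamma_two_eq)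
    moreover have "F ((labels \<Psi>)(l := labels \<Psi> l - {#s#})) = inv_sum ?w (\<Psi> - {y}) * F (\<lambda>_. {#})"
     using IH'[OF y(1)] labels_remove[OF fin y(1)] by (simp add: ye)
    ultimately show "gam2 i r l (fst (snd y)) * F ((labels \<Psi>)(l := labels \<Psi> l - {#fst (snd y)#})) = ?w {x, y} * (inv_sum ?w (\<Psi> - {y}) * F (\<lambda>_. {#}))"
     by (simp add: ye)
   qed
   finally show "(\<Sum>s\<in>#labels \<Psi> l. gam2 i r l s * F ((labels \<Psi>)(l := labels \<Psi> l - {#s#}))) = (\<Sum>y\<in>{y \<in> \<Psi>. fst y = l}. ?w {x, y} * (inv_sum ?w (\<Psi> - {y}) * F (\<lambda>_. {#})))" .
  qed
  also have "\<dots> = (\<Sum>y\<in>\<Psi>. ?w {x, y} * (inv_sum ?w (\<Psi> - {y}) * F (\<lambda>_. {#})))"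
   by (rule sum.group[OF fin]) (use pr in auto)
  finally show ?thesis unfolding IH \<Phi>(1) inv_sum_insert[OF fin \<Phi>(2)] orbit_weight_singleton
   by (simp add: xe gamma_one_eq distrib_left distrib_right sum_distrib_left sum_distrib_right mult_ac)
 qed
qed

lemma labels_labelled_set:
 "i \<in> {1..n} ==> labels (labelled_set n p e) i = (\<Sum>m\<in>{1..p i}. replicate_mset (e i m) m)"
proof -
 assume i: "i \<in> {1..n}"
 have "{x \<in> labelled_set n p e. fst x = i} = (\<lambda>(r, j). (i, r, j)) ` (SIGMA r:{1..p i}. {..<e i r})"
  using i by (auto simp: labelled_set_def)
 moreover have "inj_on (\<lambda>(r, j). (i, r, j)) (SIGMA r:{1..p i}. {..<e i r})" by (auto simp: inj_on_def)
 ultimately have "labels (labelled_set n p e) i = image_mset fst (mset_set (SIGMA r:{1..p i}. {..<e i r}))"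
  unfolding labels_def by (simp add: image_mset_mset_set[symmetric] image_mset.compositionality o_def case_prod_unfold)
 also have "\<dots> = (\<Sum>m\<in>{1..p i}. replicate_mset (e i m) m)"
 proof -
  have "image_mset fst (mset_set (SIGMA r:R. {..<e i r})) = (\<Sum>m\<in>R. replicate_mset (e i m) m)" if "finite R" for R using that
  proof induction
   case (insert m R)
   have "(SIGMA r:insert m R. {..<e i r}) = Pair m ` {..<e i m} \<union> (SIGMA r:R. {..<e i r})" by auto
   moreover have "Pair m ` {..<e i m} \<inter> (SIGMA r:R. {..<e i r}) = {}" using insert by auto
   ultimately have "mset_set (SIGMA r:insert m R. {..<e i r}) = mset_set (Pair m ` {..<e i m}) + mset_set (SIGMA r:R. {..<e i r})"
    using insert by (simp add: mset_set_Union)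
   moreover have "image_mset fst (mset_set (Pair m ` {..<e i m})) = replicate_mset (e i m) m"
    by (subst image_mset_mset_set[symmetric]) (simp_all add: inj_on_def image_mset.compositionality o_def image_mset_const_eq)
   ultimately show ?case using insert by simp
  qed simp
  thus ?thesis by simp
 qed
 finally show ?thesis .
qed

lemma Q_fun_eq: "Q_fun scale form a n \<alpha> \<beta> z \<tau> p e =
  inv_sum (orbit_weight (gamma_one scale form a n \<alpha> \<beta> z \<tau>) (gamma_two z \<tau>)) (labelled_set n p e)"
 by (simp add: Q_fun_def Gamma_inv_def inv_sum_def gamma_orbit_def orbit_weight_def)

lemma finite_labelled_set: "finite (labelled_set n p e)"
proof -
 have "labelled_set n p e \<subseteq> (SIGMA i:{1..n}. SIGMA r:{1..p i}. {..<e i r})" by (auto simp: labelled_set_def)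
 thus ?thesis by (rule finite_subset) auto
qed

end

section \<open>The n-point function as a trace\<close>

lemma infsum_convolution:
 fixes R :: "'y => 'i => complex" and E :: "'g => 'i => complex"
 assumes R: "\<And>\<nu>. \<nu> \<in> I ==> (\<lambda>y. norm (R y \<nu>)) summable_on Y" "\<And>\<nu>. \<nu> \<in> I ==> (\<Sum>\<^sub>\<infinity>y\<in>Y. norm (R y \<nu>)) \<le> d \<nu>"
  and E: "\<And>\<nu>. \<nu> \<in> I ==> (\<lambda>g. norm (E g \<nu>)) summable_on G" "\<And>\<nu>. \<nu> \<in> I ==> (\<Sum>\<^sub>\<infinity>g\<in>G. norm (E g \<nu>)) \<le> b \<nu>"
  and db: "(\<lambda>\<nu>. d \<nu> * b \<nu>) summable_on I"
 defines "f \<equiv> \<lambda>p. \<Sum>\<^sub>\<infinity>\<nu>\<in>I. R (fst p) \<nu> * E (snd p) \<nu>"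
 shows "(\<lambda>p. norm (f p)) summable_on Y \<times> G"
  "(\<Sum>\<^sub>\<infinity>p\<in>Y \<times> G. norm (f p)) \<le> (\<Sum>\<^sub>\<infinity>\<nu>\<in>I. d \<nu> * b \<nu>)"
  "(\<Sum>\<^sub>\<infinity>p\<in>Y \<times> G. f p) = (\<Sum>\<^sub>\<infinity>\<nu>\<in>I. (\<Sum>\<^sub>\<infinity>y\<in>Y. R y \<nu>) * (\<Sum>\<^sub>\<infinity>g\<in>G. E g \<nu>))"
proof -
 define H where "H = (\<lambda>(\<nu>, p). R (fst p) \<nu> * E (snd p) \<nu>)"
 have prod_s: "(\<lambda>p. norm (R (fst p) \<nu>) * norm (E (snd p) \<nu>)) summable_on Y \<times> G" if "\<nu> \<in> I" for \<nu>
  using summable_on_times[OF R(1)[OF that] E(1)[OF that]] by (simp add: case_prod_unfold)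
 have prod_v: "(\<Sum>\<^sub>\<infinity>p\<in>Y \<times> G. norm (R (fst p) \<nu>) * norm (E (snd p) \<nu>)) = (\<Sum>\<^sub>\<infinity>y\<in>Y. norm (R y \<nu>)) * (\<Sum>\<^sub>\<infinity>g\<in>G. norm (E g \<nu>))" if "\<nu> \<in> I" for \<nu>
 proof -
  have "(\<Sum>\<^sub>\<infinity>p\<in>Y \<times> G. norm (R (fst p) \<nu>) * norm (E (snd p) \<nu>)) = (\<Sum>\<^sub>\<infinity>y\<in>Y. \<Sum>\<^sub>\<infinity>g\<in>G. norm (R y \<nu>) * norm (E g \<nu>))"
   using infsum_Sigma'_banach[of "\<lambda>y g. norm (R y \<nu>) * norm (E g \<nu>)" Y "\<lambda>_. G"] prod_s[OF that] by (simp add: case_prod_unfold)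
  thus ?thesis by (simp add: infsum_cmult_right' infsum_cmult_left')
 qed
 have le: "(\<Sum>\<^sub>\<infinity>p\<in>Y \<times> G. norm (H (\<nu>, p))) \<le> d \<nu> * b \<nu>" if "\<nu> \<in> I" for \<nu>
 proof -
  have "(\<Sum>\<^sub>\<infinity>p\<in>Y \<times> G. norm (H (\<nu>, p))) = (\<Sum>\<^sub>\<infinity>y\<in>Y. norm (R y \<nu>)) * (\<Sum>\<^sub>\<infinity>g\<in>G. norm (E g \<nu>))"
   using prod_v[OF that] by (simp add: H_def norm_mult)
  also have "\<dots> \<le> d \<nu> * b \<nu>"
  proof (rule mult_mono[OF R(2)[OF that] E(2)[OF that]])
   have "0 \<le> (\<Sum>\<^sub>\<infinity>y\<in>Y. norm (R y \<nu>))" by (rule infsum_nonneg) simp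
   thus "0 \<le> d \<nu>" using R(2)[OF that] by linarith
   show "0 \<le> (\<Sum>\<^sub>\<infinity>g\<in>G. norm (E g \<nu>))" by (rule infsum_nonneg) simp
  qed
  finally show ?thesis .
 qed
 have Hs: "(\<lambda>t. norm (H t)) summable_on I \<times> (Y \<times> G)"
 proof (rule Infinite_Sum.abs_summable_on_Sigma_iff[THEN iffD2], intro conjI ballI)
  show "(\<lambda>p. norm (H (\<nu>, p))) summable_on Y \<times> G" if "\<nu> \<in> I" for \<nu>
   using prod_s[OF that] by (simp add: H_def norm_mult)
  show "(\<lambda>\<nu>. norm (\<Sum>\<^sub>\<infinity>p\<in>Y \<times> G. norm (H (\<nu>, p)))) summable_on I"
   by (rule summable_on_comparison_test[OF db]) (use le in \<open>auto simp: infsum_nonneg\<close>)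
 qed
 hence Hs': "(\<lambda>(p, \<nu>). norm (H (\<nu>, p))) summable_on (Y \<times> G) \<times> I" by (rule summable_on_swap[THEN iffD1])
 have f: "f p = (\<Sum>\<^sub>\<infinity>\<nu>\<in>I. H (\<nu>, p))" for p by (simp add: f_def H_def)
 have sec: "(\<lambda>\<nu>. norm (H (\<nu>, p))) summable_on I" if "p \<in> Y \<times> G" for p using summable_on_SigmaD1[OF Hs' that] by simp
 have nf: "norm (f p) \<le> (\<Sum>\<^sub>\<infinity>\<nu>\<in>I. norm (H (\<nu>, p)))" if "p \<in> Y \<times> G" for p
  unfolding f by (rule norm_infsum_bound[OF sec[OF that]])
 have outer: "(\<lambda>p. \<Sum>\<^sub>\<infinity>\<nu>\<in>I. norm (H (\<nu>, p))) summable_on Y \<times> G" by (rule summable_on_Sigma_banach[OF Hs'])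
 show s: "(\<lambda>p. norm (f p)) summable_on Y \<times> G" by (rule summable_on_comparison_test[OF outer nf]) auto
 have "(\<Sum>\<^sub>\<infinity>p\<in>Y \<times> G. norm (f p)) \<le> (\<Sum>\<^sub>\<infinity>p\<in>Y \<times> G. \<Sum>\<^sub>\<infinity>\<nu>\<in>I. norm (H (\<nu>, p)))"
  by (rule infsum_mono[OF s outer nf])
 also have "\<dots> = (\<Sum>\<^sub>\<infinity>\<nu>\<in>I. \<Sum>\<^sub>\<infinity>p\<in>Y \<times> G. norm (H (\<nu>, p)))" by (rule infsum_swap_banach[OF Hs'])
 also have "\<dots> \<le> (\<Sum>\<^sub>\<infinity>\<nu>\<in>I. d \<nu> * b \<nu>)"
  by (rule infsum_mono[OF _ db le]) (use summable_on_Sigma_banach[of "\<lambda>\<nu> p. norm (H (\<nu>, p))" I "\<lambda>_. Y \<times> G"] Hs in \<open>simp add: case_prod_unfold\<close>)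
 finally show "(\<Sum>\<^sub>\<infinity>p\<in>Y \<times> G. norm (f p)) \<le> (\<Sum>\<^sub>\<infinity>\<nu>\<in>I. d \<nu> * b \<nu>)" .
 have Hc: "H summable_on I \<times> (Y \<times> G)" by (rule abs_summable_summable[OF Hs])
 hence Hc': "(\<lambda>(p, \<nu>). H (\<nu>, p)) summable_on (Y \<times> G) \<times> I" by (rule summable_on_swap[THEN iffD1])
 have "(\<Sum>\<^sub>\<infinity>p\<in>Y \<times> G. f p) = (\<Sum>\<^sub>\<infinity>\<nu>\<in>I. \<Sum>\<^sub>\<infinity>p\<in>Y \<times> G. H (\<nu>, p))" unfolding f by (rule infsum_swap_banach[OF Hc'])
 also have "\<dots> = (\<Sum>\<^sub>\<infinity>\<nu>\<in>I. (\<Sum>\<^sub>\<infinity>y\<in>Y. R y \<nu>) * (\<Sum>\<^sub>\<infinity>g\<in>G. E g \<nu>))"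
 proof (rule infsum_cong)
  fix \<nu> assume \<nu>: "\<nu> \<in> I"
  have "(\<lambda>p. norm (H (\<nu>, p))) summable_on Y \<times> G" using prod_s[OF \<nu>] by (simp add: H_def norm_mult)
  from abs_summable_summable[OF this] have "(\<lambda>(y, g). R y \<nu> * E g \<nu>) summable_on Y \<times> G" by (simp add: H_def case_prod_unfold)
  from infsum_Sigma'_banach[OF this] show "(\<Sum>\<^sub>\<infinity>p\<in>Y \<times> G. H (\<nu>, p)) = (\<Sum>\<^sub>\<infinity>y\<in>Y. R y \<nu>) * (\<Sum>\<^sub>\<infinity>g\<in>G. E g \<nu>)"
   by (simp add: H_def case_prod_unfold infsum_cmult_right' infsum_cmult_left')
 qed
 finally show "(\<Sum>\<^sub>\<infinity>p\<in>Y \<times> G. f p) = (\<Sum>\<^sub>\<infinity>\<nu>\<in>I. (\<Sum>\<^sub>\<infinity>y\<in>Y. R y \<nu>) * (\<Sum>\<^sub>\<infinity>g\<in>G. E g \<nu>))" .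
qed

context genus_one
begin

definition charge :: "nat => 'h" where "charge i = \<beta> + (\<Sum>l\<in>{i<..n}. \<alpha> l)"

lemma charge_in_L: "charge i \<in> L" unfolding charge_def by (intro L_closed beta L_sum alpha) auto

lemma form_charge: "form a (charge i) = mom i" by (simp add: charge_def mom_def form_add_right form_sum_right)

lemma charge_step: "i \<in> {1..n} ==> \<alpha> i + charge i = charge (i - 1)"
proof -
 assume i: "i \<in> {1..n}"
 hence "{i - 1<..n} = insert i {i<..n}" by auto
 thus ?thesis by (simp add: charge_def add_ac)
qed

lemma charge_ends: "charge n = \<beta>" "charge 0 = \<beta>"
proof -
 have "{0<..n} = {1..n}" by auto
 thus "charge 0 = \<beta>" using neutral by (simp add: charge_def)
qed (simp add: charge_def)

definition form_k :: "nat => int" where "form_k i = (SOME k. form (\<alpha> i) (charge i) = of_int k)"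

lemma form_k: "i \<in> {1..n} ==> form (\<alpha> i) (charge i) = of_int (form_k i)"
 unfolding form_k_def by (rule someI_ex) (intro form_int alpha charge_in_L)

definition site_const :: "nat => complex" where
 "site_const i = eps (\<alpha> i) (charge i) * exp (z i * (of_int (form_k i) + form a (\<alpha> i) ^ 2 / 2))"

end

locale genus_one_states = genus_one scale form L eps a n \<alpha> \<beta> z \<tau>
 for scale :: "complex => 'h::ab_group_add => 'h" and form :: "'h => 'h => complex" and L :: "'h set"
  and eps :: "'h => 'h => complex" and a :: 'h
  and n :: nat and \<alpha> :: "nat => 'h" and \<beta> :: 'h and z :: "nat => complex" and \<tau> :: complex +
 fixes \<rho> :: "nat => nat multiset"
begin

definition st :: "nat => 'h vec" where "st i = fvec form a (\<alpha> i) (\<rho> i)"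

abbreviation (input) modes :: "nat => (nat => int) set" where "modes i \<equiv> PiE {i..n} (\<lambda>_. UNIV)"

definition site_mode :: "nat => int => 'h vec => 'h vec" where
 "site_mode i m v = smult (exp (of_int (- m - 1) * z i)) (vmode form a eps (exp_L0 form a eps (z i) (st i)) m v)"

definition site_term :: "nat => nat multiset \<times> 'h => fock_matrix" where
 "site_term i b \<mu> \<xi> = lookup (st i) b * qconj (z i) (vmat (mom i) (form a (\<alpha> i)) (sorted_list_of_multiset (fst b))) \<mu> \<xi>"

definition site_matrix :: "nat => int => fock_matrix" where
 "site_matrix i m \<mu> \<xi> = site_const i * (\<Sum>b\<in>keys (st i).
  if m = int (deg \<xi>) + int (deg (fst b)) - int (deg \<mu>) - form_k i - 1 then site_term i b \<mu> \<xi> else 0)"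

lemma vmode_exp_L0:
 "vmode form a eps (exp_L0 form a eps x u) m v =
  (\<Sum>b\<in>keys u. smult (lookup u b * exp (x * weight form a eps b)) (list_mode form a eps (sorted_list_of_multiset (fst b)) (snd b) m v))"
proof -
 let ?f = "\<lambda>(\<mu>, \<alpha>). list_mode form a eps (sorted_list_of_multiset \<mu>) \<alpha> m v"
 have "vmode form a eps (exp_L0 form a eps x u) m v = lin_ext ?f (\<Sum>b\<in>keys u. smult (lookup u b) (single b (exp (x * weight form a eps b))))"
  by (simp only: vmode_def exp_L0_def lin_ext_def[of "\<lambda>b. single b (exp (x * weight form a eps b))"])
 also have "\<dots> = (\<Sum>b\<in>keys u. smult (lookup u b) (smult (exp (x * weight form a eps b)) (?f b)))"
  by (simp only: linear_opD[OF linear_op_lin_ext] lin_ext_single)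
 also have "\<dots> = (\<Sum>b\<in>keys u. smult (lookup u b * exp (x * weight form a eps b)) (list_mode form a eps (sorted_list_of_multiset (fst b)) (snd b) m v))"
  by (rule sum.cong[OF refl], rule poly_mapping_eqI) (simp add: case_prod_unfold mult_ac)
 finally show ?thesis .
qed

lemma linear_site_mode: "linear_op (site_mode i m)" unfolding site_mode_def vmode_exp_L0 by (intro linear_op_scaled linear_op_sum linear_op_list_mode)

lemma lookup_sum_vec: "lookup (\<Sum>b\<in>S. f b :: 'c \<Rightarrow>\<^sub>0 complex) x = (\<Sum>b\<in>S. lookup (f b) x)"
 by (induction S rule: infinite_finite_induct) (simp_all add: lookup_add)

lemma lookup_site_mode_basis:
 assumes i: "i \<in> {1..n}" and \<xi>: "\<xi> \<in> Idx"
 shows "lookup (site_mode i m (basis (\<xi>, charge i))) (\<mu>, \<delta>) =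
  (if \<delta> = charge (i - 1) \<and> \<mu> \<in> Idx then site_matrix i m \<mu> \<xi> else 0)"
proof -
 have \<xi>0: "0 \<notin># \<xi>" using \<xi> by (simp add: Idx_def)
 let ?e = "exp (of_int (- m - 1) * z i)"
 have t: "?e * ((lookup (st i) b * exp (z i * weight form a eps b)) *
   lookup (list_mode form a eps (sorted_list_of_multiset (fst b)) (snd b) m (basis (\<xi>, charge i))) (\<mu>, \<delta>)) =
  (if \<delta> = charge (i - 1) \<and> \<mu> \<in> Idx then site_const i * (if m = int (deg \<xi>) + int (deg (fst b)) - int (deg \<mu>) - form_k i - 1 then site_term i b \<mu> \<xi> else 0) else 0)"
  if b: "b \<in> keys (st i)" for b
 proof -
  obtain \<sigma> where be: "b = (\<sigma>, \<alpha> i)" and \<sigma>: "0 \<notin># \<sigma>" using sector_keys[OF sector_fvec b[unfolded st_def]] by blast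
  have w: "weight form a eps b = of_nat (deg \<sigma>) + form a (\<alpha> i) ^ 2 / 2" unfolding be by (rule weight_eq[OF \<sigma> alpha[OF i]])
  have \<sigma>s: "0 \<notin> set (sorted_list_of_multiset \<sigma>)" using \<sigma> by simp
  have sl: "sum_list (sorted_list_of_multiset \<sigma>) = deg \<sigma>" by (metis mset_sorted_list_of_multiset sum_mset_sum_list)
  note l = lookup_list_mode[where form = form and a = a and eps = eps and \<alpha> = "\<alpha> i" and \<gamma> = "charge i" and ?k0.0 = "form_k i"
   and \<xi> = \<xi> and ns = "sorted_list_of_multiset \<sigma>" and m = m and \<mu> = \<mu> and \<delta> = \<delta>, OF form_k[OF i] \<xi>0 \<sigma>s]
  show ?thesis
  proof (cases "\<delta> = charge (i - 1) \<and> \<mu> \<in> Idx \<and> m = int (deg \<xi>) + int (deg \<sigma>) - int (deg \<mu>) - form_k i - 1")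
   case True
   have "?e * exp (z i * weight form a eps b) = exp (z i * (of_nat (deg \<mu>) - of_nat (deg \<xi>))) * exp (z i * (of_int (form_k i) + form a (\<alpha> i) ^ 2 / 2))"
   proof -
    have "int (deg \<sigma>) = m + 1 + int (deg \<mu>) + form_k i - int (deg \<xi>)" using True by simp
    hence "of_int (int (deg \<sigma>)) = (of_int (m + 1 + int (deg \<mu>) + form_k i - int (deg \<xi>)) :: complex)" by (rule arg_cong)
    hence "of_nat (deg \<sigma>) = (of_int m + 1 + of_nat (deg \<mu>) + of_int (form_k i) - of_nat (deg \<xi>) :: complex)" by simp
    thus ?thesis unfolding w exp_add[symmetric] by (simp only:) (simp add: algebra_simps)
   qed
   hence "?e * exp (z i * weight form a eps b) * eps (\<alpha> i) (charge i) = exp (z i * (of_nat (deg \<mu>) - of_nat (deg \<xi>))) * site_const i"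
    by (simp add: site_const_def mult_ac)
   thus ?thesis using True l unfolding be fst_conv snd_conv by (simp add: site_term_def qconj_def charge_step[OF i] form_charge sl Idx_def mult_ac)
  next
   case False
   thus ?thesis using l unfolding be fst_conv snd_conv by (auto simp: charge_step[OF i] sl Idx_def)
  qed
 qed
 have "lookup (site_mode i m (basis (\<xi>, charge i))) (\<mu>, \<delta>) = (\<Sum>b\<in>keys (st i).
   ?e * ((lookup (st i) b * exp (z i * weight form a eps b)) *
   lookup (list_mode form a eps (sorted_list_of_multiset (fst b)) (snd b) m (basis (\<xi>, charge i))) (\<mu>, \<delta>)))"
  unfolding site_mode_def vmode_exp_L0 by (simp add: lookup_sum_vec sum_distrib_left)
 also have "\<dots> = (\<Sum>b\<in>keys (st i). if \<delta> = charge (i - 1) \<and> \<mu> \<in> Idx then site_const i *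
   (if m = int (deg \<xi>) + int (deg (fst b)) - int (deg \<mu>) - form_k i - 1 then site_term i b \<mu> \<xi> else 0) else 0)"
  by (rule sum.cong[OF refl]) (rule t)
 also have "\<dots> = (if \<delta> = charge (i - 1) \<and> \<mu> \<in> Idx then site_matrix i m \<mu> \<xi> else 0)"
 proof -
  have "(\<Sum>b\<in>S. if P then X b else 0) = (if P then \<Sum>b\<in>S. X b else 0)" for P and X :: "nat multiset \<times> 'h => complex" and S by simp
  thus ?thesis unfolding site_matrix_def sum_distrib_left .
 qed
 finally show ?thesis .
qed

lemma site_mode_sector:
 assumes i: "i \<in> {1..n}" and v: "v \<in> sector (charge i)"
 shows "site_mode i m v \<in> sector (charge (i - 1))"
  "\<mu> \<in> Idx ==> lookup (site_mode i m v) (\<mu>, charge (i - 1)) = (\<Sum>\<^sub>\<infinity>\<nu>\<in>Idx. site_matrix i m \<mu> \<nu> * lookup v (\<nu>, charge i))"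
proof -
 let ?K = "keys v"
 have K: "\<exists>\<xi>\<in>Idx. b = (\<xi>, charge i)" if "b \<in> ?K" for b using sector_keys[OF v that] by (auto simp: Idx_def)
 have e: "site_mode i m v = (\<Sum>b\<in>?K. smult (lookup v b) (site_mode i m (basis b)))" by (rule linear_op_expand[OF linear_site_mode]) auto
 have l: "lookup (site_mode i m v) (\<mu>, \<delta>) = (\<Sum>b\<in>?K. lookup v b * (if \<delta> = charge (i - 1) \<and> \<mu> \<in> Idx then site_matrix i m \<mu> (fst b) else 0))" for \<mu> \<delta>
  unfolding e lookup_sum_vec lookup_smult by (rule sum.cong[OF refl]) (use K lookup_site_mode_basis[OF i] in fastforce)
 show "site_mode i m v \<in> sector (charge (i - 1))" unfolding sector_def
 proof (intro CollectI allI impI)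
  fix \<mu> \<delta> assume nz: "lookup (site_mode i m v) (\<mu>, \<delta>) \<noteq> 0"
  have "\<delta> = charge (i - 1) \<and> \<mu> \<in> Idx"
  proof (rule ccontr)
   assume "\<not> (\<delta> = charge (i - 1) \<and> \<mu> \<in> Idx)"
   thus False using nz unfolding l by (simp only: if_False mult_zero_right sum.neutral_const)
  qed
  thus "\<delta> = charge (i - 1) \<and> 0 \<notin># \<mu>" by (simp add: Idx_def)
 qed
 assume \<mu>: "\<mu> \<in> Idx"
 have "(\<Sum>\<^sub>\<infinity>\<nu>\<in>Idx. site_matrix i m \<mu> \<nu> * lookup v (\<nu>, charge i)) = (\<Sum>\<^sub>\<infinity>\<nu>\<in>fst ` ?K. site_matrix i m \<mu> \<nu> * lookup v (\<nu>, charge i))"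
 proof (rule infsum_cong_neutral)
  fix \<nu> assume "\<nu> \<in> Idx - fst ` ?K"
  hence "(\<nu>, charge i) \<notin> ?K" by force
  thus "site_matrix i m \<mu> \<nu> * lookup v (\<nu>, charge i) = 0" by (simp add: in_keys_iff)
 qed (use K in auto)
 also have "\<dots> = (\<Sum>b\<in>?K. site_matrix i m \<mu> (fst b) * lookup v (fst b, charge i))"
 proof -
  have "inj_on fst ?K"
  proof (rule inj_onI)
   fix b b' assume "b \<in> ?K" "b' \<in> ?K" "fst b = fst b'"
   thus "b = b'" using K[of b] K[of b'] by auto
  qed
  thus ?thesis by (simp add: sum.reindex)
 qed
 also have "\<dots> = (\<Sum>b\<in>?K. lookup v b * site_matrix i m \<mu> (fst b))" by (rule sum.cong[OF refl]) (use K in force)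
 finally show "lookup (site_mode i m v) (\<mu>, charge (i - 1)) = (\<Sum>\<^sub>\<infinity>\<nu>\<in>Idx. site_matrix i m \<mu> \<nu> * lookup v (\<nu>, charge i))"
  using \<mu> by (simp add: l)
qed

definition site_bound :: "nat => fock_matrix" where
 "site_bound i \<mu> \<xi> = (\<Sum>b\<in>keys (st i). of_real (norm (site_const i)) * of_real (norm (site_term i b \<mu> \<xi>)))"

lemma site_matrix_sums:
 shows "(\<lambda>m. norm (site_matrix i m \<mu> \<xi>)) summable_on UNIV"
  "(\<Sum>\<^sub>\<infinity>m. norm (site_matrix i m \<mu> \<xi>)) \<le> norm (site_bound i \<mu> \<xi>)"
  "(\<Sum>\<^sub>\<infinity>m. site_matrix i m \<mu> \<xi>) = site_const i * vops \<rho> i \<mu> \<xi>"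
proof -
 let ?K = "keys (st i)"
 let ?t = "\<lambda>b. int (deg \<xi>) + int (deg (fst b)) - int (deg \<mu>) - form_k i - 1"
 have one: "((\<lambda>m. if m = t then c else 0) has_sum c) UNIV" for t :: int and c :: "'x :: {comm_monoid_add, topological_space}"
  by (rule has_sum_finite_neutralI[of "{t}"]) auto
 have v: "vops \<rho> i \<mu> \<xi> = (\<Sum>b\<in>?K. site_term i b \<mu> \<xi>)"
  by (simp add: vops_def vop_def wmat_def Vlin_def st_def site_term_def qconj_def sum_distrib_left mult_ac)
 have "((\<lambda>m. \<Sum>b\<in>?K. if m = ?t b then site_term i b \<mu> \<xi> else 0) has_sum vops \<rho> i \<mu> \<xi>) UNIV"
  unfolding v by (rule has_sum_finite_sum) (rule one)
 hence "((\<lambda>m. site_matrix i m \<mu> \<xi>) has_sum (site_const i * vops \<rho> i \<mu> \<xi>)) UNIV"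
  unfolding site_matrix_def by (rule has_sum_cmult_right)
 thus "(\<Sum>\<^sub>\<infinity>m. site_matrix i m \<mu> \<xi>) = site_const i * vops \<rho> i \<mu> \<xi>" by (rule infsumI)
 let ?g = "\<lambda>m. \<Sum>b\<in>?K. if m = ?t b then norm (site_const i) * norm (site_term i b \<mu> \<xi>) else 0"
 have g: "(?g has_sum (\<Sum>b\<in>?K. norm (site_const i) * norm (site_term i b \<mu> \<xi>))) UNIV" by (rule has_sum_finite_sum) (rule one)
 have le: "norm (site_matrix i m \<mu> \<xi>) \<le> ?g m" for m
 proof -
  have "norm (site_matrix i m \<mu> \<xi>) \<le> norm (site_const i) * (\<Sum>b\<in>?K. norm (if m = ?t b then site_term i b \<mu> \<xi> else 0))"
   unfolding site_matrix_def norm_mult by (intro mult_left_mono norm_sum) simp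
  also have "\<dots> = ?g m" unfolding sum_distrib_left by (rule sum.cong) auto
  finally show ?thesis .
 qed
 show s: "(\<lambda>m. norm (site_matrix i m \<mu> \<xi>)) summable_on UNIV"
  by (rule summable_on_comparison_test[OF has_sum_imp_summable[OF g] le]) auto
 have "(\<Sum>\<^sub>\<infinity>m. norm (site_matrix i m \<mu> \<xi>)) \<le> (\<Sum>\<^sub>\<infinity>m. ?g m)"
  by (rule infsum_mono[OF s has_sum_imp_summable[OF g] le])
 also have "\<dots> = (\<Sum>b\<in>?K. norm (site_const i) * norm (site_term i b \<mu> \<xi>))" by (rule infsumI[OF g])
 also have "\<dots> = norm (site_bound i \<mu> \<xi>)"
 proof -
  have "site_bound i \<mu> \<xi> = of_real (\<Sum>b\<in>?K. norm (site_const i) * norm (site_term i b \<mu> \<xi>))" by (simp add: site_bound_def)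
  thus ?thesis by (simp only: norm_of_real) (simp add: sum_nonneg)
 qed
 finally show "(\<Sum>\<^sub>\<infinity>m. norm (site_matrix i m \<mu> \<xi>)) \<le> norm (site_bound i \<mu> \<xi>)" .
qed

lemma tame_site_bound: "tame (site_bound i) (xs i) (xs i)" unfolding site_bound_def[abs_def]
proof (intro tame_sum tame_scale)
 fix b
 have "tame (site_term i b) (xs i) (xs i)" unfolding site_term_def[abs_def] xs_def by (intro tame_scale tame_conj tame_vmat)
 thus "tame (\<lambda>\<mu> \<xi>. of_real (norm (site_term i b \<mu> \<xi>))) (xs i) (xs i)" by (rule tame_le) simp
qed (simp_all add: xs_def)

definition partial :: "nat => (nat => int) => nat multiset => 'h vec" where
 "partial i m \<xi> = foldr (\<lambda>j. site_mode j (m j)) [i..<Suc n] (basis (\<xi>, \<beta>))"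

lemma partial_cong: "(\<And>j. j \<in> {i..n} ==> m j = m' j) ==> partial i m \<xi> = partial i m' \<xi>"
 unfolding partial_def by (intro foldr_cong) auto

lemma partial_Suc: "i \<le> n ==> partial i m \<xi> = site_mode i (m i) (partial (Suc i) m \<xi>)"
 unfolding partial_def by (subst upt_conv_Cons) auto

lemma partial_sector: "1 \<le> i ==> i \<le> Suc n ==> \<xi> \<in> Idx ==> partial i m \<xi> \<in> sector (charge (i - 1))"
proof (induction "Suc n - i" arbitrary: i)
 case 0
 hence "i = Suc n" by simp
 thus ?case using 0 by (simp add: partial_def charge_ends sector_basis Idx_def)
next
 case (Suc d)
 hence "partial (Suc i) m \<xi> \<in> sector (charge i)" using Suc.hyps(1)[of "Suc i"] by simp
 thus ?case using Suc by (simp only: partial_Suc) (rule site_mode_sector(1), auto)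
qed

definition summed :: "nat => fock_matrix => nat multiset => nat multiset => bool" where
 "summed i B \<mu> \<xi> \<longleftrightarrow>
  (\<lambda>m. norm (lookup (partial i m \<xi>) (\<mu>, charge (i - 1)))) summable_on modes i \<and>
  (\<Sum>\<^sub>\<infinity>m\<in>modes i. norm (lookup (partial i m \<xi>) (\<mu>, charge (i - 1)))) \<le> norm (B \<mu> \<xi>) \<and>
  (\<Sum>\<^sub>\<infinity>m\<in>modes i. lookup (partial i m \<xi>) (\<mu>, charge (i - 1)))
   = (\<Prod>j\<in>{i..n}. site_const j) * prodf (vops \<rho>) [i..<Suc n] \<mu> \<xi>"

lemma partial_sums:
 assumes "1 \<le> i" "i \<le> Suc n"
 shows "\<exists>B lo hi. tame B lo hi \<and> (\<forall>j\<in>{1..<i}. xs j < lo) \<and> (\<forall>\<mu>\<in>Idx. \<forall>\<xi>\<in>Idx. summed i B \<mu> \<xi>)"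
 using assms
proof (induction "Suc n - i" arbitrary: i)
 case 0
 hence i: "i = Suc n" by simp
 define lo where "lo = xs n + 1"
 have "xs n > 0" by (simp add: xs_def)
 hence "tame idm lo lo" by (intro tame_idm) (auto simp: lo_def)
 moreover have "xs j < lo" if "j \<in> {1..<i}" for j
 proof -
  have "xs j \<le> xs n" using radial[of j n] that unfolding i by (cases "j = n") (auto simp: xs_def)
  thus ?thesis by (simp add: lo_def)
 qed
 moreover have "summed i idm \<mu> \<xi>" if "\<mu> \<in> Idx" for \<mu> \<xi>
 proof -
  have "PiE {i..n} (\<lambda>_. UNIV :: int set) = {\<lambda>_. undefined}" by (simp add: i)
  moreover have "lookup (partial i m \<xi>) (\<mu>, charge (i - 1)) = idm \<mu> \<xi>" for m
   using that by (auto simp: partial_def i charge_ends lookup_single when_def idm_def)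
  ultimately show ?thesis by (simp add: summed_def i)
 qed
 ultimately show ?case by (intro exI[of _ idm] exI[of _ lo]) simp
next
 case (Suc d)
 hence i: "i \<in> {1..n}" by simp
 have "d = Suc n - Suc i" "1 \<le> Suc i" "Suc i \<le> Suc n" using Suc i by auto
 then obtain B lo hi where B: "tame B lo hi" "\<forall>j\<in>{1..<Suc i}. xs j < lo" and S: "\<forall>\<mu>\<in>Idx. \<forall>\<xi>\<in>Idx. summed (Suc i) B \<mu> \<xi>"
  using Suc.hyps(1)[of "Suc i"] by blast
 note P = S[rule_format, unfolded summed_def diff_Suc_1, THEN conjunct1]
  S[rule_format, unfolded summed_def diff_Suc_1, THEN conjunct2, THEN conjunct1]
  S[rule_format, unfolded summed_def diff_Suc_1, THEN conjunct2, THEN conjunct2]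
 have xl: "xs i < lo" using B(2) i by simp
 let ?D = "\<lambda>\<mu> \<xi>. complex_of_real (norm (site_bound i \<mu> \<xi>))" and ?B = "\<lambda>\<mu> \<xi>. complex_of_real (norm (B \<mu> \<xi>))"
 have D: "tame ?D (xs i) (xs i)" by (rule tame_le[OF tame_site_bound]) simp
 have B': "tame ?B lo hi" by (rule tame_le[OF B(1)]) simp
 have ins: "{i..n} = insert i {Suc i..n}" using i by auto
 let ?h = "\<lambda>p :: int \<times> (nat => int). (snd p)(i := fst p)"
 have bij: "bij_betw ?h (UNIV \<times> modes (Suc i)) (modes i)" unfolding bij_betw_def ins PiE_insert_eq
  using inj_combinator[of i "{Suc i..n}" "\<lambda>_. UNIV :: int set"] by (auto simp: case_prod_unfold inj_on_def)
 show ?case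
 proof (rule exI[of _ "mm ?D ?B"], rule exI[of _ "xs i"], rule exI[of _ hi], intro conjI ballI)
  show "tame (mm ?D ?B) (xs i) hi" by (rule tame_mm[OF D B' xl])
  show "xs j < xs i" if "j \<in> {1..<i}" for j using radial[of j i] that i by (simp add: xs_def)
 next
  fix \<mu> \<xi> assume I: "\<mu> \<in> Idx" "\<xi> \<in> Idx"
  show "summed i (mm ?D ?B) \<mu> \<xi>" unfolding summed_def
  proof (intro conjI)
  let ?E = "\<lambda>m. lookup (partial i m \<xi>) (\<mu>, charge (i - 1))"
  let ?f = "\<lambda>p. \<Sum>\<^sub>\<infinity>\<nu>\<in>Idx. site_matrix i (fst p) \<mu> \<nu> * lookup (partial (Suc i) (snd p) \<xi>) (\<nu>, charge i)"
  have f: "?E (?h p) = ?f p" for p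
  proof -
   have "partial (Suc i) (?h p) \<xi> = partial (Suc i) (snd p) \<xi>" by (rule partial_cong) auto
   moreover have "partial (Suc i) (snd p) \<xi> \<in> sector (charge i)" using partial_sector[of "Suc i" \<xi> "snd p"] i I by simp
   ultimately show ?thesis using site_mode_sector(2)[OF i _ I(1)] i by (simp add: partial_Suc)
  qed
  have db: "(\<lambda>\<nu>. norm (site_bound i \<mu> \<nu>) * norm (B \<nu> \<xi>)) summable_on Idx"
   using mm_abs_summable[OF D B' xl I] by (simp add: norm_mult)
  note C = infsum_convolution[where R = "\<lambda>y \<nu>. site_matrix i y \<mu> \<nu>" and E = "\<lambda>g \<nu>. lookup (partial (Suc i) g \<xi>) (\<nu>, charge i)"
    and Y = UNIV and G = "modes (Suc i)" and I = Idx, OF site_matrix_sums(1) site_matrix_sums(2) P(1)[OF _ I(2)] P(2)[OF _ I(2)] db]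
  show "(\<lambda>m. norm (?E m)) summable_on modes i"
   unfolding summable_on_reindex_bij_betw[OF bij, of "\<lambda>m. norm (?E m)", symmetric] f using C(1) .
  have "(\<Sum>\<^sub>\<infinity>m\<in>modes i. norm (?E m)) \<le> (\<Sum>\<^sub>\<infinity>\<nu>\<in>Idx. norm (site_bound i \<mu> \<nu>) * norm (B \<nu> \<xi>))"
   unfolding infsum_reindex_bij_betw[OF bij, of "\<lambda>m. norm (?E m)", symmetric] f using C(2) .
  also have "\<dots> = norm (mm ?D ?B \<mu> \<xi>)"
  proof -
   have "mm ?D ?B \<mu> \<xi> = of_real (\<Sum>\<^sub>\<infinity>\<nu>\<in>Idx. norm (site_bound i \<mu> \<nu>) * norm (B \<nu> \<xi>))"
   proof -
    have "((\<lambda>\<nu>. complex_of_real (norm (site_bound i \<mu> \<nu>) * norm (B \<nu> \<xi>))) has_sum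
      of_real (\<Sum>\<^sub>\<infinity>\<nu>\<in>Idx. norm (site_bound i \<mu> \<nu>) * norm (B \<nu> \<xi>))) Idx"
     by (rule has_sum_of_real[OF has_sum_infsum[OF db]])
    thus ?thesis using I infsumI by (fastforce simp: mm_def)
   qed
   thus ?thesis by (simp only: norm_of_real) (simp add: infsum_nonneg)
  qed
  finally show "(\<Sum>\<^sub>\<infinity>m\<in>modes i. norm (?E m)) \<le> norm (mm ?D ?B \<mu> \<xi>)" .
  have "(\<Sum>\<^sub>\<infinity>m\<in>modes i. ?E m) = (\<Sum>\<^sub>\<infinity>\<nu>\<in>Idx. (\<Sum>\<^sub>\<infinity>y. site_matrix i y \<mu> \<nu>)
    * (\<Sum>\<^sub>\<infinity>g\<in>modes (Suc i). lookup (partial (Suc i) g \<xi>) (\<nu>, charge i)))"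
   unfolding infsum_reindex_bij_betw[OF bij, of ?E, symmetric] f by (rule C(3))
  also have "\<dots> = (\<Sum>\<^sub>\<infinity>\<nu>\<in>Idx. (site_const i * vops \<rho> i \<mu> \<nu>) * ((\<Prod>j\<in>{Suc i..n}. site_const j) * prodf (vops \<rho>) [Suc i..<Suc n] \<nu> \<xi>))"
   by (rule infsum_cong) (simp only: site_matrix_sums(3) P(3)[OF _ I(2)])
  also have "\<dots> = (\<Sum>\<^sub>\<infinity>\<nu>\<in>Idx. (\<Prod>j\<in>{i..n}. site_const j) * (vops \<rho> i \<mu> \<nu> * prodf (vops \<rho>) [Suc i..<Suc n] \<nu> \<xi>))"
   by (rule infsum_cong) (simp add: ins mult_ac)
  also have "\<dots> = (\<Prod>j\<in>{i..n}. site_const j) * prodf (vops \<rho>) [i..<Suc n] \<mu> \<xi>"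
  proof -
   have "[i..<Suc n] = i # [Suc i..<Suc n]" using i by (intro upt_conv_Cons) simp
   thus ?thesis using I by (simp only: prodf_simps mm_def infsum_cmult_right') simp
  qed
  finally show "(\<Sum>\<^sub>\<infinity>m\<in>modes i. ?E m) = (\<Prod>j\<in>{i..n}. site_const j) * prodf (vops \<rho>) [i..<Suc n] \<mu> \<xi>" .
  qed
 qed
qed

lemma n_point_eq:
 "n_point form a eps \<beta> n st z \<tau> = (\<Prod>j\<in>{1..n}. site_const j) * exp (2 * of_real pi * \<i> * \<tau> * (form a \<beta> ^ 2 / 2 - 1 / 24)) * F \<rho>"
proof -
 let ?c = "\<Prod>j\<in>{1..n}. site_const j" and ?e = "exp (2 * of_real pi * \<i> * \<tau> * (form a \<beta> ^ 2 / 2 - 1 / 24))"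
 have mp: "mode_product form a eps n st z m (basis (\<mu>, \<beta>)) = partial 1 m \<mu>" for m \<mu>
  by (simp only: mode_product_def partial_def site_mode_def[abs_def])
 have "n_point form a eps \<beta> n st z \<tau> = (\<Sum>\<^sub>\<infinity>\<mu>\<in>Idx. ?c * ?e * (prodf (vops \<rho>) sites \<mu> \<mu> * q ^ deg \<mu>))"
  unfolding n_point_def Idx_def[symmetric]
 proof (rule infsum_cong)
  fix \<mu> assume \<mu>: "\<mu> \<in> Idx"
  have 1: "(\<Sum>\<^sub>\<infinity>m\<in>PiE {1..n} (\<lambda>_. UNIV). lookup (partial 1 m \<mu>) (\<mu>, charge (1 - 1))) = ?c * prodf (vops \<rho>) sites \<mu> \<mu>"
  proof -
   obtain B where "summed 1 B \<mu> \<mu>" using partial_sums[of 1] \<mu> by auto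
   thus ?thesis unfolding summed_def by (elim conjE)
  qed
  have "weight form a eps (\<mu>, \<beta>) = of_nat (deg \<mu>) + form a \<beta> ^ 2 / 2"
   using \<mu> beta by (intro weight_eq) (simp_all add: Idx_def)
  hence "exp (2 * of_real pi * \<i> * \<tau> * (weight form a eps (\<mu>, \<beta>) - 1 / 24)) = ?e * q ^ deg \<mu>"
   by (simp add: q_def exp_of_nat_mult[symmetric] exp_add[symmetric] algebra_simps)
  thus "(\<Sum>\<^sub>\<infinity>m\<in>PiE {1..n} (\<lambda>_. UNIV). lookup (mode_product form a eps n st z m (basis (\<mu>, \<beta>))) (\<mu>, \<beta>))
    * exp (2 * of_real pi * \<i> * \<tau> * (weight form a eps (\<mu>, \<beta>) - 1 / 24)) = ?c * ?e * (prodf (vops \<rho>) sites \<mu> \<mu> * q ^ deg \<mu>)"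
   using 1 by (simp add: mp charge_ends mult_ac)
 qed
 also have "\<dots> = ?c * ?e * F \<rho>" by (simp add: F_def T_def tr_def infsum_cmult_right')
 finally show ?thesis .
qed

end

lemma n_point_cong:
 assumes "\<And>i. i \<in> {1..n} ==> u i = u' i"
 shows "n_point form a eps \<beta> n u z \<tau> = n_point form a eps \<beta> n u' z \<tau>"
proof -
 have "mode_product form a eps n u z m v = mode_product form a eps n u' z m v" for m v
  unfolding mode_product_def by (rule foldr_cong) (use assms in auto)
 thus ?thesis by (simp only: n_point_def)
qed

theorem proposition3p2:
  fixes scale :: "complex \<Rightarrow> 'h::ab_group_add \<Rightarrow> 'h"
    and form :: "'h \<Rightarrow> 'h \<Rightarrow> complex"
    and L :: "'h set"
    and eps :: "'h \<Rightarrow> 'h \<Rightarrow> complex"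
    and a \<beta> :: 'h
    and n :: nat
    and \<alpha> :: "nat \<Rightarrow> 'h"
    and p :: "nat \<Rightarrow> nat"
    and e :: "nat \<Rightarrow> nat \<Rightarrow> nat"
    and z :: "nat \<Rightarrow> complex"
    and \<tau> :: complex
  assumes lattice: "rank_one_even_lattice scale form L"
    and a_norm: "form a a = 1"
    and cocycle: "cocycle form eps L"
    and n_pos: "1 \<le> n"
    and beta: "\<beta> \<in> L"
    and alpha: "\<forall>i\<in>{1..n}. \<alpha> i \<in> L"
    and neutral: "(\<Sum>i=1..n. \<alpha> i) = 0"
    and tau: "0 < Im \<tau>"
    and radial: "\<forall>i j. 1 \<le> i \<and> i < j \<and> j \<le> n \<longrightarrow> norm (exp (z j)) < norm (exp (z i))"
    and annulus: "norm (exp (2 * of_real pi * \<i> * \<tau>) * exp (z 1)) < norm (exp (z n))"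
  shows "n_point form a eps \<beta> n (\<lambda>i. fock_state form a eps (p i) (e i) (\<alpha> i)) z \<tau> =
    Q_fun scale form a n \<alpha> \<beta> z \<tau> p e *
    n_point form a eps \<beta> n (\<lambda>i. basis ({#}, \<alpha> i)) z \<tau>"
proof -
 have voa: "lattice_voa scale form L eps a" by (rule lattice_voa.intro[OF lattice lattice_voa_axioms.intro[OF a_norm cocycle]])
 have g: "genus_one scale form L eps a n \<alpha> \<beta> z \<tau>"
  by (rule genus_one.intro[OF voa genus_one_axioms.intro[OF n_pos beta _ neutral tau _ annulus]])
   (use alpha radial in auto)
 interpret G: genus_one scale form L eps a n \<alpha> \<beta> z \<tau> by (rule g)
 let ?\<Phi> = "labelled_set n p e"
 interpret S: genus_one_states scale form L eps a n \<alpha> \<beta> z \<tau> "G.labels ?\<Phi>" by (rule genus_one_states.intro[OF g])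
 interpret S0: genus_one_states scale form L eps a n \<alpha> \<beta> z \<tau> "\<lambda>_. {#}" by (rule genus_one_states.intro[OF g])
 let ?c = "(\<Prod>j\<in>{1..n}. G.site_const j) * exp (2 * of_real pi * \<i> * \<tau> * (form a \<beta> ^ 2 / 2 - 1 / 24))"
 have "n_point form a eps \<beta> n (\<lambda>i. fock_state form a eps (p i) (e i) (\<alpha> i)) z \<tau> = n_point form a eps \<beta> n S.st z \<tau>"
  by (rule n_point_cong) (use alpha G.fock_state_eq_fvec G.labels_labelled_set in \<open>simp add: S.st_def\<close>)
 also have "\<dots> = ?c * G.F (G.labels ?\<Phi>)" by (rule S.n_point_eq)
 also have "G.F (G.labels ?\<Phi>) = Q_fun scale form a n \<alpha> \<beta> z \<tau> p e * G.F (\<lambda>_. {#})"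
  unfolding G.Q_fun_eq by (rule G.F_labels[OF G.finite_labelled_set]) (auto simp: labelled_set_def)
 also have "?c * (Q_fun scale form a n \<alpha> \<beta> z \<tau> p e * G.F (\<lambda>_. {#})) = Q_fun scale form a n \<alpha> \<beta> z \<tau> p e * n_point form a eps \<beta> n S0.st z \<tau>"
  unfolding S0.n_point_eq by (simp only: mult_ac)
 also have "n_point form a eps \<beta> n S0.st z \<tau> = n_point form a eps \<beta> n (\<lambda>i. basis ({#}, \<alpha> i)) z \<tau>"
  by (rule n_point_cong) (simp add: S0.st_def)
 finally show ?thesis .
qed

end
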